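(* Let $\mathbb{K}=\mathbb{R}$ or $\mathbb{C}$, let $n,m\geq 1$ and $\kappa\geq 2$ be integers, and let $(\mathcal{E})$ be the $\mathbb{K}$-analytic system of partial differential equations of order $\kappa$, with $n$ independent variables $x=(x_1,\dots,x_n)$ and $m$ dependent variables $u=(u^1,\dots,u^m)$, $$u^j_{x^\alpha}(x)=F^j_\alpha\Big(x,u(x),\big(u^i_{x^\beta}(x)\big)_{1\leq i\leq m,\ 1\leq|\beta|\leq\kappa-1}\Big),\qquad \alpha\in\mathbb{N}^n,\ |\alpha|=\kappa,\ j=1,\dots,m,$$ where the functions $F_\alpha^j$ are $\mathbb{K}$-analytic in a neighbourhood of the origin. Assume that $(\mathcal{E})$ is completely integrable. Then the Lie algebra $\mathfrak{Sym}(\mathcal{E})$ of infinitesimal symmetries of $(\mathcal{E})$ satisfies $$\dim_{\mathbb{K}}\mathfrak{Sym}(\mathcal{E})\leq (n+m+2)(n+m)\quad\text{if }\kappa=2,$$ $$\dim_{\mathbb{K}}\mathfrak{Sym}(\mathcal{E})\leq n^2+2n+m^2+m\,\binom{n+\kappa-1}{\kappa-1}\quad\text{if }\kappa\geq 3.$$ Moreover, these inequalities become equalities for the homogeneous system $(\mathcal{E}_0)$: $u^j_{x^\alpha}(x)=0$ for all $\alpha\in\mathbb{N}^n$ with $|\alpha|=\kappa$ and all $j=1,\dots,m$.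
   Context: Here $u^j_{x^\alpha}$ denotes $\partial^{|\alpha|}u^j/\partial x^\alpha$. All considerations are local, near the origin. Jet space and skeleton. Let $\mathcal{J}^\kappa_{n,m}$ be the space of $\kappa$-jets of $\mathbb{K}$-analytic maps $u=u(x)$ from $\mathbb{K}^n$ to $\mathbb{K}^m$, with coordinates $(x_l,u^j,U^j_\beta)$, $1\leq|\beta|\leq\kappa$, where $U^j_\beta$ corresponds to $u^j_{x^\beta}$ (and $U^j_0:=u^j$). The skeleton $\Delta_{\mathcal{E}}\subset\mathcal{J}^\kappa_{n,m}$ is the submanifold defined by $U^j_\alpha=F^j_\alpha(x,u,(U^i_\beta)_{1\leq|\beta|\leq\kappa-1})$ for $|\alpha|=\kappa$, $j=1,\dots,m$. Complete integrability. $(\mathcal{E})$ is completely integrable if the Pfaffian system naturally associated with it in the jet space is involutive in the sense of Frobenius; that is, the $n$ vector fields $$\frac{\partial}{\partial x_k}+\sum_{i=1}^m\ \sum_{|\beta|\leq\kappa-2}U^i_{\beta+e_k}\frac{\partial}{\partial U^i_\beta}+\sum_{i=1}^m\ \sum_{|\beta|=\kappa-1}F^i_{\beta+e_k}\frac{\partial}{\partial U^i_\beta},\qquad k=1,\dots,n,$$ on the space with coordinates $(x,u,(U^i_\beta)_{1\leq|\beta|\leq\kappa-1})$, where $e_k$ is the $k$-th unit multiindex, commute pairwise. Then through every point of $\Delta_{\mathcal{E}}$ there passes the jet of a local $\mathbb{K}$-analytic solution. Infinitesimal symmetries. A local $\mathbb{K}$-analytic diffeomorphism $(x',u')=\Phi(x,u)$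 of $\mathbb{K}^{n+m}$ near the origin, sufficiently close to the identity, is a Lie symmetry of $(\mathcal{E})$ if it transforms the graph of every local solution of $(\mathcal{E})$ into the graph of another local solution. A $\mathbb{K}$-analytic vector field $X=\sum_{l=1}^nQ^l(x,u)\,\partial/\partial x_l+\sum_{j=1}^mR^j(x,u)\,\partial/\partial u^j$ defined near the origin of $\mathbb{K}^{n+m}$ is an infinitesimal symmetry of $(\mathcal{E})$ if for every $s\in\mathbb{K}$ close to $0$ the flow map $(x,u)\mapsto\exp(sX)(x,u)$ is a Lie symmetry of $(\mathcal{E})$. Equivalently (Lie criterion), the $\kappa$-th prolongation $X^{(\kappa)}$ is tangent to $\Delta_{\mathcal{E}}$, where $$X^{(\kappa)}=X+\sum_{j=1}^m\ \sum_{1\leq|\beta|\leq\kappa}\mathbf{R}^j_\beta\,\frac{\partial}{\partial U^j_\beta},\qquad \mathbf{R}^j_0:=R^j,\qquad \mathbf{R}^j_{\beta+e_k}:=D_k(\mathbf{R}^j_\beta)-\sum_{l=1}^nD_k(Q^l)\,U^j_{\beta+e_l},$$ and $D_k=\partial/\partial x_k+\sum_{i}\sum_{\beta}U^i_{\beta+e_k}\,\partial/\partial U^i_\beta$ is the total differentiation operator. $\mathfrak{Sym}(\mathcal{E})$ denotes the Lie algebra over $\mathbb{K}$ of (germs at the origin of) infinitesimal symmetries of $(\mathcal{E})$. *)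

theory Defs
  imports "HOL-Analysis.Analysis"
begin

text \<open>
  The ground field is a type \<open>'k\<close> of sort \<open>{real_normed_field, euclidean_space}\<close>. Both \<^typ>\<open>real\<close> and
  \<^typ>\<open>complex\<close> are of this sort, and up to isomorphism they are its only instances
  (Gelfand-Mazur). With \<open>n = CARD('n)\<close> and \<open>m = CARD('m)\<close>, the space of independent variables is
  \<open>'k^'n\<close>, that of dependent variables \<open>'k^'m\<close>, and the space of the \<open>(x, u)\<close> is \<open>'k^('n + 'm)\<close>.
\<close>


section \<open>Analytic functions of finitely many variables\<close>

text \<open>
  Analyticity at \<open>a\<close> in the variables \<open>z i\<close>, \<open>i \<in> I\<close> (\<open>I\<close> finite): \<open>f\<close> is the sum of a convergent power
  series on a polydisc around \<open>a\<close>. In particular, there \<open>f z\<close> depends only on the \<open>z i\<close> with \<open>i \<in> I\<close>.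
  Analyticity at a point entails analyticity in a neighbourhood of it.
\<close>

definition kanalytic_at ::
    "'i set \<Rightarrow> (('i \<Rightarrow> 'k) \<Rightarrow> 'k::real_normed_field) \<Rightarrow> ('i \<Rightarrow> 'k) \<Rightarrow> bool" where
  "kanalytic_at I f a \<longleftrightarrow>
     (\<exists>(c :: ('i \<Rightarrow> nat) \<Rightarrow> 'k) r. r > 0 \<and>
        (\<forall>z. (\<forall>i\<in>I. norm (z i - a i) < r) \<longrightarrow>
           ((\<lambda>p. c p * (\<Prod>i\<in>I. (z i - a i) ^ p i)) has_sum f z) {p. \<forall>i. i \<notin> I \<longrightarrow> p i = 0}))"

definition vec_analytic_at ::
    "('k^'c::finite \<Rightarrow> 'k^'d::finite) \<Rightarrow> ('k::real_normed_field)^'c \<Rightarrow> bool" where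
  "vec_analytic_at f a \<longleftrightarrow>
     (\<forall>d. kanalytic_at UNIV (\<lambda>z. f (vec_lambda z) $ d) (vec_nth a))"


section \<open>Multiindices and partial derivatives\<close>

type_synonym 'n mindex = "nat^'n"

definition mdeg :: "'n::finite mindex \<Rightarrow> nat" where
  "mdeg \<alpha> = (\<Sum>l\<in>UNIV. \<alpha> $ l)"

abbreviation unit_mindex :: "'n::finite \<Rightarrow> 'n mindex" where
  "unit_mindex k \<equiv> axis k 1"

definition partial :: "'n::finite \<Rightarrow> ('k^'n \<Rightarrow> 'k) \<Rightarrow> 'k^'n \<Rightarrow> 'k::real_normed_field" where
  "partial l f x = deriv (\<lambda>t. f (x + axis l t)) 0"

text \<open>
  The coordinates are enumerated in an arbitrary order; for analytic functions, the only ones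
  to which this is applied below, the partial derivatives commute.
\<close>

definition mpartial :: "'n::finite mindex \<Rightarrow> ('k^'n \<Rightarrow> 'k) \<Rightarrow> 'k^'n \<Rightarrow> 'k::real_normed_field" where
  "mpartial \<alpha> = foldr (\<lambda>l. partial l ^^ (\<alpha> $ l)) (SOME ls. distinct ls \<and> set ls = UNIV)"


section \<open>Jets and systems of partial differential equations\<close>

text \<open>
  \<open>Xc l\<close> names the coordinate \<open>x\<^sub>l\<close> and \<open>Uc j \<beta>\<close> the coordinate \<open>U\<^sup>j\<^sub>\<beta>\<close>, where \<open>Uc j 0\<close> is \<open>u\<^sup>j\<close>. The
  coordinates on the space of \<open>r\<close>-jets are those in \<open>jcoords r\<close>.
\<close>

datatype ('n::finite, 'm) jcoord = Xc 'n | Uc 'm "'n mindex"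

definition jcoords :: "nat \<Rightarrow> ('n::finite, 'm) jcoord set" where
  "jcoords r = range Xc \<union> {Uc j \<beta> | j \<beta>. mdeg \<beta> \<le> r}"

definition jet ::
    "nat \<Rightarrow> ('k^'n::finite \<Rightarrow> 'k^'m::finite) \<Rightarrow> 'k^'n \<Rightarrow> ('n, 'm) jcoord \<Rightarrow> 'k::real_normed_field" where
  "jet r u x c =
     (case c of
        Xc l \<Rightarrow> x $ l
      | Uc j \<beta> \<Rightarrow> (if mdeg \<beta> \<le> r then mpartial \<beta> (\<lambda>y. u y $ j) x else 0))"

text \<open>
  A right-hand side \<open>F j \<alpha>\<close> is a total function of the jet, but only its germ at the origin matters:
  all notions below are restricted to a neighbourhood of the origin of the jet space
  that may be shrunk.
\<close>

type_synonym ('k, 'n, 'm) rhs = "'m \<Rightarrow> 'n mindex \<Rightarrow> (('n, 'm) jcoord \<Rightarrow> 'k) \<Rightarrow> 'k"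

definition local_solution ::
    "nat \<Rightarrow> ('k::real_normed_field, 'n::finite, 'm::finite) rhs \<Rightarrow> ('k^'n) set \<Rightarrow> ('k^'n \<Rightarrow> 'k^'m) \<Rightarrow> bool" where
  "local_solution \<kappa> F D u \<longleftrightarrow>
     open D \<and> (\<forall>x\<in>D. vec_analytic_at u x) \<and>
     (\<forall>x\<in>D. \<forall>j \<alpha>. mdeg \<alpha> = \<kappa> \<longrightarrow> mpartial \<alpha> (\<lambda>y. u y $ j) x = F j \<alpha> (jet (\<kappa> - 1) u x))"


section \<open>Complete integrability\<close>

definition jpartial :: "'i \<Rightarrow> (('i \<Rightarrow> 'k) \<Rightarrow> 'k) \<Rightarrow> ('i \<Rightarrow> 'k) \<Rightarrow> 'k::real_normed_field" where
  "jpartial d f z = deriv (\<lambda>t. f (z(d := t))) (z d)"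

text \<open>Component \<open>c\<close> of the bracket of the vector fields \<open>\<Sum>d\<in>I. V d \<partial>/\<partial>z\<^sub>d\<close> and \<open>\<Sum>d\<in>I. W d \<partial>/\<partial>z\<^sub>d\<close>.\<close>

definition jbracket ::
    "'i set \<Rightarrow> ('i \<Rightarrow> ('i \<Rightarrow> 'k) \<Rightarrow> 'k) \<Rightarrow> ('i \<Rightarrow> ('i \<Rightarrow> 'k) \<Rightarrow> 'k) \<Rightarrow> 'i \<Rightarrow> ('i \<Rightarrow> 'k) \<Rightarrow> 'k::real_normed_field" where
  "jbracket I V W c z = (\<Sum>d\<in>I. V d z * jpartial d (W c) z - W d z * jpartial d (V c) z)"

definition pfaff_field ::
    "nat \<Rightarrow> ('k::real_normed_field, 'n::finite, 'm::finite) rhs \<Rightarrow> 'n \<Rightarrow>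
     ('n, 'm) jcoord \<Rightarrow> (('n, 'm) jcoord \<Rightarrow> 'k) \<Rightarrow> 'k" where
  "pfaff_field \<kappa> F k c z =
     (case c of
        Xc l \<Rightarrow> (if l = k then 1 else 0)
      | Uc i \<beta> \<Rightarrow> (if mdeg \<beta> + 2 \<le> \<kappa> then z (Uc i (\<beta> + unit_mindex k))
                   else F i (\<beta> + unit_mindex k) z))"

definition completely_integrable ::
    "nat \<Rightarrow> ('k::real_normed_field, 'n::finite, 'm::finite) rhs \<Rightarrow> bool" where
  "completely_integrable \<kappa> F \<longleftrightarrow>
     (\<exists>\<epsilon>>0. \<forall>z. (\<forall>c\<in>jcoords (\<kappa> - 1). norm (z c) < \<epsilon>) \<longrightarrow>
        (\<forall>k l. \<forall>c\<in>jcoords (\<kappa> - 1).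
           jbracket (jcoords (\<kappa> - 1)) (pfaff_field \<kappa> F k) (pfaff_field \<kappa> F l) c z = 0))"


section \<open>Lie symmetries and infinitesimal symmetries\<close>

definition join_vec :: "'k^'n::finite \<Rightarrow> 'k^'m::finite \<Rightarrow> 'k^('n + 'm)" where
  "join_vec x u = (\<chi> c. case c of Inl l \<Rightarrow> x $ l | Inr j \<Rightarrow> u $ j)"

definition graph_on :: "('k^'n::finite) set \<Rightarrow> ('k^'n \<Rightarrow> 'k^'m::finite) \<Rightarrow> ('k^('n + 'm)) set" where
  "graph_on D u = (\<lambda>x. join_vec x (u x)) ` D"

definition local_analytic_diffeo ::
    "('k^'c::finite \<Rightarrow> ('k::{real_normed_field,euclidean_space})^'c) \<Rightarrow> bool" where
  "local_analytic_diffeo \<Phi> \<longleftrightarrow>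
     vec_analytic_at \<Phi> 0 \<and>
     (\<exists>\<Theta>. vec_analytic_at \<Theta> (\<Phi> 0) \<and>
        (\<forall>\<^sub>F p in nhds 0. \<Theta> (\<Phi> p) = p) \<and> (\<forall>\<^sub>F q in nhds (\<Phi> 0). \<Phi> (\<Theta> q) = q))"

text \<open>
  Only solutions whose \<open>(\<kappa> - 1)\<close>-jet is close to the origin are tested: far away \<open>F\<close> is not
  meaningful, and even for \<open>F = 0\<close> the image of the graph of a solution with a large derivative need
  not be a graph. Solutions are considered as germs, hence the passage to
  a smaller domain \<open>D'\<close>.
\<close>

definition lie_symmetry ::
    "nat \<Rightarrow> ('k::{real_normed_field,euclidean_space}, 'n::finite, 'm::finite) rhs \<Rightarrow>
     ('k^('n + 'm) \<Rightarrow> 'k^('n + 'm)) \<Rightarrow> bool" where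
  "lie_symmetry \<kappa> F \<Phi> \<longleftrightarrow>
     local_analytic_diffeo \<Phi> \<and>
     (\<exists>\<epsilon>>0. \<forall>D u. local_solution \<kappa> F D u \<longrightarrow>
        (\<forall>x\<in>D. (\<forall>c\<in>jcoords (\<kappa> - 1). norm (jet (\<kappa> - 1) u x c) < \<epsilon>) \<longrightarrow>
           (\<exists>D' E v. open D' \<and> x \<in> D' \<and> D' \<subseteq> D \<and>
              local_solution \<kappa> F E v \<and> \<Phi> ` graph_on D' u = graph_on E v)))"

text \<open>
  \<open>\<Psi> s p\<close> is \<open>exp(sX)(p)\<close>, for \<open>s\<close> in the ground field and close to \<open>0\<close>, and \<open>p\<close> close to the origin. As the
  flow of an analytic vector field, \<open>\<Psi>\<close> is analytic in \<open>(s, p)\<close>; here the variable \<open>s\<close> is indexed by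
  \<^const>\<open>None\<close>. As a germ at the origin, \<open>\<Psi>\<close> is uniquely determined by the germ of \<open>X\<close>.
\<close>

definition local_flow ::
    "('k^'c::finite \<Rightarrow> 'k^'c) \<Rightarrow> ('k::{real_normed_field,euclidean_space} \<Rightarrow> 'k^'c \<Rightarrow> 'k^'c) \<Rightarrow> bool" where
  "local_flow X \<Psi> \<longleftrightarrow>
     (\<forall>c. kanalytic_at UNIV (\<lambda>z. \<Psi> (z None) (\<chi> i. z (Some i)) $ c) (\<lambda>_. 0)) \<and>
     (\<exists>\<delta>>0. \<forall>p. norm p < \<delta> \<longrightarrow> \<Psi> 0 p = p \<and>
        (\<forall>s. norm s < \<delta> \<longrightarrow>
           (\<forall>c. ((\<lambda>t. \<Psi> t p $ c) has_field_derivative X (\<Psi> s p) $ c) (at s))))"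

text \<open>The components \<open>X $ Inl l\<close> and \<open>X $ Inr j\<close> of \<open>X\<close> are the coefficients \<open>Q\<^sup>l\<close> and \<open>R\<^sup>j\<close>.\<close>

definition infinitesimal_symmetry ::
    "nat \<Rightarrow> ('k::{real_normed_field,euclidean_space}, 'n::finite, 'm::finite) rhs \<Rightarrow>
     ('k^('n + 'm) \<Rightarrow> 'k^('n + 'm)) \<Rightarrow> bool" where
  "infinitesimal_symmetry \<kappa> F X \<longleftrightarrow>
     vec_analytic_at X 0 \<and>
     (\<exists>\<Psi>. local_flow X \<Psi> \<and> (\<forall>\<^sub>F s in nhds 0. lie_symmetry \<kappa> F (\<Psi> s)))"


section \<open>The vector space of germs at the origin\<close>

quotient_type (overloaded) ('a, 'b) germ =
    "'a::{topological_space,zero} \<Rightarrow> 'b" / "\<lambda>f g. \<forall>\<^sub>F x in nhds 0. f x = g x"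
proof (rule equivpI)
  show "reflp (\<lambda>f g :: 'a \<Rightarrow> 'b. \<forall>\<^sub>F x in nhds 0. f x = g x)"
    by (simp add: reflp_def)
  show "symp (\<lambda>f g :: 'a \<Rightarrow> 'b. \<forall>\<^sub>F x in nhds 0. f x = g x)"
    by (simp add: symp_def eq_commute)
  show "transp (\<lambda>f g :: 'a \<Rightarrow> 'b. \<forall>\<^sub>F x in nhds 0. f x = g x)"
    by (rule transpI) (auto elim: eventually_elim2)
qed

instantiation germ :: ("{topological_space,zero}", ab_group_add) ab_group_add
begin

lift_definition zero_germ :: "('a, 'b) germ" is "\<lambda>_. 0" .

lift_definition plus_germ :: "('a, 'b) germ \<Rightarrow> ('a, 'b) germ \<Rightarrow> ('a, 'b) germ"
  is "\<lambda>f g x. f x + g x"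
  by (erule (1) eventually_elim2) simp

lift_definition uminus_germ :: "('a, 'b) germ \<Rightarrow> ('a, 'b) germ" is "\<lambda>f x. - f x"
  by (elim eventually_mono) simp

lift_definition minus_germ :: "('a, 'b) germ \<Rightarrow> ('a, 'b) germ \<Rightarrow> ('a, 'b) germ"
  is "\<lambda>f g x. f x - g x"
  by (erule (1) eventually_elim2) simp

instance
  by standard (transfer; simp add: algebra_simps)+

end

lift_definition germ_scale ::
    "'k::field \<Rightarrow> ('a::{topological_space,zero}, 'k^'c::finite) germ \<Rightarrow> ('a, 'k^'c) germ"
  is "\<lambda>a f x. a *s f x"
  by (elim eventually_mono) simp

global_interpretation germ: vector_space
  "germ_scale :: 'k::field \<Rightarrow> ('a::{topological_space,zero}, 'k^'c::finite) germ \<Rightarrow> _"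
  by standard (transfer; simp add: vec.scale_right_distrib vec.scale_left_distrib)+

definition Sym ::
    "nat \<Rightarrow> ('k::{real_normed_field,euclidean_space}, 'n::finite, 'm::finite) rhs \<Rightarrow>
     ('k^('n + 'm), 'k^('n + 'm)) germ set" where
  "Sym \<kappa> F = abs_germ ` {X. infinitesimal_symmetry \<kappa> F X}"

text \<open>
  The constant \<open>germ.dim\<close> is \<open>0\<close> on infinite-dimensional spaces, so finite dimension has to be
  part of an upper bound.
\<close>

definition germ_dim_le ::
    "('a::{topological_space,zero}, ('k::field)^'c::finite) germ set \<Rightarrow> nat \<Rightarrow> bool" where
  "germ_dim_le V N \<longleftrightarrow> (\<exists>B. finite B \<and> V \<subseteq> germ.span B) \<and> germ.dim V \<le> N"

end

theory Submission
  imports Defs "HOL-Computational_Algebra.Polynomial"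
begin

text \<open>
  The jet at \<open>0\<close> parametrizes the solutions of a completely integrable system: they form an analytic
  family \<open>u\<^sub>z(x)\<close>. Transporting this family by the flow of an infinitesimal symmetry and differentiating at
  time \<open>0\<close> shows that the characteristics \<open>R\<^sup>j - \<Sum>\<^sub>l Q\<^sup>l u\<^sup>j\<^sub>l\<close> solve the linearized system along every
  solution. Give \<open>x\<close> the weight \<open>1\<close> and \<open>u\<close> the weight \<open>\<kappa> - 1\<close>. Under the corresponding scaling the system
  degenerates to the homogeneous one, so that the leading part of a symmetry satisfies the flat equation: on
  the polynomial solutions of degree less than \<open>\<kappa>\<close>, its characteristics are again such polynomials. Testing
  this on \<open>v (a + x\<^sub>l)\<^bsup>\<kappa> - 1\<^esup>\<close> yields enough relations for the leading part to vanish as soon as the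
  coefficients in a set independent of the system vanish, which bounds the dimension by their number.
  For the homogeneous system, every coefficient in this set is realized by an explicit one-parameter group,
  a shear or a projective transformation.
\<close>

section \<open>Absolutely convergent power series\<close>

text \<open>Real and complex ground fields are treated at once; the common language is the absolute
  norm of power series coefficients, in which compositions, fixed points and antiderivatives are
  estimated term by term. The weight \<open>\<kappa> - 1\<close> of \<open>u\<close> gives a
  derivative of order \<open>r\<close> the weight \<open>\<kappa> - 1 - r\<close>: nonnegative on
  the jets entering \<open>F\<close>, so that rescaled jets stay bounded, and \<open>-1\<close> at
  order \<open>\<kappa>\<close>, so that one factor of the scaling parameter remains in front of
  \<open>F\<close> and kills it in the limit. A coefficient \<open>Q^l\<close> occurs with the
  factor \<open>u_l\<close> of weight \<open>\<kappa> - 2\<close>, hence the offset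
  \<open>edef\<close>. Leading parts of total weight above \<open>\<kappa>\<close> vanish, those of
  weight \<open>\<kappa>\<close> are governed by diagonal quadratic terms, and the coefficients of
  smaller weight are simply counted. A symmetry is known through its flow, and the size of the
  solutions that it may transport depends on the time in an uncontrolled way; analyticity in the
  time and the identity theorem remove this dependence. Closure of the symmetries under addition is
  obtained only for a larger set, the vector space cut out by the linearized equation.\<close>

definition mindices :: "'i set => ('i => nat) set" where
 "mindices I = {p. ALL i. i ~: I --> p i = 0}"

definition mmon :: "'i set => ('i => 'k::comm_monoid_mult) => ('i => nat) => 'k" where
 "mmon I h p = (PROD i:I. h i ^ p i)"

definition pdisc :: "'i set => real => ('i => 'k::real_normed_field) set" where
 "pdisc I ro = {h. ALL i:I. norm (h i) <= ro}"

text \<open>Absolute summability at the radius itself makes the closed polydisc the domain and gives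
  the coefficients a finite norm. Coordinates outside \<open>I\<close> are unrestricted, so
  \<open>I\<close> may be a finite part of an infinite type such as that of the jet
  coordinates.\<close>

definition pseries ::
  "'i set => real => (('i => nat) => 'k) => (('i => 'k) => 'k::{real_normed_field,banach}) => bool" where
 "pseries I ro c f \<longleftrightarrow>
   (%p. norm (c p) * ro ^ sum p I) summable_on mindices I &
   (ALL h:pdisc I ro. ((%p. c p * mmon I h p) has_sum f h) (mindices I))"

text \<open>The weighted \<open>\<ell>\<^sup>1\<close>-norm of the coefficients makes these functions a Banach algebra.\<close>

definition ps_le ::
  "'i set => real => (('i => 'k) => 'k::{real_normed_field,banach}) => real => bool" where
 "ps_le I ro f M \<longleftrightarrow>
   (EX c. pseries I ro c f & (\<Sum>\<^sub>\<infinity>p\<in>mindices I. norm (c p) * ro ^ sum p I) <= M)"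

section \<open>Monomials and closed polydiscs\<close>

lemma mmon_add: "mmon I h (%i. p i + q i) = mmon I h p * mmon I h q"
 by (simp add: mmon_def power_add prod.distrib)

lemma mindices_add: "p : mindices I ==> q : mindices I ==> (%i. p i + q i) : mindices I"
 by (simp add: mindices_def)

lemma zero_mindices [simp]: "(%_. 0) : mindices I"
 by (simp add: mindices_def)

lemma mmon_zero_exponent [simp]: "mmon I h (%_. 0) = 1"
 by (simp add: mmon_def)

lemma norm_mmon_le:
 fixes h :: "'i => 'k::real_normed_field"
 assumes "h : pdisc I ro"
 shows "norm (mmon I h p) <= ro ^ sum p I"
proof -
 have "norm (mmon I h p) = (PROD i:I. norm (h i) ^ p i)"
  by (simp add: mmon_def prod_norm[symmetric] norm_power)
 also have "... <= (PROD i:I. ro ^ p i)"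
  by (rule prod_mono) (use assms in \<open>auto simp: pdisc_def intro: power_mono\<close>)
 finally show ?thesis by (simp add: power_sum)
qed

lemma pdisc_mono: "ro <= ro' ==> pdisc I ro \<subseteq> pdisc I ro'"
 by (force simp: pdisc_def)

lemma zero_in_pdisc [simp]: "0 <= ro ==> (%_. 0) : pdisc I ro"
 by (simp add: pdisc_def)

lemma ps_le_mono: "ps_le I ro f M ==> M <= M' ==> ps_le I ro f M'"
 unfolding ps_le_def by (meson order_trans)

lemma ps_le_cong:
 "ps_le I ro f M ==> (!!h. h : pdisc I ro ==> g h = f h) ==> ps_le I ro g M"
 unfolding ps_le_def pseries_def by auto

text \<open>Common tool for sums, products and substitutions: the terms may be listed by any set
  \<open>A\<close>, with exponents repeated. Collecting the terms of equal exponent does not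
  increase the norm, by the triangle inequality, and regrouping keeps the value.\<close>

lemma ps_le_family:
 fixes d :: "'a => 'k::{real_normed_field,banach}"
 assumes "0 < ro" and \<pi>: "!!k. k : A ==> \<pi> k : mindices I"
  and s: "((%k. norm (d k) * ro ^ sum (\<pi> k) I) has_sum T) A" and T: "T <= M"
  and f: "!!h. h : pdisc I ro ==> ((%k. d k * mmon I h (\<pi> k)) has_sum f h) A"
 shows "ps_le I ro f M"
proof -
 define B where "B p = {k : A. \<pi> k = p}" for p
 define c where "c p = (\<Sum>\<^sub>\<infinity>k\<in>B p. d k)" for p
 let ?S = "Sigma (mindices I) B"
 have s': "((%(p, k). norm (d k) * ro ^ sum p I) has_sum T) ?S"
  by (rule iffD1[OF has_sum_reindex_bij_witness[of _ snd "%k. (\<pi> k, k)"] s])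
    (auto simp: B_def \<pi>)
 have sB: "(%k. norm (d k) * ro ^ sum p I) summable_on B p" for p
 proof (cases "p : mindices I")
  case True
  then show ?thesis
   using summable_on_SigmaD1[OF has_sum_imp_summable[OF s'], of p] by simp
 next
  case False
  then have "B p = {}" using \<pi> by (auto simp: B_def)
  then show ?thesis by simp
 qed
 have dB: "(%k. norm (d k)) summable_on B p" for p
  using sB[of p] \<open>0 < ro\<close> by (simp add: summable_on_cmult_left')
 have dB': "(d has_sum c p) (B p)" for p
  unfolding c_def by (rule has_sum_infsum[OF abs_summable_summable[OF dB]])
 have n: "((%p. (\<Sum>\<^sub>\<infinity>k\<in>B p. norm (d k)) * ro ^ sum p I) has_sum T) (mindices I)"
  by (rule has_sum_SigmaD[OF s']) (simp add: has_sum_cmult_left[OF has_sum_infsum[OF dB]])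
 have le: "norm (c p) * ro ^ sum p I <= (\<Sum>\<^sub>\<infinity>k\<in>B p. norm (d k)) * ro ^ sum p I" for p
  unfolding c_def using \<open>0 < ro\<close> by (intro mult_right_mono norm_infsum_bound[OF dB]) auto
 have sc: "(%p. norm (c p) * ro ^ sum p I) summable_on mindices I"
  by (rule summable_on_comparison_test[OF has_sum_imp_summable[OF n]])
    (use le \<open>0 < ro\<close> in auto)
 have "(\<Sum>\<^sub>\<infinity>p\<in>mindices I. norm (c p) * ro ^ sum p I) <= T"
  by (rule has_sum_mono[OF has_sum_infsum[OF sc] n le])
 moreover have "((%p. c p * mmon I h p) has_sum f h) (mindices I)" if "h : pdisc I ro" for h
 proof -
  have "((%(p, k). d k * mmon I h p) has_sum f h) ?S"
   by (rule iffD1[OF has_sum_reindex_bij_witness[of _ snd "%k. (\<pi> k, k)"] f[OF that]])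
     (auto simp: B_def \<pi>)
  then show ?thesis
   by (rule has_sum_SigmaD) (simp add: has_sum_cmult_left[OF dB'])
 qed
 ultimately show ?thesis
  unfolding ps_le_def pseries_def using sc T by (intro exI[of _ c]) auto
qed

lemma pseries_abs_summable:
 assumes "pseries I ro c f" "h : pdisc I ro"
 shows "(%p. norm (c p * mmon I h p)) summable_on mindices I"
 by (rule summable_on_comparison_test[of "%p. norm (c p) * ro ^ sum p I"])
   (use assms norm_mmon_le[OF assms(2)] in
    \<open>auto simp: pseries_def norm_mult intro!: mult_left_mono\<close>)

lemma ps_le_bound:
 assumes "ps_le I ro f M" "h : pdisc I ro"
 shows "norm (f h) <= M"
proof -
 from assms obtain c where c: "pseries I ro c f"
  "(\<Sum>\<^sub>\<infinity>p\<in>mindices I. norm (c p) * ro ^ sum p I) <= M"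
  by (auto simp: ps_le_def)
 have "f h = (\<Sum>\<^sub>\<infinity>p\<in>mindices I. c p * mmon I h p)"
  using c assms(2) by (auto simp: pseries_def infsumI)
 also have "norm ... <= (\<Sum>\<^sub>\<infinity>p\<in>mindices I. norm (c p * mmon I h p))"
  by (rule norm_infsum_bound[OF pseries_abs_summable[OF c(1) assms(2)]])
 also have "... <= (\<Sum>\<^sub>\<infinity>p\<in>mindices I. norm (c p) * ro ^ sum p I)"
  by (rule infsum_mono[OF pseries_abs_summable[OF c(1) assms(2)]])
    (use c(1) norm_mmon_le[OF assms(2)] in
     \<open>auto simp: pseries_def norm_mult intro!: mult_left_mono\<close>)
 finally show ?thesis using c(2) by simp
qed

section \<open>Algebra operations in the weighted norm\<close>

lemma ps_le_const: "0 < ro ==> ps_le I ro (%_. k) (norm k)"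
 by (rule ps_le_family[where A = "{()}" and \<pi> = "%_ _. 0" and d = "%_. k"])
   (auto intro!: has_sum_finiteI)

lemma ps_le_coord:
 assumes "finite I" "i : I" "0 < ro"
 shows "ps_le I ro (%h. h i) ro"
proof -
 let ?\<pi> = "%j. if j = i then 1 else 0 :: nat"
 have "mmon I h ?\<pi> = h i" for h :: "_ => 'b"
 proof -
  have "mmon I h ?\<pi> = (PROD j:I. if j = i then h i else 1)"
   unfolding mmon_def by (rule prod.cong) auto
  then show ?thesis using assms by simp
 qed
 then show ?thesis using assms
  by (intro ps_le_family[where A = "{()}" and \<pi> = "%_. ?\<pi>" and d = "%_. 1"])
    (auto intro!: has_sum_finiteI simp: mindices_def)
qed

text \<open>Completeness of the algebra: an absolutely convergent series of functions is one double
  family of monomials, indexed by the number of the function and the exponent.\<close>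

lemma ps_le_has_sum:
 fixes f :: "'a => ('i => 'k) => 'k::{real_normed_field,banach}"
 assumes "0 < ro" and f: "!!k. k : A ==> ps_le I ro (f k) (M k)"
  and M: "(M has_sum B) A" and "B <= B'"
  and g: "!!h. h : pdisc I ro ==> ((%k. f k h) has_sum g h) A"
 shows "ps_le I ro g B'"
proof -
 obtain c where c: "!!k. k : A ==> pseries I ro (c k) (f k)"
  "!!k. k : A ==> (\<Sum>\<^sub>\<infinity>p\<in>mindices I. norm (c k p) * ro ^ sum p I) <= M k"
  using f unfolding ps_le_def by metis
 let ?S = "A \<times> mindices I"
 let ?n = "%k. \<Sum>\<^sub>\<infinity>p\<in>mindices I. norm (c k p) * ro ^ sum p I"
 have n0: "0 <= ?n k" for k using \<open>0 < ro\<close> by (intro infsum_nonneg) auto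
 have n: "?n summable_on A"
  by (rule summable_on_comparison_test[OF has_sum_imp_summable[OF M]]) (use c n0 in auto)
 have hs: "((%p. norm (c k p) * ro ^ sum p I) has_sum ?n k) (mindices I)" if "k : A" for k
  using c(1)[OF that] by (intro has_sum_infsum) (simp add: pseries_def)
 have S: "(%(k, p). norm (c k p) * ro ^ sum p I) summable_on ?S"
  by (rule summable_on_SigmaI[OF _ n]) (use hs \<open>0 < ro\<close> in auto)
 have S': "((%(k, p). norm (c k p) * ro ^ sum p I) has_sum infsum ?n A) ?S"
  by (rule has_sum_SigmaI[OF _ has_sum_infsum[OF n] S]) (use hs in auto)
 have le: "infsum ?n A <= B'"
  using has_sum_mono[OF has_sum_infsum[OF n] M] c(2) \<open>B <= B'\<close> by fastforce
 have "((%(k, p). c k p * mmon I h p) has_sum g h) ?S" if h: "h : pdisc I ro" for h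
 proof (rule has_sum_SigmaI[OF _ g[OF h]])
  show "(%(k, p). c k p * mmon I h p) summable_on ?S"
   by (rule abs_summable_summable, rule summable_on_comparison_test[OF S])
     (use norm_mmon_le[OF h] in \<open>auto simp: norm_mult intro!: mult_left_mono\<close>)
 qed (use c(1) h in \<open>auto simp: pseries_def\<close>)
 then show ?thesis
  using S' le \<open>0 < ro\<close>
  by (intro ps_le_family[where A = ?S and \<pi> = snd and d = "%(k, p). c k p"])
    (auto simp: case_prod_unfold)
qed

text \<open>The product is the family indexed by pairs of exponents, each pair contributing to the
  sum of its two members; \<open>ps_le_family\<close> then collects the terms of the Cauchy
  product.\<close>

lemma ps_le_mult:
 assumes "0 < ro" "ps_le I ro f M" "ps_le I ro g N"
 shows "ps_le I ro (%h. f h * g h) (M * N)"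
proof -
 obtain c where c: "pseries I ro c f"
  "(\<Sum>\<^sub>\<infinity>p\<in>mindices I. norm (c p) * ro ^ sum p I) <= M"
  using assms(2) unfolding ps_le_def by blast
 obtain e where e: "pseries I ro e g"
  "(\<Sum>\<^sub>\<infinity>p\<in>mindices I. norm (e p) * ro ^ sum p I) <= N"
  using assms(3) unfolding ps_le_def by blast
 let ?c = "%p. norm (c p) * ro ^ sum p I" and ?e = "%p. norm (e p) * ro ^ sum p I"
 let ?C = "infsum ?c (mindices I)" and ?E = "infsum ?e (mindices I)"
 have hc: "(?c has_sum ?C) (mindices I)" and he: "(?e has_sum ?E) (mindices I)"
  using c(1) e(1) by (auto intro: has_sum_infsum simp: pseries_def)
 have nn: "0 <= ?C" "0 <= ?E" using assms(1) by (auto intro!: infsum_nonneg)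
 let ?S = "mindices I \<times> mindices I"
 have in1: "((%q. ?c p * ?e q) has_sum ?c p * ?E) (mindices I)" for p
  by (rule has_sum_cmult_right[OF he])
 have in2: "((%p. ?c p * ?E) has_sum ?C * ?E) (mindices I)"
  by (rule has_sum_cmult_left[OF hc])
 have S: "(%(p, q). ?c p * ?e q) summable_on ?S"
  by (rule summable_on_SigmaI[OF _ has_sum_imp_summable[OF in2]])
    (use in1 \<open>0 < ro\<close> in auto)
 have S': "((%(p, q). ?c p * ?e q) has_sum ?C * ?E) ?S"
  by (rule has_sum_SigmaI[OF _ in2 S]) (use in1 in auto)
 have eq: "?c p * ?e q = norm (c p * e q) * ro ^ sum (%i. p i + q i) I" for p q
  by (simp add: norm_mult sum.distrib power_add)
 have "((%(p, q). (c p * e q) * mmon I h (%i. p i + q i)) has_sum f h * g h) ?S"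
  if h: "h : pdisc I ro" for h
 proof (rule has_sum_SigmaI)
  have f: "((%p. c p * mmon I h p) has_sum f h) (mindices I)"
   and g: "((%p. e p * mmon I h p) has_sum g h) (mindices I)"
   using c(1) e(1) h by (auto simp: pseries_def)
  show "((%q. case (p, q) of (p, q) => (c p * e q) * mmon I h (%i. p i + q i)) has_sum
   (c p * mmon I h p) * g h) (mindices I)" for p
   using has_sum_cmult_right[OF g, of "c p * mmon I h p"] by (simp add: mmon_add mult_ac)
  show "((%p. (c p * mmon I h p) * g h) has_sum f h * g h) (mindices I)"
   by (rule has_sum_cmult_left[OF f])
  show "(%(p, q). (c p * e q) * mmon I h (%i. p i + q i)) summable_on ?S"
   by (rule abs_summable_summable, rule summable_on_comparison_test[OF S])
     (use norm_mmon_le[OF h] in \<open>auto simp: norm_mult eq intro!: mult_left_mono\<close>)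
 qed
 moreover have "?C * ?E <= M * N"
  using c(2) e(2) nn by (intro mult_mono) auto
 ultimately show ?thesis
  using S' assms(1)
  by (intro ps_le_family[where A = ?S and \<pi> = "%(p, q) i. p i + q i" and d = "%(p, q). c p * e q"])
    (auto simp: case_prod_unfold eq mindices_add)
qed

lemma ps_le_add:
 assumes "0 < ro" "ps_le I ro f M" "ps_le I ro g N"
 shows "ps_le I ro (%h. f h + g h) (M + N)"
 by (rule ps_le_has_sum[where A = UNIV and f = "%b. if b then f else g" and M = "%b. if b then M else N"])
   (use assms in \<open>auto intro!: has_sum_finiteI simp: UNIV_bool\<close>)

lemma ps_le_sum:
 fixes f :: "'a => ('i => 'k) => 'k::{real_normed_field,banach}"
 assumes "0 < ro" "finite A" "!!k. k : A ==> ps_le I ro (f k) (M k)"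
 shows "ps_le I ro (%h. SUM k:A. f k h) (SUM k:A. M k)"
 by (rule ps_le_has_sum[where A = A and f = f and M = M]) (use assms in \<open>auto intro!: has_sum_finiteI\<close>)

lemma ps_le_power:
 assumes "0 < ro" "ps_le I ro f M"
 shows "ps_le I ro (%h. f h ^ n) (M ^ n)"
 by (induction n) (use ps_le_const[of ro I 1] ps_le_mult assms in auto)

lemma ps_le_prod:
 fixes f :: "'a => ('i => 'k) => 'k::{real_normed_field,banach}"
 assumes "0 < ro" "finite A" "!!k. k : A ==> ps_le I ro (f k) (M k)"
 shows "ps_le I ro (%h. PROD k:A. f k h) (PROD k:A. M k)"
 using assms(2,3)
proof (induction A)
 case empty
 then show ?case using ps_le_const[of ro I 1] assms(1) by simp
next
 case (insert x F)
 then show ?case using ps_le_mult[OF assms(1), of I "f x" "M x"] by simp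
qed

lemma ps_le_cmult: "0 < ro ==> ps_le I ro f M ==> ps_le I ro (%h. k * f h) (norm k * M)"
 by (intro ps_le_mult ps_le_const)

lemma ps_le_uminus: "0 < ro ==> ps_le I ro f M ==> ps_le I ro (%h. - f h) M"
 using ps_le_cmult[of ro I f M "-1"] by simp

lemma ps_le_diff:
 "0 < ro ==> ps_le I ro f M ==> ps_le I ro g N ==> ps_le I ro (%h. f h - g h) (M + N)"
 using ps_le_add[of ro I f M "%h. - g h" N] ps_le_uminus[of ro I g N] by simp

lemma ps_le_mmon:
 assumes "0 < ro" "finite J" "!!j. j : J ==> ps_le I ro (g j) sg"
 shows "ps_le I ro (%h. mmon J (%j. g j h) p) (sg ^ sum p J)"
 unfolding mmon_def power_sum
 by (rule ps_le_prod[OF assms(1,2)], rule ps_le_power[OF assms(1) assms(3)])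

section \<open>Change of radius and substitution\<close>

lemma pseries_shrink:
 assumes "pseries I ro c f" "0 <= ro'" "ro' <= ro"
 shows "pseries I ro' c f"
 unfolding pseries_def
proof (intro conjI ballI)
 show "(%p. norm (c p) * ro' ^ sum p I) summable_on mindices I"
  by (rule summable_on_comparison_test[of "%p. norm (c p) * ro ^ sum p I"])
    (use assms in \<open>auto simp: pseries_def intro!: mult_left_mono power_mono\<close>)
qed (use assms pdisc_mono[OF assms(3)] in \<open>auto simp: pseries_def\<close>)

lemma ps_le_shrink:
 assumes "ps_le I ro f M" "0 <= ro'" "ro' <= ro"
 shows "ps_le I ro' f M"
proof -
 from assms obtain c where c: "pseries I ro c f"
  "(\<Sum>\<^sub>\<infinity>p\<in>mindices I. norm (c p) * ro ^ sum p I) <= M"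
  by (auto simp: ps_le_def)
 have c': "pseries I ro' c f" by (rule pseries_shrink[OF c(1) assms(2,3)])
 have "(\<Sum>\<^sub>\<infinity>p\<in>mindices I. norm (c p) * ro' ^ sum p I) <= (\<Sum>\<^sub>\<infinity>p\<in>mindices I. norm (c p) * ro ^ sum p I)"
  by (rule infsum_mono)
    (use c(1) c' assms in \<open>auto simp: pseries_def intro!: mult_left_mono power_mono\<close>)
 with c' c(2) show ?thesis by (auto simp: ps_le_def)
qed

text \<open>A monomial in functions of norm at most \<open>sg\<close> has norm at most
  \<open>sg\<close> to its degree, so the outer series at radius \<open>sg\<close> majorizes the
  composition.\<close>

lemma pseries_compose:
 assumes "0 < ro" "finite J" and f: "pseries J sg c f"
  and g: "!!j. j : J ==> ps_le I ro (g j) sg"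
 shows "ps_le I ro (%h. f (%j. g j h)) (\<Sum>\<^sub>\<infinity>p\<in>mindices J. norm (c p) * sg ^ sum p J)"
proof (rule ps_le_has_sum[where A = "mindices J" and f = "%p h. c p * mmon J (%j. g j h) p"
   and M = "%p. norm (c p) * sg ^ sum p J"])
 show "((%p. norm (c p) * sg ^ sum p J) has_sum (\<Sum>\<^sub>\<infinity>p\<in>mindices J. norm (c p) * sg ^ sum p J)) (mindices J)"
  using f by (intro has_sum_infsum) (simp add: pseries_def)
 show "((%p. c p * mmon J (%j. g j h) p) has_sum f (%j. g j h)) (mindices J)"
  if "h : pdisc I ro" for h
 proof -
  have "(%j. g j h) : pdisc J sg"
   using ps_le_bound[OF g that] by (auto simp: pdisc_def)
  then show ?thesis using f by (simp add: pseries_def)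
 qed
qed (use assms in \<open>auto intro!: ps_le_cmult ps_le_mmon\<close>)

lemma ps_le_compose:
 assumes "0 < ro" "finite J" "ps_le J sg f M" "!!j. j : J ==> ps_le I ro (g j) sg"
 shows "ps_le I ro (%h. f (%j. g j h)) M"
proof -
 from assms(3) obtain c where c: "pseries J sg c f"
  "(\<Sum>\<^sub>\<infinity>p\<in>mindices J. norm (c p) * sg ^ sum p J) <= M"
  by (auto simp: ps_le_def)
 show ?thesis
  by (rule ps_le_mono[OF pseries_compose[OF assms(1,2) c(1) assms(4)] c(2)])
qed

section \<open>Comparison with analyticity at a point\<close>

lemma summable_on_geometric_mindices:
 fixes \<theta> :: real
 assumes "finite I" "0 <= \<theta>" "\<theta> < 1"
 shows "(%p. \<theta> ^ sum p I) summable_on mindices I"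
 using assms(1)
proof (induction I)
 case empty
 have "mindices {} = {(%_. 0) :: 'a => nat}" by (auto simp: mindices_def)
 then show ?case by simp
next
 case (insert i I)
 have g: "((^) \<theta> :: nat => real) summable_on UNIV"
  by (rule summable_nonneg_imp_summable_on) (use assms in \<open>auto intro: summable_geometric\<close>)
 have "(%(n, p). \<theta> ^ n * \<theta> ^ sum p I) summable_on (UNIV :: nat set) \<times> mindices I"
  by (rule summable_on_SigmaI[where g = "%n. \<theta> ^ n * (\<Sum>\<^sub>\<infinity>p\<in>mindices I. \<theta> ^ sum p I)"])
    (use assms in \<open>auto intro!: has_sum_cmult_right has_sum_infsum insert.IH summable_on_cmult_left g\<close>)
 then show ?case
 proof (rule iffD1[OF summable_on_reindex_bij_witness
    [of _ "%p. (p i, p(i := 0))" "%(n, p). p(i := n)"], rotated -1], goal_cases)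
  case (4 a)
  then show ?case using insert.hyps by (auto simp: mindices_def)
 next
  case (5 a)
  have "sum (%j. if j = i then fst a else snd a j) I = sum (snd a) I"
   by (rule sum.cong) (use insert.hyps in auto)
  then show ?case using insert.hyps 5 by (auto simp: power_add fun_upd_def case_prod_unfold)
 qed (use insert.hyps in \<open>auto simp: mindices_def fun_upd_def fun_eq_iff\<close>)
qed

text \<open>Finite partial sums that contain a suitable \<open>X\<close> lie within 1 of the sum; a
  term outside \<open>X\<close> is the difference of two of them, hence at most 2. The finitely many
  terms inside \<open>X\<close> are bounded by the sum of their norms.\<close>

lemma has_sum_bounded_terms:
 fixes f :: "'a => 'k::real_normed_vector"
 assumes "(f has_sum s) A"
 obtains C where "C >= 0" "!!p. p : A ==> norm (f p) <= C"
proof -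
 have "\<forall>\<^sub>F X in finite_subsets_at_top A. dist (sum f X) s < 1"
  using assms unfolding has_sum_def by (rule tendstoD) simp
 then obtain X where X: "finite X" "X \<subseteq> A"
  and Y: "ALL Y. finite Y & X \<subseteq> Y & Y \<subseteq> A --> dist (sum f Y) s < 1"
  unfolding eventually_finite_subsets_at_top by metis
 have "norm (f p) <= 2 + (SUM q:X. norm (f q))" if "p : A" for p
 proof (cases "p : X")
  case True
  then have "norm (f p) <= (SUM q:X. norm (f q))"
   using X by (intro member_le_sum) auto
  then show ?thesis by simp
 next
  case False
  have "f p = sum f (insert p X) - sum f X" using False X by simp
  also have "norm ... <= dist (sum f (insert p X)) s + dist (sum f X) s"
   by (metis dist_norm dist_triangle2)
  also have "... <= 2"
   using Y[rule_format, of "insert p X"] Y[rule_format, of X] X that subset_insertI[of X p] by auto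
  finally show ?thesis by (simp add: add_increasing2 sum_nonneg)
 qed
 then show ?thesis by (intro that[of "2 + (SUM q:X. norm (f q))"]) (auto simp: sum_nonneg)
qed

text \<open>Abel's argument: convergence at a corner of a smaller polydisc bounds the terms there,
  and at half of its radius a geometric series dominates. So pointwise convergence already yields a
  finite norm at some radius.\<close>

lemma kanalytic_at_iff_ps_le:
 fixes f :: "('i => 'k) => 'k::{real_normed_field,banach}"
 assumes "finite I"
 shows "kanalytic_at I f a \<longleftrightarrow> (EX ro>0. EX M. ps_le I ro (%h. f (%i. a i + h i)) M)"
proof
 assume "kanalytic_at I f a"
 then obtain c r where r: "r > 0"
  and c: "!!z. (ALL i:I. norm (z i - a i) < r) ==>
   ((%p. c p * mmon I (%i. z i - a i) p) has_sum f z) (mindices I)"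
  unfolding kanalytic_at_def mmon_def mindices_def by blast
 \<comment> \<open>Strictly below \<open>r\<close>, because convergence is given only in the open
   polydisc and is used at the point with all coordinates shifted by \<open>ro\<close>.\<close>
 define ro where "ro = r / 2"
 have ro: "0 < ro" "ro < r" using r by (auto simp: ro_def)
 have "((%p. c p * mmon I (%i. of_real ro) p) has_sum f (%i. a i + of_real ro)) (mindices I)"
  using c[of "%i. a i + of_real ro"] ro by simp
 then obtain C where C: "C >= 0" "!!p. p : mindices I ==> norm (c p * mmon I (%i. of_real ro) p) <= C"
  by (rule has_sum_bounded_terms) blast
 have C': "norm (c p) * ro ^ sum p I <= C" if "p : mindices I" for p
  using C(2)[OF that] ro
  by (simp add: norm_mult mmon_def prod_norm[symmetric] norm_power power_sum)
 have "(%p. norm (c p) * (ro / 2) ^ sum p I) summable_on mindices I"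
 proof (rule summable_on_comparison_test)
  show "(%p. C * (1 / 2) ^ sum p I) summable_on mindices I"
   by (intro summable_on_cmult_right summable_on_geometric_mindices assms) auto
  show "norm (c p) * (ro / 2) ^ sum p I <= C * (1 / 2) ^ sum p I" if "p : mindices I" for p
   using mult_right_mono[OF C'[OF that], of "(1 / 2) ^ sum p I"]
   by (simp add: power_divide field_simps)
 qed (use ro in auto)
 then have "pseries I (ro / 2) c (%h. f (%i. a i + h i))"
  unfolding pseries_def pdisc_def using c[of "%i. a i + _ i"] ro by force
 then show "EX ro>0. EX M. ps_le I ro (%h. f (%i. a i + h i)) M"
  unfolding ps_le_def using ro by (metis half_gt_zero order_refl)
next
 assume "EX ro>0. EX M. ps_le I ro (%h. f (%i. a i + h i)) M"
 then obtain ro c where ro: "ro > 0" and c: "pseries I ro c (%h. f (%i. a i + h i))"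
  unfolding ps_le_def by blast
 have "((%p. c p * mmon I (%i. z i - a i) p) has_sum f z) (mindices I)"
  if "ALL i:I. norm (z i - a i) < ro" for z
 proof -
  have "(%i. z i - a i) : pdisc I ro" using that by (auto simp: pdisc_def less_imp_le)
  with c show ?thesis unfolding pseries_def by fastforce
 qed
 with ro show "kanalytic_at I f a"
  unfolding kanalytic_at_def mmon_def mindices_def by blast
qed

section \<open>Differentiation term by term\<close>

lemma countable_mindices: "finite I ==> countable (mindices I)"
proof -
 assume I: "finite I"
 have "mindices I \<subseteq> (%p i. if i : I then p i else 0) ` (PiE I (%_. UNIV :: nat set))"
 proof
  fix p :: "'a => nat" assume "p : mindices I"
  then have "p = (%i. if i : I then restrict p I i else 0)"
   by (auto simp: mindices_def fun_eq_iff)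
  then show "p : (%p i. if i : I then p i else 0) ` (PiE I (%_. UNIV :: nat set))"
   by (intro image_eqI[of _ _ "restrict p I"]) auto
 qed
 moreover have "countable (PiE I (%_. UNIV :: nat set))"
  by (rule countable_PiE[OF I]) simp
 ultimately show ?thesis by (meson countable_image countable_subset)
qed

lemma has_sum_nat_enumeration:
 fixes f :: "'a => 'k::{topological_comm_monoid_add,t2_space}"
 assumes "countable A"
 shows "(f has_sum s) A \<longleftrightarrow>
  ((%n. if n : to_nat_on A ` A then f (from_nat_into A n) else 0) has_sum s) UNIV"
proof -
 have "(f has_sum s) A \<longleftrightarrow> ((%n. f (from_nat_into A n)) has_sum s) (to_nat_on A ` A)"
  using assms by (intro has_sum_reindex_bij_witness[of _ "from_nat_into A" "to_nat_on A"]) auto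
 also have "... \<longleftrightarrow> ((%n. if n : to_nat_on A ` A then f (from_nat_into A n) else 0) has_sum s) UNIV"
  by (rule has_sum_cong_neutral) auto
 finally show ?thesis .
qed

text \<open>The unordered sum becomes an ordinary series by enumerating \<open>A\<close>, with zero
  terms off the image of the enumeration; the majorant \<open>N\<close> gives uniform convergence of
  the derivatives on \<open>S\<close>.\<close>

lemma has_field_derivative_has_sum:
 fixes g :: "'a => 'k => 'k::{real_normed_field,banach}"
 assumes "countable A" "convex S" "t0 : interior S"
  and d: "!!k t. k : A ==> t : S ==> (g k has_field_derivative g' k t) (at t within S)"
  and b: "!!k t. k : A ==> t : S ==> norm (g' k t) <= N k"
  and N: "N summable_on A"
  and G: "!!t. t : S ==> ((%k. g k t) has_sum G t) A"
  and D: "((%k. g' k t0) has_sum D) A"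
 shows "(G has_field_derivative D) (at t0)"
proof -
 let ?A = "to_nat_on A ` A" and ?e = "from_nat_into A"
 define h where "h n t = (if n : ?A then g (?e n) t else 0)" for n t
 define h' where "h' n t = (if n : ?A then g' (?e n) t else 0)" for n t
 define N' where "N' n = (if n : ?A then N (?e n) else 0)" for n
 have e: "?e n : A" if "n : ?A" for n using that assms(1) by auto
 have t0: "t0 : S" using assms(3) interior_subset by blast
 have G': "(%n. h n t) sums G t" if "t : S" for t
  using has_sum_imp_sums[OF G[OF that, unfolded has_sum_nat_enumeration[OF assms(1)]]]
  by (simp add: h_def)
 have D': "(%n. h' n t0) sums D"
  using has_sum_imp_sums[OF D[unfolded has_sum_nat_enumeration[OF assms(1)]]]
  by (simp add: h'_def)
 have N': "summable N'"
  using summable_on_imp_summable[OF has_sum_imp_summable[OF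
     has_sum_infsum[OF N, unfolded has_sum_nat_enumeration[OF assms(1)]]]]
  by (simp add: N'_def[abs_def])
 have "uniform_limit S (%n x. \<Sum>i<n. h' i x) (%x. suminf (%i. h' i x)) sequentially"
  by (rule Weierstrass_m_test[OF _ N']) (use b e in \<open>auto simp: h'_def N'_def\<close>)
 then have "uniformly_convergent_on S (%n x. \<Sum>i<n. h' i x)"
  by (auto simp: uniformly_convergent_on_def)
 moreover have "(h n has_field_derivative h' n t) (at t within S)" if "t : S" for n t
  by (cases "n : ?A") (use d[OF e that] in \<open>auto simp: h_def[abs_def] h'_def\<close>)
 ultimately have "((%x. \<Sum>n. h n x) has_field_derivative (\<Sum>n. h' n t0)) (at t0)"
  using has_field_derivative_series'(2)[OF assms(2), of h h' t0 t0] t0 G' assms(3)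
  by (auto simp: sums_iff)
 then have *: "((%x. \<Sum>n. h n x) has_field_derivative D) (at t0)"
  using D' by (simp add: sums_iff)
 have "\<forall>\<^sub>F x in nhds t0. x : interior S"
  using assms(3) by (intro eventually_nhds_in_open) auto
 then have "\<forall>\<^sub>F x in nhds t0. (\<Sum>n. h n x) = G x"
  by eventually_elim (use G' interior_subset[of S] in \<open>auto simp: sums_iff\<close>)
 then show ?thesis using * by (subst (asm) DERIV_cong_ev) auto
qed

text \<open>Plays the role of Cauchy's estimate over both fields: the quotient
  \<open>(ro^n - ro'^n) / (ro - ro')\<close> is a sum of \<open>n\<close> products, each at least
  \<open>ro'^(n - 1)\<close>.\<close>

lemma power_deriv_le:
 fixes ro :: real
 assumes "0 <= ro'" "ro' < ro"
 shows "of_nat n * ro' ^ (n - 1) <= ro ^ n / (ro - ro')"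
proof (cases n)
 case (Suc k)
 have "of_nat (Suc k) * ro' ^ k = (\<Sum>p<Suc k. ro' ^ k)" by simp
 also have "... <= (\<Sum>p<Suc k. ro ^ p * ro' ^ (k - p))"
 proof (rule sum_mono)
  fix p assume "p : {..<Suc k}"
  then have "ro' ^ k = ro' ^ p * ro' ^ (k - p)" by (simp flip: power_add)
  also have "... <= ro ^ p * ro' ^ (k - p)"
   using assms by (intro mult_right_mono power_mono) auto
  finally show "ro' ^ k <= ro ^ p * ro' ^ (k - p)" .
 qed
 also have "... = (ro ^ Suc k - ro' ^ Suc k) / (ro - ro')"
  using assms by (subst diff_power_eq_sum) (simp add: mult_ac)
 also have "... <= ro ^ Suc k / (ro - ro')"
  using assms by (intro divide_right_mono) auto
 finally show ?thesis using Suc by simp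
qed (use assms in auto)

definition dcoef :: "'i => (('i => nat) => 'k) => ('i => nat) => 'k::real_normed_field" where
 "dcoef i c p = of_nat (p i + 1) * c (p(i := p i + 1))"

lemma has_sum_shift_exponent:
 fixes w :: "('i => nat) => 'a::real_normed_field"
 assumes "i : I"
 shows "((%p. of_nat (p i) * w p) has_sum s) (mindices I) \<longleftrightarrow>
  ((%p. of_nat (p i + 1) * w (p(i := p i + 1))) has_sum s) (mindices I)"
proof -
 have inj: "p : mindices I ==> p(i := n) : mindices I" for p n
  using assms by (auto simp: mindices_def)
 have "((%p. of_nat (p i) * w p) has_sum s) (mindices I) \<longleftrightarrow>
  ((%p. of_nat (p i) * w p) has_sum s) {p : mindices I. p i > 0}"
  by (rule has_sum_cong_neutral) auto
 also have "... \<longleftrightarrow> ((%p. of_nat (p i + 1) * w (p(i := p i + 1))) has_sum s) (mindices I)"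
  by (rule has_sum_reindex_bij_witness[of _ "%p. p(i := p i + 1)" "%p. p(i := p i - 1)"])
    (auto simp: inj fun_upd_idem)
 finally show ?thesis .
qed

text \<open>Differentiation costs radius: by \<open>power_deriv_le\<close> the norm of the
  derivative at radius \<open>ro'\<close> exceeds that of \<open>f\<close> at radius
  \<open>ro\<close> at most by the factor \<open>1 / (ro - ro')\<close>. The existence of the
  derivative and its series come from the same majorant.\<close>

lemma pseries_deriv:
 fixes f :: "('i => 'k) => 'k::{real_normed_field,banach}"
 assumes "finite I" "i : I" "0 < ro'" "ro' < ro" and f: "pseries I ro c f"
 shows "h : pdisc I ro' ==>
   ((%t. f (h(i := t))) has_field_derivative jpartial i f h) (at (h i))"
  and "pseries I ro' (dcoef i c) (jpartial i f)"
  and "(\<Sum>\<^sub>\<infinity>p\<in>mindices I. norm (dcoef i c p) * ro' ^ sum p I)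
   <= (\<Sum>\<^sub>\<infinity>p\<in>mindices I. norm (c p) * ro ^ sum p I) / (ro - ro')"
proof -
 let ?m = "%(h :: 'i => 'k) p. (PROD j:I - {i}. h j ^ p j)"
 let ?c = "%p. norm (c p) * ro ^ sum p I"
 have split: "mmon I h p = h i ^ p i * ?m h p" for h p
  unfolding mmon_def using assms by (subst prod.remove) auto
 have sc: "?c summable_on mindices I" using f by (simp add: pseries_def)
 have key: "norm (c p) * of_nat (p i) * r ^ (p i - 1) * r ^ sum p (I - {i}) <= ?c p / (ro - r)"
  if "0 <= r" "r < ro" for p r
 proof -
  have "norm (c p) * (of_nat (p i) * r ^ (p i - 1)) * r ^ sum p (I - {i}) <=
   norm (c p) * (ro ^ p i / (ro - r)) * ro ^ sum p (I - {i})"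
   by (intro mult_mono power_mono power_deriv_le mult_left_mono) (use that in auto)
  also have "... = norm (c p) * (ro ^ p i * ro ^ sum p (I - {i})) / (ro - r)" by simp
  also have "ro ^ p i * ro ^ sum p (I - {i}) = ro ^ sum p I"
   using assms by (subst sum.remove[of I i p]) (auto simp: power_add)
  finally show ?thesis by (simp add: mult_ac)
 qed
 note shift = has_sum_shift_exponent[OF assms(2)]
 have sumupd: "sum (p(i := n)) (I - {i}) = sum p (I - {i})" for p :: "'i => nat" and n
  by (rule sum.cong) auto
 have mupd: "?m h (p(i := n)) = ?m h p" for h :: "'i => 'k" and p n
  by (rule prod.cong) auto
 have nd: "norm (dcoef i c p) * r ^ sum p I =
   real (p i + 1) * (norm (c (p(i := p i + 1))) * r ^ (((p(i := p i + 1)) i) - 1) * r ^ sum (p(i := p i + 1)) (I - {i}))" for p r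
 proof -
  have "r ^ sum p I = r ^ p i * r ^ sum p (I - {i})"
   using assms by (subst sum.remove[of I i p]) (auto simp: power_add)
  then show ?thesis unfolding sumupd by (simp add: dcoef_def norm_mult del: of_nat_Suc of_nat_add)
 qed
 have base: "(%p. real (p i) * (norm (c p) * r ^ (p i - 1) * r ^ sum p (I - {i}))) summable_on mindices I"
  if "0 <= r" "r < ro" for r
  by (rule summable_on_comparison_test[OF summable_on_cmult_left[OF sc, of "1 / (ro - r)"]])
    (use key[of r] that in \<open>auto simp: mult_ac\<close>)
 have sd: "((%p. norm (dcoef i c p) * ro' ^ sum p I) has_sum
   (\<Sum>\<^sub>\<infinity>p\<in>mindices I. real (p i) * (norm (c p) * ro' ^ (p i - 1) * ro' ^ sum p (I - {i})))) (mindices I)"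
  unfolding nd
  by (rule iffD1[OF shift]) (rule has_sum_infsum, rule base, use assms in auto)
 show "(\<Sum>\<^sub>\<infinity>p\<in>mindices I. norm (dcoef i c p) * ro' ^ sum p I) <= (\<Sum>\<^sub>\<infinity>p\<in>mindices I. ?c p) / (ro - ro')"
  unfolding infsumI[OF sd]
  by (rule has_sum_mono[OF has_sum_infsum[OF base] has_sum_divide_const[OF has_sum_infsum[OF sc]]])
    (use key[of ro'] assms in \<open>auto simp: mult_ac\<close>)
 have Dsum: "((%p. of_nat (p i) * (c p * h i ^ (p i - 1) * ?m h p)) has_sum
    (\<Sum>\<^sub>\<infinity>p\<in>mindices I. dcoef i c p * mmon I h p)) (mindices I)"
  if h: "h : pdisc I ro'" for h
 proof -
  have eq: "of_nat (p i + 1) * (c (p(i := p i + 1)) * h i ^ ((p(i := p i + 1)) i - 1) * ?m h (p(i := p i + 1)))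
    = dcoef i c p * mmon I h p" for p
   unfolding mupd split dcoef_def by simp
  have "(%p. norm (dcoef i c p * mmon I h p)) summable_on mindices I"
   by (rule summable_on_comparison_test[OF has_sum_imp_summable[OF sd]])
     (use norm_mmon_le[OF h] in \<open>auto simp: norm_mult intro!: mult_left_mono\<close>)
  from has_sum_infsum[OF abs_summable_summable[OF this]]
  show ?thesis by (subst shift) (simp only: eq)
 qed
 have der: "((%t. f (h(i := t))) has_field_derivative
   (\<Sum>\<^sub>\<infinity>p\<in>mindices I. dcoef i c p * mmon I h p)) (at (h i))"
  if h: "h : pdisc I ro'" for h
 proof -
  \<comment> \<open>An intermediate radius: \<open>h i\<close> must lie in the interior of the disc
    on which the differentiated terms are dominated.\<close>
  define r where "r = (ro + ro') / 2"
  have r: "ro' < r" "r < ro" using assms by (auto simp: r_def)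
  have hu: "h(i := t) : pdisc I r" if "t : cball 0 r" for t
   using h r that by (auto simp: pdisc_def)
  have mu: "?m (h(i := t)) p = ?m h p" for t p by (rule prod.cong) auto
  have mle: "norm (?m h p) <= r ^ sum p (I - {i})" for p
  proof -
   have "norm (mmon (I - {i}) h p) <= r ^ sum p (I - {i})"
    by (rule norm_mmon_le) (use h r in \<open>auto simp: pdisc_def\<close>)
   then show ?thesis by (simp add: mmon_def)
  qed
  show ?thesis
  proof (rule has_field_derivative_has_sum[where A = "mindices I" and S = "cball 0 r"
    and g = "%p t. c p * (t ^ p i * ?m h p)"
    and g' = "%p t. of_nat (p i) * (c p * t ^ (p i - 1) * ?m h p)"
    and N = "%p. real (p i) * (norm (c p) * r ^ (p i - 1) * r ^ sum p (I - {i}))"])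
   show "countable (mindices I)" by (rule countable_mindices[OF assms(1)])
   have "ball 0 r \<subseteq> cball 0 r" by auto
   moreover have "h i : ball 0 r" using h r assms by (auto simp: pdisc_def)
   ultimately show "h i : interior (cball 0 r)" by (meson interiorI open_ball)
   show "((%t. c p * (t ^ p i * ?m h p)) has_field_derivative
     of_nat (p i) * (c p * t ^ (p i - 1) * ?m h p)) (at t within cball 0 r)" for p t
    by (auto intro!: derivative_eq_intros)
   show "norm (of_nat (p i) * (c p * t ^ (p i - 1) * ?m h p))
     <= real (p i) * (norm (c p) * r ^ (p i - 1) * r ^ sum p (I - {i}))" if "t : cball 0 r" for p t
    unfolding norm_mult norm_power norm_of_nat
    by (intro mult_left_mono mult_mono power_mono mle) (use that r assms in auto)
   show "((%p. c p * (t ^ p i * ?m h p)) has_sum f (h(i := t))) (mindices I)"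
    if "t : cball 0 r" for t
   proof -
    have "h(i := t) : pdisc I ro" using hu[OF that] pdisc_mono[of r ro I] r by auto
    then have "((%p. c p * mmon I (h(i := t)) p) has_sum f (h(i := t))) (mindices I)"
     using f by (simp add: pseries_def)
    then show ?thesis unfolding split mu by simp
   qed
  qed (use Dsum[OF h] base r assms in auto)
 qed
 have J: "jpartial i f h = (\<Sum>\<^sub>\<infinity>p\<in>mindices I. dcoef i c p * mmon I h p)" if "h : pdisc I ro'" for h
  unfolding jpartial_def by (rule DERIV_imp_deriv[OF der[OF that]])
 show "((%t. f (h(i := t))) has_field_derivative jpartial i f h) (at (h i))"
  if "h : pdisc I ro'" for h
  using der[OF that] J[OF that] by simp
 show "pseries I ro' (dcoef i c) (jpartial i f)"
  unfolding pseries_def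
 proof (intro conjI ballI)
  fix h :: "'i => 'k" assume h: "h : pdisc I ro'"
  have "(%p. norm (dcoef i c p * mmon I h p)) summable_on mindices I"
   by (rule summable_on_comparison_test[OF has_sum_imp_summable[OF sd]])
     (use norm_mmon_le[OF h] in \<open>auto simp: norm_mult intro!: mult_left_mono\<close>)
  then show "((%p. dcoef i c p * mmon I h p) has_sum jpartial i f h) (mindices I)"
   unfolding J[OF h] by (rule has_sum_infsum[OF abs_summable_summable])
 qed (rule has_sum_imp_summable[OF sd])
qed

section \<open>Uniqueness of coefficients and the identity theorem\<close>

lemma has_sum_minus:
 fixes f g :: "'a => 'k::real_normed_vector"
 assumes "(f has_sum a) A" "(g has_sum b) A"
 shows "((%x. f x - g x) has_sum (a - b)) A"
 using has_sum_add[OF assms(1), of "%x. - g x" "- b"] assms(2) by (simp add: has_sum_uminus)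

lemma pseries_diff:
 assumes "pseries I ro c f" "pseries I ro d g" "0 <= ro"
 shows "pseries I ro (%p. c p - d p) (%h. f h - g h)"
 unfolding pseries_def
proof (intro conjI ballI)
 show "(%p. norm (c p - d p) * ro ^ sum p I) summable_on mindices I"
  by (rule summable_on_comparison_test[OF summable_on_add
     [of "%p. norm (c p) * ro ^ sum p I" _ "%p. norm (d p) * ro ^ sum p I"]])
    (use assms in \<open>auto simp: pseries_def simp flip: distrib_right
     intro!: mult_right_mono norm_triangle_ineq4\<close>)
qed (use assms in \<open>auto simp: pseries_def left_diff_distrib intro!: has_sum_minus\<close>)

lemma mindices_fun_upd: "i : I ==> p : mindices I ==> p(i := n) : mindices I"
 by (auto simp: mindices_def)

lemma jpartial_cong_pdisc:
 assumes "!!h. h : pdisc I dt ==> f h = g h" "h : pdisc I dt'" "dt' < dt"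
 shows "jpartial i f h = jpartial i g h"
proof (cases "i : I")
 case True
 have "\<forall>\<^sub>F t in nhds (h i). norm t < dt"
 proof (rule eventually_mono[OF eventually_nhds_in_open[of "ball 0 dt"]])
  show "h i : ball 0 dt" using assms True by (force simp: pdisc_def)
 qed auto
 then have "\<forall>\<^sub>F t in nhds (h i). f (h(i := t)) = g (h(i := t))"
  by eventually_elim (use assms in \<open>force simp: pdisc_def\<close>)
 then show ?thesis unfolding jpartial_def by (intro deriv_cong_ev) auto
next
 case False
 \<comment> \<open>A direction outside \<open>I\<close> is unrestricted, so the polydisc contains
   the whole line and the two functions agree on all of it.\<close>
 then have "h(i := t) : pdisc I dt" for t using assms by (force simp: pdisc_def)
 then show ?thesis unfolding jpartial_def using assms(1) by simp
qed

lemma pseries_at_zero: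
 fixes f :: "('i => 'k) => 'k::{real_normed_field,banach}"
 assumes "finite I" "0 <= ro" "pseries I ro c f"
 shows "f (%_. 0) = c (%_. 0)"
proof -
 have "((%q. c q * mmon I (%_. 0) q) has_sum f (%_. 0)) (mindices I)"
  using assms zero_in_pdisc[OF assms(2), of I] unfolding pseries_def by blast
 moreover have "((%q. c q * mmon I (%_. 0) q) has_sum c (%_. 0)) (mindices I)"
 proof (rule has_sum_finite_neutralI[of "{%_. 0}"])
  fix q :: "'i => nat" assume "q : mindices I - {%_. 0}"
  then obtain i where "i : I" "q i ~= 0" by (force simp: mindices_def fun_eq_iff)
  then show "c q * mmon I (%_. 0) q = 0" using assms(1) by (auto simp: mmon_def)
 qed auto
 ultimately show ?thesis by (rule has_sum_unique)
qed

text \<open>Induction on the degree of \<open>p\<close>: up to a nonzero integer factor the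
  coefficient of \<open>p\<close> is a coefficient of smaller degree in a partial derivative of
  \<open>f\<close>, which vanishes on a smaller polydisc. In degree 0 the coefficient is the value
  at the origin.\<close>

lemma pseries_zero_coeffs:
 fixes f :: "('i => 'k) => 'k::{real_normed_field,banach}"
 assumes "finite I" "0 < ro" "0 < dt" "pseries I ro c f" "!!h. h : pdisc I dt ==> f h = 0" "p : mindices I"
 shows "c p = 0"
 using assms(2-)
proof (induction "sum p I" arbitrary: p c f ro dt)
 case 0
 then have p: "p = (%_. 0)" using assms(1) by (auto simp: mindices_def fun_eq_iff)
 have "f (%_. 0) = c (%_. 0)"
  by (rule pseries_at_zero[OF assms(1) _ 0(4)]) (use 0 in auto)
 then show ?case using p 0(5)[of "%_. 0"] 0(3) by simp
next
 case (Suc n)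
 then have "sum p I ~= 0" by simp
 then obtain i where i: "i : I" "p i ~= 0" by (meson sum.neutral)
 define q where "q = p(i := p i - 1)"
 have p: "p = q(i := q i + 1)" using i by (auto simp: q_def)
 have q: "q : mindices I" unfolding q_def by (rule mindices_fun_upd[OF i(1) Suc.prems(5)])
 have "sum p I = Suc (sum q I)"
  unfolding p using assms(1) i(1) by (subst (1 2) sum.remove[of I i]) auto
 with Suc.hyps have n: "n = sum q I" by simp
 have "dcoef i c q = 0"
 proof (rule Suc.hyps(1)[OF n _ _ pseries_deriv(2)[OF assms(1) i(1) _ _ Suc.prems(3)] _ q])
  show "0 < ro / 2" "0 < ro / 2" "ro / 2 < ro" "0 < dt / 2" using Suc.prems by auto
  show "jpartial i f h = 0" if "h : pdisc I (dt / 2)" for h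
   using jpartial_cong_pdisc[of I dt f "%_. 0" h "dt / 2" i] Suc.prems that
   by (simp add: jpartial_def)
 qed
 then have "of_nat (q i + 1) = (0 :: 'k) | c p = 0" unfolding dcoef_def using p by simp
 then show ?case unfolding of_nat_eq_0_iff by simp
qed

lemma pseries_unique:
 fixes f :: "('i => 'k) => 'k::{real_normed_field,banach}"
 assumes "finite I" "0 < ro" "0 < dt" "pseries I ro c f" "pseries I ro' d g" "0 < ro'"
  and "!!h. h : pdisc I dt ==> f h = g h" "p : mindices I"
 shows "c p = d p"
proof -
 let ?r = "min ro ro'"
 have "pseries I ?r (%p. c p - d p) (%h. f h - g h)"
  by (intro pseries_diff pseries_shrink[OF assms(4)] pseries_shrink[OF assms(5)])
    (use assms in auto)
 from pseries_zero_coeffs[OF assms(1) _ assms(3) this _ assms(8)] assms show ?thesis by auto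
qed

lemma ps_le_identity:
 fixes f :: "('i => 'k) => 'k::{real_normed_field,banach}"
 assumes "finite I" "0 < ro" "ps_le I ro f M" "0 < dt" "!!h. h : pdisc I dt ==> f h = 0"
  and "h : pdisc I ro"
 shows "f h = 0"
proof -
 obtain c where c: "pseries I ro c f" using assms(3) by (auto simp: ps_le_def)
 have "((%p. c p * mmon I h p) has_sum f h) (mindices I)"
  using c assms(6) by (auto simp: pseries_def)
 moreover have "((%p. c p * mmon I h p) has_sum 0) (mindices I)"
  using pseries_zero_coeffs[OF assms(1,2,4) c assms(5)] by (intro has_sum_0) auto
 ultimately show ?thesis by (rule has_sum_unique)
qed

lemma ps_le_translate:
 fixes f :: "('i => 'k) => 'k::{real_normed_field,banach}"
 assumes "finite I" "ps_le I ro f M" "b : pdisc I be" "0 < ro'" "be + ro' <= ro"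
 shows "ps_le I ro' (%h. f (%i. b i + h i)) M"
proof (rule ps_le_compose[OF assms(4,1,2)])
 fix j assume j: "j : I"
 have "ps_le I ro' (%h. b j + h j) (norm (b j) + ro')"
  by (intro ps_le_add ps_le_const ps_le_coord) (use assms j in auto)
 then show "ps_le I ro' (%h. b j + h j) ro"
  by (rule ps_le_mono) (use assms j in \<open>force simp: pdisc_def\<close>)
qed

text \<open>The polydisc of radius \<open>3 * ro / 4\<close> about \<open>b\<close> fits into the
  given one and covers the radius \<open>ro / 2\<close> about the origin, so the centred identity
  theorem applies first at \<open>b\<close> and then at the origin.\<close>

lemma ps_le_identity_off_center:
 fixes f :: "('i => 'k) => 'k::{real_normed_field,banach}"
 assumes "finite I" "0 < ro" "ps_le I ro f M" "b : pdisc I (ro / 4)" "0 < dt"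
  and f: "!!h. h : pdisc I dt ==> f (%i. b i + h i) = 0" and h: "h : pdisc I ro"
 shows "f h = 0"
proof -
 have "ps_le I (3 * ro / 4) (%h. f (%i. b i + h i)) M"
  by (rule ps_le_translate[OF assms(1,3,4)]) (use assms in auto)
 then have z: "f (%i. b i + h i) = 0" if "h : pdisc I (3 * ro / 4)" for h
  using ps_le_identity[of I "3 * ro / 4" "%h. f (%i. b i + h i)" M dt h] assms that by simp
 have *: "f h = 0" if "h : pdisc I (ro / 2)" for h
 proof -
  have "(%i. h i - b i) : pdisc I (3 * ro / 4)"
   unfolding pdisc_def
  proof safe
   fix i assume "i : I"
   with that assms(4) have "norm (h i) <= ro / 2" "norm (b i) <= ro / 4" by (auto simp: pdisc_def)
   then show "norm (h i - b i) <= 3 * ro / 4" using norm_triangle_ineq4[of "h i" "b i"] by simp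
  qed
  from z[OF this] show ?thesis by simp
 qed
 show ?thesis by (rule ps_le_identity[OF assms(1-3) _ * h]) (use assms in auto)
qed

text \<open>A Schwarz lemma for the coefficient norm: without constant term every monomial gains at
  least one factor \<open>\<theta>\<close>.\<close>

lemma ps_le_small:
 fixes f :: "('i => 'k) => 'k::{real_normed_field,banach}"
 assumes "finite I" "0 < ro" "ps_le I ro f M" "f (%_. 0) = 0" "0 < \<theta>" "\<theta> <= 1"
 shows "ps_le I (\<theta> * ro) f (\<theta> * M)"
proof -
 obtain c where c: "pseries I ro c f"
  "(\<Sum>\<^sub>\<infinity>p\<in>mindices I. norm (c p) * ro ^ sum p I) <= M" using assms(3) by (auto simp: ps_le_def)
 have "f (%_. 0) = c (%_. 0)"
  by (rule pseries_at_zero[OF assms(1) _ c(1)]) (use assms in auto)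
 then have c0: "c (%_. 0) = 0" using assms by simp
 have le: "norm (c p) * (\<theta> * ro) ^ sum p I <= \<theta> * (norm (c p) * ro ^ sum p I)" if "p : mindices I" for p
 proof (cases "sum p I")
  case 0
  then have "p = (%_. 0)" using assms(1) that by (auto simp: mindices_def fun_eq_iff)
  then show ?thesis using c0 by simp
 next
  case (Suc n)
  have "\<theta> ^ Suc n <= \<theta>" using assms by (simp add: mult_left_le power_le_one)
  then have "\<theta> ^ Suc n * (norm (c p) * ro ^ Suc n) <= \<theta> * (norm (c p) * ro ^ Suc n)"
   using assms by (intro mult_right_mono) auto
  then show ?thesis unfolding Suc power_mult_distrib by (simp only: mult_ac)
 qed
 have s: "pseries I (\<theta> * ro) c f"
  by (rule pseries_shrink[OF c(1)]) (use assms in \<open>auto simp: mult_left_le_one_le\<close>)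
 have "(\<Sum>\<^sub>\<infinity>p\<in>mindices I. norm (c p) * (\<theta> * ro) ^ sum p I)
   <= (\<Sum>\<^sub>\<infinity>p\<in>mindices I. \<theta> * (norm (c p) * ro ^ sum p I))"
  by (rule infsum_mono[OF _ _ le]) (use s c(1) in \<open>auto simp: pseries_def intro: summable_on_cmult_right\<close>)
 also have "... <= \<theta> * M"
  using c(2) assms(5) by (subst infsum_cmult_right') (auto intro: mult_left_mono)
 finally show ?thesis using s by (auto simp: ps_le_def)
qed

section \<open>Linear approximation and the chain rule\<close>

definition unit_exp :: "'i => 'i => nat" where
 "unit_exp j = (%i. if i = j then 1 else 0)"

lemma unit_exp_simps [simp]: "unit_exp j j = 1" "i ~= j ==> unit_exp j i = 0"
 by (auto simp: unit_exp_def)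

lemma mmon_unit_exp: "finite I ==> i : I ==> mmon I h (unit_exp i) = h i"
 unfolding mmon_def by (subst prod.remove[of I i]) (auto intro!: prod.neutral)

lemma unit_exp_mindices [simp]: "j : I ==> unit_exp j : mindices I"
 by (auto simp: mindices_def unit_exp_def)

lemma mindices_degree_le_1:
 assumes "finite J"
 shows "{p : mindices J. sum p J <= 1} = insert (%_. 0) (unit_exp ` J)"
proof safe
 fix p assume p: "p : mindices J" "sum p J <= 1" "p ~: unit_exp ` J"
 show "p = (%_. 0)"
 proof (cases "sum p J = 1")
  case True
  then obtain a where a: "a : J" "p a = 1" "ALL b:J. a ~= b --> p b = 0"
   unfolding sum_eq_1_iff[OF assms] by blast
  then have "p = unit_exp a" using p(1) by (force simp: mindices_def unit_exp_def fun_eq_iff)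
  with a p(3) show ?thesis by blast
 next
  case False
  with p(2) have "sum p J = 0" by simp
  then show ?thesis using p(1) assms by (auto simp: mindices_def fun_eq_iff)
 qed
next
 fix j assume "j : J"
 then show "unit_exp j : mindices J" by simp
 show "sum (unit_exp j) J <= 1"
  using assms by (simp add: unit_exp_def)
qed auto

lemma norm_has_sum_le:
 fixes f :: "'a => 'k::banach"
 assumes N: "(N has_sum s) A" and f: "(f has_sum a) A" and le: "!!p. p : A ==> norm (f p) <= N p"
 shows "norm a <= s"
proof -
 have n: "(%p. norm (f p)) summable_on A"
  by (rule summable_on_comparison_test[OF has_sum_imp_summable[OF N]]) (use le in auto)
 show ?thesis
  by (rule norm_has_sum_bound[OF has_sum_infsum[OF n] f, THEN order_trans])
    (rule has_sum_mono[OF has_sum_infsum[OF n] N le])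
qed

text \<open>If \<open>m\<close> is the sum of the norms of the \<open>h j\<close>, a term of degree
  at least 2 is at most \<open>(m / r)^2\<close> times its majorant at radius \<open>r\<close>. The
  constant is therefore \<open>T / r^2\<close> with the full norm \<open>T\<close>.\<close>

lemma pseries_linear_approx:
 fixes F :: "('i => 'k) => 'k::{real_normed_field,banach}"
 assumes "finite J" "0 < r" and F: "pseries J r c F"
 obtains C where "C >= 0" "!!h. (SUM j:J. norm (h j)) <= r ==>
  norm (F h - c (%_. 0) - (SUM j:J. c (unit_exp j) * h j)) <= C * (SUM j:J. norm (h j)) ^ 2"
proof -
 let ?S = "insert (%_. 0) (unit_exp ` J)"
 define T where "T = (\<Sum>\<^sub>\<infinity>p\<in>mindices J. norm (c p) * r ^ sum p J)"
 have T: "((%p. norm (c p) * r ^ sum p J) has_sum T) (mindices J)"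
  unfolding T_def using F by (intro has_sum_infsum) (simp add: pseries_def)
 have T0: "T >= 0" unfolding T_def using assms(2) by (intro infsum_nonneg) auto
 have inj: "inj_on unit_exp J"
 proof (rule inj_onI)
  fix x y :: 'i assume "unit_exp x = unit_exp y"
  then have "unit_exp x x = unit_exp y x" by simp
  then show "x = y" by (simp add: unit_exp_def split: if_splits)
 qed
 have notin: "(%_. 0) ~: unit_exp ` J"
  by (metis image_iff unit_exp_simps(1) zero_neq_one)
 have "norm (F h - c (%_. 0) - (SUM j:J. c (unit_exp j) * h j)) <= T / r\<^sup>2 * (SUM j:J. norm (h j)) ^ 2"
  if h: "(SUM j:J. norm (h j)) <= r" for h
 proof -
  define m where "m = (SUM j:J. norm (h j))"
  have m: "0 <= m" "m <= r" using h by (auto simp: m_def sum_nonneg)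
  have hm: "h : pdisc J m"
   unfolding pdisc_def m_def using assms(1) by (auto intro!: member_le_sum)
  then have hr: "h : pdisc J r" using pdisc_mono[OF m(2)] by auto
  have 1: "((%p. c p * mmon J h p) has_sum F h) (mindices J)"
   using F hr by (simp add: pseries_def)
  have 2: "((%p. if p : ?S then c p * mmon J h p else 0) has_sum
    (c (%_. 0) + (SUM j:J. c (unit_exp j) * h j))) (mindices J)"
  proof (rule has_sum_finite_neutralI[of ?S])
   show "?S \<subseteq> mindices J" by auto
   have "(SUM p:?S. c p * mmon J h p) = c (%_. 0) + (SUM j:J. c (unit_exp j) * h j)"
    using notin assms(1) by (simp add: sum.reindex[OF inj] mmon_unit_exp)
   then show "c (%_. 0) + (SUM j:J. c (unit_exp j) * h j) =
     (SUM p:?S. if p : ?S then c p * mmon J h p else 0)" by simp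
  qed (use assms(1) in auto)
  have 3: "((%p. c p * mmon J h p - (if p : ?S then c p * mmon J h p else 0)) has_sum
    (F h - (c (%_. 0) + (SUM j:J. c (unit_exp j) * h j)))) (mindices J)"
   by (rule has_sum_minus[OF 1 2])
  have "norm (F h - (c (%_. 0) + (SUM j:J. c (unit_exp j) * h j))) <= T * (m / r) ^ 2"
  proof (rule norm_has_sum_le[OF has_sum_cmult_left[OF T] 3])
   fix p assume p: "p : mindices J"
   show "norm (c p * mmon J h p - (if p : ?S then c p * mmon J h p else 0))
     <= norm (c p) * r ^ sum p J * (m / r) ^ 2"
   proof (cases "p : ?S")
    case True
    then show ?thesis using assms(2) m by simp
   next
    case False
    then have "~ sum p J <= 1" using mindices_degree_le_1[OF assms(1)] p by blast
    then obtain k where k: "sum p J = k + 2" by (metis add.commute le_Suc_ex not_less_eq_eq one_add_one plus_1_eq_Suc)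
    have "norm (c p * mmon J h p) <= norm (c p) * m ^ sum p J"
     unfolding norm_mult by (intro mult_left_mono norm_mmon_le[OF hm]) auto
    also have "m ^ sum p J <= r ^ k * m ^ 2"
     unfolding k power_add using m by (intro mult_right_mono power_mono) auto
    also have "... = r ^ sum p J * (m / r) ^ 2"
     unfolding k power_add using assms(2) by (simp add: power_divide)
    finally show ?thesis using False by (simp add: mult_left_mono mult.assoc)
   qed
  qed
  then show ?thesis by (simp add: m_def power_divide algebra_simps)
 qed
 then show ?thesis using that[of "T / r\<^sup>2"] T0 by auto
qed

text \<open>The function is re-expanded about the point of the curve; after division by
  \<open>t - t0\<close> the quadratic remainder is a product of a null function and a convergent
  one.\<close>

lemma ps_le_chain_rule:
 fixes f :: "('i => 'k) => 'k::{real_normed_field,banach}"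
 assumes "finite J" "ps_le J ro f M" "(%j. g j t0) : pdisc J ro'" "ro' < ro"
  and g: "!!j. j : J ==> (g j has_field_derivative g' j) (at t0)"
 shows "((%t. f (%j. g j t)) has_field_derivative
  (SUM j:J. jpartial j f (%j. g j t0) * g' j)) (at t0)"
proof -
 define z where "z = (%j. g j t0)"
 define r where "r = ro - ro'"
 have r: "0 < r" using assms by (simp add: r_def)
 have "ps_le J r (%h. f (%i. z i + h i)) M"
  by (rule ps_le_translate[OF assms(1-2) assms(3)[folded z_def]]) (use r in \<open>auto simp: r_def\<close>)
 then obtain c where c: "pseries J r c (%h. f (%i. z i + h i))" by (auto simp: ps_le_def)
 obtain C where C: "C >= 0" and approx: "!!h. (SUM j:J. norm (h j)) <= r ==>
  norm (f (%i. z i + h i) - c (%_. 0) - (SUM j:J. c (unit_exp j) * h j)) <= C * (SUM j:J. norm (h j)) ^ 2"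
  by (rule pseries_linear_approx[OF assms(1) r c]) (rule that, assumption+)
 have c0: "f z = c (%_. 0)"
  using pseries_at_zero[OF assms(1) _ c] r by simp
 \<comment> \<open>Stated for arbitrary curves through \<open>z\<close>: applied to coordinate lines
   it identifies the linear coefficients with the partial derivatives, applied to \<open>g\<close>
   it gives the claim.\<close>
 have main: "((%t. f (%j. g j t)) has_field_derivative (SUM j:J. c (unit_exp j) * g' j)) (at t0)"
  if g: "!!j. j : J ==> (g j has_field_derivative g' j) (at t0)" and gz: "(%j. g j t0) = z" for g g' t0
 proof -
  define h where "h j y = g j y - z j" for j y
  define q where "q j y = h j y / (y - t0)" for j y
  define R where "R y = f (%j. g j y) - f z - (SUM j:J. c (unit_exp j) * h j y)" for y
  have q: "(q j \<longlongrightarrow> g' j) (at t0)" if "j : J" for j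
   using g[OF that] fun_cong[OF gz, of j]
   by (simp add: has_field_derivative_iff q_def[abs_def] h_def)
  have "(g j \<longlongrightarrow> z j) (at t0)" if "j : J" for j
   using DERIV_isCont[OF g[OF that]] fun_cong[OF gz, of j] by (simp add: isCont_def)
  then have h: "(h j \<longlongrightarrow> 0) (at t0)" if "j : J" for j
   unfolding h_def using that by (simp add: LIM_zero_iff)
  have sh: "((%y. SUM j:J. norm (h j y)) \<longlongrightarrow> 0) (at t0)"
   using tendsto_sum[of J "%j y. norm (h j y)" "%_. 0"] tendsto_norm_zero[OF h] by simp
  have R: "norm (R y / (y - t0)) <= C * (SUM j:J. norm (h j y)) * (SUM j:J. norm (q j y))"
   if "y ~= t0" "(SUM j:J. norm (h j y)) < r" for y
  proof -
   have "norm (R y) <= C * (SUM j:J. norm (h j y)) ^ 2"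
    using approx[of "%j. h j y"] that by (simp add: R_def c0 h_def)
   then have "norm (R y / (y - t0)) <= C * (SUM j:J. norm (h j y)) ^ 2 / norm (y - t0)"
    by (simp add: norm_divide divide_right_mono)
   also have "... = C * (SUM j:J. norm (h j y)) * ((SUM j:J. norm (h j y)) / norm (y - t0))"
    by (simp add: power2_eq_square)
   also have "(SUM j:J. norm (h j y)) / norm (y - t0) = (SUM j:J. norm (q j y))"
    by (simp add: q_def norm_divide sum_divide_distrib)
   finally show ?thesis .
  qed
  have ev: "\<forall>\<^sub>F y in at t0. norm (R y / (y - t0)) <= C * (SUM j:J. norm (h j y)) * (SUM j:J. norm (q j y))"
   using order_tendstoD(2)[OF sh r] eventually_neq_at_within[of t0 t0]
   by eventually_elim (use R in auto)
  have "((%y. C * (SUM j:J. norm (h j y)) * (SUM j:J. norm (q j y))) \<longlongrightarrow> C * 0 * (SUM j:J. norm (g' j))) (at t0)"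
   by (intro tendsto_mult tendsto_const sh tendsto_sum tendsto_norm q)
  then have R0: "((%y. R y / (y - t0)) \<longlongrightarrow> 0) (at t0)"
   using Lim_null_comparison[OF ev] by simp
  have "((%y. (SUM j:J. c (unit_exp j) * q j y) + R y / (y - t0)) \<longlongrightarrow>
    (SUM j:J. c (unit_exp j) * g' j) + 0) (at t0)"
   by (intro tendsto_add tendsto_sum tendsto_mult tendsto_const q R0)
  moreover have "(SUM j:J. c (unit_exp j) * q j y) + R y / (y - t0) =
    (f (%j. g j y) - f (%j. g j t0)) / (y - t0)" for y
   by (simp add: R_def q_def gz diff_divide_distrib sum_divide_distrib)
  ultimately show ?thesis by (simp add: has_field_derivative_iff)
 qed
 have "jpartial j f z = c (unit_exp j)" if j: "j : J" for j
 proof -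
  have "((%t. f (%i. (z(j := t)) i)) has_field_derivative
    (SUM i:J. c (unit_exp i) * (if i = j then 1 else 0))) (at (z j))"
   by (rule main) (auto intro!: derivative_eq_intros)
  then have "((%t. f (z(j := t))) has_field_derivative c (unit_exp j)) (at (z j))"
   using j assms(1) by (simp add: if_distrib cong: if_cong) (simp add: fun_upd_def)
  then show ?thesis by (simp add: jpartial_def DERIV_imp_deriv)
 qed
 then have "(SUM j:J. c (unit_exp j) * g' j) = (SUM j:J. jpartial j f z * g' j)"
  by simp
 then show ?thesis using main[of g g' t0] g by (simp add: z_def)
qed

section \<open>Germs of analytic functions at the origin\<close>

text \<open>Neighbourhoods of the origin in the coordinates of \<open>I\<close> alone, the others
  being free. As a filter it lets finitely many identities of germs be combined without tracking
  radii.\<close>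

definition nb :: "'i set => ('i => 'k::real_normed_field) filter" where
 "nb I = (INF dt\<in>{0<..}. principal (pdisc I dt))"

lemma eventually_nb: "eventually P (nb I) \<longleftrightarrow> (EX dt>0. ALL h:pdisc I dt. P h)"
 unfolding nb_def
proof (subst eventually_INF_base)
 fix a b :: real assume "a : {0<..}" "b : {0<..}"
 then show "EX x:{0<..}. principal (pdisc I x) <= inf (principal (pdisc I a)) (principal (pdisc I b))"
  by (intro bexI[of _ "min a b"]) (auto simp: pdisc_def)
qed (auto simp: eventually_principal)

lemma eventually_nb_zero: "eventually P (nb I) ==> P (%_. 0)"
 by (auto simp: eventually_nb)

definition analytic0 :: "'i set => (('i => 'k) => 'k::{real_normed_field,banach}) => bool" where
 "analytic0 I f \<longleftrightarrow> (EX ro>0. EX M. ps_le I ro f M)"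

lemma kanalytic_at_iff_analytic0:
 fixes f :: "('i => 'k) => 'k::{real_normed_field,banach}"
 shows "finite I ==> kanalytic_at I f a \<longleftrightarrow> analytic0 I (%h. f (%i. a i + h i))"
 by (simp add: kanalytic_at_iff_ps_le analytic0_def)

lemma analytic0_ex_small:
 assumes "analytic0 I f" "0 < dt"
 obtains ro M where "0 < ro" "ro <= dt" "ps_le I ro f M"
 using assms ps_le_shrink[of I _ f _ "min _ dt"] unfolding analytic0_def
 by (metis less_imp_le min.cobounded1 min.cobounded2 min_less_iff_conj)

lemma analytic0_common_radius:
 fixes f :: "'a => ('i => 'k) => 'k::{real_normed_field,banach}"
 assumes "finite A" "!!k. k : A ==> analytic0 I (f k)" "0 < dt"
 obtains ro M where "0 < ro" "ro <= dt" "ALL k:A. ps_le I ro (f k) M"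
proof -
 have "EX ro>0. ro <= dt & (EX M. ALL k:A. ps_le I ro (f k) M)"
  using assms(1,2)
 proof (induction A)
  case empty
  then show ?case using assms(3) by auto
 next
  case (insert x A)
  then obtain ro M where 1: "ro > 0" "ro <= dt" "ALL k:A. ps_le I ro (f k) M" by auto
  obtain ro' M' where 2: "ro' > 0" "ro' <= ro" "ps_le I ro' (f x) M'"
   using analytic0_ex_small[of I "f x" ro] insert.prems[of x] 1 by auto
  show ?case
   by (rule exI[of _ ro'], intro conjI exI[of _ "max M M'"])
     (use 1 2 in \<open>auto intro: ps_le_mono[OF ps_le_shrink[of I ro _ M ro']] ps_le_mono[of I ro' _ M']\<close>)
 qed
 then show ?thesis using that by blast
qed

lemma analytic0_common_radius2:
 fixes f g :: "('i => 'k) => 'k::{real_normed_field,banach}"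
 assumes "analytic0 I f" "analytic0 I g"
 obtains ro M where "0 < ro" "ps_le I ro f M" "ps_le I ro g M"
proof -
 obtain ro M where 1: "0 < ro" "ps_le I ro f M"
  using assms(1) by (auto simp: analytic0_def)
 obtain sg N where 2: "0 < sg" "sg <= ro" "ps_le I sg g N"
  by (rule analytic0_ex_small[OF assms(2) 1(1)])
 show ?thesis
  by (rule that[of sg "max M N"])
    (use 1 2 in \<open>auto intro: ps_le_mono[OF ps_le_shrink[of I ro f M sg]] ps_le_mono[of I sg g N]\<close>)
qed

lemma analytic0_const [simp]: "analytic0 I (%_. k)"
 unfolding analytic0_def using ps_le_const[of 1] zero_less_one by blast

lemma analytic0_coord: "finite I ==> i : I ==> analytic0 I (%h. h i)"
 unfolding analytic0_def using ps_le_coord[of I i 1] zero_less_one by blast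

lemma analytic0_add: "analytic0 I f ==> analytic0 I g ==> analytic0 I (%h. f h + g h)"
 by (erule (1) analytic0_common_radius2) (auto simp: analytic0_def intro: ps_le_add)

lemma analytic0_diff: "analytic0 I f ==> analytic0 I g ==> analytic0 I (%h. f h - g h)"
 by (erule (1) analytic0_common_radius2) (auto simp: analytic0_def intro: ps_le_diff)

lemma analytic0_mult: "analytic0 I f ==> analytic0 I g ==> analytic0 I (%h. f h * g h)"
 by (erule (1) analytic0_common_radius2) (auto simp: analytic0_def intro: ps_le_mult)

lemma analytic0_uminus: "analytic0 I f ==> analytic0 I (%h. - f h)"
 by (auto simp: analytic0_def intro: ps_le_uminus)

lemma analytic0_power: "analytic0 I f ==> analytic0 I (%h. f h ^ n)"
 by (auto simp: analytic0_def intro: ps_le_power)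

lemma analytic0_sum:
 "finite A ==> (!!k. k : A ==> analytic0 I (f k)) ==> analytic0 I (%h. SUM k:A. f k h)"
 by (induction A rule: finite_induct) (auto intro: analytic0_add)

lemma analytic0_prod:
 "finite A ==> (!!k. k : A ==> analytic0 I (f k)) ==> analytic0 I (%h. PROD k:A. f k h)"
 by (induction A rule: finite_induct) (auto intro: analytic0_mult)

text \<open>Germs that vanish at the origin become as small as desired after shrinking the radius;
  this is what makes substitution into another germ legitimate.\<close>

lemma analytic0_small:
 fixes g :: "'j => ('i => 'k) => 'k::{real_normed_field,banach}"
 assumes "finite I" "finite J" "!!j. j : J ==> analytic0 I (g j)" "!!j. j : J ==> g j (%_. 0) = 0" "0 < sg"
 obtains ro where "0 < ro" "ALL j:J. ps_le I ro (g j) sg"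
proof -
 obtain ro M where ro: "0 < ro" "ALL j:J. ps_le I ro (g j) M"
  using analytic0_common_radius[where f = g, OF assms(2,3) zero_less_one] by blast
 define \<theta> where "\<theta> = min 1 (sg / (1 + \<bar>M\<bar>))"
 have \<theta>: "0 < \<theta>" "\<theta> <= 1" using assms(5) by (auto simp: \<theta>_def)
 have "\<theta> * M <= sg / (1 + \<bar>M\<bar>) * (1 + \<bar>M\<bar>)"
  by (rule order_trans[OF mult_left_mono[of M "1 + \<bar>M\<bar>" \<theta>] mult_right_mono])
    (use \<theta> in \<open>auto simp: \<theta>_def\<close>)
 then have "\<theta> * M <= sg" by simp
 then have "ps_le I (\<theta> * ro) (g j) sg" if "j : J" for j
  using ps_le_mono[OF ps_le_small[OF assms(1) ro(1) bspec[OF ro(2) that] assms(4)[OF that] \<theta>]] by blast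
 then show ?thesis using that[of "\<theta> * ro"] \<theta> ro by auto
qed

lemma analytic0_compose:
 fixes f :: "('j => 'k) => 'k::{real_normed_field,banach}" and g :: "'j => ('i => 'k) => 'k"
 assumes "finite I" "finite J" "analytic0 J f"
  "!!j. j : J ==> analytic0 I (g j)" "!!j. j : J ==> g j (%_. 0) = 0"
 shows "analytic0 I (%h. f (%j. g j h))"
proof -
 obtain sg M where sg: "0 < sg" "ps_le J sg f M" using assms(3) by (auto simp: analytic0_def)
 obtain ro where ro: "0 < ro" "ALL j:J. ps_le I ro (g j) sg"
  by (rule analytic0_small[OF assms(1,2,4,5) sg(1)])
 have "ps_le I ro (%h. f (%j. g j h)) M"
  by (rule ps_le_compose[OF ro(1) assms(2) sg(2)]) (use ro(2) in simp)
 then show ?thesis unfolding analytic0_def using ro(1) by (intro exI[of _ ro] exI[of _ M] conjI)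
qed

lemma eventually_nb_compose:
 fixes g :: "'j => ('i => 'k) => 'k::{real_normed_field,banach}"
 assumes "finite I" "finite J"
  "!!j. j : J ==> analytic0 I (g j)" "!!j. j : J ==> g j (%_. 0) = 0"
  and "eventually P (nb J)"
 shows "\<forall>\<^sub>F h in nb I. P (%j. g j h)"
proof -
 obtain sg where sg: "0 < sg" "!!z. z : pdisc J sg ==> P z" using assms(5) by (auto simp: eventually_nb)
 obtain ro where ro: "0 < ro" "ALL j:J. ps_le I ro (g j) sg"
  by (rule analytic0_small[OF assms(1-4) sg(1)])
 have "P (%j. g j h)" if "h : pdisc I ro" for h
  by (rule sg(2)) (use ps_le_bound[OF bspec[OF ro(2)] that] in \<open>auto simp: pdisc_def\<close>)
 with ro(1) show ?thesis by (auto simp: eventually_nb)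
qed

section \<open>Calculus of partial derivatives of germs\<close>

lemma pseries_deriv_radius:
 assumes "analytic0 I f" "finite I"
 obtains ro c where "0 < ro" "pseries I ro c f"
 using assms by (auto simp: analytic0_def ps_le_def)

lemma analytic0_jpartial:
 assumes "finite I" "i : I" "analytic0 I f"
 shows "analytic0 I (jpartial i f)"
proof -
 obtain ro c where c: "0 < ro" "pseries I ro c f" by (rule pseries_deriv_radius[OF assms(3,1)])
 then show ?thesis
  using pseries_deriv(2)[OF assms(1,2) _ _ c(2), of "ro / 2"]
  unfolding analytic0_def ps_le_def by (intro exI[of _ "ro / 2"]) auto
qed

lemma eventually_has_field_derivative_jpartial:
 assumes "finite I" "i : I" "analytic0 I f"
 shows "\<forall>\<^sub>F h in nb I. ((%t. f (h(i := t))) has_field_derivative jpartial i f h) (at (h i))"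
proof -
 obtain ro c where c: "0 < ro" "pseries I ro c f" by (rule pseries_deriv_radius[OF assms(3,1)])
 then show ?thesis
  using pseries_deriv(1)[OF assms(1,2) _ _ c(2), of "ro / 2"]
  unfolding eventually_nb by (intro exI[of _ "ro / 2"]) auto
qed

lemma eventually_jpartial_cong:
 assumes "\<forall>\<^sub>F h in nb I. f h = g h"
 shows "\<forall>\<^sub>F h in nb I. jpartial i f h = jpartial i g h"
proof -
 obtain dt where "dt > 0" "!!h. h : pdisc I dt ==> f h = g h" using assms by (auto simp: eventually_nb)
 then show ?thesis unfolding eventually_nb
  using jpartial_cong_pdisc[of I dt f g _ "dt / 2" i] by (intro exI[of _ "dt / 2"]) auto
qed

lemma dcoef_commute: "dcoef i (dcoef j c) = dcoef j (dcoef i c)"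
 by (cases "i = j") (auto simp: dcoef_def fun_eq_iff fun_upd_twist)

text \<open>Both sides have the same coefficients, since raising two exponents commutes.\<close>

lemma eventually_jpartial_commute:
 fixes f :: "('i => 'k) => 'k::{real_normed_field,banach}"
 assumes "finite I" "i : I" "j : I" "analytic0 I f"
 shows "\<forall>\<^sub>F h in nb I. jpartial i (jpartial j f) h = jpartial j (jpartial i f) h"
proof -
 obtain ro c where c: "0 < ro" "pseries I ro c f" by (rule pseries_deriv_radius[OF assms(4,1)])
 have r: "0 < ro / 2" "ro / 2 < ro" "0 < ro / 3" "ro / 3 < ro / 2" using c(1) by auto
 have 1: "pseries I (ro / 3) (dcoef i (dcoef j c)) (jpartial i (jpartial j f))"
  by (intro pseries_deriv(2)[OF assms(1,2) r(3,4)] pseries_deriv(2)[OF assms(1,3) r(1,2)] c(2))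
 have 2: "pseries I (ro / 3) (dcoef j (dcoef i c)) (jpartial j (jpartial i f))"
  by (intro pseries_deriv(2)[OF assms(1,3) r(3,4)] pseries_deriv(2)[OF assms(1,2) r(1,2)] c(2))
 have "jpartial i (jpartial j f) h = jpartial j (jpartial i f) h" if "h : pdisc I (ro / 3)" for h
  using 1 2 that unfolding pseries_def dcoef_commute[of i j] by (meson has_sum_unique)
 then show ?thesis unfolding eventually_nb using r by blast
qed

lemma eventually_jpartial_chain:
 fixes f :: "('j => 'k) => 'k::{real_normed_field,banach}" and g :: "'j => ('i => 'k) => 'k"
 assumes "finite I" "i : I" "finite J" "analytic0 J f"
  "!!j. j : J ==> analytic0 I (g j)" "!!j. j : J ==> g j (%_. 0) = 0"
 shows "\<forall>\<^sub>F h in nb I. jpartial i (%h. f (%j. g j h)) h =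
  (SUM j:J. jpartial j f (%j. g j h) * jpartial i (g j) h)"
proof -
 obtain sg M where sg: "0 < sg" "ps_le J sg f M" using assms(4) by (auto simp: analytic0_def)
 have "\<forall>\<^sub>F z in nb J. z : pdisc J (sg / 2)" unfolding eventually_nb using sg(1) half_gt_zero by blast
 from eventually_nb_compose[OF assms(1,3,5,6) this]
 have 1: "\<forall>\<^sub>F h in nb I. (%j. g j h) : pdisc J (sg / 2)" by simp
 have 2: "\<forall>\<^sub>F h in nb I. ALL j:J. ((%t. g j (h(i := t))) has_field_derivative jpartial i (g j) h) (at (h i))"
  by (intro eventually_ball_finite assms ballI eventually_has_field_derivative_jpartial)
 show ?thesis using 1 2
 proof eventually_elim
  case (elim h)
  have "((%t. f (%j. g j (h(i := t)))) has_field_derivative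
   (SUM j:J. jpartial j f (%j. g j (h(i := h i))) * jpartial i (g j) h)) (at (h i))"
   by (rule ps_le_chain_rule[OF assms(3) sg(2), of "%j t. g j (h(i := t))" _ "sg / 2"])
     (use elim sg(1) in auto)
  then show ?case by (simp add: jpartial_def DERIV_imp_deriv)
 qed
qed

lemma eventually_jpartial_add:
 assumes "finite I" "i : I" "analytic0 I f" "analytic0 I g"
 shows "\<forall>\<^sub>F h in nb I. jpartial i (%h. f h + g h) h = jpartial i f h + jpartial i g h"
 using eventually_has_field_derivative_jpartial[OF assms(1,2,3)]
  eventually_has_field_derivative_jpartial[OF assms(1,2,4)]
 by eventually_elim (subst (1) jpartial_def, auto intro!: DERIV_imp_deriv derivative_eq_intros)

lemma eventually_jpartial_diff:
 assumes "finite I" "i : I" "analytic0 I f" "analytic0 I g"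
 shows "\<forall>\<^sub>F h in nb I. jpartial i (%h. f h - g h) h = jpartial i f h - jpartial i g h"
 using eventually_has_field_derivative_jpartial[OF assms(1,2,3)]
  eventually_has_field_derivative_jpartial[OF assms(1,2,4)]
 by eventually_elim (subst (1) jpartial_def, auto intro!: DERIV_imp_deriv derivative_eq_intros)

lemma eventually_jpartial_mult:
 assumes "finite I" "i : I" "analytic0 I f" "analytic0 I g"
 shows "\<forall>\<^sub>F h in nb I. jpartial i (%h. f h * g h) h = jpartial i f h * g h + f h * jpartial i g h"
 using eventually_has_field_derivative_jpartial[OF assms(1,2,3)]
  eventually_has_field_derivative_jpartial[OF assms(1,2,4)]
 by eventually_elim (subst (1) jpartial_def, auto intro!: DERIV_imp_deriv derivative_eq_intros)

lemma eventually_jpartial_sum: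
 assumes "finite I" "i : I" "finite A" "!!k. k : A ==> analytic0 I (f k)"
 shows "\<forall>\<^sub>F h in nb I. jpartial i (%h. SUM k:A. f k h) h = (SUM k:A. jpartial i (f k) h)"
proof -
 have "\<forall>\<^sub>F h in nb I. ALL k:A. ((%t. f k (h(i := t))) has_field_derivative jpartial i (f k) h) (at (h i))"
  by (intro eventually_ball_finite assms ballI eventually_has_field_derivative_jpartial)
 then show ?thesis
  by eventually_elim (subst (1) jpartial_def, auto intro!: DERIV_imp_deriv DERIV_sum)
qed

lemma jpartial_coord: "jpartial i (%h. h j) h = (if j = i then 1 else 0)"
 unfolding jpartial_def by (auto intro!: DERIV_imp_deriv derivative_eq_intros)

lemma jpartial_const [simp]: "jpartial i (%_. k) h = 0"
 unfolding jpartial_def by simp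

section \<open>Analytic solutions of fixed point equations\<close>

lemma ps_le_zero: "0 < ro ==> ps_le I ro (%_. 0) 0"
 using ps_le_const[of ro I 0] by simp

lemma ps_le_power_diff:
 assumes "0 < ro" "0 < ta" "ps_le I ro g ta" "ps_le I ro g' ta" "ps_le I ro (%h. g h - g' h) dt"
 shows "ps_le I ro (%h. g h ^ k - g' h ^ k) (real k * ta ^ k * dt / ta)"
proof (induction k)
 case 0
 then show ?case using ps_le_zero[OF assms(1)] by simp
next
 case (Suc k)
 have "ps_le I ro (%h. (g h - g' h) * g h ^ k + g' h * (g h ^ k - g' h ^ k))
   (dt * ta ^ k + ta * (real k * ta ^ k * dt / ta))"
  by (intro ps_le_add ps_le_mult ps_le_power assms Suc.IH)
 moreover have "dt * ta ^ k + ta * (real k * ta ^ k * dt / ta) = real (Suc k) * ta ^ Suc k * dt / ta"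
  using assms(2) by (simp add: field_simps)
 moreover have "(g h - g' h) * g h ^ k + g' h * (g h ^ k - g' h ^ k) = g h ^ Suc k - g' h ^ Suc k" for h
  by (simp add: algebra_simps)
 ultimately show ?case by simp
qed

lemma ps_le_mmon_diff:
 assumes "finite J" "0 < ro" "0 < ta" "!!j. j : J ==> ps_le I ro (g j) ta"
  "!!j. j : J ==> ps_le I ro (g' j) ta" "!!j. j : J ==> ps_le I ro (%h. g j h - g' j h) dt"
 shows "ps_le I ro (%h. mmon J (%j. g j h) p - mmon J (%j. g' j h) p)
  (real (sum p J) * ta ^ sum p J * dt / ta)"
 using assms(1,4-6)
proof (induction J)
 case empty
 then show ?case using ps_le_zero[OF assms(2)] by (simp add: mmon_def)
next
 case (insert x J)
 let ?P = "%h. mmon J (%j. g j h) p" and ?P' = "%h. mmon J (%j. g' j h) p"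
 have "ps_le I ro (%h. (g x h ^ p x - g' x h ^ p x) * ?P h + g' x h ^ p x * (?P h - ?P' h))
   (real (p x) * ta ^ p x * dt / ta * ta ^ sum p J + ta ^ p x * (real (sum p J) * ta ^ sum p J * dt / ta))"
 proof (intro ps_le_add ps_le_mult ps_le_power_diff ps_le_power ps_le_mmon assms(2,3) insert.hyps)
  show "ps_le I ro (%h. ?P h - ?P' h) (real (sum p J) * ta ^ sum p J * dt / ta)"
   by (rule insert.IH) (use insert.prems in auto)
 qed (use insert.prems in auto)
 moreover have "real (p x) * ta ^ p x * dt / ta * ta ^ sum p J + ta ^ p x * (real (sum p J) * ta ^ sum p J * dt / ta)
   = real (sum p (insert x J)) * ta ^ sum p (insert x J) * dt / ta"
  using insert.hyps by (simp add: power_add field_simps add_divide_distrib)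
 moreover have "(g x h ^ p x - g' x h ^ p x) * ?P h + g' x h ^ p x * (?P h - ?P' h)
   = mmon (insert x J) (%j. g j h) p - mmon (insert x J) (%j. g' j h) p" for h
  using insert.hyps by (simp add: mmon_def algebra_simps)
 ultimately show ?case by simp
qed

text \<open>Telescoping a monomial costs its degree as a factor; passing from \<open>ta\<close> to
  the larger radius \<open>sg\<close> absorbs it, exactly as in the estimate of a
  derivative.\<close>

lemma ps_le_compose_diff:
 fixes f :: "('j => 'k) => 'k::{real_normed_field,banach}"
 assumes "finite J" "0 < ro" "0 < ta" "ta < sg" "ps_le J sg f B" "0 <= dt"
  "!!j. j : J ==> ps_le I ro (g j) ta" "!!j. j : J ==> ps_le I ro (g' j) ta"
  "!!j. j : J ==> ps_le I ro (%h. g j h - g' j h) dt"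
 shows "ps_le I ro (%h. f (%j. g j h) - f (%j. g' j h)) (B * dt / (sg - ta))"
proof -
 obtain c where c: "pseries J sg c f"
  "(\<Sum>\<^sub>\<infinity>p\<in>mindices J. norm (c p) * sg ^ sum p J) <= B" using assms(5) by (auto simp: ps_le_def)
 let ?c = "%p. norm (c p) * sg ^ sum p J"
 have sc: "(?c has_sum infsum ?c (mindices J)) (mindices J)"
  using c(1) by (intro has_sum_infsum) (simp add: pseries_def)
 show ?thesis
 proof (rule ps_le_has_sum[OF assms(2)])
  show "ps_le I ro (%h. c p * (mmon J (%j. g j h) p - mmon J (%j. g' j h) p))
    (?c p * (dt / (sg - ta)))" if "p : mindices J" for p
  proof (rule ps_le_mono[OF ps_le_cmult[OF assms(2) ps_le_mmon_diff[OF assms(1-3,7-9)]]])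
   have "real (sum p J) * ta ^ sum p J / ta <= sg ^ sum p J / (sg - ta)"
   proof (cases "sum p J")
    case (Suc k)
    then show ?thesis using power_deriv_le[of ta sg "sum p J"] assms(3,4) by simp
   qed (use assms in simp)
   then have "norm (c p) * (real (sum p J) * ta ^ sum p J / ta) * dt <= norm (c p) * (sg ^ sum p J / (sg - ta)) * dt"
    using assms(6) by (intro mult_right_mono mult_left_mono) auto
   then show "norm (c p) * (real (sum p J) * ta ^ sum p J * dt / ta) <= ?c p * (dt / (sg - ta))"
    by (simp add: field_simps)
  qed
  show "((%p. ?c p * (dt / (sg - ta))) has_sum infsum ?c (mindices J) * (dt / (sg - ta))) (mindices J)"
   by (rule has_sum_cmult_left[OF sc])
  show "infsum ?c (mindices J) * (dt / (sg - ta)) <= B * dt / (sg - ta)"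
   using mult_right_mono[OF c(2), of "dt / (sg - ta)"] assms(4,6) by simp
  show "((%p. c p * (mmon J (%j. g j h) p - mmon J (%j. g' j h) p)) has_sum
    (f (%j. g j h) - f (%j. g' j h))) (mindices J)" if h: "h : pdisc I ro" for h
  proof -
   have "((%p. c p * mmon J (%j. g j h) p) has_sum f (%j. g j h)) (mindices J)"
    if "!!j. j : J ==> ps_le I ro (g j) ta" for g
   proof -
    have "(%j. g j h) : pdisc J sg"
     using ps_le_bound[OF that h] assms(4) by (force simp: pdisc_def)
    then show ?thesis using c(1) by (simp add: pseries_def)
   qed
   from has_sum_minus[OF this[of g] this[of g']] assms show ?thesis by (simp add: right_diff_distrib)
  qed
 qed
qed

text \<open>Picard iteration in the coefficient norm. The operator \<open>L\<close>, of norm at most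
  \<open>\<mu>\<close>, is left abstract because it is used twice: multiplication by a parameter
  yields implicit functions, integration yields differential equations.\<close>

lemma ps_le_fixpoint:
 fixes G :: "'j => ('i + 'j => 'k) => 'k::{real_normed_field,banach}"
  and L :: "(('i => 'k) => 'k) => ('i => 'k) => 'k"
 assumes fin: "finite I" "finite J" and ro: "0 < ro" "2 * ro <= sg"
  and G: "!!j. j : J ==> ps_le (I <+> J) sg (G j) B" and "0 <= B"
  and L1: "!!f M. ps_le I ro f M ==> ps_le I ro (L f) (\<mu> * M)"
  and L2: "!!f g M N h. ps_le I ro f M ==> ps_le I ro g N ==> h : pdisc I ro ==>
   L (%h. f h - g h) h = L f h - L g h"
  and small: "0 <= \<mu>" "4 * (\<mu> * B) <= sg"
 obtains y where "ALL j:J. ps_le I ro (y j) (sg / 2)"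
  "ALL j:J. ALL h:pdisc I ro. y j h = L (%h. G j (case_sum h (%j. y j h))) h"
proof -
 \<comment> \<open>Iterates stay within \<open>ta\<close>, where substitution has the Lipschitz
   constant \<open>B / (sg - ta) = 2 * B / sg\<close>; together with
   \<open>4 * (\<mu> * B) <= sg\<close> the contraction factor is at most 1/2.\<close>
 define ta where "ta = sg / 2"
 have ta: "0 < ta" "ta < sg" "ro <= ta" "sg - ta = ta" and sg: "0 < sg" using ro by (auto simp: ta_def)
 let ?E = "%y q h. case_sum h (%j. y j h) (q :: 'i + 'j) :: 'k"
 define T where "T y j = L (%h. G j (%q. ?E y q h))" for y j
 have fin': "finite (I <+> J)" using fin by simp
 have E: "ps_le I ro (?E y q) ta" if "ALL j:J. ps_le I ro (y j) ta" "q : I <+> J" for y q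
  using that ta(3) by (auto intro!: ps_le_mono[OF ps_le_coord[OF fin(1) _ ro(1)]])
 have GE: "ps_le I ro (%h. G j (%q. ?E y q h)) B" if "ALL j:J. ps_le I ro (y j) ta" "j : J" for y j
  by (rule ps_le_compose[OF ro(1) fin' G[OF that(2)]])
    (rule ps_le_mono[OF E[OF that(1)]], use ta in auto)
 have T: "ps_le I ro (T y j) ta" if "ALL j:J. ps_le I ro (y j) ta" "j : J" for y j
  unfolding T_def by (rule ps_le_mono[OF L1[OF GE[OF that]]]) (use small sg in \<open>auto simp: ta_def\<close>)
 have Td: "ps_le I ro (%h. T y j h - T y' j h) (dt / 2)"
  if y: "ALL j:J. ps_le I ro (y j) ta" "ALL j:J. ps_le I ro (y' j) ta"
   and d: "ALL j:J. ps_le I ro (%h. y j h - y' j h) dt" "0 <= dt" and j: "j : J" for y y' j dt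
 proof -
  have "ps_le I ro (%h. G j (%q. ?E y q h) - G j (%q. ?E y' q h)) (B * dt / (sg - ta))"
  proof (rule ps_le_compose_diff[OF fin' ro(1) ta(1,2) G[OF j] d(2) E[OF y(1)] E[OF y(2)]])
   show "ps_le I ro (%h. ?E y q h - ?E y' q h) dt" if "q : I <+> J" for q
    using that d ps_le_mono[OF ps_le_zero[OF ro(1)]] by auto
  qed
  from L1[OF this] have "ps_le I ro (L (%h. G j (%q. ?E y q h) - G j (%q. ?E y' q h))) (dt / 2)"
  proof (rule ps_le_mono)
   have "\<mu> * B * dt <= sg / 4 * dt" by (rule mult_right_mono) (use small d in auto)
   then show "\<mu> * (B * dt / (sg - ta)) <= dt / 2"
    using sg unfolding ta(4) by (simp add: ta_def field_simps)
  qed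
  then show ?thesis
   by (rule ps_le_cong) (simp add: T_def L2[OF GE[OF y(1) j] GE[OF y(2) j]])
 qed
 define Y where "Y k = (T ^^ k) (%_ _. 0)" for k
 have Y0: "Y 0 j h = 0" and YS: "Y (Suc k) = T (Y k)" for k j h by (auto simp: Y_def)
 have Yb: "ALL j:J. ps_le I ro (Y k j) ta" for k
 proof (induction k)
  case 0
  show ?case using ta(1) by (auto simp: Y_def intro!: ps_le_mono[OF ps_le_zero[OF ro(1)]])
 qed (use T in \<open>auto simp: YS\<close>)
 have Yd: "ALL j:J. ps_le I ro (%h. Y (Suc k) j h - Y k j h) (sg / 4 * (1 / 2) ^ k)" for k
 proof (induction k)
  case 0
  have "ps_le I ro (T (Y 0) j) (sg / 4)" if "j : J" for j
   unfolding T_def by (rule ps_le_mono[OF L1[OF GE[OF Yb that]]]) (use small in auto)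
  then show ?case by (simp add: YS Y0)
 next
  case (Suc k)
  have "ps_le I ro (%h. T (Y (Suc k)) j h - T (Y k) j h) (sg / 4 * (1 / 2) ^ k / 2)" if "j : J" for j
   by (rule Td[OF Yb Yb Suc.IH _ that]) (use sg in auto)
  then show ?case by (simp add: YS)
 qed
 \<comment> \<open>The limit is the sum of the increments. They are bounded by
   \<open>sg / 4 * (1 / 2)^k\<close>, so the limit again has norm at most
   \<open>sg / 2\<close>.\<close>
 define y where "y j h = (\<Sum>\<^sub>\<infinity>k. Y (Suc k) j h - Y k j h)" for j h
 have geo: "((%k. (1 / 2 :: real) ^ (k + n)) has_sum (2 * (1 / 2) ^ n)) UNIV" for n
 proof -
  have "(%k. (1 / 2 :: real) ^ k) sums 2" using geometric_sums[of "1 / 2 :: real"] by simp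
  then have "((%k. (1 / 2 :: real) ^ k) has_sum 2) UNIV" by (rule sums_nonneg_imp_has_sum) auto
  from has_sum_cmult_left[OF this, of "(1 / 2) ^ n"] show ?thesis by (simp add: power_add)
 qed
 have ysum: "((%k. Y (Suc k) j h - Y k j h) has_sum y j h) UNIV"
  if "j : J" "h : pdisc I ro" for j h
  unfolding y_def
 proof (rule has_sum_infsum[OF abs_summable_summable])
  show "(%k. norm (Y (Suc k) j h - Y k j h)) summable_on UNIV"
   by (rule summable_on_comparison_test[OF summable_on_cmult_right
       [OF has_sum_imp_summable[OF geo[of 0]], of "sg / 4"]])
     (use ps_le_bound[OF bspec[OF Yd that(1)] that(2)] in auto)
 qed
 have tail: "((%k. Y (Suc (k + n)) j h - Y (k + n) j h) has_sum (y j h - Y n j h)) UNIV"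
  if "j : J" "h : pdisc I ro" for j h n
 proof -
  have "(\<Sum>k<n. Y (Suc k) j h - Y k j h) = Y n j h" by (subst sum_lessThan_telescope) (simp add: Y0)
  then have "((%k. Y (Suc k) j h - Y k j h) has_sum Y n j h) {..<n}" by (intro has_sum_finiteI) auto
  from has_sum_Diff[OF ysum[OF that] this]
  have "((%k. Y (Suc k) j h - Y k j h) has_sum (y j h - Y n j h)) (UNIV - {..<n})" by simp
  then show ?thesis
   by (rule iffD1[OF has_sum_reindex_bij_witness[of _ "%k. k + n" "%k. k - n"], rotated -1]) auto
 qed
 have yd: "ps_le I ro (%h. y j h - Y n j h) (sg / 2 * (1 / 2) ^ n)" if "j : J" for j n
 proof (rule ps_le_has_sum[OF ro(1) _ has_sum_cmult_right[OF geo[of n], of "sg / 4"] _ tail[OF that]])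
  show "ps_le I ro (%h. Y (Suc (k + n)) j h - Y (k + n) j h) (sg / 4 * (1 / 2) ^ (k + n))" for k
   using Yd that by blast
 qed auto
 have yb: "ALL j:J. ps_le I ro (y j) ta"
  using yd[of _ 0] by (simp add: Y0 ta_def)
 have fix_y: "y j h = T y j h" if j: "j : J" and h: "h : pdisc I ro" for j h
 proof -
  have "norm (y j h - T y j h) <= sg * (1 / 2) ^ n" for n
  proof -
   have "ALL j:J. ps_le I ro (%h. y j h - Y n j h) (sg / 2 * (1 / 2) ^ n)" using yd by blast
   from Td[OF yb Yb this _ j] have "ps_le I ro (%h. T y j h - T (Y n) j h) (sg / 2 * (1 / 2) ^ n / 2)"
    using sg by simp
   from ps_le_bound[OF this h] have 1: "norm (T y j h - Y (Suc n) j h) <= sg / 2 * (1 / 2) ^ n / 2"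
    by (simp add: YS)
   have 2: "norm (y j h - Y (Suc n) j h) <= sg / 2 * (1 / 2) ^ Suc n"
    using ps_le_bound[OF yd[OF j] h] .
   have "norm (y j h - T y j h) <= norm (y j h - Y (Suc n) j h) + norm (T y j h - Y (Suc n) j h)"
    by (metis norm_minus_commute norm_triangle_sub add.commute dist_norm dist_triangle2)
   also have "... <= sg / 2 * (1 / 2) ^ Suc n + sg / 2 * (1 / 2) ^ n / 2" using 1 2 by simp
   also have "... = sg / 2 * (1 / 2) ^ n" by simp
   also have "... <= sg * (1 / 2) ^ n" using sg by (intro mult_right_mono) auto
   finally show ?thesis .
  qed
  moreover have "(%n. sg * (1 / 2) ^ n) \<longlonglongrightarrow> sg * 0"
   by (intro tendsto_mult tendsto_const LIMSEQ_realpow_zero) auto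
  ultimately have "norm (y j h - T y j h) <= sg * 0"
   by (intro LIMSEQ_le_const) auto
  then show ?thesis by simp
 qed
 have "(%q. ?E y q h) = case_sum h (%j. y j h)" for h by (auto split: sum.splits)
 then show ?thesis using that[of y] yb fix_y by (auto simp: T_def ta_def)
qed

text \<open>The factor \<open>h s\<close> is small near the origin, so the right-hand side is a
  contraction in \<open>y\<close> whatever \<open>G\<close> is; this yields the inverse of a map
  that is the identity at \<open>h s = 0\<close>.\<close>

lemma analytic0_fixpoint_mult:
 fixes G :: "'j => ('i + 'j => 'k) => 'k::{real_normed_field,banach}"
 assumes fin: "finite I" "finite J" "s : I" and G: "!!j. j : J ==> analytic0 (I <+> J) (G j)"
 obtains y where "ALL j:J. analytic0 I (y j)"
  "\<forall>\<^sub>F h in nb I. ALL j:J. y j h = h s * G j (case_sum h (%j. y j h))"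
proof -
 obtain sg B where sg: "0 < sg" "ALL j:J. ps_le (I <+> J) sg (G j) B"
  using analytic0_common_radius[where f = G, OF fin(2) G zero_less_one] by blast
 define b where "b = \<bar>B\<bar> + 1"
 \<comment> \<open>Then \<open>ro * b = sg / 4\<close>, as the contraction requires, and
   \<open>ro <= sg / 4\<close> because \<open>b\<close> is at least 1.\<close>
 define ro where "ro = sg / (4 * b)"
 have b: "1 <= b" "\<bar>B\<bar> <= b" by (auto simp: b_def)
 then have ro: "0 < ro" using sg by (simp add: ro_def)
 have "4 * (ro * \<bar>B\<bar>) <= 4 * (ro * b)" using ro b by (intro mult_left_mono) auto
 also have "... = sg" unfolding ro_def using b by simp
 finally have 1: "4 * (ro * \<bar>B\<bar>) <= sg" .
 have "ro <= sg / 4" unfolding ro_def using sg(1) b by (intro divide_left_mono) auto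
 then have 2: "2 * ro <= sg" using sg(1) by simp
 have 3: "ps_le (I <+> J) sg (G j) \<bar>B\<bar>" if "j : J" for j
  using sg(2) that by (auto intro: ps_le_mono)
 have 4: "ps_le I ro (%h. h s * f h) (ro * M)" if "ps_le I ro f M" for f M
  by (intro ps_le_mult ro ps_le_coord fin that)
 obtain y where "ALL j:J. ps_le I ro (y j) (sg / 2)"
  "ALL j:J. ALL h:pdisc I ro. y j h = h s * G j (case_sum h (%j. y j h))"
  by (rule ps_le_fixpoint[where L = "%f h. h s * f h" and \<mu> = ro, OF fin(1,2) ro 2 3 _ 4 _ _ 1])
    (use ro in \<open>auto simp: algebra_simps\<close>)
 then show ?thesis using that[of y] ro unfolding analytic0_def eventually_nb by blast
qed

subsection \<open>Integration in one variable\<close>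

definition ps_coeffs :: "'i set => (('i => 'k) => 'k) => ('i => nat) => 'k::{real_normed_field,banach}" where
 "ps_coeffs I f = (SOME c. EX ro>0. pseries I ro c f)"

lemma ps_coeffs_eq:
 assumes "finite I" "0 < ro" "pseries I ro c f" "p : mindices I"
 shows "ps_coeffs I f p = c p"
proof -
 have "EX c. EX ro>0. pseries I ro c f"
  using assms(2,3) by (intro exI[of _ c] exI[of _ ro] conjI)
 then have "EX ro>0. pseries I ro (ps_coeffs I f) f"
  unfolding ps_coeffs_def by (rule someI_ex)
 then obtain ro' where "0 < ro'" "pseries I ro' (ps_coeffs I f) f" by (elim exE conjE)
 then show ?thesis
  by (intro pseries_unique[OF assms(1) _ zero_less_one _ assms(3,2) _ assms(4)]) auto
qed

text \<open>The antiderivative in the variable \<open>i\<close> that vanishes at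
  \<open>h i = 0\<close>, formed on the coefficients and hence the same over both fields.\<close>

definition integ :: "'i set => 'i => (('i => 'k) => 'k) => ('i => 'k) => 'k::{real_normed_field,banach}" where
 "integ I i f h = (\<Sum>\<^sub>\<infinity>p\<in>mindices I.
   (ps_coeffs I f p / of_nat (p i + 1)) * mmon I h (p(i := p i + 1)))"

lemma mmon_shift:
 fixes h :: "'i => 'k::comm_monoid_mult"
 assumes "finite I" "i : I"
 shows "mmon I h (p(i := p i + 1)) = h i * mmon I h p"
proof -
 have "mmon I h (p(i := p i + 1)) = mmon I h (%j. unit_exp i j + p j)"
  by (rule arg_cong[of _ _ "mmon I h"]) (auto simp: unit_exp_def)
 then show ?thesis using assms by (simp add: mmon_add mmon_unit_exp)
qed

lemma sum_shift:
 assumes "finite I" "i : I"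
 shows "sum (p(i := p i + 1)) I = sum p I + (1 :: nat)"
 using assms by (subst (1 2) sum.remove[of I i]) auto

text \<open>Raising one exponent gains a factor \<open>ro\<close> and the division by
  \<open>p i + 1\<close> only decreases coefficients, so integration has norm at most
  \<open>ro\<close> and is small on small polydiscs.\<close>

lemma integ_props:
 fixes f :: "('i => 'k) => 'k::{real_normed_field,banach}"
 assumes fin: "finite I" "i : I" and ro: "0 < ro" and f: "ps_le I ro f M"
 shows "ps_le I ro (integ I i f) (ro * M)"
  and "h : pdisc I ro ==> ((%p. (ps_coeffs I f p / of_nat (p i + 1)) * mmon I h (p(i := p i + 1)))
   has_sum integ I i f h) (mindices I)"
  and "\<forall>\<^sub>F h in nb I. jpartial i (integ I i f) h = f h"
  and "h i = 0 ==> integ I i f h = 0"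
proof -
 obtain c where c: "pseries I ro c f" "(\<Sum>\<^sub>\<infinity>p\<in>mindices I. norm (c p) * ro ^ sum p I) <= M"
  using f by (auto simp: ps_le_def)
 have cc: "ps_coeffs I f p = c p" if "p : mindices I" for p
  by (rule ps_coeffs_eq[OF fin(1) ro c(1) that])
 let ?d = "%p. ps_coeffs I f p / of_nat (p i + 1)" and ?s = "%p. p(i := p i + 1)"
 have le: "norm (?d p) * ro ^ sum (?s p) I <= ro * (norm (c p) * ro ^ sum p I)" if "p : mindices I" for p
 proof -
  have "norm (?d p) = norm (c p) / real (p i + 1)"
   using cc[OF that] by (simp only: norm_divide norm_of_nat)
  also have "... <= norm (c p)" by (simp add: divide_le_eq_1 mult_left_le field_simps)
  finally have "norm (?d p) * ro ^ sum (?s p) I <= norm (c p) * ro ^ sum (?s p) I"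
   using ro by (intro mult_right_mono) auto
  then show ?thesis unfolding sum_shift[OF fin] by (simp add: mult_ac)
 qed
 have S: "(%p. norm (?d p) * ro ^ sum (?s p) I) summable_on mindices I"
  by (rule summable_on_comparison_test[OF summable_on_cmult_right[of "%p. norm (c p) * ro ^ sum p I" _ ro]])
    (use c(1) le ro in \<open>auto simp: pseries_def\<close>)
 have hs: "((%p. ?d p * mmon I h (?s p)) has_sum integ I i f h) (mindices I)" if h: "h : pdisc I ro" for h
  unfolding integ_def
 proof (rule has_sum_infsum[OF abs_summable_summable], rule summable_on_comparison_test[OF S])
  show "norm (?d p * mmon I h (?s p)) <= norm (?d p) * ro ^ sum (?s p) I" for p
   unfolding norm_mult by (intro mult_left_mono norm_mmon_le[OF h]) auto
 qed auto
 then show "h : pdisc I ro ==> ((%p. ?d p * mmon I h (?s p)) has_sum integ I i f h) (mindices I)" .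
 have "(\<Sum>\<^sub>\<infinity>p\<in>mindices I. norm (?d p) * ro ^ sum (?s p) I) <= ro * (\<Sum>\<^sub>\<infinity>p\<in>mindices I. norm (c p) * ro ^ sum p I)"
  by (subst infsum_cmult_right'[symmetric], rule infsum_mono[OF S _ le])
    (use c(1) in \<open>auto simp: pseries_def intro: summable_on_cmult_right\<close>)
 also have "... <= ro * M" using c(2) ro by (intro mult_left_mono) auto
 finally have le': "(\<Sum>\<^sub>\<infinity>p\<in>mindices I. norm (?d p) * ro ^ sum (?s p) I) <= ro * M" .
 show "ps_le I ro (integ I i f) (ro * M)"
  by (rule ps_le_family[where \<pi> = ?s and d = ?d, OF ro _ has_sum_infsum[OF S] le' hs])
    (rule mindices_fun_upd[OF fin(2)])
 show "integ I i f h = 0" if "h i = 0"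
  unfolding integ_def mmon_shift[OF fin] using that by simp
 \<comment> \<open>The integrated series reindexed by its true exponents; its formal derivative is
   \<open>c\<close> again.\<close>
 define e where "e p = (if p i = 0 then 0 else c (p(i := p i - 1)) / of_nat (p i))" for p
 have e: "pseries I ro e (integ I i f)"
 proof -
  have eq: "(g has_sum x) {p : mindices I. p i > 0} \<longleftrightarrow> ((%p. g (?s p)) has_sum x) (mindices I)"
   for g :: "('i => nat) => 'x::{comm_monoid_add,topological_space}" and x
   by (rule has_sum_reindex_bij_witness[of _ ?s "%p. p(i := p i - 1)"])
     (auto simp: mindices_fun_upd[OF fin(2)] fun_upd_idem)
  have es: "e (?s p) = ?d p" if "p : mindices I" for p
   using cc[OF that] by (simp add: e_def)
  show ?thesis unfolding pseries_def
  proof (intro conjI ballI)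
   have "((%p. norm (e p) * ro ^ sum p I) has_sum (\<Sum>\<^sub>\<infinity>p\<in>mindices I. norm (?d p) * ro ^ sum (?s p) I)) {p : mindices I. p i > 0}"
    unfolding eq by (rule iffD1[OF has_sum_cong has_sum_infsum[OF S]]) (simp only: es)
   then have "((%p. norm (e p) * ro ^ sum p I) has_sum (\<Sum>\<^sub>\<infinity>p\<in>mindices I. norm (?d p) * ro ^ sum (?s p) I)) (mindices I)"
    by (rule iffD1[OF has_sum_cong_neutral, rotated -1]) (auto simp: e_def)
   then show "(%p. norm (e p) * ro ^ sum p I) summable_on mindices I" by (rule has_sum_imp_summable)
   fix h :: "'i => 'k" assume h: "h : pdisc I ro"
   have "((%p. e p * mmon I h p) has_sum integ I i f h) {p : mindices I. p i > 0}"
    unfolding eq by (rule iffD1[OF has_sum_cong hs[OF h]]) (simp only: es)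
   then show "((%p. e p * mmon I h p) has_sum integ I i f h) (mindices I)"
    by (rule iffD1[OF has_sum_cong_neutral, rotated -1]) (auto simp: e_def)
  qed
 qed
 have de: "dcoef i e = c"
  by (rule ext) (simp add: dcoef_def e_def del: of_nat_add of_nat_Suc)
 have r: "0 < ro / 2" "ro / 2 < ro" using ro by auto
 have "pseries I (ro / 2) c (jpartial i (integ I i f))"
  using pseries_deriv(2)[OF fin r e] by (simp add: de)
 moreover have "pseries I (ro / 2) c f" by (rule pseries_shrink[OF c(1)]) (use ro in auto)
 ultimately have "jpartial i (integ I i f) h = f h" if "h : pdisc I (ro / 2)" for h
  using that unfolding pseries_def by (meson has_sum_unique)
 then show "\<forall>\<^sub>F h in nb I. jpartial i (integ I i f) h = f h"
  unfolding eventually_nb using r(1) by blast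
qed

lemma integ_diff:
 fixes f :: "('i => 'k) => 'k::{real_normed_field,banach}"
 assumes fin: "finite I" "i : I" and ro: "0 < ro" and f: "ps_le I ro f M" and g: "ps_le I ro g N"
  and h: "h : pdisc I ro"
 shows "integ I i (%h. f h - g h) h = integ I i f h - integ I i g h"
proof -
 obtain c where c: "pseries I ro c f" using f by (auto simp: ps_le_def)
 obtain d where d: "pseries I ro d g" using g by (auto simp: ps_le_def)
 have cd: "pseries I ro (%p. c p - d p) (%h. f h - g h)"
  by (rule pseries_diff[OF c d]) (use ro in auto)
 have "ps_coeffs I (%h. f h - g h) p = ps_coeffs I f p - ps_coeffs I g p" if "p : mindices I" for p
  using ps_coeffs_eq[OF fin(1) ro c that] ps_coeffs_eq[OF fin(1) ro d that] ps_coeffs_eq[OF fin(1) ro cd that] by simp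
 then have "((%p. (ps_coeffs I (%h. f h - g h) p / of_nat (p i + 1)) * mmon I h (p(i := p i + 1)))
   has_sum (integ I i f h - integ I i g h)) (mindices I)"
  by (intro iffD1[OF has_sum_cong has_sum_minus[OF integ_props(2)[OF fin ro f h] integ_props(2)[OF fin ro g h]]])
    (simp add: diff_divide_distrib left_diff_distrib)
 then show ?thesis
  using integ_props(2)[OF fin ro ps_le_diff[OF ro f g] h] by (rule has_sum_unique[symmetric])
qed

text \<open>The coordinate \<open>s\<close> is the time, the other members of \<open>I\<close> are
  parameters. The solution starts at 0, so initial values have to be subtracted from the unknown
  beforehand.\<close>

lemma analytic0_ode:
 fixes G :: "'j => ('i + 'j => 'k) => 'k::{real_normed_field,banach}"
 assumes fin: "finite I" "finite J" "s : I" and G: "!!j. j : J ==> analytic0 (I <+> J) (G j)"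
 obtains y where "ALL j:J. analytic0 I (y j)"
  "\<forall>\<^sub>F h in nb I. ALL j:J. jpartial s (y j) h = G j (case_sum h (%j. y j h))"
  "\<forall>\<^sub>F h in nb I. ALL j:J. h s = 0 --> y j h = 0"
proof -
 obtain sg B where sg: "0 < sg" "ALL j:J. ps_le (I <+> J) sg (G j) B"
  using analytic0_common_radius[where f = G, OF fin(2) G zero_less_one] by blast
 define b where "b = \<bar>B\<bar> + 1"
 define ro where "ro = sg / (4 * b)"
 have b: "1 <= b" "\<bar>B\<bar> <= b" by (auto simp: b_def)
 then have ro: "0 < ro" using sg by (simp add: ro_def)
 have "4 * (ro * \<bar>B\<bar>) <= 4 * (ro * b)" using ro b by (intro mult_left_mono) auto
 also have "... = sg" unfolding ro_def using b by simp
 finally have 1: "4 * (ro * \<bar>B\<bar>) <= sg" .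
 have "ro <= sg / 4" unfolding ro_def using sg(1) b by (intro divide_left_mono) auto
 then have 2: "2 * ro <= sg" using sg(1) by simp
 have 3: "ps_le (I <+> J) sg (G j) \<bar>B\<bar>" if "j : J" for j
  using sg(2) that by (auto intro: ps_le_mono)
 obtain y where y: "ALL j:J. ps_le I ro (y j) (sg / 2)"
  "ALL j:J. ALL h:pdisc I ro. y j h = integ I s (%h. G j (case_sum h (%j. y j h))) h"
  by (rule ps_le_fixpoint[where L = "integ I s" and \<mu> = ro, OF fin(1,2) ro 2 3 _
     integ_props(1)[OF fin(1,3) ro] integ_diff[OF fin(1,3) ro] _ 1])
    (use ro in auto)
 have yE: "ps_le I ro (%h. case_sum h (%j. y j h) q) sg" if "q : I <+> J" for q
 proof (cases q)
  case (Inl i)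
  then show ?thesis using that 2 ro by (auto intro!: ps_le_mono[OF ps_le_coord[OF fin(1) _ ro]])
 next
  case (Inr j)
  then show ?thesis using that sg(1) by (auto intro!: ps_le_mono[OF bspec[OF y(1)]])
 qed
 have GE: "ps_le I ro (%h. G j (case_sum h (%j. y j h))) \<bar>B\<bar>" if "j : J" for j
  using ps_le_compose[OF ro _ 3[OF that] yE] fin by simp
 have "\<forall>\<^sub>F h in nb I. ALL j:J. jpartial s (y j) h = G j (case_sum h (%j. y j h))"
 proof (intro eventually_ball_finite fin ballI)
  fix j assume j: "j : J"
  have "\<forall>\<^sub>F h in nb I. y j h = integ I s (%h. G j (case_sum h (%j. y j h))) h"
   unfolding eventually_nb using y(2) j ro by blast
  from eventually_jpartial_cong[OF this, of s] integ_props(3)[OF fin(1,3) ro GE[OF j]]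
  show "\<forall>\<^sub>F h in nb I. jpartial s (y j) h = G j (case_sum h (%j. y j h))"
   by eventually_elim simp
 qed
 moreover have "\<forall>\<^sub>F h in nb I. ALL j:J. h s = 0 --> y j h = 0"
  unfolding eventually_nb using y(2) integ_props(4)[OF fin(1,3) ro GE] ro by (intro exI[of _ ro]) auto
 ultimately show ?thesis using that[of y] y(1) ro unfolding analytic0_def by blast
qed

text \<open>Let \<open>m\<close> be the maximum over a compact disc in the variable \<open>s\<close>
  of the sum of the norms. Integrating the equation from 0 gives
  \<open>m <= r * C * card J * m <= m / 2\<close>, hence \<open>m = 0\<close>.\<close>

lemma linear_ode_zero:
 fixes Y :: "'j => ('i => 'k) => 'k::{real_normed_field,euclidean_space}"
 assumes fin: "finite I" "finite J" "s : I"
  and an: "!!j. j : J ==> analytic0 I (Y j)" "!!j i. j : J ==> i : J ==> analytic0 I (A j i)"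
  and ode: "!!j. j : J ==> \<forall>\<^sub>F h in nb I. jpartial s (Y j) h = (SUM i:J. A j i h * Y i h)"
  and init: "!!j. j : J ==> \<forall>\<^sub>F h in nb I. h s = 0 --> Y j h = 0"
  and j: "j : J"
 shows "\<forall>\<^sub>F h in nb I. Y j h = 0"
proof -
 have "analytic0 I (A (fst q) (snd q))" if "q : J \<times> J" for q using an(2) that by auto
 then obtain ro M where M: "0 < ro" "ALL q:J \<times> J. ps_le I ro (A (fst q) (snd q)) M"
  using analytic0_common_radius[where f = "%q. A (fst q) (snd q)",
    OF finite_cartesian_product[OF fin(2) fin(2)] _ zero_less_one] by blast
 have ev: "\<forall>\<^sub>F h in nb I. ALL j:J. jpartial s (Y j) h = (SUM i:J. A j i h * Y i h) &
   (h s = 0 --> Y j h = 0) &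
   ((%t. Y j (h(s := t))) has_field_derivative jpartial s (Y j) h) (at (h s))"
  by (intro eventually_ball_finite fin ballI eventually_conj ode init
     eventually_has_field_derivative_jpartial an)
 then obtain dt where dt: "0 < dt" and D: "!!h j. h : pdisc I dt ==> j : J ==>
   jpartial s (Y j) h = (SUM i:J. A j i h * Y i h) & (h s = 0 --> Y j h = 0) &
   ((%t. Y j (h(s := t))) has_field_derivative jpartial s (Y j) h) (at (h s))"
  unfolding eventually_nb by blast
 define C where "C = \<bar>M\<bar> + 1"
 \<comment> \<open>The last entry makes \<open>r * C * card J\<close> at most 1/2, where
   \<open>C\<close> bounds the coefficients.\<close>
 define r where "r = min (min dt ro) (1 / (2 * C * (real (card J) + 1)))"
 have C: "C > 0" by (simp add: C_def)
 have r: "0 < r" "r <= dt" "r <= ro" using dt M(1) C by (auto simp: r_def)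
 have "r * C * real (card J) <= 1 / (2 * C * (real (card J) + 1)) * (C * (real (card J) + 1))"
  unfolding mult.assoc by (rule mult_mono) (use C r(1) in \<open>auto simp: r_def\<close>)
 also have "... = 1 / 2" using C by (simp add: divide_simps)
 finally have rC: "r * C * real (card J) <= 1 / 2" .
 have "Y j h = 0" if h: "h : pdisc I r" for h
 proof -
  let ?y = "%j t. Y j (h(s := t))"
  have hu: "h(s := t) : pdisc I dt" "h(s := t) : pdisc I ro" if "t : cball 0 r" for t
   using h that r by (auto simp: pdisc_def)
  have d: "(?y j has_field_derivative (SUM i:J. A j i (h(s := t)) * ?y i t)) (at t)"
   if "j : J" "t : cball 0 r" for j t
  proof -
   note D' = D[OF hu(1)[OF that(2)] that(1)]
   have e: "jpartial s (Y j) (h(s := t)) = (SUM i:J. A j i (h(s := t)) * ?y i t)"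
    using D' by blast
   have "((%u. Y j ((h(s := t))(s := u))) has_field_derivative jpartial s (Y j) (h(s := t)))
     (at ((h(s := t)) s))"
    using D' by blast
   then show ?thesis by (simp only: e fun_upd_upd fun_upd_same)
  qed
  have A: "norm (A j i (h(s := t))) <= C" if "j : J" "i : J" "t : cball 0 r" for j i t
   using ps_le_bound[OF bspec[OF M(2), of "(j, i)"] hu(2)[OF that(3)]] that by (simp add: C_def)
  have cont: "continuous_on (cball 0 r) (%t. SUM j:J. norm (?y j t))"
   by (intro continuous_intros DERIV_continuous_on[OF has_field_derivative_at_within[OF d]]) auto
  obtain tm where tm: "tm : cball 0 r"
   and mx: "!!t. t : cball 0 r ==> (SUM j:J. norm (?y j t)) <= (SUM j:J. norm (?y j tm))"
   using continuous_attains_sup[OF compact_cball _ cont] r(1) by (metis cball_eq_empty not_less_iff_gr_or_eq)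
  define m where "m = (SUM j:J. norm (?y j tm))"
  have m0: "0 <= m" by (simp add: m_def sum_nonneg)
  have bound: "norm (?y j tm) <= C * m * r" if jJ: "j : J" for j
  proof -
   have "norm (?y j tm - ?y j 0) <= (C * m) * norm (tm - 0)"
   proof (rule field_differentiable_bound[of "cball 0 r" "?y j"])
    fix t :: 'k assume t: "t : cball 0 r"
    show "(?y j has_field_derivative (SUM i:J. A j i (h(s := t)) * ?y i t)) (at t within cball 0 r)"
     by (rule has_field_derivative_at_within[OF d[OF jJ t]])
    have "norm (SUM i:J. A j i (h(s := t)) * ?y i t) <= (SUM i:J. C * norm (?y i t))"
     by (rule sum_norm_le) (auto simp: norm_mult intro!: mult_right_mono A jJ t)
    also have "... <= C * m"
     unfolding sum_distrib_left[symmetric] m_def using mx[OF t] C by (intro mult_left_mono) auto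
    finally show "norm (SUM i:J. A j i (h(s := t)) * ?y i t) <= C * m" .
   qed (use tm r in auto)
   moreover have "?y j 0 = 0" using D[OF hu(1)[of 0] jJ] r by simp
   ultimately have "norm (?y j tm) <= C * m * norm tm" by simp
   also have "... <= C * m * r" using tm C m0 by (intro mult_left_mono) auto
   finally show ?thesis .
  qed
  have "m <= (SUM j:J. C * m * r)" by (subst (1) m_def) (intro sum_mono bound)
  also have "... = (r * C * real (card J)) * m" by simp
  also have "... <= 1 / 2 * m" by (rule mult_right_mono[OF rC m0])
  finally have "m = 0" using m0 by simp
  moreover have "h s : cball 0 r" using h fin(3) by (auto simp: pdisc_def)
  ultimately have "(SUM j:J. norm (?y j (h s))) <= 0" using mx[of "h s"] by (simp add: m_def)
  moreover have "norm (?y j (h s)) <= (SUM j:J. norm (?y j (h s)))"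
   using j fin by (intro member_le_sum) auto
  ultimately have "norm (?y j (h s)) <= 0" by linarith
  then show ?thesis by simp
 qed
 then show ?thesis unfolding eventually_nb using r(1) by blast
qed

section \<open>The solution family of a completely integrable system\<close>

lemma mdeg_zero [simp]: "mdeg 0 = 0"
 by (simp add: mdeg_def)

lemma mdeg_add: "mdeg (aa + be) = mdeg aa + mdeg be"
 by (simp add: mdeg_def sum.distrib)

lemma mdeg_axis [simp]: "mdeg (axis k a) = a"
 by (simp add: mdeg_def axis_def)

lemma finite_mdeg_le: "finite {be :: 'n::finite mindex. mdeg be <= r}"
proof -
 have "{be :: 'n mindex. mdeg be <= r} \<subseteq> vec_lambda ` (UNIV \<rightarrow>\<^sub>E {..r})"
 proof
  fix be :: "'n mindex" assume "be : {be. mdeg be <= r}"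
  then have "be $ l <= r" for l
   unfolding mdeg_def using member_le_sum[of l UNIV "vec_nth be"] by auto
  then have "vec_nth be : UNIV \<rightarrow>\<^sub>E {..r}" by auto
  then show "be : vec_lambda ` (UNIV \<rightarrow>\<^sub>E {..r})" by (intro image_eqI[of _ _ "vec_nth be"]) auto
 qed
 then show ?thesis by (rule finite_subset) (intro finite_imageI finite_PiE, auto)
qed

lemma finite_jcoords [simp]: "finite (jcoords r :: ('n::finite, 'm::finite) jcoord set)"
proof -
 have "{Uc j be |(j :: 'm) (be :: 'n mindex). mdeg be <= r} = case_prod Uc ` (UNIV \<times> {be. mdeg be <= r})"
  by auto
 then show ?thesis by (simp add: jcoords_def finite_mdeg_le)
qed

lemma Xc_jcoords [simp]: "Xc l : jcoords r"
 by (simp add: jcoords_def)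

lemma Uc_jcoords [simp]: "Uc j be : jcoords r \<longleftrightarrow> mdeg be <= r"
 by (auto simp: jcoords_def)

text \<open>Functions of \<open>(z, t, x)\<close>, where \<open>z\<close> is a jet, \<open>t\<close> a scalar and \<open>x\<close> a vector.\<close>

type_synonym ('n, 'm) wvar = "('n, 'm) jcoord + 'n option"

abbreviation zv :: "('n::finite, 'm) jcoord => ('n, 'm) wvar" where "zv c \<equiv> Inl c"
abbreviation tv :: "('n::finite, 'm) wvar" where "tv \<equiv> Inr None"
abbreviation xv :: "'n::finite => ('n, 'm) wvar" where "xv l \<equiv> Inr (Some l)"

definition wemb :: "'k => (('n::finite, 'm) jcoord => 'k) => 'k^'n => ('n, 'm) wvar => 'k" where
 "wemb t z x = case_sum z (case_option t (vec_nth x))"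

lemma wemb_simps [simp]: "wemb t z x (zv c) = z c" "wemb t z x tv = t" "wemb t z x (xv l) = x $ l"
 by (simp_all add: wemb_def)

lemma finite_Plus_UNIV [simp]: "finite I ==> finite (I <+> (UNIV :: 'a::finite set))"
 by simp

lemma partial_cong:
 assumes "open D" "x : D" "!!y. y : D ==> f y = g y"
 shows "partial l f x = partial l (g :: 'k::real_normed_field^'n::finite => 'k) x"
proof -
 have "((%t. \<chi> i. x $ i + (if i = l then t else 0)) \<longlongrightarrow> (\<chi> i. x $ i)) (nhds (0 :: 'k))"
 proof (rule tendsto_vec_lambda)
  show "((%t. x $ i + (if i = l then t else 0)) \<longlongrightarrow> x $ i) (nhds (0 :: 'k))" for i
   using tendsto_add[OF tendsto_const[of "x $ i"] filterlim_ident[of "nhds (0 :: 'k)"]]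
   by (cases "i = l") simp_all
 qed
 moreover have "(\<chi> i. x $ i + (if i = l then t else 0)) = x + axis l t" for t
  by (simp add: vec_eq_iff axis_def)
 ultimately have "((%t. x + axis l t) \<longlongrightarrow> x) (nhds 0)" by simp
 then have "\<forall>\<^sub>F t in nhds 0. x + axis l t : D"
  by (rule topological_tendstoD[OF _ assms(1,2)])
 then have "\<forall>\<^sub>F t in nhds 0. f (x + axis l t) = g (x + axis l t)"
  by eventually_elim (rule assms(3))
 then show ?thesis unfolding partial_def by (rule deriv_cong_ev) simp
qed

text \<open>\<open>mpartial\<close> takes the variables in an arbitrary order. A family of functions
  indexed by multiindices and closed under differentiation computes the result independently of that
  order.\<close>

lemma mpartial_eqI:
 fixes val :: "'n::finite mindex => 'k^'n => 'k::real_normed_field"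
 assumes D: "open D" and step: "!!be l x. x : D ==> mdeg be < K ==> partial l (val be) x = val (be + axis l 1) x"
  and "mdeg aa <= K" "x : D" and f: "!!y. y : D ==> f y = val 0 y"
 shows "mpartial aa f x = val aa x"
proof -
 have pow: "(partial l ^^ n) f x = val (be + axis l n) x"
  if "!!y. y : D ==> f y = val be y" "mdeg be + n <= K" "x : D" for f be l n x
  using that(2,3)
 proof (induction n arbitrary: x)
  case 0
  have e: "be + axis l 0 = be" by (simp add: vec_eq_iff axis_def)
  show ?case unfolding e using that(1)[OF 0(2)] by simp
 next
  case (Suc n)
  have "(partial l ^^ Suc n) f x = partial l (val (be + axis l n)) x"
   unfolding funpow.simps o_def by (rule partial_cong[OF D Suc.prems(2)]) (use Suc in auto)
  also have "... = val (be + axis l n + axis l 1) x"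
   using Suc.prems by (intro step) (auto simp: mdeg_add)
  also have "be + axis l n + axis l 1 = be + axis l (Suc n)" by (simp add: vec_eq_iff axis_def)
  finally show ?case .
 qed
 have main: "foldr (%l. partial l ^^ (aa $ l)) ls f x = val (SUM l:set ls. axis l (aa $ l)) x"
  if "distinct ls" "x : D" for ls x
  using that
 proof (induction ls arbitrary: x)
  case Nil
  then show ?case using f by simp
 next
  case (Cons l ls)
  have "mdeg (SUM l:set ls. axis l (aa $ l)) = (SUM l:set ls. aa $ l)"
   by (induction ls) (use Cons.prems in \<open>auto simp: mdeg_add insert_absorb sum.insert_if\<close>)
  moreover have "(SUM l:set ls. aa $ l) + aa $ l = (SUM l:set (l # ls). aa $ l)" using Cons.prems by simp
  moreover have "(SUM l:set (l # ls). aa $ l) <= mdeg aa" unfolding mdeg_def by (rule sum_mono2) auto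
  ultimately have "mdeg (SUM l:set ls. axis l (aa $ l)) + aa $ l <= K" using assms(3) by linarith
  then show ?case using Cons by (simp add: pow add.commute)
 qed
 define ls where "ls = (SOME ls :: 'n list. distinct ls & set ls = UNIV)"
 have "EX ls :: 'n list. distinct ls & set ls = UNIV"
  using finite_distinct_list[of "UNIV :: 'n set"] by auto
 then have ls: "distinct ls & set ls = UNIV" unfolding ls_def by (rule someI_ex)
 have "(SUM l:UNIV. axis l (aa $ l)) = aa" by (simp add: vec_eq_iff axis_def sum_component)
 then show ?thesis using main[of ls x] ls assms(4) by (simp add: mpartial_def ls_def[symmetric])
qed

lemma wemb_axis: "wemb t z (x + axis l u) = (wemb t z x)(xv l := x $ l + (u :: 'k::real_normed_field))"
 by (rule ext) (auto simp: wemb_def axis_def split: sum.splits option.splits)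

lemma partial_wemb: "partial l (%y. f (wemb t z y)) x = jpartial (xv l) f (wemb t z x)"
proof -
 have "((%u. f ((wemb t z x)(xv l := u))) has_field_derivative D) (at (x $ l)) \<longleftrightarrow>
   ((%u. f ((wemb t z x)(xv l := x $ l + u))) has_field_derivative D) (at 0)" for D
  using DERIV_shift[of "%u. f ((wemb t z x)(xv l := u))" D 0 "x $ l"] by (simp add: add.commute)
 then show ?thesis by (simp add: partial_def jpartial_def deriv_def wemb_axis)
qed

lemma kanalytic_at_wemb:
 fixes f :: "(('n::finite, 'm) wvar => 'k) => 'k::{real_normed_field,banach}"
 assumes "finite I" "0 < ro" and f: "ps_le (I <+> UNIV) ro f M"
  and z: "!!c. c : I ==> norm (z c) <= ro" and t: "norm t <= ro" and x: "!!l. norm (x $ l) < ro"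
 shows "kanalytic_at UNIV (%y. f (wemb t z (vec_lambda y))) (vec_nth x)"
proof -
 define r where "r = ro - Max (range (%l. norm (x $ l)))"
 have "Max (range (%l. norm (x $ l))) : range (%l. norm (x $ l))" by (rule Max_in) auto
 then have r: "0 < r" using x by (auto simp: r_def)
 have xr: "norm (x $ l) + r <= ro" for l
 proof -
  have "norm (x $ l) <= Max (range (%l. norm (x $ l)))" by (rule Max_ge) auto
  then show ?thesis unfolding r_def by linarith
 qed
 have "ps_le UNIV r (%h. f (%q. wemb t z (\<chi> i. x $ i + h i) q)) M"
 proof (rule ps_le_compose[OF r _ f])
  fix q :: "('n, 'm) wvar" assume q: "q : I <+> UNIV"
  show "ps_le UNIV r (%h. wemb t z (\<chi> i. x $ i + h i) q) ro"
  proof (cases q)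
   case (Inl c)
   then show ?thesis using q z ps_le_mono[OF ps_le_const[OF r]] by auto
  next
   case (Inr l)
   show ?thesis
   proof (cases l)
    case None
    then show ?thesis using Inr t ps_le_mono[OF ps_le_const[OF r]] by auto
   next
    case (Some l)
    have "ps_le UNIV r (%h. x $ l + h l) (norm (x $ l) + r)"
     by (intro ps_le_add ps_le_const ps_le_coord r) auto
    then show ?thesis using Inr Some xr ps_le_mono by fastforce
   qed
  qed
 qed (use assms(1) in auto)
 then show ?thesis
  unfolding kanalytic_at_iff_ps_le[OF finite_class.finite_UNIV] using r by blast
qed

text \<open>A right-hand side receives a total function on an infinite coordinate type. Since its
  series involves only the coordinates in \<open>I\<close>, jets that agree there can be
  exchanged.\<close>

lemma analytic0_depends:
 assumes "analytic0 I f"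
 shows "\<forall>\<^sub>F h in nb I. ALL h'. (ALL i:I. h' i = h i) --> f h' = f h"
proof -
 obtain ro c where ro: "0 < ro" and c: "pseries I ro c f"
  using assms by (auto simp: analytic0_def ps_le_def)
 have "f h' = f h" if h: "h : pdisc I ro" and eq: "ALL i:I. h' i = h i" for h h'
 proof -
  have h': "h' : pdisc I ro" using h eq by (auto simp: pdisc_def)
  have m: "mmon I h' p = mmon I h p" for p
   unfolding mmon_def using eq by (intro prod.cong) auto
  have "((%p. c p * mmon I h p) has_sum f h') (mindices I)"
   using c h' unfolding pseries_def by (simp flip: m)
  moreover have "((%p. c p * mmon I h p) has_sum f h) (mindices I)"
   using c h by (simp add: pseries_def)
  ultimately show ?thesis by (rule has_sum_unique)
 qed
 then show ?thesis unfolding eventually_nb using ro by blast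
qed

locale pde =
 fixes \<kappa> :: nat and F :: "('k::{real_normed_field,euclidean_space}, 'n::finite, 'm::finite) rhs"
 assumes order: "\<kappa> >= 2"
  and analytic_F: "!!j aa. mdeg aa = \<kappa> ==> kanalytic_at (jcoords (\<kappa> - 1)) (F j aa) (%_. 0)"
  and integrable: "completely_integrable \<kappa> F"
begin

abbreviation JC :: "('n, 'm) jcoord set" where "JC \<equiv> jcoords (\<kappa> - 1)"
abbreviation WC :: "('n, 'm) wvar set" where "WC \<equiv> JC <+> UNIV"
abbreviation V where "V \<equiv> pfaff_field \<kappa> F"

lemma finite_WC: "finite WC" by simp

lemma F_analytic0: "mdeg aa = \<kappa> ==> analytic0 JC (F j aa)"
 using analytic_F[of aa j] by (simp add: kanalytic_at_iff_analytic0)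

lemma V_analytic0:
 assumes "c : JC"
 shows "analytic0 JC (V k c)"
proof (cases c)
 case (Xc l)
 have "V k c = (%_. if l = k then 1 else 0)" by (auto simp: pfaff_field_def Xc fun_eq_iff)
 then show ?thesis by simp
next
 case (Uc i be)
 show ?thesis
 proof (cases "mdeg be + 2 <= \<kappa>")
  case True
  then have "V k c = (%z. z (Uc i (be + unit_mindex k)))"
   by (auto simp: pfaff_field_def Uc fun_eq_iff)
  moreover have "Uc i (be + unit_mindex k) : JC" using True by (simp add: mdeg_add)
  ultimately show ?thesis by (simp add: analytic0_coord)
 next
  case False
  then have "V k c = F i (be + unit_mindex k)"
   by (auto simp: pfaff_field_def Uc fun_eq_iff)
  moreover have "mdeg (be + unit_mindex k) = \<kappa>"
   using False assms Uc order by (auto simp: mdeg_add)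
  ultimately show ?thesis using F_analytic0 by simp
 qed
qed

lemma V_bracket:
 "\<forall>\<^sub>F z in nb JC. ALL k l. ALL c:JC. (SUM d:JC. jpartial d (V l c) z * V k d z) = (SUM d:JC. jpartial d (V k c) z * V l d z)"
proof -
 obtain \<epsilon> where \<epsilon>: "\<epsilon> > 0" and b: "!!z. (ALL c:JC. norm (z c) < \<epsilon>) ==>
   ALL k l. ALL c:JC. jbracket JC (V k) (V l) c z = 0"
  using integrable unfolding completely_integrable_def by auto
 have "ALL k l. ALL c:JC. (SUM d:JC. jpartial d (V l c) z * V k d z) = (SUM d:JC. jpartial d (V k c) z * V l d z)"
  if "z : pdisc JC (\<epsilon> / 2)" for z
 proof -
  have "ALL c:JC. norm (z c) < \<epsilon>" using that \<epsilon> by (force simp: pdisc_def)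
  from b[OF this] show ?thesis by (simp add: jbracket_def sum_subtractf mult.commute)
 qed
 then show ?thesis unfolding eventually_nb using \<epsilon> half_gt_zero by blast
qed

text \<open>The left part of the argument holds the parameters \<open>(z, t, x)\<close>, the right
  part the displacement from \<open>z\<close>; adding the two lets the unknown start at 0.\<close>

definition flow_rhs :: "('n, 'm) jcoord => (('n, 'm) wvar + ('n, 'm) jcoord => 'k) => 'k" where
 "flow_rhs c q = (SUM k:UNIV. q (Inl (xv k)) * V k c (%d. q (Inl (zv d)) + q (Inr d)))"

lemma flow_rhs_analytic0:
 assumes "c : JC"
 shows "analytic0 (WC <+> JC) (flow_rhs c)"
proof -
 have fin: "finite (WC <+> JC)" by simp
 show ?thesis unfolding flow_rhs_def
  by (intro analytic0_sum analytic0_mult analytic0_compose[OF fin finite_jcoords V_analytic0[OF assms]]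
    analytic0_add analytic0_coord fin) auto
qed

text \<open>Integrating along the straight lines \<open>t \<mapsto> t x\<close>: involutivity makes the result
  independent of the path, so that all \<open>x\<^sub>k\<close>-derivatives are as prescribed.\<close>

lemma solution_flow:
 obtains Z :: "('n, 'm) jcoord => (('n, 'm) wvar => 'k) => 'k"
 where "ALL c:JC. analytic0 WC (Z c)"
  "\<forall>\<^sub>F h in nb WC. ALL c:JC. (ALL l. h (xv l) = 0) --> Z c h = h (zv c)"
  "\<forall>\<^sub>F h in nb WC. ALL l. Z (Xc l) h = h (zv (Xc l)) + h tv * h (xv l)"
  "\<forall>\<^sub>F h in nb WC. ALL c:JC. ALL k. jpartial (xv k) (Z c) h = h tv * V k c (%d. Z d h)"
proof -
 note fin = finite_WC
 have tv: "tv : WC" by auto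
 obtain y where y: "ALL c:JC. analytic0 WC (y c)"
  "\<forall>\<^sub>F h in nb WC. ALL c:JC. jpartial tv (y c) h = flow_rhs c (case_sum h (%c. y c h))"
  "\<forall>\<^sub>F h in nb WC. ALL c:JC. h tv = 0 --> y c h = 0"
  by (rule analytic0_ode[OF fin finite_jcoords tv flow_rhs_analytic0])
 define Z where "Z c h = h (zv c) + y c h" for c h
 have Zan: "analytic0 WC (Z c)" if "c : JC" for c
  unfolding Z_def using that y(1) by (intro analytic0_add analytic0_coord fin) auto
 have Zt0: "\<forall>\<^sub>F h in nb WC. ALL c:JC. h tv = 0 --> Z c h = h (zv c)"
  using y(3) by eventually_elim (auto simp: Z_def)
 have Z0: "Z c (%_. 0) = 0" if "c : JC" for c
  using eventually_nb_zero[OF Zt0] that by auto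
 have Vz: "analytic0 WC (%h. V k c (%d. Z d h))" if "c : JC" for k c
  by (rule analytic0_compose[OF fin finite_jcoords V_analytic0[OF that] Zan Z0])
 have dZ: "\<forall>\<^sub>F h in nb WC. ALL c:JC. jpartial tv (Z c) h = (SUM k:UNIV. h (xv k) * V k c (%d. Z d h))"
 proof -
  have "\<forall>\<^sub>F h in nb WC. ALL c:JC. jpartial tv (Z c) h = jpartial tv (%h. h (zv c)) h + jpartial tv (y c) h"
   unfolding Z_def using y(1)
   by (intro eventually_ball_finite ballI finite_jcoords eventually_jpartial_add fin tv analytic0_coord) auto
  then show ?thesis using y(2)
   by eventually_elim (simp add: flow_rhs_def jpartial_coord Z_def)
 qed
 \<comment> \<open>At \<open>x = 0\<close> the right-hand side vanishes, so the flow is constant in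
   \<open>t\<close>. Substituting \<open>q\<close>, which sets \<open>x\<close> to 0, turns this
   into an equation between germs, to which uniqueness applies.\<close>
 have Zx0: "\<forall>\<^sub>F h in nb WC. ALL c:JC. (ALL l. h (xv l) = 0) --> Z c h = h (zv c)"
 proof (intro eventually_ball_finite ballI finite_jcoords)
  fix c assume c: "c : JC"
  define q where "q i h = (if i = tv | i : range Inl then h i else 0)" for i :: "('n, 'm) wvar" and h :: "('n, 'm) wvar => 'k"
  have qan: "analytic0 WC (q i)" if "i : WC" for i
   using analytic0_coord[OF fin that] by (cases "i = tv | i : range Inl") (auto simp: q_def[abs_def])
  have q0: "q i (%_. 0) = 0" for i by (simp add: q_def)
  have dq: "jpartial tv (q i) h = (if i = tv then 1 else 0)" for i h
   by (cases "i = tv | i : range Inl") (auto simp: q_def[abs_def] jpartial_coord)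
  let ?Y = "%h. Z c (%i. q i h) - h (zv c)"
  have Zq: "analytic0 WC (%h. Z c (%i. q i h))"
   by (rule analytic0_compose[where g = q, OF fin fin Zan[OF c]]) (use qan q0 in auto)
  have Yan: "analytic0 WC ?Y" using c by (intro analytic0_diff Zq analytic0_coord fin) auto
  have zc: "zv c : WC" using c by auto
  have "\<forall>\<^sub>F h in nb WC. jpartial tv (%h. Z c (%i. q i h)) h =
    (SUM i:WC. jpartial i (Z c) (%i. q i h) * jpartial tv (q i) h)"
   by (rule eventually_jpartial_chain[where g = q, OF fin tv fin Zan[OF c]]) (use qan q0 in auto)
  moreover have "\<forall>\<^sub>F h in nb WC. ALL c:JC. jpartial tv (Z c) (%i. q i h) =
    (SUM k:UNIV. q (xv k) h * V k c (%d. Z d (%i. q i h)))"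
   by (rule eventually_nb_compose[where g = q, OF fin fin _ _ dZ]) (use qan q0 in auto)
  moreover have "\<forall>\<^sub>F h in nb WC. jpartial tv ?Y h =
    jpartial tv (%h. Z c (%i. q i h)) h - jpartial tv (%h. h (zv c)) h"
   by (rule eventually_jpartial_diff[OF fin tv Zq analytic0_coord[OF fin zc]])
  ultimately have "\<forall>\<^sub>F h in nb WC. jpartial tv ?Y h = 0"
  proof eventually_elim
   case (elim h)
   have "(SUM i:WC. jpartial i (Z c) (%i. q i h) * jpartial tv (q i) h) = jpartial tv (Z c) (%i. q i h)"
    unfolding dq using fin tv by (simp add: if_distrib cong: if_cong)
   also have "... = 0" using elim(2) c by (simp add: q_def image_iff)
   finally show ?case using elim(1,3) by (simp add: jpartial_coord)
  qed
  then have "\<forall>\<^sub>F h in nb WC. jpartial tv ?Y h = (SUM i:{()}. 0 * ?Y h)" by simp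
  moreover have "\<forall>\<^sub>F h in nb WC. h tv = 0 --> ?Y h = 0"
  proof -
   have "\<forall>\<^sub>F h in nb WC. ALL c:JC. q tv h = 0 --> Z c (%i. q i h) = q (zv c) h"
    by (rule eventually_nb_compose[where g = q, OF fin fin _ _ Zt0]) (use qan q0 in auto)
   then show ?thesis by eventually_elim (use c in \<open>auto simp: q_def\<close>)
  qed
  ultimately have "\<forall>\<^sub>F h in nb WC. ?Y h = 0"
   by (intro linear_ode_zero[of WC "{()}" tv "%_. ?Y" "%_ _ _. 0" "()"] fin tv Yan analytic0_const) auto
  then show "\<forall>\<^sub>F h in nb WC. (ALL l. h (xv l) = 0) --> Z c h = h (zv c)"
  proof eventually_elim
   case (elim h)
   show ?case
   proof
    assume "ALL l. h (xv l) = 0"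
    then have "(%i. q i h) = h"
    proof (intro ext)
     fix i assume "ALL l. h (xv l) = 0"
     then show "q i h = h i" by (cases i; cases "projr i") (auto simp: q_def)
    qed
    then show "Z c h = h (zv c)" using elim by simp
   qed
  qed
 qed
 have ZX: "\<forall>\<^sub>F h in nb WC. ALL l. Z (Xc l) h = h (zv (Xc l)) + h tv * h (xv l)"
 proof (intro eventually_all_finite)
  fix l :: 'n
  have zc: "zv (Xc l) : WC" "xv l : WC" by auto
  let ?g = "%h :: ('n, 'm) wvar => 'k. h (zv (Xc l)) + h tv * h (xv l)"
  let ?Y = "%h. Z (Xc l) h - ?g h"
  have gan: "analytic0 WC ?g" by (intro analytic0_add analytic0_mult analytic0_coord fin zc tv)
  have Yan: "analytic0 WC ?Y" by (intro analytic0_diff gan Zan) auto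
  have dg: "jpartial tv ?g h = h (xv l)" for h
   unfolding jpartial_def by (auto intro!: DERIV_imp_deriv derivative_eq_intros)
  have "\<forall>\<^sub>F h in nb WC. jpartial tv ?Y h = 0"
   using eventually_jpartial_diff[OF fin tv Zan[OF Xc_jcoords[of l]] gan] dZ
  proof eventually_elim
   case (elim h)
   have "jpartial tv (Z (Xc l)) h = (SUM k:UNIV. h (xv k) * (if l = k then 1 else 0))"
    using elim(2) by (auto simp: pfaff_field_def intro!: sum.cong)
   then show ?case using elim(1) dg by (simp add: if_distrib cong: if_cong)
  qed
  then have "\<forall>\<^sub>F h in nb WC. jpartial tv ?Y h = (SUM i:{()}. 0 * ?Y h)" by simp
  moreover have "\<forall>\<^sub>F h in nb WC. h tv = 0 --> ?Y h = 0"
   using Zt0 by eventually_elim auto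
  ultimately have "\<forall>\<^sub>F h in nb WC. ?Y h = 0"
   by (intro linear_ode_zero[of WC "{()}" tv "%_. ?Y" "%_ _ _. 0" "()"] fin tv Yan analytic0_const) auto
  then show "\<forall>\<^sub>F h in nb WC. Z (Xc l) h = ?g h" by eventually_elim simp
 qed
 have "\<forall>\<^sub>F h in nb WC. ALL k. ALL c:JC. jpartial (xv k) (Z c) h = h tv * V k c (%d. Z d h)"
 proof (intro eventually_all_finite)
  fix k :: 'n
  have xk: "xv k : WC" by auto
  let ?D = "%c d l h. jpartial d (V l c) (%d. Z d h)"
  \<comment> \<open>The defect of the desired equation. It vanishes at \<open>t = 0\<close>, and it
    will satisfy a homogeneous linear equation in \<open>t\<close>.\<close>
  define Y where "Y c h = jpartial (xv k) (Z c) h - h tv * V k c (%d. Z d h)" for c h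
  define A where "A c d h = (SUM l:UNIV. h (xv l) * ?D c d l h)" for c d h
  have DZ: "analytic0 WC (%h. ?D c d l h)" if "c : JC" "d : JC" for c d l
   by (rule analytic0_compose[OF fin finite_jcoords _ Zan Z0])
     (rule analytic0_jpartial[OF finite_jcoords that(2) V_analytic0[OF that(1)]])
  have kZ: "analytic0 WC (jpartial (xv k) (Z c))" if "c : JC" for c
   by (rule analytic0_jpartial[OF fin xk Zan[OF that]])
  have tV: "analytic0 WC (%h. h tv * V k c (%d. Z d h))" if "c : JC" for c
   by (intro analytic0_mult analytic0_coord fin tv Vz that)
  have "\<forall>\<^sub>F h in nb WC. Y c h = 0" if c: "c : JC" for c
  proof (rule linear_ode_zero[of WC JC tv Y A])
   show "analytic0 WC (Y c)" if "c : JC" for c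
    unfolding Y_def by (intro analytic0_diff kZ tV that)
   show "analytic0 WC (A c d)" if "c : JC" "d : JC" for c d
    unfolding A_def by (intro analytic0_sum analytic0_mult analytic0_coord fin DZ that) auto
   show "\<forall>\<^sub>F h in nb WC. h tv = 0 --> Y c h = 0" if c: "c : JC" for c
   proof -
    define q where "q i h = (if i = tv then 0 else h i)" for i :: "('n, 'm) wvar" and h :: "('n, 'm) wvar => 'k"
    have qan: "analytic0 WC (q i)" if "i : WC" for i
     using analytic0_coord[OF fin that] by (cases "i = tv") (auto simp: q_def[abs_def])
    have q0: "q i (%_. 0) = 0" for i by (simp add: q_def)
    have "\<forall>\<^sub>F h in nb WC. Z c (%i. q i h) = h (zv c)"
    proof -
     have "\<forall>\<^sub>F h in nb WC. ALL c:JC. q tv h = 0 --> Z c (%i. q i h) = q (zv c) h"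
      by (rule eventually_nb_compose[where g = q, OF fin fin _ _ Zt0]) (use qan q0 in auto)
     then show ?thesis by eventually_elim (use c in \<open>auto simp: q_def\<close>)
    qed
    from eventually_jpartial_cong[OF this, of "xv k"]
    show ?thesis
    proof eventually_elim
     case (elim h)
     show ?case
     proof
      assume t: "h tv = 0"
      have "(%i. q i (h(xv k := u))) = h(xv k := u)" for u using t by (auto simp: q_def fun_eq_iff)
      then have "jpartial (xv k) (%h. Z c (%i. q i h)) h = jpartial (xv k) (Z c) h"
       by (simp add: jpartial_def)
      then show "Y c h = 0" using elim t by (simp add: Y_def jpartial_coord)
     qed
    qed
   qed
   show "\<forall>\<^sub>F h in nb WC. jpartial tv (Y c) h = (SUM d:JC. A c d h * Y d h)" if c: "c : JC" for c
   proof -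
    have g: "\<forall>\<^sub>F h in nb WC. jpartial tv (Z c) h = (SUM l:UNIV. h (xv l) * V l c (%d. Z d h))"
     using dZ by eventually_elim (use c in auto)
    have prod: "analytic0 WC (%h. h (xv l) * V l c (%d. Z d h))" for l
     by (intro analytic0_mult analytic0_coord fin Vz c) auto
    have e1: "\<forall>\<^sub>F h in nb WC. jpartial tv (Y c) h =
      jpartial tv (jpartial (xv k) (Z c)) h - jpartial tv (%h. h tv * V k c (%d. Z d h)) h"
     unfolding Y_def by (rule eventually_jpartial_diff[OF fin tv kZ[OF c] tV[OF c]])
    have e2: "\<forall>\<^sub>F h in nb WC. jpartial tv (jpartial (xv k) (Z c)) h = jpartial (xv k) (jpartial tv (Z c)) h"
     by (rule eventually_jpartial_commute[OF fin tv xk Zan[OF c]])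
    have e3: "\<forall>\<^sub>F h in nb WC. jpartial (xv k) (jpartial tv (Z c)) h =
      jpartial (xv k) (%h. SUM l:UNIV. h (xv l) * V l c (%d. Z d h)) h"
     by (rule eventually_jpartial_cong[OF g])
    have e4: "\<forall>\<^sub>F h in nb WC. jpartial (xv k) (%h. SUM l:UNIV. h (xv l) * V l c (%d. Z d h)) h =
      (SUM l:UNIV. jpartial (xv k) (%h. h (xv l) * V l c (%d. Z d h)) h)"
     by (rule eventually_jpartial_sum[OF fin xk _ prod]) simp
    have e5: "\<forall>\<^sub>F h in nb WC. ALL l. jpartial (xv k) (%h. h (xv l) * V l c (%d. Z d h)) h =
      jpartial (xv k) (%h. h (xv l)) h * V l c (%d. Z d h) + h (xv l) * jpartial (xv k) (%h. V l c (%d. Z d h)) h"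
     by (intro eventually_all_finite eventually_jpartial_mult fin xk analytic0_coord Vz c) auto
    have e6: "\<forall>\<^sub>F h in nb WC. ALL l. jpartial (xv k) (%h. V l c (%d. Z d h)) h =
      (SUM d:JC. ?D c d l h * jpartial (xv k) (Z d) h)"
     by (intro eventually_all_finite eventually_jpartial_chain[OF fin xk finite_jcoords V_analytic0[OF c] Zan Z0])
    have e7: "\<forall>\<^sub>F h in nb WC. jpartial tv (%h. h tv * V k c (%d. Z d h)) h =
      jpartial tv (%h. h tv) h * V k c (%d. Z d h) + h tv * jpartial tv (%h. V k c (%d. Z d h)) h"
     by (rule eventually_jpartial_mult[OF fin tv analytic0_coord[OF fin tv] Vz[OF c]])
    have e8: "\<forall>\<^sub>F h in nb WC. jpartial tv (%h. V k c (%d. Z d h)) h =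
      (SUM d:JC. ?D c d k h * jpartial tv (Z d) h)"
     by (rule eventually_jpartial_chain[OF fin tv finite_jcoords V_analytic0[OF c] Zan Z0])
    \<comment> \<open>Involutivity enters here: exchanging \<open>k\<close> and \<open>l\<close>
      makes the derivative of the prescribed field match that of the flow, so only terms linear in
      the defect survive.\<close>
    have e9: "\<forall>\<^sub>F h in nb WC. ALL k l. ALL c:JC. (SUM d:JC. ?D c d l h * V k d (%d. Z d h)) =
      (SUM d:JC. ?D c d k h * V l d (%d. Z d h))"
     by (rule eventually_nb_compose[OF fin finite_jcoords Zan Z0 V_bracket])
    show ?thesis using e1 e2 e3 e4 e5 e6 e7 e8 e9 dZ
    proof eventually_elim
     case (elim h)
     let ?V = "%l c. V l c (%d. Z d h)"
     have a: "jpartial tv (jpartial (xv k) (Z c)) h =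
       (SUM l:UNIV. (if l = k then 1 else 0) * ?V l c + h (xv l) * (SUM d:JC. ?D c d l h * jpartial (xv k) (Z d) h))"
      using elim(2,3,4,5,6) by (simp add: jpartial_coord)
     also have "... = ?V k c + (SUM l:UNIV. SUM d:JC. h (xv l) * ?D c d l h * jpartial (xv k) (Z d) h)"
      by (simp add: sum.distrib if_distrib[of "%x. x * _"] sum_distrib_left mult.assoc cong: if_cong)
     finally have a': "jpartial tv (jpartial (xv k) (Z c)) h = ..." .
     have "jpartial tv (%h. h tv * V k c (%d. Z d h)) h =
       ?V k c + h tv * (SUM d:JC. ?D c d k h * (SUM l:UNIV. h (xv l) * ?V l d))"
      using elim(7,8,10) by (simp add: jpartial_coord)
     also have "(SUM d:JC. ?D c d k h * (SUM l:UNIV. h (xv l) * ?V l d)) =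
       (SUM l:UNIV. h (xv l) * (SUM d:JC. ?D c d k h * ?V l d))"
      by (simp add: sum_distrib_left mult_ac) (rule sum.swap)
     also have "... = (SUM l:UNIV. h (xv l) * (SUM d:JC. ?D c d l h * ?V k d))"
      using elim(9) c by simp
     finally have b: "jpartial tv (%h. h tv * V k c (%d. Z d h)) h =
       ?V k c + (SUM l:UNIV. SUM d:JC. h (xv l) * ?D c d l h * (h tv * ?V k d))"
      by (simp add: sum_distrib_left mult_ac)
     have "jpartial tv (Y c) h = (SUM l:UNIV. SUM d:JC. h (xv l) * ?D c d l h * Y d h)"
      unfolding elim(1) a' b Y_def by (simp add: right_diff_distrib sum_subtractf)
     also have "... = (SUM d:JC. A c d h * Y d h)"
      unfolding A_def sum_distrib_right by (rule sum.swap)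
     finally show ?case .
    qed
   qed
  qed (use fin tv that in auto)
  then have "\<forall>\<^sub>F h in nb WC. ALL c:JC. Y c h = 0" by (intro eventually_ball_finite finite_jcoords) auto
  then show "\<forall>\<^sub>F h in nb WC. ALL c:JC. jpartial (xv k) (Z c) h = h tv * V k c (%d. Z d h)"
   by eventually_elim (auto simp: Y_def)
 qed
 then have "\<forall>\<^sub>F h in nb WC. ALL c:JC. ALL k. jpartial (xv k) (Z c) h = h tv * V k c (%d. Z d h)"
  by eventually_elim auto
 with Zan Zx0 ZX show ?thesis using that[of Z] by blast
qed

text \<open>By the last clause the time has been eliminated; the slot \<open>tv\<close> becomes free
  and later serves as the time of the symmetry flow and as the scaling parameter.\<close>

definition solution_family :: "(('n, 'm) jcoord => (('n, 'm) wvar => 'k) => 'k) => bool" where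
 "solution_family U \<longleftrightarrow>
   (ALL c:JC. analytic0 WC (U c)) &
   (\<forall>\<^sub>F h in nb WC. ALL c:JC. (ALL l. h (xv l) = 0) --> U c h = h (zv c)) &
   (\<forall>\<^sub>F h in nb WC. ALL l. U (Xc l) h = h (zv (Xc l)) + h (xv l)) &
   (\<forall>\<^sub>F h in nb WC. ALL c:JC. ALL k. jpartial (xv k) (U c) h = V k c (%d. U d h)) &
   (ALL c h t. U c (h(tv := t)) = U c h)"

lemma ex_solution_family: "EX U. solution_family U"
proof -
 note fin = finite_WC
 obtain Z :: "('n, 'm) jcoord => (('n, 'm) wvar => 'k) => 'k"
  where Z: "ALL c:JC. analytic0 WC (Z c)"
  "\<forall>\<^sub>F h in nb WC. ALL c:JC. (ALL l. h (xv l) = 0) --> Z c h = h (zv c)"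
  "\<forall>\<^sub>F h in nb WC. ALL l. Z (Xc l) h = h (zv (Xc l)) + h tv * h (xv l)"
  "\<forall>\<^sub>F h in nb WC. ALL c:JC. ALL k. jpartial (xv k) (Z c) h = h tv * V k c (%d. Z d h)"
  by (rule solution_flow)
 have d: "\<forall>\<^sub>F h in nb WC. ALL k. ALL c:JC.
   ((%t. Z c (h(xv k := t))) has_field_derivative jpartial (xv k) (Z c) h) (at (h (xv k)))"
  by (intro eventually_all_finite eventually_ball_finite finite_jcoords ballI
    eventually_has_field_derivative_jpartial fin) (use Z(1) in auto)
 obtain dt where dt: "0 < dt" and P: "ALL h:pdisc WC dt.
   (ALL c:JC. (ALL l. h (xv l) = 0) --> Z c h = h (zv c)) &
   (ALL l. Z (Xc l) h = h (zv (Xc l)) + h tv * h (xv l)) &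
   (ALL c:JC. ALL k. jpartial (xv k) (Z c) h = h tv * V k c (%d. Z d h)) &
   (ALL k. ALL c:JC. ((%t. Z c (h(xv k := t))) has_field_derivative jpartial (xv k) (Z c) h) (at (h (xv k))))"
  using eventually_conj[OF Z(2) eventually_conj[OF Z(3) eventually_conj[OF Z(4) d]]]
  unfolding eventually_nb by (elim exE conjE) (rule that)
 obtain ro M where ro: "0 < ro" "ro <= dt" and M: "ALL c:JC. ps_le WC ro (Z c) M"
  using analytic0_common_radius[where f = Z, OF finite_jcoords bspec[OF Z(1)] dt] by blast
 \<comment> \<open>Time 1 may lie outside the domain of \<open>Z\<close>, so \<open>t = ro\<close>
   and \<open>x / ro\<close> stand in for \<open>t = 1\<close> and \<open>x\<close>. The bound
   \<open>ro * ro\<close> keeps \<open>x / ro\<close> within radius \<open>ro\<close>.\<close>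
 define r where "r = min ro (ro * ro)"
 have r: "0 < r" "r <= ro" "r / ro <= ro" using ro by (auto simp: r_def min_def divide_simps)
 define q where "q h = case_sum (%c. h (zv c)) (case_option (of_real ro) (%l. h (xv l) / of_real ro))"
  for h :: "('n, 'm) wvar => 'k"
 have q [simp]: "q h (zv c) = h (zv c)" "q h tv = of_real ro" "q h (xv l) = h (xv l) / of_real ro" for h c l
  by (auto simp: q_def)
 have qb: "q h : pdisc WC ro" if "h : pdisc WC r" for h
  unfolding pdisc_def
 proof safe
  fix c :: "('n, 'm) jcoord" assume "c : JC"
  then show "norm (q h (Inl c)) <= ro" using that r by (force simp: pdisc_def)
 next
  fix l :: "'n option"
  show "norm (q h (Inr l)) <= ro"
  proof (cases l)
   case (Some k)
   have "norm (h (xv k)) <= r" using that by (auto simp: pdisc_def)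
   then have "norm (h (xv k)) / ro <= r / ro" using ro by (intro divide_right_mono) auto
   then show ?thesis using Some r ro by (simp add: norm_divide)
  qed (use ro in auto)
 qed
 then have qb': "q h : pdisc WC dt" if "h : pdisc WC r" for h
  using pdisc_mono[OF ro(2)] that by blast
 define U where "U c h = Z c (q h)" for c h
 have "analytic0 WC (U c)" if "c : JC" for c
 proof -
  have "ps_le WC r (%h. Z c (%i. q h i)) M"
  proof (rule ps_le_compose[OF r(1) fin bspec[OF M that]])
   fix i :: "('n, 'm) wvar" assume i: "i : WC"
   show "ps_le WC r (%h. q h i) ro"
   proof (cases i)
    case (Inl c)
    have "ps_le WC r (%h. h i) ro" by (rule ps_le_mono[OF ps_le_coord[OF fin i r(1)] r(2)])
    then show ?thesis unfolding Inl by simp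
   next
    case (Inr l)
    show ?thesis
    proof (cases l)
     case None
     then show ?thesis using Inr ps_le_const[OF r(1), of WC "of_real ro"] ro by simp
    next
     case (Some k)
     have "ps_le WC r (%h :: ('n, 'm) wvar => 'k. (1 / of_real ro) * h (xv k)) (norm (1 / of_real ro :: 'k) * r)"
      by (rule ps_le_cmult[OF r(1) ps_le_coord[OF fin _ r(1)]]) auto
     then have "ps_le WC r (%h :: ('n, 'm) wvar => 'k. (1 / of_real ro) * h (xv k)) ro"
      by (rule ps_le_mono) (use r ro in \<open>simp add: norm_divide\<close>)
     then show ?thesis using Inr Some by simp
    qed
   qed
  qed
  then show ?thesis unfolding analytic0_def U_def using r(1) by blast
 qed
 moreover have 2: "ALL h:pdisc WC r. ALL c:JC. (ALL l. h (xv l) = 0) --> U c h = h (zv c)"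
 proof (intro ballI impI)
  fix h :: "('n, 'm) wvar => 'k" and c assume "h : pdisc WC r" "c : JC" "ALL l. h (xv l) = 0"
  then show "U c h = h (zv c)" using bspec[OF P qb'[of h]] by (simp add: U_def)
 qed
 moreover have 3: "ALL h:pdisc WC r. ALL l. U (Xc l) h = h (zv (Xc l)) + h (xv l)"
 proof (intro ballI allI)
  fix h :: "('n, 'm) wvar => 'k" and l assume "h : pdisc WC r"
  then show "U (Xc l) h = h (zv (Xc l)) + h (xv l)"
   using bspec[OF P qb'[of h]] ro(1) by (simp add: U_def)
 qed
 moreover have 4: "ALL h:pdisc WC r. ALL c:JC. ALL k. jpartial (xv k) (U c) h = V k c (%d. U d h)"
 proof (intro ballI allI)
  fix h :: "('n, 'm) wvar => 'k" and c k assume h: "h : pdisc WC r" and c: "c : JC"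
  have D: "((%t. Z c ((q h)(xv k := t))) has_field_derivative of_real ro * V k c (%d. Z d (q h))) (at (h (xv k) / of_real ro))"
  proof -
   have "jpartial (xv k) (Z c) (q h) = of_real ro * V k c (%d. Z d (q h))"
    using bspec[OF P qb'[OF h]] c by simp
   moreover have "((%t. Z c ((q h)(xv k := t))) has_field_derivative jpartial (xv k) (Z c) (q h)) (at (q h (xv k)))"
    using bspec[OF P qb'[OF h]] c by blast
   ultimately show ?thesis by simp
  qed
  have "((%t. Z c ((q h)(xv k := t / of_real ro))) has_field_derivative
    of_real ro * V k c (%d. Z d (q h)) * (1 / of_real ro)) (at (h (xv k)))"
   by (rule DERIV_chain2[where g = "%t. t / of_real ro", OF D])
     (use ro(1) in \<open>auto intro!: derivative_eq_intros\<close>)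
  then have "((%t. Z c ((q h)(xv k := t / of_real ro))) has_field_derivative V k c (%d. Z d (q h))) (at (h (xv k)))"
   using ro(1) by simp
  moreover have "(q h)(xv k := t / of_real ro) = q (h(xv k := t))" for t
   by (rule ext) (auto simp: q_def split: sum.splits option.splits)
  ultimately show "jpartial (xv k) (U c) h = V k c (%d. U d h)"
   by (simp add: U_def jpartial_def DERIV_imp_deriv)
 qed
 moreover have "U c (h(tv := t)) = U c h" for c h t
 proof -
  have "q (h(tv := t)) = q h" by (rule ext) (auto simp: q_def split: sum.splits option.splits)
  then show ?thesis by (simp add: U_def)
 qed
 moreover have "\<forall>\<^sub>F h in nb WC. P h" if "ALL h:pdisc WC r. P h" for P
  unfolding eventually_nb using r(1) that by (intro exI[of _ r] conjI)
 note this[OF 2] this[OF 3] this[OF 4]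
 ultimately show ?thesis unfolding solution_family_def by (intro exI[of _ U] conjI ballI allI) auto
qed

definition U where "U = (SOME U. solution_family U)"

lemma U_family: "solution_family U"
 unfolding U_def by (rule someI_ex[OF ex_solution_family])

lemma U_analytic0: "c : JC ==> analytic0 WC (U c)"
 and U_init: "\<forall>\<^sub>F h in nb WC. ALL c:JC. (ALL l. h (xv l) = 0) --> U c h = h (zv c)"
 and U_base: "\<forall>\<^sub>F h in nb WC. ALL l. U (Xc l) h = h (zv (Xc l)) + h (xv l)"
 and U_deriv: "\<forall>\<^sub>F h in nb WC. ALL c:JC. ALL k. jpartial (xv k) (U c) h = V k c (%d. U d h)"
 and U_tv: "U c (h(tv := t)) = U c h"
 using U_family unfolding solution_family_def by blast+

lemma U_zero: "c : JC ==> U c (%_. 0) = 0"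
 using eventually_nb_zero[OF U_init] by auto

definition sol :: "(('n, 'm) jcoord => 'k) => 'k^'n => 'k^'m" where
 "sol z x = (\<chi> j. U (Uc j 0) (wemb 0 z x))"

lemma F_depends_U:
 "\<forall>\<^sub>F h in nb WC. ALL aa:{aa. mdeg aa = \<kappa>}. ALL j z'. (ALL c:JC. z' c = U c h) --> F j aa z' = F j aa (%d. U d h)"
proof (intro eventually_ball_finite ballI eventually_all_finite)
 show "finite {aa :: 'n mindex. mdeg aa = \<kappa>}" by (rule finite_subset[OF _ finite_mdeg_le[of \<kappa>]]) auto
 fix aa :: "'n mindex" and j assume "aa : {aa. mdeg aa = \<kappa>}"
 then have "analytic0 JC (F j aa)" using F_analytic0[of aa j] by simp
 from eventually_nb_compose[OF finite_WC finite_jcoords U_analytic0 U_zero analytic0_depends[OF this]]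
 show "\<forall>\<^sub>F h in nb WC. ALL z'. (ALL c:JC. z' c = U c h) --> F j aa z' = F j aa (%d. U d h)" .
qed

text \<open>One radius serves all small parameters \<open>z\<close>; this uniformity is used when
  all these solutions are transported by a symmetry. The base point is fixed at 0, so the variable
  of the family is the independent variable itself.\<close>

lemma sol_local_solution:
 obtains dt where "0 < dt"
  "!!z. (!!c. c : JC ==> norm (z c) <= dt) ==> (!!l. z (Xc l) = 0) ==>
    local_solution \<kappa> F {x. ALL l. norm (x $ l) < dt} (sol z) &
    (ALL x c. (ALL l. norm (x $ l) < dt) --> c : JC --> jet (\<kappa> - 1) (sol z) x c = U c (wemb 0 z x))"
proof -
 obtain dt where dt: "0 < dt" and P: "ALL h:pdisc WC dt. (ALL l. U (Xc l) h = h (zv (Xc l)) + h (xv l)) &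
   (ALL c:JC. ALL k. jpartial (xv k) (U c) h = V k c (%d. U d h)) &
   (ALL aa:{aa. mdeg aa = \<kappa>}. ALL j z'. (ALL c:JC. z' c = U c h) --> F j aa z' = F j aa (%d. U d h))"
  using eventually_conj[OF U_base eventually_conj[OF U_deriv F_depends_U]]
  unfolding eventually_nb by (elim exE conjE) (rule that)
 obtain ro M where ro: "0 < ro" "ro <= dt" and M: "ALL c:JC. ps_le WC ro (U c) M"
  using analytic0_common_radius[where f = U, OF finite_jcoords U_analytic0 dt] by blast
 have "local_solution \<kappa> F {x. ALL l. norm (x $ l) < ro} (sol z) &
    (ALL x c. (ALL l. norm (x $ l) < ro) --> c : JC --> jet (\<kappa> - 1) (sol z) x c = U c (wemb 0 z x))"
  if z: "!!c. c : JC ==> norm (z c) <= ro" and zX: "!!l. z (Xc l) = 0" for z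
 proof -
  let ?D = "{x :: 'k^'n. ALL l. norm (x $ l) < ro}"
  have D: "open ?D"
   by (subst Collect_all_eq, intro open_INT ballI open_Collect_less continuous_intros) auto
  have w: "wemb 0 z x : pdisc WC dt" if "x : ?D" for x
   unfolding pdisc_def
  proof safe
   fix c :: "('n, 'm) jcoord" assume "c : JC"
   then show "norm (wemb 0 z x (Inl c)) <= dt" using z ro by force
  next
   fix l :: "'n option"
   show "norm (wemb 0 z x (Inr l)) <= dt"
    using that ro by (cases l) (auto intro: order.trans[OF less_imp_le])
  qed
  \<comment> \<open>Order \<open>\<kappa>\<close> is included through \<open>F\<close>, so that the
    recursion for the derivatives yields the equation itself.\<close>
  define val where "val j be x = (if mdeg be <= \<kappa> - 1 then U (Uc j be) (wemb 0 z x)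
    else F j be (%d. U d (wemb 0 z x)))" for j be x
  have step: "partial l (val j be) x = val j (be + axis l 1) x" if "x : ?D" "mdeg be < \<kappa>" for j be l x
  proof -
   have b: "mdeg be <= \<kappa> - 1" using that by simp
   then have "val j be = (%x. U (Uc j be) (wemb 0 z x))" by (simp add: val_def fun_eq_iff)
   then have "partial l (val j be) x = jpartial (xv l) (U (Uc j be)) (wemb 0 z x)"
    by (simp add: partial_wemb)
   also have "... = V l (Uc j be) (%d. U d (wemb 0 z x))"
    using P w[OF that(1)] b by simp
   also have "... = val j (be + axis l 1) x"
    using order b by (auto simp: pfaff_field_def val_def mdeg_add)
   finally show ?thesis .
  qed
  have mp: "mpartial aa (%y. sol z y $ j) x = val j aa x" if "mdeg aa <= \<kappa>" "x : ?D" for aa j x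
   by (rule mpartial_eqI[OF D step that]) (auto simp: sol_def val_def)
  have jet: "jet (\<kappa> - 1) (sol z) x c = U c (wemb 0 z x)" if "x : ?D" "c : JC" for x c
  proof (cases c)
   case (Xc l)
   then show ?thesis using P w[OF that(1)] zX by (simp add: jet_def)
  next
   case (Uc j be)
   then show ?thesis using that mp[of be x j] by (simp add: jet_def val_def)
  qed
  have jetF: "F j aa (jet (\<kappa> - 1) (sol z) x) = F j aa (%d. U d (wemb 0 z x))"
   if "mdeg aa = \<kappa>" "x : ?D" for j aa x
   using bspec[OF P w[OF that(2)]] that(1) jet[OF that(2)] by blast
  have "vec_analytic_at (sol z) x" if "x : ?D" for x
   unfolding vec_analytic_at_def sol_def
  proof
   fix d :: 'm
   have "ps_le WC ro (U (Uc d 0)) M" using M by simp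
   then have "kanalytic_at UNIV (%y. U (Uc d 0) (wemb 0 z (vec_lambda y))) (vec_nth x)"
    by (intro kanalytic_at_wemb[OF finite_jcoords ro(1)]) (use z that ro in auto)
   then show "kanalytic_at UNIV (%za. (\<chi> j. U (Uc j 0) (wemb 0 z (vec_lambda za))) $ d) (vec_nth x)"
    by simp
  qed
  then have "local_solution \<kappa> F ?D (sol z)"
   unfolding local_solution_def using D mp jetF order by (auto simp: val_def)
  with jet show ?thesis by blast
 qed
 with ro(1) show ?thesis by (rule that)
qed

end

section \<open>Division by a coordinate and Lipschitz bounds\<close>

lemma has_sum_shift_index:
 fixes g :: "('i => nat) => 'x::{comm_monoid_add,topological_space}"
 assumes "i : I"
 shows "(g has_sum x) {p : mindices I. p i > 0} \<longleftrightarrow>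
  ((%p. g (p(i := p i + 1))) has_sum x) (mindices I)"
 by (rule has_sum_reindex_bij_witness[of _ "%p. p(i := p i + 1)" "%p. p(i := p i - 1)"])
   (auto simp: mindices_fun_upd[OF assms] fun_upd_idem)

text \<open>Setting \<open>h i = 0\<close> retains exactly the coefficients with
  \<open>p i = 0\<close>; they vanish by uniqueness, and all remaining exponents can be lowered by
  one without changing the radius.\<close>

lemma analytic0_div:
 fixes f :: "('i => 'k) => 'k::{real_normed_field,banach}"
 assumes I: "finite I" "i : I" and f: "analytic0 I f"
  and z: "\<forall>\<^sub>F h in nb I. h i = 0 --> f h = 0"
 obtains g where "analytic0 I g" "\<forall>\<^sub>F h in nb I. f h = h i * g h"
proof -
 obtain ro c where ro: "0 < ro" and c: "pseries I ro c f"
  using f by (auto simp: analytic0_def ps_le_def)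
 have sc: "(%p. norm (c p) * ro ^ sum p I) summable_on mindices I" using c by (simp add: pseries_def)
 define c0 where "c0 p = (if p i = 0 then c p else 0)" for p
 have "pseries I ro c0 (%h. f (h(i := 0)))"
  unfolding pseries_def
 proof (intro conjI ballI)
  show "(%p. norm (c0 p) * ro ^ sum p I) summable_on mindices I"
   by (rule summable_on_comparison_test[OF sc]) (use ro in \<open>auto simp: c0_def\<close>)
  fix h :: "'i => 'k" assume h: "h : pdisc I ro"
  then have "h(i := 0) : pdisc I ro" using ro by (auto simp: pdisc_def)
  then have "((%p. c p * mmon I (h(i := 0)) p) has_sum f (h(i := 0))) (mindices I)"
   using c by (simp add: pseries_def)
  moreover have "c p * mmon I (h(i := 0)) p = c0 p * mmon I h p" for p
  proof (cases "p i = 0")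
   case True
   have "mmon I (h(i := 0)) p = mmon I h p"
    unfolding mmon_def by (rule prod.cong) (use True in auto)
   then show ?thesis using True by (simp add: c0_def)
  next
   case False
   then have "mmon I (h(i := 0)) p = 0" using I by (auto simp: mmon_def)
   then show ?thesis using False by (simp add: c0_def)
  qed
  ultimately show "((%p. c0 p * mmon I h p) has_sum f (h(i := 0))) (mindices I)" by simp
 qed
 moreover obtain dt where dt: "0 < dt" "!!h. h : pdisc I dt ==> h i = 0 --> f h = 0"
  using z unfolding eventually_nb by blast
 have "f (h(i := 0)) = 0" if "h : pdisc I dt" for h
  using dt(2)[of "h(i := 0)"] dt(1) that by (auto simp: pdisc_def)
 ultimately have c0: "c0 p = 0" if "p : mindices I" for p
  using pseries_zero_coeffs[OF I(1) ro dt(1)] that by blast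
 define e where "e p = c (p(i := p i + 1))" for p
 define g where "g h = (\<Sum>\<^sub>\<infinity>p\<in>mindices I. e p * mmon I h p)" for h
 have restrict: "(k has_sum x) {p : mindices I. p i > 0}" if "(k has_sum x) (mindices I)"
  "!!p. p : mindices I ==> p i = 0 ==> k p = 0" for k :: "('i => nat) => 'x::{comm_monoid_add,topological_space}" and x
  by (rule iffD1[OF has_sum_cong_neutral that(1)]) (use that(2) in auto)
 have cz: "c p = 0" if "p : mindices I" "p i = 0" for p using c0[OF that(1)] that(2) by (simp add: c0_def)
 have se: "(%p. norm (e p) * ro ^ sum p I) summable_on mindices I"
 proof -
  have "((%p. norm (c p) * ro ^ sum p I) has_sum (\<Sum>\<^sub>\<infinity>p\<in>mindices I. norm (c p) * ro ^ sum p I)) {p : mindices I. p i > 0}"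
   by (rule restrict[OF has_sum_infsum[OF sc]]) (simp add: cz)
  then have "(%p. norm (c (p(i := p i + 1))) * ro ^ sum (p(i := p i + 1)) I) summable_on mindices I"
   unfolding has_sum_shift_index[OF I(2)] by (rule has_sum_imp_summable)
  from summable_on_cmult_left[OF this, of "1 / ro"] show ?thesis
   unfolding sum_shift[OF I] e_def using ro by simp
 qed
 have ge: "pseries I ro e g"
  unfolding pseries_def
 proof (intro conjI ballI se)
  fix h :: "'i => 'k" assume h: "h : pdisc I ro"
  have "(%p. norm (e p * mmon I h p)) summable_on mindices I"
   by (rule summable_on_comparison_test[OF se])
     (use norm_mmon_le[OF h] in \<open>auto simp: norm_mult intro!: mult_left_mono\<close>)
  then show "((%p. e p * mmon I h p) has_sum g h) (mindices I)"
   unfolding g_def by (rule has_sum_infsum[OF abs_summable_summable])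
 qed
 have fg: "f h = h i * g h" if h: "h : pdisc I ro" for h
 proof -
  have "((%p. c p * mmon I h p) has_sum f h) (mindices I)" using c h by (simp add: pseries_def)
  then have "((%p. c p * mmon I h p) has_sum f h) {p : mindices I. p i > 0}"
   by (rule restrict) (simp add: cz)
  then have "((%p. h i * (e p * mmon I h p)) has_sum f h) (mindices I)"
   unfolding has_sum_shift_index[OF I(2)] mmon_shift[OF I] e_def by (simp add: mult_ac)
  moreover have "((%p. h i * (e p * mmon I h p)) has_sum h i * g h) (mindices I)"
   using ge h by (intro has_sum_cmult_right) (simp add: pseries_def)
  ultimately show ?thesis by (rule has_sum_unique)
 qed
 show ?thesis
 proof (rule that[of g])
  show "analytic0 I g" unfolding analytic0_def ps_le_def using ro ge by blast
  show "\<forall>\<^sub>F h in nb I. f h = h i * g h" unfolding eventually_nb using ro fg by blast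
 qed
qed

lemma ps_le_lipschitz:
 fixes f :: "('j => 'k) => 'k::{real_normed_field,banach}"
 assumes "finite J" "0 < ta" "ta < sg" "ps_le J sg f B" "p : pdisc J ta" "q : pdisc J ta"
  "0 <= dt" "!!j. j : J ==> norm (p j - q j) <= dt"
 shows "norm (f p - f q) <= B * dt / (sg - ta)"
proof -
 \<comment> \<open>Points are regarded as constant functions of no variables, so that the estimate
   for substitutions applies to them.\<close>
 have c: "ps_le ({} :: unit set) 1 (%_. k) m" if "norm k <= m" for k :: 'k and m
  by (rule ps_le_mono[OF ps_le_const that]) simp
 have "ps_le ({} :: unit set) 1 (%h. f (%j. p j) - f (%j. q j)) (B * dt / (sg - ta))"
  by (rule ps_le_compose_diff[where g = "%j _. p j" and g' = "%j _. q j", OF assms(1) zero_less_one assms(2-4,7)])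
    (use assms(5,6,8) in \<open>auto simp: pdisc_def intro!: c\<close>)
 from ps_le_bound[OF this, of "%_. 0"] show ?thesis by simp
qed

subsection \<open>Iterated partial derivatives\<close>

definition jml :: "'i list => (('i => 'k) => 'k) => ('i => 'k) => 'k::real_normed_field" where
 "jml is = foldr jpartial is"

lemma jml_simps [simp]: "jml [] f = f" "jml (i # is) f = jpartial i (jml is f)"
 by (simp_all add: jml_def)

lemma jml_append: "jml (is @ js) f = jml is (jml js f)"
 by (simp add: jml_def)

lemma jml_replicate: "jml (replicate n i) f = (jpartial i ^^ n) f"
 by (induction n) auto

lemma analytic0_jml:
 "finite I ==> set is \<subseteq> I ==> analytic0 I f ==> analytic0 I (jml is f)"
 by (induction "is") (auto intro: analytic0_jpartial)

lemma eventually_jml_cong: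
 assumes "\<forall>\<^sub>F h in nb I. f h = g h"
 shows "\<forall>\<^sub>F h in nb I. jml is f h = jml is g h"
 by (induction "is") (auto intro: assms eventually_jpartial_cong)

lemma eventually_jml_commute:
 assumes "finite I" "set is \<subseteq> I" "i : I" "analytic0 I f"
 shows "\<forall>\<^sub>F h in nb I. jml is (jpartial i f) h = jpartial i (jml is f) h"
 using assms(2)
proof (induction "is")
 case (Cons j js)
 then have "\<forall>\<^sub>F h in nb I. jpartial j (jml js (jpartial i f)) h = jpartial j (jpartial i (jml js f)) h"
  by (intro eventually_jpartial_cong) auto
 moreover have "\<forall>\<^sub>F h in nb I. jpartial j (jpartial i (jml js f)) h = jpartial i (jpartial j (jml js f)) h"
  using Cons.prems assms by (intro eventually_jpartial_commute analytic0_jml) auto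
 ultimately show ?case by eventually_elim simp
qed simp

text \<open>Identities on the hyperplane \<open>h s = 0\<close> may be differentiated in tangential
  directions: composing with the projection onto it gives an identity of germs.\<close>

lemma eventually_jpartial_cong_restricted:
 assumes "\<forall>\<^sub>F h in nb I. h s = 0 --> f h = g h" "i ~= s"
 shows "\<forall>\<^sub>F h in nb I. h s = 0 --> jpartial i f h = jpartial i g h"
proof -
 let ?z = "%h. h(s := 0)"
 obtain dt where dt: "0 < dt" "!!h. h : pdisc I dt ==> h s = 0 --> f h = g h"
  using assms(1) unfolding eventually_nb by blast
 have "f (?z h) = g (?z h)" if "h : pdisc I dt" for h
  using dt(2)[of "?z h"] that dt(1) by (auto simp: pdisc_def)
 then have "\<forall>\<^sub>F h in nb I. f (?z h) = g (?z h)" unfolding eventually_nb using dt(1) by blast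
 from eventually_jpartial_cong[OF this, of i] show ?thesis
 proof eventually_elim
  case (elim h)
  have "(h(i := t))(s := 0) = h(i := t)" if "h s = 0" for t using that assms(2) by auto
  then show ?case using elim assms(2) by (auto simp: jpartial_def)
 qed
qed

lemma eventually_jml_cong_restricted:
 assumes "\<forall>\<^sub>F h in nb I. h s = 0 --> f h = g h" "s ~: set is"
 shows "\<forall>\<^sub>F h in nb I. h s = 0 --> jml is f h = jml is g h"
 using assms(2) by (induction "is") (auto intro: assms(1) eventually_jpartial_cong_restricted)

text \<open>The variables are taken in the same order as in \<open>mpartial\<close>, so that both
  agree on every function of the form \<open>f (wemb t z y)\<close> without any regularity
  assumption.\<close>

definition jm :: "'n::finite mindex => ((('n, 'm) wvar => 'k) => 'k) => (('n, 'm) wvar => 'k) => 'k::real_normed_field" where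
 "jm aa = jml (concat (map (%l. replicate (aa $ l) (xv l)) (SOME ls. distinct ls & set ls = UNIV)))"

lemma jm_eq_jml:
 obtains "is" where "jm aa = (jml is :: ((('n::finite, 'm) wvar => 'k) => 'k) => _ => 'k::real_normed_field)"
  "set is \<subseteq> range xv"
 by (rule that[OF jm_def]) auto

lemma mpartial_wemb:
 fixes f :: "(('n::finite, 'm) wvar => 'k) => 'k::real_normed_field"
 shows "mpartial aa (%y. f (wemb t z y)) x = jm aa f (wemb t z x)"
proof -
 have pow: "(partial l ^^ n) (%y. f (wemb t z y)) = (%y. (jpartial (xv l) ^^ n) f (wemb t z y))"
  for l n and f :: "(('n, 'm) wvar => 'k) => 'k"
 proof (induction n)
  case (Suc n)
  show ?case by (rule ext) (simp add: Suc.IH partial_wemb)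
 qed simp
 have "foldr (%l. partial l ^^ (aa $ l)) ls (%y. f (wemb t z y)) =
   (%y. jml (concat (map (%l. replicate (aa $ l) (xv l)) ls)) f (wemb t z y))" for ls
  by (induction ls) (auto simp: jml_append jml_replicate pow)
 then show ?thesis by (simp add: mpartial_def jm_def)
qed

lemma jm_zero [simp]:
 fixes f :: "(('n::finite, 'm) wvar => 'k) => 'k::real_normed_field"
 shows "jm 0 f = f"
proof -
 have "concat (map (%l. []) ls) = ([] :: ('n, 'm) wvar list)" for ls :: "'n list" by (induction ls) auto
 then show ?thesis by (simp only: jm_def zero_index replicate_0 jml_simps)
qed

lemma mpartial_cong:
 fixes f g :: "'k::real_normed_field^'n::finite => 'k"
 assumes D: "open D" and x: "x : D" and eq: "!!y. y : D ==> f y = g y"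
 shows "mpartial aa f x = mpartial aa g x"
proof -
 have pow: "(partial l ^^ n) f y = (partial l ^^ n) g y"
  if "!!y. y : D ==> f y = g y" "y : D" for f g :: "'k^'n => 'k" and l n y
  using that(2) by (induction n arbitrary: y) (auto intro: that(1) partial_cong[OF D])
 have "foldr (%l. partial l ^^ (aa $ l)) ls f y = foldr (%l. partial l ^^ (aa $ l)) ls g y" if "y : D" for ls y
  using that by (induction ls arbitrary: y) (auto intro: eq pow)
 then show ?thesis unfolding mpartial_def using x by blast
qed

lemma open_box: "open {x :: 'k::real_normed_vector^'n::finite. ALL l. norm (x $ l - a l) < r}"
 by (subst Collect_all_eq, intro open_INT ballI open_Collect_less continuous_intros) auto

lemma norm_vec_le_sum: "norm (x :: 'k::real_normed_vector^'n::finite) <= (SUM l:UNIV. norm (x $ l))"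
 unfolding norm_vec_def by (rule L2_set_le_sum) auto

lemma eventually_nb_norm_vec:
 assumes "0 < dt"
 shows "\<forall>\<^sub>F p in nb UNIV. norm (vec_lambda p :: 'k::real_normed_field^'c::finite) < dt"
proof -
 define r where "r = dt / (real CARD('c) + 1)"
 have r: "0 < r" using assms by (simp add: r_def add_pos_pos)
 have "norm (vec_lambda p :: 'k^'c) < dt" if "p : pdisc UNIV r" for p
 proof -
  have "norm (vec_lambda p :: 'k^'c) <= (SUM l:(UNIV :: 'c set). norm (p l))"
   using norm_vec_le_sum[of "vec_lambda p :: 'k^'c"] by simp
  also have "... <= (SUM l:(UNIV :: 'c set). r)" by (rule sum_mono) (use that in \<open>auto simp: pdisc_def\<close>)
  also have "... = real CARD('c) * r" by simp
  also have "... < (real CARD('c) + 1) * r" using r by simp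
  also have "... = dt" by (simp add: r_def add_nonneg_eq_0_iff)
  finally show ?thesis .
 qed
 then show ?thesis unfolding eventually_nb using r by blast
qed

subsection \<open>Solutions based at the origin\<close>

definition zeroX :: "(('n::finite, 'm) wvar => 'k) => ('n, 'm) wvar => 'k::zero" where
 "zeroX h i = (case i of Inl c => (case c of Xc l => 0 | Uc j be => h i) | Inr l => h i)"

lemma zeroX_simps [simp]:
 "zeroX h (zv (Xc l)) = 0" "zeroX h (zv (Uc j be)) = h (zv (Uc j be))" "zeroX h (Inr i) = h (Inr i)"
 by (simp_all add: zeroX_def)

lemma zeroX_upd: "zeroX (h(Inr l := t)) = (zeroX h)(Inr l := t)"
 by (rule ext) (auto simp: zeroX_def split: sum.splits jcoord.splits)

lemma zeroX_pdisc: "h : pdisc I ro ==> 0 <= ro ==> zeroX h : pdisc I ro"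
 by (auto simp: pdisc_def zeroX_def split: sum.splits jcoord.splits)

lemma eventually_nb_zeroX: "eventually P (nb I) ==> \<forall>\<^sub>F h in nb I. P (zeroX h)"
 unfolding eventually_nb using zeroX_pdisc less_imp_le by blast

context pde
begin

text \<open>With the base point fixed at the origin, the family is parametrized by the derivatives
  of the solution at 0 up to order \<open>\<kappa> - 1\<close>.\<close>

definition U0 where "U0 c h = U c (zeroX h)"

lemma U0_analytic0: "c : JC ==> analytic0 WC (U0 c)"
proof -
 assume c: "c : JC"
 have "analytic0 WC (%h. U c (%i. zeroX h i))"
 proof (rule analytic0_compose[OF finite_WC finite_WC U_analytic0[OF c]])
  fix i :: "('n, 'm) wvar" assume i: "i : WC"
  show "analytic0 WC (%h. zeroX h i :: 'k)"
  proof (cases i)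
   case (Inl c)
   then show ?thesis using analytic0_coord[OF finite_WC i] by (cases c) (auto simp: zeroX_def)
  next
   case (Inr l)
   then show ?thesis using analytic0_coord[OF finite_WC i] by (auto simp: zeroX_def)
  qed
  show "zeroX (%_. 0) i = (0 :: 'k)" by (auto simp: zeroX_def split: sum.splits jcoord.splits)
 qed
 then show ?thesis by (simp add: U0_def[abs_def])
qed

lemma U0_init: "\<forall>\<^sub>F h in nb WC. ALL j be. mdeg be <= \<kappa> - 1 --> (ALL l. h (xv l) = 0) --> U0 (Uc j be) h = h (zv (Uc j be))"
 using eventually_nb_zeroX[OF U_init] by eventually_elim (simp add: U0_def)

lemma U0_base: "\<forall>\<^sub>F h in nb WC. ALL l. U0 (Xc l) h = h (xv l)"
 using eventually_nb_zeroX[OF U_base] by eventually_elim (simp add: U0_def)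

lemma U0_deriv: "\<forall>\<^sub>F h in nb WC. ALL c:JC. ALL k. jpartial (xv k) (U0 c) h = V k c (%d. U0 d h)"
 using eventually_nb_zeroX[OF U_deriv]
 by eventually_elim (simp add: U0_def jpartial_def zeroX_upd)

lemma U0_tv: "U0 c (h(tv := t)) = U0 c h"
 by (simp add: U0_def zeroX_upd U_tv)

lemma U0_zero: "c : JC ==> U0 c (%_. 0) = 0"
proof -
 assume "c : JC"
 moreover have "zeroX (%_. 0) = ((%_. 0) :: ('n, 'm) wvar => 'k)"
  by (rule ext) (auto simp: zeroX_def split: sum.splits jcoord.splits)
 ultimately show ?thesis using U_zero by (simp add: U0_def)
qed

definition base0 :: "(('n, 'm) jcoord => 'k) => ('n, 'm) jcoord => 'k" where
 "base0 z c = (case c of Xc l => 0 | Uc j be => z c)"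

lemma U0_wemb: "U0 c (wemb t z x) = U c (wemb 0 (base0 z) x)"
proof -
 have "zeroX (wemb t z x) = (wemb 0 (base0 z) x)(tv := t)"
  by (rule ext) (auto simp: zeroX_def wemb_def base0_def split: sum.splits jcoord.splits option.splits)
 then show ?thesis by (simp add: U0_def U_tv)
qed

definition U0val where
 "U0val j be h = (if mdeg be <= \<kappa> - 1 then U0 (Uc j be) h else F j be (%d. U0 d h))"

lemma jm_U0:
 "\<forall>\<^sub>F h in nb WC. ALL j aa. mdeg aa <= \<kappa> --> jm aa (U0 (Uc j 0)) h = U0val j aa h"
proof -
 obtain dt where dt: "0 < dt" and P: "!!h. h : pdisc WC dt ==> ALL c:JC. ALL k. jpartial (xv k) (U0 c) h = V k c (%d. U0 d h)"
  using U0_deriv unfolding eventually_nb by blast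
 have "jm aa (U0 (Uc j 0)) h = U0val j aa h" if h: "h : pdisc WC (dt / 2)" and aa: "mdeg aa <= \<kappa>" for h j aa
 proof -
  define t where "t = h tv"
  define z where "z c = h (zv c)" for c
  define x where "x = (\<chi> l. h (xv l))"
  have hw: "h = wemb t z x"
   by (rule ext) (auto simp: wemb_def t_def z_def x_def split: sum.splits option.splits)
  let ?D = "{x :: 'k^'n. ALL l. norm (x $ l - 0) < dt}"
  have hx: "norm (h i) < dt" if "i : WC" for i
  proof -
   have "norm (h i) <= dt / 2" using h that by (auto simp: pdisc_def)
   then show ?thesis using dt by simp
  qed
  have x: "x : ?D" using hx by (auto simp: x_def)
  have w: "wemb t z y : pdisc WC dt" if "y : ?D" for y
   unfolding pdisc_def
  proof safe
   fix c :: "('n, 'm) jcoord" assume "c : JC"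
   then have "Inl c : WC" by (rule InlI)
   from hx[OF this] show "norm (wemb t z y (Inl c)) <= dt" by (simp add: z_def)
  next
   fix l :: "'n option"
   show "norm (wemb t z y (Inr l)) <= dt"
    using that hx[of tv] by (cases l) (auto simp: t_def intro: less_imp_le)
  qed
  have "mpartial aa (%y. U0 (Uc j 0) (wemb t z y)) x = U0val j aa (wemb t z x)"
  proof (rule mpartial_eqI[where val = "%be y. U0val j be (wemb t z y)", OF open_box _ aa x])
   fix be :: "'n mindex" and l y assume y: "y : ?D" and b: "mdeg be < \<kappa>"
   then have b': "mdeg be <= \<kappa> - 1" by simp
   then have "partial l (%y. U0val j be (wemb t z y)) y = jpartial (xv l) (U0 (Uc j be)) (wemb t z y)"
    by (simp add: U0val_def partial_wemb)
   also have "... = V l (Uc j be) (%d. U0 d (wemb t z y))" using P[OF w[OF y]] b' by simp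
   also have "... = U0val j (be + axis l 1) (wemb t z y)"
    using order b' by (auto simp: pfaff_field_def U0val_def mdeg_add)
   finally show "partial l (%y. U0val j be (wemb t z y)) y = U0val j (be + axis l 1) (wemb t z y)" .
  qed (simp add: U0val_def)
  then show ?thesis by (simp add: mpartial_wemb hw[symmetric])
 qed
 then show ?thesis unfolding eventually_nb using dt half_gt_zero by blast
qed

end

declare One_nat_def [simp del]

section \<open>The linearized equation for infinitesimal symmetries\<close>

lemma wemb_pdisc:
 fixes x :: "'k::real_normed_field^'n::finite" and z :: "('n, 'm) jcoord => 'k"
 shows "wemb t z x : pdisc (I <+> UNIV) ro \<longleftrightarrow> (ALL c:I. norm (z c) <= ro) & norm t <= ro & (ALL l. norm (x $ l) <= ro)"
proof -
 have "(ALL l :: 'n option. norm (wemb t z x (Inr l)) <= ro) \<longleftrightarrow> norm t <= ro & (ALL l. norm (x $ l) <= ro)"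
  by (subst split_option_all) simp
 moreover have "(ALL i:I <+> UNIV. Q i) \<longleftrightarrow> (ALL c:I. Q (Inl c)) & (ALL l. Q (Inr l))" for Q :: "('n, 'm) wvar => bool"
  by (auto elim!: PlusE)
 ultimately show ?thesis by (simp add: pdisc_def)
qed

lemma wemb_collapse: "wemb (h tv) (%c. h (zv c)) (\<chi> l. h (xv l)) = h"
 by (rule ext) (auto simp: wemb_def split: sum.splits option.splits)

definition vcomp :: "('k^'c::finite => 'k^'c) => 'c => ('c => 'k) => 'k" where
 "vcomp X c p = X (vec_lambda p) $ c"

lemma vcomp_analytic0:
 fixes X :: "'k::{real_normed_field,banach}^'c::finite => 'k^'c"
 assumes "vec_analytic_at X 0"
 shows "analytic0 UNIV (vcomp X c)"
proof -
 have "kanalytic_at UNIV (%z. X (vec_lambda z) $ c) (vec_nth 0)"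
  using assms by (simp add: vec_analytic_at_def)
 then show ?thesis by (simp add: kanalytic_at_iff_analytic0 vcomp_def[abs_def])
qed

context pde
begin

definition pt :: "(('n, 'm) wvar => 'k) => 'n + 'm => 'k" where
 "pt h i = (case i of Inl l => h (xv l) | Inr j => U0 (Uc j 0) h)"

lemma pt_simps [simp]: "pt h (Inl l) = h (xv l)" "pt h (Inr j) = U0 (Uc j 0) h"
 by (simp_all add: pt_def)

text \<open>The vertical part of \<open>X\<close> along the graph of the solution encoded in
  \<open>h\<close>: what remains of \<open>X\<close> after subtracting a field tangent to the
  graph.\<close>

definition charac :: "('k^('n + 'm) => 'k^('n + 'm)) => 'm => (('n, 'm) wvar => 'k) => 'k" where
 "charac X j h = vcomp X (Inr j) (pt h) - (SUM l:UNIV. vcomp X (Inl l) (pt h) * jpartial (xv l) (U0 (Uc j 0)) h)"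

lemma pt_analytic0: "analytic0 WC (%h. pt h i)"
 by (cases i) (use U0_analytic0 in \<open>auto simp: pt_def intro!: analytic0_coord\<close>)

lemma pt_zero: "pt (%_. 0) i = 0"
 by (cases i) (auto simp: U0_zero)

lemma pt_tv: "pt (h(tv := t)) = pt h"
 by (rule ext) (auto simp: pt_def U0_tv split: sum.splits)

end

locale pde_sym = pde \<kappa> F
 for \<kappa> and F :: "('k::{real_normed_field,euclidean_space}, 'n::finite, 'm::finite) rhs" +
 fixes X :: "'k^('n + 'm) => 'k^('n + 'm)"
  and \<Psi> :: "'k => 'k^('n + 'm) => 'k^('n + 'm)"
 assumes analytic_X: "vec_analytic_at X 0"
  and flow: "local_flow X \<Psi>"
  and sym: "\<forall>\<^sub>F s in nhds 0. lie_symmetry \<kappa> F (\<Psi> s)"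
begin

abbreviation xi where "xi \<equiv> vcomp X"
abbreviation W where "W \<equiv> charac X"

section \<open>The flow acting on graphs of solutions\<close>

definition \<Phi> :: "'n + 'm => (('n, 'm) wvar => 'k) => 'k" where
 "\<Phi> c h = \<Psi> (h tv) (\<chi> i. pt h i) $ c"

lemma \<Phi>_analytic0: "analytic0 WC (\<Phi> c)"
proof -
 have "kanalytic_at UNIV (%z. \<Psi> (z None) (\<chi> i. z (Some i)) $ c) (%_. 0)"
  using flow by (simp add: local_flow_def)
 then have a: "analytic0 UNIV (%z. \<Psi> (z None) (\<chi> i. z (Some i)) $ c)"
  by (simp add: kanalytic_at_iff_analytic0)
 have "analytic0 WC (%h. (%z. \<Psi> (z None) (\<chi> i. z (Some i)) $ c) (%i. case_option (h tv) (pt h) i))"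
 proof (rule analytic0_compose[OF finite_WC finite_class.finite_UNIV a])
  show "analytic0 WC (%h. case_option (h tv) (pt h) i)" for i
   by (cases i) (auto intro!: pt_analytic0 analytic0_coord)
  show "case_option 0 (pt (%_. 0)) i = (0 :: 'k)" for i by (cases i) (auto simp: pt_zero)
 qed
 then show ?thesis by (simp add: \<Phi>_def[abs_def])
qed

lemma flow_near_zero:
 "\<forall>\<^sub>F h in nb WC. \<Psi> 0 (\<chi> i. pt h i) = (\<chi> i. pt h i) &
   (ALL c. ((%t. \<Psi> t (\<chi> i. pt h i) $ c) has_field_derivative xi c (pt h)) (at 0))"
proof -
 obtain dt where dt: "0 < dt" and P: "!!p. norm p < dt ==> \<Psi> 0 p = p &
    (ALL s. norm s < dt --> (ALL c. ((%t. \<Psi> t p $ c) has_field_derivative X (\<Psi> s p) $ c) (at s)))"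
  using flow unfolding local_flow_def by blast
 have "\<forall>\<^sub>F h in nb WC. norm (\<chi> i. pt h i) < dt"
  using eventually_nb_compose[where g = "%i h. pt h i", OF finite_WC finite_class.finite_UNIV
   pt_analytic0 pt_zero eventually_nb_norm_vec[OF dt]] by simp
 then show ?thesis
 proof eventually_elim
  case (elim h)
  define p where "p = (\<chi> i. pt h i)"
  have p: "\<Psi> 0 p = p" and d: "ALL s. norm s < dt -->
    (ALL c. ((%t. \<Psi> t p $ c) has_field_derivative X (\<Psi> s p) $ c) (at s))"
   using P[OF elim] by (auto simp: p_def)
  have "ALL c. ((%t. \<Psi> t p $ c) has_field_derivative X p $ c) (at 0)"
   using d[rule_format, of 0] dt unfolding p by simp
  with p show ?case by (simp add: vcomp_def p_def)
 qed
qed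

lemma \<Phi>_init: "\<forall>\<^sub>F h in nb WC. h tv = 0 --> (ALL c. \<Phi> c h = pt h c)"
 using flow_near_zero by eventually_elim (simp add: \<Phi>_def)

lemma \<Phi>_deriv: "\<forall>\<^sub>F h in nb WC. h tv = 0 --> (ALL c. jpartial tv (\<Phi> c) h = xi c (pt h))"
 using flow_near_zero
 by eventually_elim (simp add: \<Phi>_def jpartial_def pt_tv DERIV_imp_deriv)

lemma \<Phi>_zero: "\<Phi> c (%_. 0) = 0"
 using eventually_nb_zero[OF \<Phi>_init] by (simp add: pt_zero)

text \<open>The solution \<open>u\<^sub>z\<close> is transported by the flow to \<open>v = b \<circ> a\<^sup>-\<^sup>1\<close>, where \<open>(a, b) = \<Psi>\<^sub>s(x, u\<^sub>z(x))\<close>;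
  the inverse \<open>y + \<xi>(s, z, y)\<close> of \<open>a\<close> solves a fixed point equation.\<close>

definition inverse_pair where
 "inverse_pair \<xi> H \<longleftrightarrow> (ALL k. analytic0 WC (\<xi> k)) & (ALL l. analytic0 WC (H l)) &
  (\<forall>\<^sub>F h in nb WC. ALL l. \<Phi> (Inl l) h = h (xv l) + h tv * H l h) &
  (\<forall>\<^sub>F h in nb WC. ALL l. \<xi> l h = - (h tv * H l (wemb (h tv) (%c. h (zv c)) (\<chi> k. h (xv k) + \<xi> k h))))"

lemma ex_inverse: "EX \<xi> H. inverse_pair \<xi> H"
proof -
 have "EX g. analytic0 WC g & (\<forall>\<^sub>F h in nb WC. \<Phi> (Inl l) h - h (xv l) = h tv * g h)" for l
 proof -
  have xl: "xv l : WC" and tv: "tv : WC" by auto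
  have "\<forall>\<^sub>F h in nb WC. h tv = 0 --> \<Phi> (Inl l) h - h (xv l) = 0"
   using \<Phi>_init by eventually_elim auto
  then show ?thesis
   by (rule analytic0_div[OF finite_WC tv analytic0_diff[OF \<Phi>_analytic0 analytic0_coord[OF finite_WC xl]]]) blast
 qed
 then have "ALL l. EX g. analytic0 WC g & (\<forall>\<^sub>F h in nb WC. \<Phi> (Inl l) h - h (xv l) = h tv * g h)" ..
 from choice[OF this] obtain H where H': "ALL l. analytic0 WC (H l) &
   (\<forall>\<^sub>F h in nb WC. \<Phi> (Inl l) h - h (xv l) = h tv * H l h)" ..
 have H: "analytic0 WC (H l)" "\<forall>\<^sub>F h in nb WC. \<Phi> (Inl l) h - h (xv l) = h tv * H l h" for l
  using H' by auto
 \<comment> \<open>The horizontal part of the flow is \<open>x + s H(x)\<close>. Requiring it to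
   equal \<open>y\<close> at \<open>x = y + \<xi>\<close> gives the equation
   \<open>\<xi> = - s H(y + \<xi>)\<close>, whose factor \<open>s\<close> makes it a
   contraction.\<close>
 define G where "G l q = - H l (%i. case i of Inl c => q (Inl (zv c))
   | Inr q' => (case q' of None => q (Inl tv) | Some k => q (Inl (xv k)) + q (Inr k)))" for l and q :: "('n, 'm) wvar + 'n => 'k"
 have fin: "finite (WC <+> (UNIV :: 'n set))" by simp
 have Gan: "analytic0 (WC <+> UNIV) (G l)" for l
  unfolding G_def
 proof (intro analytic0_uminus analytic0_compose[OF fin finite_WC H(1)])
  fix i :: "('n, 'm) wvar" assume i: "i : WC"
  show "analytic0 (WC <+> UNIV) (%q :: ('n, 'm) wvar + 'n => 'k. case i of Inl c => q (Inl (zv c))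
   | Inr q' => (case q' of None => q (Inl tv) | Some k => q (Inl (xv k)) + q (Inr k)))"
   using i by (cases i; cases "projr i") (auto intro!: analytic0_add analytic0_coord[OF fin])
  show "(case i of Inl c => 0 | Inr q' => (case q' of None => 0 | Some k => 0 + 0)) = (0 :: 'k)"
   by (auto split: sum.splits option.splits)
 qed
 have tv: "tv : WC" by auto
 obtain \<xi> where \<xi>: "ALL l:UNIV. analytic0 WC (\<xi> l)"
  "\<forall>\<^sub>F h in nb WC. ALL l:UNIV. \<xi> l h = h tv * G l (case_sum h (%l. \<xi> l h))"
  by (rule analytic0_fixpoint_mult[OF finite_WC finite_class.finite_UNIV tv Gan])
 have eq: "(%i. case i of Inl c => case_sum h (%l. \<xi> l h) (Inl (zv c))
   | Inr q' => (case q' of None => case_sum h (%l. \<xi> l h) (Inl tv)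
    | Some k => case_sum h (%l. \<xi> l h) (Inl (xv k)) + case_sum h (%l. \<xi> l h) (Inr k)))
   = wemb (h tv) (%c. h (zv c)) (\<chi> k. h (xv k) + \<xi> k h)" for h
  by (rule ext) (auto simp: wemb_def split: sum.splits option.splits)
 have "\<forall>\<^sub>F h in nb WC. ALL l. \<Phi> (Inl l) h = h (xv l) + h tv * H l h"
  by (rule eventually_mono[OF eventually_all_finite[of _ "nb WC", OF H(2)]]) (simp add: algebra_simps)
 moreover have "\<forall>\<^sub>F h in nb WC. ALL l. \<xi> l h = - (h tv * H l (wemb (h tv) (%c. h (zv c)) (\<chi> k. h (xv k) + \<xi> k h)))"
  using \<xi>(2)
 proof eventually_elim
  case (elim h)
  show ?case
  proof
   fix l
   have "\<xi> l h = h tv * G l (case_sum h (%l. \<xi> l h))" using elim by blast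
   then show "\<xi> l h = - (h tv * H l (wemb (h tv) (%c. h (zv c)) (\<chi> k. h (xv k) + \<xi> k h)))"
    unfolding G_def eq by (simp only: mult_minus_right)
  qed
 qed
 ultimately show ?thesis unfolding inverse_pair_def using \<xi>(1) H(1) by auto
qed

definition \<xi> where "\<xi> = (SOME \<xi>. EX H. inverse_pair \<xi> H)"
definition H where "H = (SOME H. inverse_pair \<xi> H)"

lemma inverse_pair: "inverse_pair \<xi> H"
proof -
 have "EX H. inverse_pair \<xi> H" unfolding \<xi>_def by (rule someI_ex[OF ex_inverse])
 then show ?thesis unfolding H_def by (rule someI_ex)
qed

lemma \<xi>_analytic0: "analytic0 WC (\<xi> k)"
 and H_analytic0: "analytic0 WC (H k)"
 and \<Phi>_H: "\<forall>\<^sub>F h in nb WC. ALL l. \<Phi> (Inl l) h = h (xv l) + h tv * H l h"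
 using inverse_pair unfolding inverse_pair_def by auto

definition inv where "inv h = wemb (h tv) (%c. h (zv c)) (\<chi> k. h (xv k) + \<xi> k h)"

lemma inv_simps [simp]: "inv h (zv c) = h (zv c)" "inv h tv = h tv" "inv h (xv k) = h (xv k) + \<xi> k h"
 by (simp_all add: inv_def)

lemma \<xi>_eq: "\<forall>\<^sub>F h in nb WC. ALL l. \<xi> l h = - (h tv * H l (inv h))"
 using inverse_pair unfolding inverse_pair_def inv_def by auto

lemma \<xi>_zero: "\<xi> k (%_. 0) = 0"
 using eventually_nb_zero[OF \<xi>_eq] by simp

lemma inv_analytic0: "i : WC ==> analytic0 WC (%h. inv h i)"
 by (cases i; cases "projr i")
   (auto intro!: analytic0_add \<xi>_analytic0 analytic0_coord[OF finite_WC])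

lemma inv_zero: "inv (%_. 0) i = 0"
 by (cases i; cases "projr i") (auto simp: \<xi>_zero)

lemma \<Phi>_inv: "\<forall>\<^sub>F h in nb WC. ALL l. \<Phi> (Inl l) (inv h) = h (xv l)"
proof -
 have "\<forall>\<^sub>F h in nb WC. ALL l. \<Phi> (Inl l) (%i. inv h i) = inv h (xv l) + inv h tv * H l (%i. inv h i)"
  by (rule eventually_nb_compose[where g = "%i h. inv h i", OF finite_WC finite_WC inv_analytic0 inv_zero \<Phi>_H])
 then show ?thesis using \<xi>_eq by eventually_elim simp
qed

definition v where "v j h = \<Phi> (Inr j) (inv h)"

lemma \<Phi>_inv_analytic0: "analytic0 WC (%h. \<Phi> c (inv h))"
 using analytic0_compose[where g = "%i h. inv h i", OF finite_WC finite_WC \<Phi>_analytic0 inv_analytic0 inv_zero]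
 by simp

lemma v_analytic0: "analytic0 WC (v j)"
 using \<Phi>_inv_analytic0 by (simp add: v_def[abs_def])

lemma inv_init: "\<forall>\<^sub>F h in nb WC. h tv = 0 --> inv h = h"
 using \<xi>_eq
proof eventually_elim
 case (elim h)
 show ?case
 proof
  assume t: "h tv = 0"
  then have "(\<chi> k. h (xv k) + \<xi> k h) = (\<chi> k. h (xv k))" using elim by (simp add: vec_eq_iff)
  then show "inv h = h" unfolding inv_def by (simp only: wemb_collapse)
 qed
qed

lemma v_init: "\<forall>\<^sub>F h in nb WC. h tv = 0 --> v j h = U0 (Uc j 0) h"
 using inv_init \<Phi>_init by eventually_elim (simp add: v_def)

lemma sum_WC: "(SUM i:WC. f i) = (SUM c:JC. f (zv c)) + (f tv + (SUM k:UNIV. f (xv k)))" for f :: "('n, 'm) wvar => 'k"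
proof -
 have "(SUM i:WC. f i) = sum (f \<circ> Inl) JC + sum (f \<circ> Inr) UNIV" by (rule sum.Plus) auto
 also have "sum (f \<circ> Inr) UNIV = f tv + (SUM k:UNIV. f (xv k))"
  unfolding UNIV_option_conv by (subst sum.insert) (auto simp: sum.reindex o_def)
 finally show ?thesis by (simp add: o_def)
qed

text \<open>At time 0 the inverse is the identity and \<open>\<Phi>\<close> is the graph point, so
  the spatial derivatives of \<open>\<Phi>\<close> are those of the graph. They are tangential to
  \<open>tv = 0\<close>, and the restricted congruence supplies them.\<close>

lemma chain_inv:
 "\<forall>\<^sub>F h in nb WC. h tv = 0 --> (ALL c. jpartial tv (%h. \<Phi> c (inv h)) h =
   xi c (pt h) + (SUM k:UNIV. jpartial (xv k) (%h. pt h c) h * jpartial tv (\<xi> k) h))"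
proof -
 have tv: "tv : WC" by auto
 have "\<forall>\<^sub>F h in nb WC. ALL c. jpartial tv (%h. \<Phi> c (%i. inv h i)) h =
   (SUM i:WC. jpartial i (\<Phi> c) (%i. inv h i) * jpartial tv (%h. inv h i) h)"
  by (intro eventually_all_finite eventually_jpartial_chain[where g = "%i h. inv h i", OF finite_WC tv finite_WC
     \<Phi>_analytic0 inv_analytic0 inv_zero])
 moreover have "\<forall>\<^sub>F h in nb WC. ALL k. jpartial tv (%h. h (xv k) + \<xi> k h) h =
   jpartial tv (%h. h (xv k)) h + jpartial tv (\<xi> k) h"
  by (intro eventually_all_finite eventually_jpartial_add finite_WC tv analytic0_coord \<xi>_analytic0) auto
 moreover have "\<forall>\<^sub>F h in nb WC. ALL c k. h tv = 0 --> jpartial (xv k) (\<Phi> c) h = jpartial (xv k) (%h. pt h c) h"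
 proof (intro eventually_all_finite eventually_jpartial_cong_restricted)
  show "\<forall>\<^sub>F h in nb WC. h tv = 0 --> \<Phi> c h = pt h c" for c using \<Phi>_init by eventually_elim auto
 qed auto
 ultimately show ?thesis using inv_init \<Phi>_deriv
 proof eventually_elim
  case (elim h)
  show ?case
  proof (intro impI allI)
   fix c assume t: "h tv = 0"
   have "jpartial tv (%h. \<Phi> c (inv h)) h = (SUM i:WC. jpartial i (\<Phi> c) h * jpartial tv (%h. inv h i) h)"
    using elim(1,4) t by simp
   also have "... = jpartial tv (\<Phi> c) h + (SUM k:UNIV. jpartial (xv k) (\<Phi> c) h * jpartial tv (\<xi> k) h)"
    unfolding sum_WC inv_simps using elim(2) by (simp add: jpartial_coord)
   finally show "jpartial tv (%h. \<Phi> c (inv h)) h =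
     xi c (pt h) + (SUM k:UNIV. jpartial (xv k) (%h. pt h c) h * jpartial tv (\<xi> k) h)"
    using elim(3,5) t by simp
  qed
 qed
qed

lemma v_deriv: "\<forall>\<^sub>F h in nb WC. h tv = 0 --> (ALL j. jpartial tv (v j) h = W j h)"
proof -
 have "\<forall>\<^sub>F h in nb WC. ALL l. jpartial tv (%h. \<Phi> (Inl l) (inv h)) h = jpartial tv (%h. h (xv l)) h"
 proof (intro eventually_all_finite eventually_jpartial_cong)
  show "\<forall>\<^sub>F h in nb WC. \<Phi> (Inl l) (inv h) = h (xv l)" for l
   using \<Phi>_inv by eventually_elim simp
 qed
 then show ?thesis using chain_inv
 proof eventually_elim
  case (elim h)
  show ?case
  proof (intro impI allI)
   fix j assume t: "h tv = 0"
   \<comment> \<open>Differentiating \<open>\<Phi> (Inl l) (inv h) = h (xv l)\<close> at time 0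
     gives the inverse the velocity \<open>- Q^l\<close>; this supplies the second term of the
     characteristic.\<close>
   have \<xi>': "jpartial tv (\<xi> l) h = - xi (Inl l) (pt h)" for l
   proof -
    have "0 = xi (Inl l) (pt h) + (SUM k:UNIV. (if l = k then 1 else 0) * jpartial tv (\<xi> k) h)"
     using elim t by (simp add: jpartial_coord)
    also have "(SUM k:UNIV. (if l = k then 1 else 0) * jpartial tv (\<xi> k) h) = jpartial tv (\<xi> l) h"
     by (simp add: if_distrib[of "%x. x * _"] cong: if_cong)
    finally show ?thesis by (simp add: eq_neg_iff_add_eq_0 add.commute)
   qed
   show "jpartial tv (v j) h = W j h"
    using elim(2) t by (simp add: v_def[abs_def] charac_def \<xi>' sum_negf mult.commute)
  qed
 qed
qed

section \<open>Jets of the transported family\<close>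

definition jets where
 "jets h d = (case d of Xc l => h (xv l) | Uc i be => jm be (v i) h)"

lemma jm_analytic0:
 fixes f :: "(('n, 'm) wvar => 'k) => 'k"
 assumes f: "analytic0 WC f"
 shows "analytic0 WC (jm be f)"
proof -
 obtain "is" where "is": "jm be = (jml is :: ((('n, 'm) wvar => 'k) => 'k) => _)" "set is \<subseteq> range xv"
  by (rule jm_eq_jml)
 show ?thesis unfolding "is"(1) by (rule analytic0_jml[OF finite_WC _ f]) (use "is"(2) in auto)
qed

lemma jm_cong_restricted:
 assumes "\<forall>\<^sub>F h in nb WC. h tv = 0 --> f h = g h"
 shows "\<forall>\<^sub>F h in nb WC. h tv = 0 --> jm be f h = (jm be g h :: 'k)"
proof -
 obtain "is" where "is": "jm be = (jml is :: ((('n, 'm) wvar => 'k) => 'k) => _)" "set is \<subseteq> range xv"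
  by (rule jm_eq_jml)
 then show ?thesis unfolding "is"(1) by (intro eventually_jml_cong_restricted assms) auto
qed

lemma jm_tv_commute:
 fixes f :: "(('n, 'm) wvar => 'k) => 'k"
 assumes "analytic0 WC f"
 shows "\<forall>\<^sub>F h in nb WC. jm be (jpartial tv f) h = jpartial tv (jm be f) h"
proof -
 obtain "is" where "is": "jm be = (jml is :: ((('n, 'm) wvar => 'k) => 'k) => _)" "set is \<subseteq> range xv"
  by (rule jm_eq_jml)
 show ?thesis unfolding "is"(1)
  by (rule eventually_jml_commute[OF finite_WC _ _ assms]) (use "is"(2) in auto)
qed

lemma jets_analytic0: "analytic0 WC (%h. jets h d)"
 by (cases d) (auto simp: jets_def intro!: jm_analytic0[OF v_analytic0] analytic0_coord)

lemma jets_init: "\<forall>\<^sub>F h in nb WC. h tv = 0 --> (ALL d:JC. jets h d = U0 d h)"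
proof -
 have "\<forall>\<^sub>F h in nb WC. ALL d:JC. h tv = 0 --> jets h d = U0 d h"
 proof (intro eventually_ball_finite ballI finite_jcoords)
  fix d :: "('n, 'm) jcoord" assume d: "d : JC"
  show "\<forall>\<^sub>F h in nb WC. h tv = 0 --> jets h d = U0 d h"
  proof (cases d)
   case (Xc l)
   then show ?thesis using U0_base by (auto simp: jets_def elim: eventually_mono)
  next
   case (Uc i be)
   then show ?thesis using jm_cong_restricted[OF v_init, of be i] jm_U0
    by (eventually_elim) (use d Uc in \<open>auto simp: jets_def U0val_def\<close>)
  qed
 qed
 then show ?thesis by eventually_elim auto
qed

lemma jets_zero: "d : JC ==> jets (%_. 0) d = 0"
 using eventually_nb_zero[OF jets_init] U0_zero by auto

lemma ps_le_wemb:
 fixes f :: "(('n, 'm) wvar => 'k) => 'k"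
 assumes "0 < ro" "ps_le WC ro f M" "!!c. c : JC ==> norm (z c) <= ro" "norm s <= ro"
 shows "ps_le WC ro (%h. f (wemb s z (\<chi> l. h (xv l)))) M"
proof (rule ps_le_compose[where g = "%i h. wemb s z (\<chi> l. h (xv l)) i", OF assms(1) finite_WC assms(2), simplified])
 fix i :: "('n, 'm) wvar" assume i: "i : WC"
 show "ps_le WC ro (%h. wemb s z (\<chi> l. h (xv l)) i) ro"
 proof (cases i)
  case (Inl c)
  then have "norm (z c) <= ro" using i assms(3) by auto
  then show ?thesis using ps_le_mono[OF ps_le_const[OF assms(1)]] Inl by simp
 next
  case (Inr l)
  show ?thesis
  proof (cases l)
   case None
   then show ?thesis using Inr ps_le_mono[OF ps_le_const[OF assms(1)] assms(4)] by simp
  next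
   case (Some k)
   then show ?thesis using Inr ps_le_coord[OF finite_WC i assms(1)] by simp
  qed
 qed
qed

lemma ps_le_fix_tv:
 fixes f :: "(('n, 'm) wvar => 'k) => 'k"
 assumes "0 < ro" "ps_le WC ro f M" "norm s <= ro"
 shows "ps_le WC ro (%h. f (h(tv := s))) M"
proof (rule ps_le_compose[where g = "%i h. (h(tv := s)) i", OF assms(1) finite_WC assms(2)])
 fix i :: "('n, 'm) wvar" assume i: "i : WC"
 show "ps_le WC ro (%h. (h(tv := s)) i) ro"
  using ps_le_mono[OF ps_le_const[OF assms(1)] assms(3)] ps_le_coord[OF finite_WC i assms(1)]
  by (cases "i = tv") auto
qed

text \<open>A symmetry only provides some image domain and some solution on it. Here the equality of
  graphs is read pointwise on a box around 0, whose size may depend on \<open>s\<close> and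
  \<open>z\<close>.\<close>

lemma transported_solution_local:
 assumes lie: "lie_symmetry \<kappa> F (\<Psi> s)"
  and sol: "local_solution \<kappa> F {x. ALL l. norm (x $ l) < dt} (sol (base0 z))" "0 < dt"
  and jet: "!!c. c : JC ==> norm (jet (\<kappa> - 1) (sol (base0 z)) 0 c) < \<epsilon>"
  and \<epsilon>: "!!D u x. local_solution \<kappa> F D u ==> x : D ==>
    (ALL c:JC. norm (jet (\<kappa> - 1) u x c) < \<epsilon>) ==>
     (EX D' E v. open D' & x : D' & D' \<subseteq> D &
       local_solution \<kappa> F E v & \<Psi> s ` graph_on D' u = graph_on E v)"
 obtains d E w where "0 < d" "local_solution \<kappa> F E w"
  "!!x. (!!l. norm (x $ l) <= d) ==>
    (\<chi> l. \<Phi> (Inl l) (wemb s z x)) : E &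
    (ALL j. w (\<chi> l. \<Phi> (Inl l) (wemb s z x)) $ j = \<Phi> (Inr j) (wemb s z x))"
proof -
 have "(0 :: 'k^'n) : {x. ALL l. norm (x $ l) < dt}" using sol(2) by simp
 from \<epsilon>[OF sol(1) this] jet obtain D' E w where D': "open D'" "0 : D'"
  and w: "local_solution \<kappa> F E w" "\<Psi> s ` graph_on D' (sol (base0 z)) = graph_on E w" by blast
 obtain e where e: "0 < e" "!!x. norm x < e ==> x : D'"
  using D' unfolding open_contains_ball by (metis dist_0_norm mem_ball subsetD)
 obtain d where d: "0 < d" "!!p. p : pdisc UNIV d ==> norm (vec_lambda p :: 'k^'n) < e"
  using eventually_nb_norm_vec[OF e(1)] unfolding eventually_nb by blast
 show ?thesis
 proof (rule that[OF d(1) w(1)])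
  fix x :: "'k^'n" assume x: "!!l. norm (x $ l) <= d"
  have "vec_nth x : pdisc UNIV d" using x by (simp add: pdisc_def)
  from d(2)[OF this] have "x : D'" using e(2) by simp
  then have "join_vec x (sol (base0 z) x) : graph_on D' (sol (base0 z))"
   unfolding graph_on_def by (rule imageI)
  then have "\<Psi> s (join_vec x (sol (base0 z) x)) : graph_on E w"
   unfolding w(2)[symmetric] by (rule imageI)
  then obtain y where y: "y : E" "\<Psi> s (join_vec x (sol (base0 z) x)) = join_vec y (w y)"
   by (auto simp: graph_on_def)
  have "join_vec x (sol (base0 z) x) = (\<chi> i. pt (wemb s z x) i)"
   by (auto simp: vec_eq_iff join_vec_def sol_def U0_wemb pt_def split: sum.splits)
  then have \<Phi>: "\<Phi> c (wemb s z x) = join_vec y (w y) $ c" for c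
   using y(2) by (simp add: \<Phi>_def)
  have "(\<chi> l. \<Phi> (Inl l) (wemb s z x)) = y"
   unfolding \<Phi> by (simp add: vec_eq_iff join_vec_def)
  then show "(\<chi> l. \<Phi> (Inl l) (wemb s z x)) : E &
    (ALL j. w (\<chi> l. \<Phi> (Inl l) (wemb s z x)) $ j = \<Phi> (Inr j) (wemb s z x))"
   using y(1) unfolding \<Phi>[of "Inr _"] by (simp add: join_vec_def)
 qed
qed

end

context pde_sym
begin

text \<open>For fixed \<open>s\<close>, the function \<open>v(s, z, \<cdot>)\<close> solves the system near \<open>a(s, z, 0)\<close>, at first only for \<open>z\<close> in a
  neighbourhood of \<open>0\<close> whose size depends on \<open>s\<close>. The identity theorem for power series makes this uniform.\<close>

lemma v_solution:
 assumes aa: "mdeg aa = \<kappa>"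
 shows "\<forall>\<^sub>F h in nb WC. jm aa (v j) h = F j aa (jets h)"
proof -
 \<comment> \<open>The defect of the equation. As an analytic germ in \<open>(s, z, y)\<close> it
   has a fixed radius \<open>ro\<close>, to which vanishing on small sets will be continued.\<close>
 define E where "E h = jm aa (v j) h - F j aa (jets h)" for h
 have Fan: "analytic0 WC (%h. F j aa (%d. jets h d))"
  by (rule analytic0_compose[OF finite_WC finite_jcoords F_analytic0[OF aa] jets_analytic0 jets_zero])
 have Ean: "analytic0 WC E"
  unfolding E_def[abs_def] using analytic0_diff[OF jm_analytic0[OF v_analytic0] Fan] by simp
 have dep: "\<forall>\<^sub>F h in nb WC. ALL z'. (ALL c:JC. z' c = jets h c) --> F j aa z' = F j aa (jets h)"
  by (rule eventually_nb_compose[where g = "%d h. jets h d", OF finite_WC finite_jcoords jets_analytic0 jets_zero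
    analytic0_depends[OF F_analytic0[OF aa]]])
 define P where "P h \<longleftrightarrow> (ALL l. \<Phi> (Inl l) (inv h) = h (xv l)) &
   (ALL l. \<Phi> (Inl l) h = h (xv l) + h tv * H l h) &
   (ALL z'. (ALL c:JC. z' c = jets h c) --> F j aa z' = F j aa (jets h)) &
   (ALL j be. mdeg be <= \<kappa> - 1 --> (ALL l. h (xv l) = 0) --> U0 (Uc j be) h = h (zv (Uc j be))) &
   (ALL l. U0 (Xc l) h = h (xv l))" for h
 have "eventually P (nb WC)"
  using \<Phi>_inv \<Phi>_H dep U0_init U0_base unfolding P_def by eventually_elim blast
 then obtain dt0 where dt0: "0 < dt0" and P: "!!h. h : pdisc WC dt0 ==> P h"
  unfolding eventually_nb by blast
 obtain dts where dts: "0 < dts" and sol: "!!z. (!!c. c : JC ==> norm (z c) <= dts) ==> (!!l. z (Xc l) = 0) ==>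
    local_solution \<kappa> F {x. ALL l. norm (x $ l) < dts} (sol z) &
    (ALL x c. (ALL l. norm (x $ l) < dts) --> c : JC --> jet (\<kappa> - 1) (sol z) x c = U c (wemb 0 z x))"
 proof (rule sol_local_solution)
  fix dt assume a: "0 < dt" "!!z. (!!c. c : JC ==> norm (z c) <= dt) ==> (!!l. z (Xc l) = 0) ==>
    local_solution \<kappa> F {x. ALL l. norm (x $ l) < dt} (sol z) &
    (ALL x c. (ALL l. norm (x $ l) < dt) --> c : JC --> jet (\<kappa> - 1) (sol z) x c = U c (wemb 0 z x))"
  show thesis by (rule that[OF a])
 qed
 have "0 < min dt0 dts" using dt0 dts by simp
 moreover have "analytic0 WC (case_option E H i)" for i using Ean H_analytic0 by (cases i) auto
 ultimately obtain ro M0 where ro: "0 < ro" "ro <= min dt0 dts"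
  and M0: "ALL i:UNIV. ps_le WC ro (case_option E H i) M0"
  using analytic0_common_radius[where f = "case_option E H" and A = UNIV] by (metis finite)
 define M where "M = \<bar>M0\<bar> + 1"
 have M: "1 <= M" "M0 <= M" by (auto simp: M_def)
 have EM: "ps_le WC ro E M" using ps_le_mono[OF bspec[OF M0, of None] M(2)] by simp
 have HM: "ps_le WC ro (H l) M" for l using ps_le_mono[OF bspec[OF M0, of "Some l"] M(2)] by simp
 \<comment> \<open>\<open>\<xi>\<close> vanishes at the origin; the bound \<open>ro / 4\<close>
   keeps \<open>y + \<xi>\<close> within \<open>ro / 2\<close> for \<open>y\<close> within
   \<open>ro / 4\<close>.\<close>
 obtain r1 where r1: "0 < r1" "ALL k:UNIV. ps_le WC r1 (\<xi> k) (ro / 4)"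
  by (rule analytic0_small[where g = \<xi> and J = UNIV and sg = "ro / 4", OF finite_WC _ \<xi>_analytic0 \<xi>_zero])
    (use ro in auto)
 define r2 where "r2 = min r1 (ro / 4)"
 have r2: "0 < r2" "r2 <= ro / 4" using r1 ro by (auto simp: r2_def)
 have \<xi>b: "ps_le WC r2 (\<xi> k) (ro / 4)" for k
  by (rule ps_le_shrink[OF bspec[OF r1(2) UNIV_I] less_imp_le[OF r2(1)]]) (simp add: r2_def)
 obtain \<eta> where \<eta>: "0 < \<eta>" "!!s. norm s < \<eta> ==> lie_symmetry \<kappa> F (\<Psi> s)"
  using sym unfolding eventually_nhds_metric dist_norm diff_0_right by blast
 define N where "N = real CARD('n)"
 have N: "1 <= N" using zero_less_card_finite[where 'a = 'n] by (simp add: N_def Suc_le_eq One_nat_def)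
 \<comment> \<open>The first entry makes \<open>\<Psi> s\<close> a symmetry. The second makes the
   displacement \<open>s H\<close> small even after summation over all independent
   variables.\<close>
 define r where "r = min (\<eta> / 2) (r2 / (4 * N * M))"
 have r: "0 < r" "r < \<eta>" using \<eta> r2 N M by (auto simp: r_def)
 have NM: "1 <= N * M" using N M by (simp add: mult_ge1_I)
 have rNM: "r * (N * M) <= r2 / 4"
 proof -
  have "r * (N * M) <= r2 / (4 * N * M) * (N * M)" using NM by (intro mult_right_mono) (auto simp: r_def)
  also have "... = r2 / 4" using N M by simp
  finally show ?thesis .
 qed
 have rM: "r * M <= r2 / 4"
 proof -
  have "1 * M <= N * M" using N M by (intro mult_right_mono) auto
  then have "r * M <= r * (N * M)" using r by (intro mult_left_mono) auto
  then show ?thesis using rNM by linarith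
 qed
 have rr: "r <= r2 / 4"
 proof -
  have "r * 1 <= r * M" using r M by (intro mult_left_mono) auto
  then show ?thesis using rM by linarith
 qed
 have main: "E h = 0" if h: "h : pdisc WC r" for h
 proof -
  define s where "s = h tv"
  have s: "norm s <= r" using h by (auto simp: s_def pdisc_def)
  have lie: "lie_symmetry \<kappa> F (\<Psi> s)" using \<eta>(2) s r by simp
  then obtain \<epsilon> where \<epsilon>: "0 < \<epsilon>" "ALL D u. local_solution \<kappa> F D u -->
    (ALL x:D. (ALL c:JC. norm (jet (\<kappa> - 1) u x c) < \<epsilon>) -->
      (EX D' E v. open D' & x : D' & D' \<subseteq> D &
       local_solution \<kappa> F E v & \<Psi> s ` graph_on D' u = graph_on E v))"
   unfolding lie_symmetry_def by blast
  \<comment> \<open>This bound on \<open>z\<close> depends on \<open>s\<close> through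
    \<open>\<epsilon>\<close>; the continuation in \<open>z\<close> at the end disposes of
    it.\<close>
  define \<epsilon>' where "\<epsilon>' = min (\<epsilon> / 2) (r2 / 4)"
  have \<epsilon>': "0 < \<epsilon>'" "\<epsilon>' < \<epsilon>" "\<epsilon>' <= r2 / 4" using \<epsilon> r2 by (auto simp: \<epsilon>'_def)
  have A: "E (wemb s z y) = 0" if z: "!!c. c : JC ==> norm (z c) <= \<epsilon>'" and y: "!!l. norm (y $ l) <= ro" for z y
  proof -
   have small: "wemb s z x : pdisc WC ta" if "!!l. norm (x $ l) <= ta" "r2 / 4 <= ta" for x ta
    using that z \<epsilon>' s rr unfolding wemb_pdisc by (meson order_trans)
   \<comment> \<open>The image of the base point. Only near it is the transported function known to
     be a solution, so vanishing is first established around \<open>y0\<close>.\<close>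
   define y0 where "y0 = (\<chi> l. \<Phi> (Inl l) (wemb s z 0))"
   have w0: "wemb s z 0 : pdisc WC ta" if "r2 / 4 <= ta" for ta
    using small[of 0 ta] that r2 by simp
   have y0_eq: "y0 $ l = s * H l (wemb s z 0)" for l
    using P[OF w0] ro r2 by (simp add: P_def y0_def)
   have y0_b: "norm (y0 $ l) <= r2 / 4" for l
   proof -
    have "norm (H l (wemb s z 0)) <= M" by (rule ps_le_bound[OF HM w0]) (use r2 ro in auto)
    then have "norm (y0 $ l) <= r * M"
     unfolding y0_eq norm_mult using s M r(1) by (intro mult_mono) auto
    then show ?thesis using rM by simp
   qed
   define x where "x y = (\<chi> k. y $ k + \<xi> k (wemb s z y))" for y
   have inv_w: "inv (wemb s z y) = wemb s z (x y)" for y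
    by (simp add: inv_def x_def)
   have x_b: "norm (x y $ l) <= ro / 2" if "!!l. norm (y $ l) <= r2" for y l
   proof -
    have "norm (\<xi> l (wemb s z y)) <= ro / 4"
     by (rule ps_le_bound[OF \<xi>b small]) (use that r2 in auto)
    then show ?thesis
     using that[of l] r2 norm_triangle_ineq[of "y $ l" "\<xi> l (wemb s z y)"] by (simp add: x_def)
   qed
   \<comment> \<open>The map \<open>x + s H(x)\<close> has the value \<open>y0\<close> both at 0 and
     at \<open>x y0\<close>. As \<open>s H\<close> is Lipschitz with a small constant, the sum
     \<open>?m\<close> of the norms satisfies \<open>?m <= ?m / 8\<close>.\<close>
   have x0: "x y0 = 0"
   proof -
    let ?m = "SUM l:UNIV. norm (x y0 $ l)"
    have xb: "norm (x y0 $ l) <= ro / 2" for l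
     by (rule x_b, rule order_trans[OF y0_b]) (use r2 in simp)
    have m0: "0 <= ?m" by (simp add: sum_nonneg)
    have w1: "wemb s z (x y0) : pdisc WC (ro / 2)" by (rule small) (use xb r2 in auto)
    have y0w: "wemb s z y0 : pdisc WC dt0"
     by (rule small) (use y0_b r2 ro in \<open>auto intro: order_trans[of _ "r2 / 4"]\<close>)
    have w1': "wemb s z (x y0) : pdisc WC dt0" using w1 pdisc_mono[of "ro / 2" dt0] ro by auto
    have eq: "x y0 $ l = s * (H l (wemb s z 0) - H l (wemb s z (x y0)))" for l
    proof -
     have "\<Phi> (Inl l) (wemb s z (x y0)) = y0 $ l" using P[OF y0w] by (simp add: P_def inv_w)
     moreover have "\<Phi> (Inl l) (wemb s z (x y0)) = x y0 $ l + s * H l (wemb s z (x y0))"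
      using P[OF w1'] by (simp add: P_def)
     ultimately show ?thesis using y0_eq[of l] by (simp add: algebra_simps)
    qed
    have "norm (x y0 $ l) <= r * (M * ?m / (ro / 2))" for l
    proof -
     have "norm (H l (wemb s z 0) - H l (wemb s z (x y0))) <= M * ?m / (ro - ro / 2)"
     proof (rule ps_le_lipschitz[OF finite_WC _ _ HM w0 w1 m0])
      fix i :: "('n, 'm) wvar" assume "i : WC"
      have "norm (x y0 $ l) <= ?m" for l by (rule member_le_sum) auto
      then show "norm (wemb s z 0 i - wemb s z (x y0) i) <= ?m"
       using m0 by (cases i; cases "projr i") auto
     qed (use ro r2 in auto)
     then show ?thesis unfolding eq[of l] norm_mult using s r by (intro mult_mono) auto
    qed
    then have "?m <= (SUM l:(UNIV :: 'n set). r * (M * ?m / (ro / 2)))" by (intro sum_mono)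
    also have "... = (r * (N * M)) * ?m / (ro / 2)" by (simp add: N_def)
    also have "... <= (ro / 16) * ?m / (ro / 2)"
     using rNM r2 m0 ro by (intro divide_right_mono mult_right_mono) auto
    also have "... = ?m / 8" using ro by simp
    finally have "?m = 0" using m0 by simp
    then have "ALL l:UNIV. norm (x y0 $ l) = 0" by (subst (asm) sum_nonneg_eq_0_iff) auto
    then show ?thesis by (simp add: vec_eq_iff)
   qed
   have zb: "norm (base0 z c) <= \<epsilon>'" if "c : JC" for c
    using z[OF that] \<epsilon>' by (cases c) (auto simp: base0_def)
   have zs: "norm (base0 z c) <= dts" if "c : JC" for c
    using zb[OF that] \<epsilon>' r2 ro by auto
   have base0X: "base0 z (Xc l) = 0" for l by (simp add: base0_def)
   have sz: "local_solution \<kappa> F {x. ALL l. norm (x $ l) < dts} (sol (base0 z))"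
    "!!c. c : JC ==> jet (\<kappa> - 1) (sol (base0 z)) 0 c = U c (wemb 0 (base0 z) 0)"
    using sol[of "base0 z", OF zs base0X] dts by auto
   have jet0: "norm (jet (\<kappa> - 1) (sol (base0 z)) 0 c) < \<epsilon>" if "c : JC" for c
   proof -
    have "jet (\<kappa> - 1) (sol (base0 z)) 0 c = U0 c (wemb s z 0)" using sz(2)[OF that] by (simp add: U0_wemb)
    also have "... = base0 z c"
     using P[OF w0] ro r2 that by (cases c) (auto simp: P_def base0_def)
    finally show ?thesis using zb[OF that] \<epsilon>'(2) by simp
   qed
   obtain d E' w where d: "0 < d" and w: "local_solution \<kappa> F E' w"
    and tr: "!!x. (!!l. norm (x $ l) <= d) ==>
     (\<chi> l. \<Phi> (Inl l) (wemb s z x)) : E' &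
     (ALL j. w (\<chi> l. \<Phi> (Inl l) (wemb s z x)) $ j = \<Phi> (Inr j) (wemb s z x))"
   proof (rule transported_solution_local[OF lie sz(1) dts jet0])
    show "EX D' E v. open D' & x : D' & D' \<subseteq> D &
       local_solution \<kappa> F E v & \<Psi> s ` graph_on D' u = graph_on E v"
     if "local_solution \<kappa> F D u" "x : D" "ALL c:JC. norm (jet (\<kappa> - 1) u x c) < \<epsilon>" for D u x
     using \<epsilon>(2) that by blast
   next
    fix d E' w assume a: "0 < d" "local_solution \<kappa> F E' w"
     "!!x. (!!l. norm (x $ l) <= d) ==>
     (\<chi> l. \<Phi> (Inl l) (wemb s z x)) : E' &
     (ALL j. w (\<chi> l. \<Phi> (Inl l) (wemb s z x)) $ j = \<Phi> (Inr j) (wemb s z x))"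
    show thesis by (rule that[OF a])
   qed
   \<comment> \<open>A Lipschitz constant of the inverse map; dividing \<open>d\<close> by it gives
     a box about \<open>y0\<close> whose preimage lies where the image graph is known.\<close>
   define K where "K = 1 + ro / (2 * r2)"
   have K: "1 <= K" using ro r2 by (simp add: K_def)
   define \<eta>' where "\<eta>' = min (r2 / 4) (d / K)"
   have \<eta>': "0 < \<eta>'" "\<eta>' <= r2 / 4" "\<eta>' * K <= d"
   proof -
    show "0 < \<eta>'" using r2 d K by (simp add: \<eta>'_def)
    show "\<eta>' <= r2 / 4" unfolding \<eta>'_def by (rule min.cobounded1)
    have "\<eta>' * K <= d / K * K" using K by (intro mult_right_mono) (auto simp: \<eta>'_def)
    then show "\<eta>' * K <= d" using K by simp
   qed
   let ?N = "{y. ALL l. norm (y $ l - y0 $ l) < \<eta>'}"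
   have yb: "norm (y $ l) <= r2 / 2" if "y : ?N" for y l
    using that y0_b[of l] \<eta>'(2) norm_triangle_ineq[of "y0 $ l" "y $ l - y0 $ l"]
    by (force dest: spec[of _ l])
   have xd: "norm (x y $ l) <= d" if y: "y : ?N" for y l
   proof -
    have "norm (\<xi> l (wemb s z y) - \<xi> l (wemb s z y0)) <= ro / 4 * \<eta>' / (r2 - r2 / 2)"
    proof (rule ps_le_lipschitz[OF finite_WC _ _ \<xi>b])
     show "wemb s z y : pdisc WC (r2 / 2)" by (rule small) (use yb[OF y] r2 in auto)
     show "wemb s z y0 : pdisc WC (r2 / 2)"
      by (rule small, rule order_trans[OF y0_b]) (use r2 in simp_all)
     fix i :: "('n, 'm) wvar" assume "i : WC"
     show "norm (wemb s z y i - wemb s z y0 i) <= \<eta>'"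
      using y \<eta>'(1) by (cases i; cases "projr i") (auto intro: less_imp_le)
    qed (use r2 \<eta>' in auto)
    also have "ro / 4 * \<eta>' / (r2 - r2 / 2) = \<eta>' * (ro / (2 * r2))" using r2 by (simp add: field_simps)
    finally have 1: "norm (\<xi> l (wemb s z y) - \<xi> l (wemb s z y0)) <= \<eta>' * (ro / (2 * r2))" .
    have "x y $ l = x y $ l - x y0 $ l" using x0 by simp
    also have "... = (y $ l - y0 $ l) + (\<xi> l (wemb s z y) - \<xi> l (wemb s z y0))" by (simp add: x_def)
    also have "norm ... <= \<eta>' + \<eta>' * (ro / (2 * r2))"
     using y by (intro order_trans[OF norm_triangle_ineq] add_mono 1) (auto intro: less_imp_le)
    also have "... = \<eta>' * K" by (simp add: K_def algebra_simps)
    finally show ?thesis using \<eta>'(3) by simp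
   qed
   have onN: "y : E' & (ALL j. w y $ j = v j (wemb s z y))" if y: "y : ?N" for y
   proof -
    have "wemb s z y : pdisc WC dt0"
     by (rule small, rule order_trans[OF yb[OF y]]) (use r2 ro in simp_all)
    from P[OF this] have "(\<chi> l. \<Phi> (Inl l) (wemb s z (x y))) = y"
     by (simp add: P_def inv_w vec_eq_iff)
    with tr[OF xd[OF y]] show ?thesis by (simp add: v_def inv_w)
   qed
   have C: "E (wemb s z y) = 0" if y: "y : ?N" for y
   proof -
    have mp: "mpartial be (%y. w y $ j) y = jm be (v j) (wemb s z y)" for be j
     unfolding mpartial_wemb[symmetric] by (rule mpartial_cong[OF open_box y]) (use onN in blast)
    have "y : E'" using onN[OF y] by blast
    then have "mpartial aa (%y. w y $ j) y = F j aa (jet (\<kappa> - 1) w y)"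
     using w aa unfolding local_solution_def by blast
    also have "... = F j aa (jets (wemb s z y))"
    proof -
     have "wemb s z y : pdisc WC dt0"
      by (rule small, rule order_trans[OF yb[OF y]]) (use r2 ro in simp_all)
     from P[OF this] have dep: "(ALL c:JC. z' c = jets (wemb s z y) c) --> F j aa z' = F j aa (jets (wemb s z y))" for z'
      unfolding P_def by blast
     have "jet (\<kappa> - 1) w y c = jets (wemb s z y) c" if "c : JC" for c
      using that mp by (cases c) (auto simp: jet_def jets_def)
     then show ?thesis using dep by blast
    qed
    finally show ?thesis by (simp add: E_def mp)
   qed
   \<comment> \<open>Continuation in \<open>x\<close> for fixed \<open>s\<close> and
     \<open>z\<close>: the defect vanishes near \<open>y0\<close> and hence on the whole polydisc.
     The remaining coordinates are dummies set to 0.\<close>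
   define b :: "('n, 'm) wvar => 'k" where "b = wemb 0 (%_. 0) y0"
   let ?f = "%h :: ('n, 'm) wvar => 'k. E (wemb s z (\<chi> l. h (xv l)))"
   have fM: "ps_le WC ro ?f M"
    by (rule ps_le_wemb[OF ro(1) EM]) (use z \<epsilon>' r2 ro s rr in \<open>auto intro: order_trans[of _ \<epsilon>'] order_trans[of _ r]\<close>)
   have "norm (y0 $ l) <= ro / 4" for l using y0_b[of l] r2 by linarith
   then have b: "b : pdisc WC (ro / 4)" unfolding b_def wemb_pdisc using ro by simp
   have "?f (wemb 0 (%_. 0 :: 'k) y :: ('n, 'm) wvar => 'k) = 0"
   proof (rule ps_le_identity_off_center[OF finite_WC ro(1) fM b])
    show "0 < \<eta>' / 2" using \<eta>' by simp
    fix h :: "('n, 'm) wvar => 'k" assume h: "h : pdisc WC (\<eta>' / 2)"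
    have "norm (h (xv l)) < \<eta>'" for l
    proof -
     have "norm (h (xv l)) <= \<eta>' / 2" using h by (auto simp: pdisc_def)
     then show ?thesis using \<eta>' by simp
    qed
    then have "(\<chi> l. b (xv l) + h (xv l)) : ?N" by (simp add: b_def)
    from C[OF this] show "E (wemb s z (\<chi> l. b (xv l) + h (xv l))) = 0" .
   next
    show "wemb 0 (%_. 0 :: 'k) y : pdisc WC ro" unfolding wemb_pdisc using y ro by simp
   qed
   then show ?thesis by simp
  qed
  \<comment> \<open>Continuation in \<open>z\<close> for fixed \<open>s\<close>, from the size
    \<open>\<epsilon>'\<close> to the radius \<open>ro\<close>, which is independent of
    \<open>s\<close>.\<close>
  have "E (h(tv := s)) = 0"
  proof (rule ps_le_identity[OF finite_WC ro(1) ps_le_fix_tv[OF ro(1) EM] \<epsilon>'(1)])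
   show "norm s <= ro" using s rr r2 ro by simp
   show "h : pdisc WC ro" using h pdisc_mono[of r ro WC] rr r2 ro by auto
   fix h :: "('n, 'm) wvar => 'k" assume h: "h : pdisc WC \<epsilon>'"
   have "h(tv := s) = wemb s (%c. h (zv c)) (\<chi> l. h (xv l))"
    by (rule ext) (auto simp: wemb_def split: sum.splits option.splits)
   moreover have "E (wemb s (%c. h (zv c)) (\<chi> l. h (xv l))) = 0"
   proof (rule A)
    show "norm (h (zv c)) <= \<epsilon>'" if "c : JC" for c using h that by (auto simp: pdisc_def)
    show "norm ((\<chi> l. h (xv l)) $ l) <= ro" for l
    proof -
     have "norm (h (xv l)) <= \<epsilon>'" using h by (auto simp: pdisc_def)
     then show ?thesis using \<epsilon>' r2 ro by simp
    qed
   qed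
   ultimately show "E (h(tv := s)) = 0" by simp
  qed
  then show ?thesis by (simp add: s_def)
 qed
 then have "\<forall>\<^sub>F h in nb WC. E h = 0" unfolding eventually_nb using r(1) by blast
 then show ?thesis by eventually_elim (simp add: E_def)
qed

text \<open>The equation for \<open>v\<close> is differentiated in the time: at time 0 the
  derivative of \<open>v\<close> is the characteristic, and derivatives in time and space
  commute.\<close>

theorem linearized_equation:
 assumes aa: "mdeg aa = \<kappa>"
 shows "\<forall>\<^sub>F h in nb WC. h tv = 0 --> jm aa (W j) h =
  (SUM d:JC. jpartial d (F j aa) (%d. U0 d h) * (case d of Xc l => 0 | Uc i be => jm be (W i) h))"
proof -
 have tv: "tv : WC" by auto
 have 1: "\<forall>\<^sub>F h in nb WC. jpartial tv (jm aa (v j)) h = jpartial tv (%h. F j aa (%d. jets h d)) h"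
  using eventually_jpartial_cong[OF v_solution[OF aa]] by simp
 have 2: "\<forall>\<^sub>F h in nb WC. jpartial tv (%h. F j aa (%d. jets h d)) h =
   (SUM d:JC. jpartial d (F j aa) (%d. jets h d) * jpartial tv (%h. jets h d) h)"
  by (rule eventually_jpartial_chain[where g = "%d h. jets h d", OF finite_WC tv finite_jcoords
     F_analytic0[OF aa] jets_analytic0 jets_zero])
 have Wj: "\<forall>\<^sub>F h in nb WC. h tv = 0 --> jpartial tv (jm be (v i)) h = jm be (W i) h" for be i
 proof -
  have "\<forall>\<^sub>F h in nb WC. h tv = 0 --> jpartial tv (v i) h = W i h"
   using v_deriv by eventually_elim auto
  from jm_cong_restricted[OF this, of be] jm_tv_commute[OF v_analytic0[of i], of be]
  show ?thesis by eventually_elim auto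
 qed
 have 3: "\<forall>\<^sub>F h in nb WC. ALL d:JC. h tv = 0 --> jpartial tv (%h. jets h d) h =
   (case d of Xc l => 0 | Uc i be => jm be (W i) h)"
 proof (intro eventually_ball_finite ballI finite_jcoords)
  fix d :: "('n, 'm) jcoord"
  show "\<forall>\<^sub>F h in nb WC. h tv = 0 --> jpartial tv (%h. jets h d) h =
   (case d of Xc l => 0 | Uc i be => jm be (W i) h)"
  proof (cases d)
   case (Xc l)
   then show ?thesis by (simp add: jets_def jpartial_coord)
  next
   case (Uc i be)
   have "(%h. jm be (v i) h) = jm be (v i)" by simp
   then show ?thesis using Wj[of be i] Uc by (simp add: jets_def)
  qed
 qed
 \<comment> \<open>\<open>jets h\<close> and \<open>U0\<close> agree only on \<open>JC\<close>, so
   the derivatives of \<open>F\<close> have to be insensitive to all other coordinates.\<close>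
 have 4: "\<forall>\<^sub>F h in nb WC. ALL d:JC. ALL z'. (ALL c:JC. z' c = U0 c h) -->
   jpartial d (F j aa) z' = jpartial d (F j aa) (%d. U0 d h)"
 proof (intro eventually_ball_finite ballI finite_jcoords)
  fix d :: "('n, 'm) jcoord" assume d: "d : JC"
  show "\<forall>\<^sub>F h in nb WC. ALL z'. (ALL c:JC. z' c = U0 c h) -->
   jpartial d (F j aa) z' = jpartial d (F j aa) (%d. U0 d h)"
   by (rule eventually_nb_compose[where g = U0, OF finite_WC finite_jcoords U0_analytic0 U0_zero
      analytic0_depends[OF analytic0_jpartial[OF finite_jcoords d F_analytic0[OF aa]]]])
 qed
 show ?thesis using 1 2 3 4 Wj[of aa j] jets_init
 proof eventually_elim
  case (elim h)
  show ?case
  proof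
   assume t: "h tv = 0"
   have "jm aa (W j) h = (SUM d:JC. jpartial d (F j aa) (%d. jets h d) * jpartial tv (%h. jets h d) h)"
    unfolding mp[OF elim(5) t, symmetric] elim(1) by (rule elim(2))
   also have "... = (SUM d:JC. jpartial d (F j aa) (%d. U0 d h) * (case d of Xc l => 0 | Uc i be => jm be (W i) h))"
   proof (rule sum.cong)
    fix d assume d: "d : JC"
    have "jpartial d (F j aa) (%d. jets h d) = jpartial d (F j aa) (%d. U0 d h)"
     by (rule mp[OF spec[OF bspec[OF elim(4) d]]]) (use elim(6) t in blast)
    then show "jpartial d (F j aa) (%d. jets h d) * jpartial tv (%h. jets h d) h =
     jpartial d (F j aa) (%d. U0 d h) * (case d of Xc l => 0 | Uc i be => jm be (W i) h)"
     using elim(3) t d by auto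
   qed simp
   finally show "jm aa (W j) h = ..." .
  qed
 qed
qed

end

section \<open>Weighted homogeneous expansions\<close>

text \<open>Where \<open>h i\<close> is nonzero the factor cancels pointwise; where it is zero, the
  product rule applied to \<open>h i * g = 0\<close> leaves \<open>g = 0\<close>.\<close>

lemma eventually_cancel:
 fixes g :: "('i => 'k) => 'k::{real_normed_field,banach}"
 assumes I: "finite I" "i : I" and "analytic0 I g" "\<forall>\<^sub>F h in nb I. h i ^ k * g h = 0"
 shows "\<forall>\<^sub>F h in nb I. g h = 0"
 using assms(3,4)
proof (induction k arbitrary: g)
 case 0
 then show ?case by simp
next
 case (Suc k)
 let ?g = "%h. h i ^ k * g h"
 have an: "analytic0 I ?g" by (intro analytic0_mult analytic0_power analytic0_coord I Suc.prems)
 have z: "\<forall>\<^sub>F h in nb I. h i * ?g h = 0" using Suc.prems(2) by eventually_elim simp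
 have "\<forall>\<^sub>F h in nb I. jpartial i (%h. h i * ?g h) h = 0"
  using eventually_jpartial_cong[OF z, of i] by simp
 then have "\<forall>\<^sub>F h in nb I. ?g h = 0"
  using eventually_jpartial_mult[OF I analytic0_coord[OF I] an] z
 proof eventually_elim
  case (elim h)
  then show ?case by (cases "h i = 0") (auto simp: jpartial_coord)
 qed
 then show ?case by (rule Suc.IH[OF Suc.prems(1)])
qed

text \<open>The coordinates are switched on one at a time, along segments that stay inside the
  box.\<close>

lemma box_const:
 fixes f :: "'k::{real_normed_field,euclidean_space}^'n::finite => 'k"
 assumes d: "!!x l. (!!i. norm (x $ i) < r) ==> ((%t. f (x + axis l t)) has_field_derivative 0) (at 0)"
  and x: "!!i. norm (x $ i) < r"
 shows "f x = f 0"
proof -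
 have r: "0 < r" using x[of undefined] norm_ge_zero less_le_trans not_less by (meson order_le_less_trans)
 have "f (\<chi> i. if i : S then x $ i else 0) = f 0" for S
  using finite[of S]
 proof (induction S)
  case empty
  have "(\<chi> i. if i : {} then x $ i else 0) = 0" by (simp add: vec_eq_iff)
  then show ?case by simp
 next
  case (insert l S)
  define y where "y = (\<chi> i. if i : S then x $ i else 0)"
  have yl: "y $ l = 0" using insert.hyps by (simp add: y_def)
  have "((%t. f (y + axis l t)) has_field_derivative 0) (at s within ball 0 r)" if "s : ball 0 r" for s
  proof -
   have "norm ((y + axis l s) $ i) < r" for i
    using that x r yl by (cases "i = l") (auto simp: y_def axis_def)
   from d[OF this, of l] have "((%t. f (y + axis l s + axis l t)) has_field_derivative 0) (at 0)" .
   moreover have "y + axis l s + axis l t = y + axis l (t + s)" for t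
    by (simp add: vec_eq_iff axis_def)
   ultimately have "((%t. f (y + axis l (t + s))) has_field_derivative 0) (at 0)" by simp
   then have "((%t. f (y + axis l t)) has_field_derivative 0) (at s)"
    using DERIV_shift[of "%t. f (y + axis l t)" 0 0 s] by simp
   then show ?thesis by (simp add: has_field_derivative_at_within)
  qed
  then obtain c where "ALL s:ball 0 r. f (y + axis l s) = c"
   using has_field_derivative_zero_constant[of "ball 0 r" "%t. f (y + axis l t)"] by auto
  then have "f (y + axis l (x $ l)) = f (y + axis l 0)" using x[of l] r by auto
  moreover have "y + axis l (x $ l) = (\<chi> i. if i : insert l S then x $ i else 0)"
   using insert.hyps by (auto simp: vec_eq_iff axis_def y_def)
  moreover have "y + axis l 0 = y" by (simp add: vec_eq_iff axis_def)
  ultimately show ?case using insert.IH unfolding y_def[symmetric] by metis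
 qed
 from this[of UNIV] show ?thesis by simp
qed

text \<open>Descending induction on the order: once all first derivatives of \<open>val be\<close>
  are zero, it is constant and equal to its value at the origin.\<close>

lemma box_polynomial_zero:
 fixes val :: "'n::finite mindex => 'k::{real_normed_field,euclidean_space}^'n => 'k"
 assumes d: "!!be x l. mdeg be < K ==> (!!i. norm (x $ i) < r) ==>
   ((%t. val be (x + axis l t)) has_field_derivative val (be + axis l 1) x) (at 0)"
  and top: "!!aa x. mdeg aa = K ==> (!!i. norm (x $ i) < r) ==> val aa x = 0"
  and low: "!!be. mdeg be < K ==> val be 0 = 0"
  and "mdeg be <= K" "!!i. norm (x $ i) < r"
 shows "val be x = 0"
 using assms(4,5)
proof (induction "K - mdeg be" arbitrary: be x)
 case 0
 then show ?case using top by simp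
next
 case (Suc n)
 then have b: "mdeg be < K" by simp
 have "((%t. val be (y + axis l t)) has_field_derivative 0) (at 0)" if y: "!!i. norm (y $ i) < r" for y l
 proof -
  have "val (be + axis l 1) y = 0"
   by (rule Suc.hyps(1)) (use Suc.hyps(2) b y in \<open>auto simp: mdeg_add\<close>)
  then show ?thesis using d[OF b y, of l] by simp
 qed
 then have "val be x = val be 0" by (rule box_const) (use Suc.prems in auto)
 then show ?case using low[OF b] by simp
qed

section \<open>Order of differentiation and Taylor polynomials\<close>

lemma eventually_jml_perm:
 fixes f :: "('i => 'k) => 'k::{real_normed_field,banach}"
 assumes "finite I" "set is \<subseteq> I" "mset is = mset js" "analytic0 I f"
 shows "\<forall>\<^sub>F h in nb I. jml is f h = jml js f h"
proof -
 obtain ro c where c: "0 < ro" "pseries I ro c f" using assms(4) by (auto simp: analytic0_def ps_le_def)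
 have ex: "EX ro>0. pseries I ro (foldr dcoef ks c) (jml ks f)" if "set ks \<subseteq> I" for ks
  using that
 proof (induction ks)
  case Nil
  then show ?case using c by auto
 next
  case (Cons k ks)
  then obtain ro where "0 < ro" "pseries I ro (foldr dcoef ks c) (jml ks f)" by auto
  then have "pseries I (ro / 2) (dcoef k (foldr dcoef ks c)) (jpartial k (jml ks f))"
   using Cons.prems by (intro pseries_deriv(2)[OF assms(1)]) auto
  then show ?case using \<open>0 < ro\<close> by (intro exI[of _ "ro / 2"]) auto
 qed
 have "set js \<subseteq> I" using assms(2,3) by (metis set_mset_mset)
 with ex assms(2) obtain r1 r2 where r: "0 < r1" "pseries I r1 (foldr dcoef is c) (jml is f)"
  "0 < r2" "pseries I r2 (foldr dcoef js c) (jml js f)" by blast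
 have "foldr dcoef is = (foldr dcoef js :: (('i => nat) => 'k) => _)"
 proof -
  have c: "dcoef x \<circ> dcoef y = (dcoef y \<circ> dcoef x :: (('i => nat) => 'k) => _)" for x y
   by (rule ext) (unfold o_apply, rule dcoef_commute)
  show ?thesis unfolding foldr_conv_fold
   by (rule fold_multiset_equiv[OF c]) (use assms(3) in simp)
 qed
 note eq = this
 have "jml is f h = jml js f h" if h: "h : pdisc I (min r1 r2)" for h
 proof -
  have "h : pdisc I r1" "h : pdisc I r2"
   using h pdisc_mono[of "min r1 r2" r1 I] pdisc_mono[of "min r1 r2" r2 I] by auto
  then have "((%p. foldr dcoef is c p * mmon I h p) has_sum jml is f h) (mindices I)"
   "((%p. foldr dcoef js c p * mmon I h p) has_sum jml js f h) (mindices I)"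
   using r(2,4) by (auto simp: pseries_def)
  then show ?thesis unfolding eq by (rule has_sum_unique)
 qed
 then show ?thesis unfolding eventually_nb using r by (intro exI[of _ "min r1 r2"]) auto
qed

lemma count_list_mindex:
 "distinct ls ==> count_list (concat (map (%l. replicate (a l) (xv l)) ls)) i =
  (case i of xv k => if k : set ls then a k else 0 | _ => 0)"
 for a :: "'n::finite => nat"
proof (induction ls)
 case (Cons l ls)
 have "count_list (replicate m (xv l)) i = (if i = xv l then m else 0)" for m by (induction m) auto
 then show ?case using Cons by (auto split: sum.splits option.splits)
qed (auto split: sum.splits option.splits)

definition xlist :: "'n::finite mindex => ('n, 'm) wvar list" where
 "xlist aa = concat (map (%l. replicate (aa $ l) (xv l)) (SOME ls. distinct ls & set ls = UNIV))"

lemma jm_def': "jm aa = jml (xlist aa)"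
 by (simp add: jm_def xlist_def)

lemma set_xlist: "set (xlist aa) \<subseteq> range xv"
 by (auto simp: xlist_def)

lemma some_enumeration: "distinct (SOME ls :: 'n::finite list. distinct ls & set ls = UNIV)"
  "set (SOME ls :: 'n::finite list. distinct ls & set ls = UNIV) = UNIV"
proof -
 have "EX ls :: 'n list. distinct ls & set ls = UNIV"
  using finite_distinct_list[of "UNIV :: 'n set"] by auto
 from someI_ex[OF this] show "distinct (SOME ls :: 'n list. distinct ls & set ls = UNIV)"
  "set (SOME ls :: 'n list. distinct ls & set ls = UNIV) = UNIV" by auto
qed

lemma count_xlist:
 "count (mset (xlist aa :: ('n::finite, 'm) wvar list)) i = (case i of xv k => aa $ k | _ => 0)"
proof -
 have "count (mset (xlist aa :: ('n, 'm) wvar list)) i = count_list (xlist aa) i"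
  by (simp add: count_mset count_list_eq_length_filter)
 then show ?thesis
  unfolding xlist_def count_list_mindex[OF some_enumeration(1)] some_enumeration(2)
  by (simp split: sum.splits option.splits)
qed

lemma length_xlist: "length (xlist aa :: ('n::finite, 'm) wvar list) = mdeg aa"
proof -
 have len: "length (concat (map (%l. replicate (aa $ l) (xv l :: ('n, 'm) wvar)) ls)) = sum (vec_nth aa) (set ls)" if "distinct ls" for ls
  using that by (induction ls) auto
 show ?thesis unfolding xlist_def len[OF some_enumeration(1)] some_enumeration(2) mdeg_def ..
qed

text \<open>\<open>jm\<close> uses a fixed order of the variables, so the new derivative has to be
  moved to its place; for analytic germs only the multiset of the variables counts.\<close>

lemma jm_step:
 fixes f :: "(('n::finite, 'm) wvar => 'k) => 'k::{real_normed_field,banach}"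
 assumes "finite I" "analytic0 (I <+> UNIV) f"
 shows "\<forall>\<^sub>F h in nb (I <+> UNIV). jpartial (xv l) (jm be f) h = jm (be + axis l 1) f h"
proof -
 have "mset (xv l # xlist be) = mset (xlist (be + axis l 1) :: ('n, 'm) wvar list)"
  by (rule multiset_eqI) (auto simp del: count_mset simp: count_xlist axis_def split: sum.splits option.splits)
 then have "\<forall>\<^sub>F h in nb (I <+> UNIV). jml (xv l # xlist be) f h = jml (xlist (be + axis l 1)) f h"
  by (intro eventually_jml_perm assms) (use set_xlist assms(1) in auto)
 then show ?thesis by (simp add: jm_def')
qed

lemma jpartial_wemb_field_derivative:
 assumes "((%t. f ((wemb s z x)(xv l := t))) has_field_derivative D) (at (x $ l))"
 shows "((%t. f (wemb s z (x + axis l t))) has_field_derivative (D :: 'k::real_normed_field)) (at 0)"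
 using assms DERIV_shift[of "%u. f ((wemb s z x)(xv l := u))" D 0 "x $ l"]
 by (simp add: wemb_axis add.commute)

text \<open>On the subspace \<open>tv = 0\<close>, a function whose derivatives of order \<open>K\<close> vanish is its Taylor polynomial \<open>val 0\<close>.\<close>

lemma jm_taylor:
 fixes g :: "(('n::finite, 'm) wvar => 'k) => 'k::{real_normed_field,euclidean_space}"
 assumes I: "finite I" and an: "analytic0 (I <+> UNIV) g"
  and top: "ALL aa. mdeg aa = K --> (\<forall>\<^sub>F h in nb (I <+> UNIV). h tv = 0 --> jm aa g h = 0)"
 shows "EX dt>0. ALL z val. (ALL c:I. norm (z c) <= dt) -->
   (ALL be x l. mdeg be < K --> ((%t. val be (x + axis l t)) has_field_derivative val (be + axis l 1) x) (at 0)) -->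
   (ALL aa x. mdeg aa = K --> val aa x = 0) -->
   (ALL be. mdeg be < K --> jm be g (wemb 0 z 0) = val be 0) -->
   (ALL x be. (ALL l. norm (x $ l) < dt) --> mdeg be <= K --> jm be g (wemb 0 z x) = val be x)"
proof -
 have fin: "finite (I <+> (UNIV :: 'n option set))" using I by simp
 have fK: "finite {be :: 'n mindex. mdeg be <= K}" by (rule finite_mdeg_le)
 have jan: "analytic0 (I <+> UNIV) (jm be g)" for be
  unfolding jm_def' by (rule analytic0_jml[OF fin _ an]) (use set_xlist in auto)
 define Q where "Q be h \<longleftrightarrow>
   (mdeg be = K --> h tv = 0 --> jm be g h = 0) &
   (ALL l. jpartial (xv l) (jm be g) h = jm (be + axis l 1) g h) &
   (ALL l. ((%t. jm be g (h(xv l := t))) has_field_derivative jpartial (xv l) (jm be g) h) (at (h (xv l))))" for be h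
 have "\<forall>\<^sub>F h in nb (I <+> UNIV). ALL be:{be. mdeg be <= K}. Q be h"
  unfolding Q_def
 proof (intro eventually_ball_finite fK ballI eventually_conj eventually_all_finite)
  fix be :: "'n mindex" and l assume "be : {be. mdeg be <= K}"
  show "\<forall>\<^sub>F h in nb (I <+> UNIV). mdeg be = K --> h tv = 0 --> jm be g h = 0"
   by (cases "mdeg be = K") (use top in auto)
  show "\<forall>\<^sub>F h in nb (I <+> UNIV). jpartial (xv l) (jm be g) h = jm (be + axis l 1) g h"
   by (rule jm_step[OF I an])
  show "\<forall>\<^sub>F h in nb (I <+> UNIV). ((%t. jm be g (h(xv l := t))) has_field_derivative jpartial (xv l) (jm be g) h) (at (h (xv l)))"
   by (rule eventually_has_field_derivative_jpartial[OF fin _ jan]) auto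
 qed
 then obtain dt where dt: "0 < dt" and PQ: "!!h be. h : pdisc (I <+> UNIV) dt ==> mdeg be <= K ==> Q be h"
  unfolding eventually_nb by blast
 note P = PQ[unfolded Q_def]
 have "jm be g (wemb 0 z x) = val be x"
  if z: "ALL c:I. norm (z c) <= dt"
   and d: "ALL be x l. mdeg be < K --> ((%t. val be (x + axis l t)) has_field_derivative val (be + axis l 1) x) (at 0)"
   and vt: "ALL aa x. mdeg aa = K --> val aa x = 0"
   and v0: "ALL be. mdeg be < K --> jm be g (wemb 0 z 0) = val be 0"
   and x: "ALL l. norm (x $ l) < dt" and b: "mdeg be <= K" for z val x be
 proof -
  have w: "wemb 0 z y : pdisc (I <+> UNIV) dt" if "!!i. norm (y $ i) < dt" for y
   unfolding wemb_pdisc using that dt z by (auto intro: less_imp_le)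
  have "jm be g (wemb 0 z x) - val be x = 0"
  proof (rule box_polynomial_zero[where val = "%be y. jm be g (wemb 0 z y) - val be y" and K = K and r = dt])
   fix be :: "'n mindex" and y :: "'k^'n" and l assume b: "mdeg be < K" and y: "!!i. norm (y $ i) < dt"
   have P': "jpartial (xv l) (jm be g) (wemb 0 z y) = jm (be + axis l 1) g (wemb 0 z y)"
    "((%t. jm be g ((wemb 0 z y)(xv l := t))) has_field_derivative jpartial (xv l) (jm be g) (wemb 0 z y)) (at (wemb 0 z y (xv l)))"
    using P[OF w[OF y] less_imp_le[OF b]] by blast+
   have "((%t. jm be g (wemb 0 z (y + axis l t))) has_field_derivative jm (be + axis l 1) g (wemb 0 z y)) (at 0)"
    using jpartial_wemb_field_derivative[of "jm be g" 0 z y l] P' by simp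
   then show "((%t. jm be g (wemb 0 z (y + axis l t)) - val be (y + axis l t)) has_field_derivative
     jm (be + axis l 1) g (wemb 0 z y) - val (be + axis l 1) y) (at 0)"
    by (rule DERIV_diff) (use d b in blast)
  next
   show "jm aa g (wemb 0 z y) - val aa y = 0" if "mdeg aa = K" "!!i. norm (y $ i) < dt" for aa y
    using P[OF w[OF that(2)], of aa] that(1) vt by simp
   show "jm be g (wemb 0 z 0) - val be 0 = 0" if "mdeg be < K" for be
    using v0 that by simp
  qed (use b x in auto)
  then show ?thesis by simp
 qed
 then show ?thesis by (intro exI[of _ dt] conjI dt allI impI)
qed

lemma jm_polynomial_zero:
 fixes g :: "(('n::finite, 'm) wvar => 'k) => 'k::{real_normed_field,euclidean_space}"
 assumes I: "finite I" and an: "analytic0 (I <+> UNIV) g"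
  and top: "!!aa. mdeg aa = K ==> \<forall>\<^sub>F h in nb (I <+> UNIV). h tv = 0 --> jm aa g h = 0"
  and low: "!!be. mdeg be < K ==> \<forall>\<^sub>F h in nb (I <+> UNIV). h tv = 0 --> (ALL l. h (xv l) = 0) --> jm be g h = 0"
 shows "\<forall>\<^sub>F h in nb (I <+> UNIV). h tv = 0 --> g h = 0"
proof -
 obtain dt where dt: "0 < dt" and T: "!!z x. (ALL c:I. norm (z c) <= dt) ==>
   (ALL be. mdeg be < K --> jm be g (wemb 0 z 0) = 0) ==> (ALL l. norm (x $ l) < dt) ==> g (wemb 0 z x) = 0"
 proof -
  have "ALL aa. mdeg aa = K --> (\<forall>\<^sub>F h in nb (I <+> UNIV). h tv = 0 --> jm aa g h = 0)" using top by blast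
  from jm_taylor[OF I an this] obtain dt where "0 < dt" and T: "ALL z val. (ALL c:I. norm (z c) <= dt) -->
   (ALL be x l. mdeg be < K --> ((%t. val be (x + axis l t)) has_field_derivative val (be + axis l 1) x) (at 0)) -->
   (ALL aa x. mdeg aa = K --> val aa x = 0) -->
   (ALL be. mdeg be < K --> jm be g (wemb 0 z 0) = val be 0) -->
   (ALL x be. (ALL l. norm (x $ l) < dt) --> mdeg be <= K --> jm be g (wemb 0 z x) = val be x)"
   by (elim exE conjE) (rule that)
  show ?thesis
  proof (rule that[OF \<open>0 < dt\<close>])
   fix z :: "('n, 'm) jcoord => 'k" and x :: "'k^'n"
   assume "ALL c:I. norm (z c) <= dt" "ALL be. mdeg be < K --> jm be g (wemb 0 z 0) = 0" "ALL l. norm (x $ l) < dt"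
   with T[rule_format, of z "%_ _. 0" x 0] show "g (wemb 0 z x) = 0" by simp
  qed
 qed
 have "\<forall>\<^sub>F h in nb (I <+> UNIV). ALL be:{be. mdeg be <= K}. mdeg be < K --> h tv = 0 --> (ALL l. h (xv l) = 0) --> jm be g h = 0"
 proof (intro eventually_ball_finite finite_mdeg_le ballI)
  fix be :: "'n mindex"
  show "\<forall>\<^sub>F h in nb (I <+> UNIV). mdeg be < K --> h tv = 0 --> (ALL l. h (xv l) = 0) --> jm be g h = 0"
   by (cases "mdeg be < K") (use low in auto)
 qed
 then obtain dt' where dt': "0 < dt'" and L: "!!h. h : pdisc (I <+> UNIV) dt' ==>
   ALL be:{be. mdeg be <= K}. mdeg be < K --> h tv = 0 --> (ALL l. h (xv l) = 0) --> jm be g h = 0"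
  unfolding eventually_nb by blast
 define r where "r = min (dt / 2) dt'"
 have r: "0 < r" "r < dt" "r <= dt'" using dt dt' by (auto simp: r_def)
 have "g h = 0" if h: "h : pdisc (I <+> UNIV) r" "h tv = 0" for h
 proof -
  define z where "z c = h (zv c)" for c
  define x where "x = (\<chi> l. h (xv l))"
  have hw: "wemb 0 z x = h" using wemb_collapse[of h] h(2) by (simp add: z_def[abs_def] x_def)
  have hb: "norm (h i) <= r" if "i : I <+> UNIV" for i using h that by (auto simp: pdisc_def)
  have z: "norm (z c) <= r" if "c : I" for c using hb[OF InlI[OF that]] by (simp add: z_def)
  have "norm (h (xv i)) <= r" for i by (rule hb) auto
  then have x: "ALL l. norm (x $ l) < dt" using r by (auto simp: x_def intro: le_less_trans)
  have w: "wemb 0 z 0 : pdisc (I <+> UNIV) dt'"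
   unfolding wemb_pdisc using z r by (auto intro: order_trans)
  have "ALL be. mdeg be < K --> jm be g (wemb 0 z 0) = 0" using L[OF w] by simp
  moreover have "ALL c:I. norm (z c) <= dt" using z r by fastforce
  ultimately have "g (wemb 0 z x) = 0" by (intro T x)
  then show ?thesis by (simp add: hw)
 qed
 then show ?thesis unfolding eventually_nb using r(1) by blast
qed

lemma jml_pull_tv:
 fixes G :: "(('n::finite, 'm) wvar => 'k) => 'k::{real_normed_field,banach}"
 assumes "finite I" "analytic0 (I <+> UNIV) G" "set is \<subseteq> range xv"
 shows "\<forall>\<^sub>F h in nb (I <+> UNIV). jml is (%h. h tv ^ k * G h) h = h tv ^ k * jml is G h"
 using assms(3)
proof (induction "is")
 case (Cons i "is")
 then obtain l where i: "i = xv l" by auto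
 have fin: "finite (I <+> (UNIV :: 'n option set))" using assms(1) by simp
 have an: "analytic0 (I <+> UNIV) (jml is G)"
  by (rule analytic0_jml[OF fin _ assms(2)]) (use Cons.prems in auto)
 have pw: "analytic0 (I <+> UNIV) (%h :: ('n, 'm) wvar => 'k. h tv ^ k)"
  by (intro analytic0_power analytic0_coord fin) auto
 have z: "jpartial i (%h. h tv ^ k) h = (0 :: 'k)" for h
  by (simp add: jpartial_def i)
 have "\<forall>\<^sub>F h in nb (I <+> UNIV). jpartial i (jml is (%h. h tv ^ k * G h)) h = jpartial i (%h. h tv ^ k * jml is G h) h"
  using Cons by (intro eventually_jpartial_cong) auto
 moreover have "\<forall>\<^sub>F h in nb (I <+> UNIV). jpartial i (%h. h tv ^ k * jml is G h) h =
   jpartial i (%h. h tv ^ k) h * jml is G h + h tv ^ k * jpartial i (jml is G) h"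
  by (rule eventually_jpartial_mult[OF fin _ pw an]) (use i in auto)
 ultimately show ?case by eventually_elim (simp add: z)
qed simp

text \<open>Scaling the variable \<open>i\<close> by the power \<open>w i\<close> of the parameter
  multiplies each monomial by its weight as a power. If all total weights are at least
  \<open>N\<close>, that power divides out, and at parameter 0 exactly the terms of weight
  \<open>N\<close> survive. The parameter sits in slot \<open>None\<close>.\<close>

lemma weighted_division:
 fixes f :: "('i::finite => 'k) => 'k::{real_normed_field,banach}"
 assumes ro: "0 < ro" "pseries UNIV ro c f"
  and N: "!!q. c q ~= 0 ==> N <= (SUM i:UNIV. w i * q i) + e"
 obtains g where "analytic0 UNIV g"
  "\<forall>\<^sub>F h in nb UNIV. h None ^ e * f (%i. h None ^ w i * h (Some i)) = h None ^ N * g h"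
  "!!h. (ALL i. norm (h (Some i)) <= ro) ==> h None = 0 ==>
    ((%q. (if (SUM i:UNIV. w i * q i) + e = N then c q else 0) * mmon UNIV (%i. h (Some i)) q) has_sum g h) UNIV"
proof -
 define wt where "wt q = (SUM i:UNIV. w i * q i) + e" for q
 have MU: "mindices UNIV = (UNIV :: ('i => nat) set)" by (simp add: mindices_def)
 \<comment> \<open>At most 1, so that surplus powers of the scaling parameter do not increase the
   norm.\<close>
 define r where "r = min ro 1"
 have r: "0 < r" "r <= 1" "r <= ro" using ro by (auto simp: r_def)
 define T where "T h q = c q * h None ^ (wt q - N) * mmon UNIV (%i. h (Some i)) q" for h q
 have sc: "(%q. norm (c q) * ro ^ sum q UNIV) summable_on UNIV" using ro(2) by (simp add: pseries_def MU)
 have Tb: "norm (T h q) <= norm (c q) * ro ^ sum q UNIV" if "norm (h None) <= 1" "ALL i. norm (h (Some i)) <= ro" for h q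
 proof -
  have "norm (mmon UNIV (%i. h (Some i)) q) <= ro ^ sum q UNIV"
   by (rule norm_mmon_le) (use that in \<open>auto simp: pdisc_def\<close>)
  moreover have "norm (h None) ^ (wt q - N) <= 1" using that by (simp add: power_le_one)
  ultimately have "norm (h None) ^ (wt q - N) * norm (mmon UNIV (%i. h (Some i)) q) <= 1 * ro ^ sum q UNIV"
   by (intro mult_mono) auto
  from mult_left_mono[OF this, of "norm (c q)"] show ?thesis
   by (simp add: T_def norm_mult norm_power mult.assoc)
 qed
 define g where "g h = (\<Sum>\<^sub>\<infinity>q. T h q)" for h
 have Tg: "(T h has_sum g h) UNIV" if "norm (h None) <= 1" "ALL i. norm (h (Some i)) <= ro" for h
  unfolding g_def
  by (rule has_sum_infsum[OF abs_summable_summable], rule summable_on_comparison_test[OF sc])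
    (use Tb[OF that] in auto)
 have "ps_le UNIV r g (\<Sum>\<^sub>\<infinity>q. norm (c q) * ro ^ sum q UNIV)"
 proof (rule ps_le_has_sum[OF r(1) _ has_sum_infsum[OF sc] order_refl])
  fix q :: "'i => nat"
  have "ps_le UNIV r (%h. T h q) (norm (c q) * r ^ (wt q - N) * r ^ sum q UNIV)"
   unfolding T_def
   by (intro ps_le_mult ps_le_const ps_le_power ps_le_mmon ps_le_coord r(1)) auto
  then show "ps_le UNIV r (%h. T h q) (norm (c q) * ro ^ sum q UNIV)"
  proof (rule ps_le_mono)
   have "r ^ (wt q - N) * r ^ sum q UNIV <= 1 * ro ^ sum q UNIV"
    using r by (intro mult_mono power_le_one power_mono) auto
   from mult_left_mono[OF this, of "norm (c q)"]
   show "norm (c q) * r ^ (wt q - N) * r ^ sum q UNIV <= norm (c q) * ro ^ sum q UNIV" by (simp add: mult.assoc)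
  qed
  show "(T h has_sum g h) UNIV" if "h : pdisc UNIV r" for h
   by (rule Tg) (use that r in \<open>auto simp: pdisc_def intro: order_trans\<close>)
 qed
 then have an: "analytic0 UNIV g" unfolding analytic0_def using r(1) by blast
 have "h None ^ e * f (%i. h None ^ w i * h (Some i)) = h None ^ N * g h" if h: "h : pdisc UNIV r" for h
 proof -
  have hN: "norm (h None) <= 1" "ALL i. norm (h (Some i)) <= ro"
   using h r by (auto simp: pdisc_def intro: order_trans)
  have "(%i. h None ^ w i * h (Some i)) : pdisc UNIV ro"
  proof -
   have "norm (h None) ^ w i * norm (h (Some i)) <= 1 * ro" for i
    using hN by (intro mult_mono power_le_one) auto
   then show ?thesis by (simp add: pdisc_def norm_mult norm_power)
  qed
  then have "((%q. c q * mmon UNIV (%i. h None ^ w i * h (Some i)) q) has_sum f (%i. h None ^ w i * h (Some i))) UNIV"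
   using ro(2) by (simp add: pseries_def MU)
  from has_sum_cmult_right[OF this, of "h None ^ e"]
  have "((%q. h None ^ N * T h q) has_sum h None ^ e * f (%i. h None ^ w i * h (Some i))) UNIV"
  proof (rule iffD1[OF has_sum_cong, rotated -1])
   fix q :: "'i => nat"
   have m: "mmon UNIV (%i. h None ^ w i * h (Some i)) q = h None ^ (SUM i:UNIV. w i * q i) * mmon UNIV (%i. h (Some i)) q"
    by (simp add: mmon_def power_mult_distrib prod.distrib power_sum power_mult)
   show "h None ^ e * (c q * mmon UNIV (%i. h None ^ w i * h (Some i)) q) = h None ^ N * T h q"
   proof (cases "c q = 0")
    case False
    from N[OF this] have "h None ^ N * h None ^ (wt q - N) = h None ^ wt q"
     by (simp add: wt_def flip: power_add)
    then show ?thesis unfolding m T_def by (simp add: wt_def power_add mult_ac)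
   qed (simp add: T_def)
  qed
  moreover have "((%q. h None ^ N * T h q) has_sum h None ^ N * g h) UNIV"
   by (rule has_sum_cmult_right[OF Tg[OF hN]])
  ultimately show ?thesis by (rule has_sum_unique)
 qed
 then have ev: "\<forall>\<^sub>F h in nb UNIV. h None ^ e * f (%i. h None ^ w i * h (Some i)) = h None ^ N * g h"
  unfolding eventually_nb using r(1) by blast
 have "((%q. (if (SUM i:UNIV. w i * q i) + e = N then c q else 0) * mmon UNIV (%i. h (Some i)) q) has_sum g h) UNIV"
  if "ALL i. norm (h (Some i)) <= ro" "h None = 0" for h
 proof -
  have "(T h has_sum g h) UNIV" using that by (intro Tg) auto
  moreover have "T h = (%q. (if (SUM i:UNIV. w i * q i) + e = N then c q else 0) * mmon UNIV (%i. h (Some i)) q)"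
  proof
   fix q :: "'i => nat"
   show "T h q = (if (SUM i:UNIV. w i * q i) + e = N then c q else 0) * mmon UNIV (%i. h (Some i)) q"
   proof (cases "c q = 0")
    case False
    from N[OF this] show ?thesis using that(2) by (auto simp: T_def wt_def)
   qed (simp add: T_def)
  qed
  ultimately show ?thesis by (simp only:)
 qed
 with an ev show ?thesis by (rule that)
qed

context pde
begin

subsection \<open>Scaling the solutions\<close>

text \<open>The scaling \<open>x \<mapsto> \<epsilon> x\<close>, \<open>u \<mapsto> \<epsilon>\<^bsup>\<kappa> - 1\<^esup> u\<close>, where the parameter \<open>\<epsilon>\<close> is stored in the variable \<open>tv\<close>,
  on which \<open>U0\<close> does not depend.\<close>

definition dl :: "(('n, 'm) wvar => 'k) => ('n, 'm) wvar => 'k" where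
 "dl h i = (case i of
   Inl c => (case c of Xc l => 0 | Uc j be => h tv ^ (\<kappa> - 1 - mdeg be) * h i)
  | Inr l' => (case l' of None => 0 | Some l => h tv * h i))"

lemma dl_simps [simp]:
 "dl h (zv (Xc l)) = 0" "dl h (zv (Uc j be)) = h tv ^ (\<kappa> - 1 - mdeg be) * h (zv (Uc j be))"
 "dl h tv = 0" "dl h (xv l) = h tv * h (xv l)"
 by (simp_all add: dl_def)

lemma dl_analytic0: "i : WC ==> analytic0 WC (%h. dl h i)"
proof -
 assume i: "i : WC"
 have c: "analytic0 WC (%h :: ('n, 'm) wvar => 'k. h i)" by (rule analytic0_coord[OF finite_WC i])
 have t: "analytic0 WC (%h :: ('n, 'm) wvar => 'k. h tv)" by (rule analytic0_coord[OF finite_WC]) auto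
 show ?thesis
 proof (cases i)
  case (Inl c')
  then show ?thesis using c t by (cases c') (auto simp: dl_def intro!: analytic0_mult analytic0_power)
 next
  case (Inr l')
  then show ?thesis using c t by (cases l') (auto simp: dl_def intro!: analytic0_mult)
 qed
qed

lemma dl_zero: "dl (%_. 0) i = 0"
 by (auto simp: dl_def split: sum.splits jcoord.splits option.splits)

lemma eventually_dl:
 assumes "eventually P (nb WC)"
 shows "\<forall>\<^sub>F h in nb WC. P (dl h)"
 by (rule eventually_nb_compose[where g = "%i h. dl h i", OF finite_WC finite_WC dl_analytic0 dl_zero assms])

lemma analytic0_dl:
 assumes "analytic0 WC f"
 shows "analytic0 WC (%h. f (dl h))"
 by (rule analytic0_compose[where g = "%i h. dl h i", OF finite_WC finite_WC assms dl_analytic0 dl_zero])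

lemma dl_upd: "dl (h(xv l := t)) = (dl h)(xv l := h tv * t)"
 by (rule ext) (auto simp: dl_def split: sum.splits jcoord.splits option.splits)

lemma jml_dl:
 assumes f: "analytic0 WC f" and "set is \<subseteq> range xv"
 shows "\<forall>\<^sub>F h in nb WC. jml is (%h. f (dl h)) h = h tv ^ length is * jml is f (dl h)"
 using assms(2)
proof (induction "is")
 case (Cons i "is")
 then obtain l where i: "i = xv l" by auto
 have iW: "i : WC" using i by auto
 define g where "g = jml is f"
 have g: "analytic0 WC g" unfolding g_def
  by (rule analytic0_jml[OF finite_WC _ f]) (use Cons.prems in auto)
 have pw: "analytic0 WC (%h :: ('n, 'm) wvar => 'k. h tv ^ length is)"
  by (intro analytic0_power analytic0_coord finite_WC) auto
 have z: "jpartial i (%h. h tv ^ length is) h = (0 :: 'k)" for h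
  by (simp add: jpartial_def i)
 have IH: "\<forall>\<^sub>F h in nb WC. jml is (%h. f (dl h)) h = h tv ^ length is * g (dl h)"
  using Cons unfolding g_def by simp
 have 2: "\<forall>\<^sub>F h in nb WC. jpartial i (%h. h tv ^ length is * g (dl h)) h =
   jpartial i (%h. h tv ^ length is) h * g (dl h) + h tv ^ length is * jpartial i (%h. g (dl h)) h"
  by (rule eventually_jpartial_mult[OF finite_WC iW pw analytic0_dl[OF g]])
 show ?case using eventually_jpartial_cong[OF IH, of i] 2
   eventually_dl[OF eventually_has_field_derivative_jpartial[OF finite_WC iW g]]
 proof eventually_elim
  case (elim h)
  have "((%t. g ((dl h)(xv l := h tv * t))) has_field_derivative jpartial i g (dl h) * h tv) (at (h (xv l)))"
  proof (rule DERIV_chain2[where f = "%s. g ((dl h)(xv l := s))"])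
   show "((%s. g ((dl h)(xv l := s))) has_field_derivative jpartial i g (dl h)) (at (h tv * h (xv l)))"
    using elim(3) unfolding i by simp
   show "((%t. h tv * t) has_field_derivative h tv) (at (h (xv l)))"
    by (auto intro!: derivative_eq_intros)
  qed
  then have "jpartial i (%h. g (dl h)) h = jpartial i g (dl h) * h tv"
   unfolding i jpartial_def dl_upd by (rule DERIV_imp_deriv)
  then show ?case using elim(1,2) by (simp add: z g_def)
 qed
qed simp

lemma jm_dl:
 assumes f: "analytic0 WC f"
 shows "\<forall>\<^sub>F h in nb WC. jm aa (%h. f (dl h)) h = h tv ^ mdeg aa * jm aa f (dl h)"
 using jml_dl[OF f set_xlist, of aa] by (simp add: jm_def' length_xlist)

lemma U0val_analytic0: "mdeg be <= \<kappa> ==> analytic0 WC (U0val j be)"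
proof -
 assume b: "mdeg be <= \<kappa>"
 show ?thesis
 proof (cases "mdeg be <= \<kappa> - 1")
  case True
  then show ?thesis using U0_analytic0[of "Uc j be"] by (simp add: U0val_def[abs_def])
 next
  case False
  then have "mdeg be = \<kappa>" using b by simp
  from analytic0_compose[where g = "%d h. U0 d h", OF finite_WC finite_jcoords F_analytic0[OF this, of j] U0_analytic0 U0_zero] False
  show ?thesis by (simp add: U0val_def[abs_def])
 qed
qed

lemma jm_analytic: "analytic0 WC f ==> analytic0 WC (jm be f)"
 for f :: "(('n, 'm) wvar => 'k) => 'k"
 unfolding jm_def' by (rule analytic0_jml[OF finite_WC]) (use set_xlist in auto)

lemma tv_power_analytic0: "analytic0 WC (%h :: ('n, 'm) wvar => 'k. h tv ^ k)"
 by (intro analytic0_power analytic0_coord finite_WC) auto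

lemma eventually_cancel_tv:
 fixes f g :: "(('n, 'm) wvar => 'k) => 'k"
 assumes "analytic0 WC f" "analytic0 WC g" "\<forall>\<^sub>F h in nb WC. h tv ^ k * f h = h tv ^ k * g h"
 shows "\<forall>\<^sub>F h in nb WC. f h = g h"
proof -
 have "\<forall>\<^sub>F h in nb WC. h tv ^ k * (f h - g h) = 0"
  using assms(3) by eventually_elim (simp add: algebra_simps)
 then have "\<forall>\<^sub>F h in nb WC. f h - g h = 0"
  by (intro eventually_cancel[of WC tv, OF finite_WC _ analytic0_diff[OF assms(1,2)]]) auto
 then show ?thesis by eventually_elim simp
qed

text \<open>\<open>g\<close> is the scaled solution divided by the power \<open>k\<close> of the
  parameter; the multiplicative form keeps its meaning at parameter 0.\<close>

definition divided :: "'m => nat => ((('n, 'm) wvar => 'k) => 'k) => bool" where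
 "divided j k g \<longleftrightarrow> analytic0 WC g & (\<forall>\<^sub>F h in nb WC. U0 (Uc j 0) (dl h) = h tv ^ k * g h)"

lemma divided_jm:
 assumes "divided j k g" "mdeg be <= \<kappa>"
 shows "\<forall>\<^sub>F h in nb WC. h tv ^ mdeg be * U0val j be (dl h) = h tv ^ k * jm be g h"
proof -
 have g: "analytic0 WC g" and e: "\<forall>\<^sub>F h in nb WC. U0 (Uc j 0) (dl h) = h tv ^ k * g h"
  using assms by (auto simp: divided_def)
 have "\<forall>\<^sub>F h in nb WC. jm be (%h. U0 (Uc j 0) (dl h)) h = jm be (%h. h tv ^ k * g h) h"
  unfolding jm_def' by (rule eventually_jml_cong[OF e])
 moreover have "\<forall>\<^sub>F h in nb WC. jm be (%h. h tv ^ k * g h) h = h tv ^ k * jm be g h"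
  unfolding jm_def' by (rule jml_pull_tv[OF finite_jcoords g set_xlist])
 moreover have "\<forall>\<^sub>F h in nb WC. jm be (%h. U0 (Uc j 0) (dl h)) h = h tv ^ mdeg be * jm be (U0 (Uc j 0)) (dl h)"
  by (rule jm_dl) (simp add: U0_analytic0)
 ultimately show ?thesis using eventually_dl[OF jm_U0] by eventually_elim (use assms(2) in simp)
qed

lemma divided_jm_high:
 assumes "divided j k g" "k <= mdeg be" "mdeg be <= \<kappa>"
 shows "\<forall>\<^sub>F h in nb WC. jm be g h = h tv ^ (mdeg be - k) * U0val j be (dl h)"
proof (rule eventually_cancel_tv)
 have g: "analytic0 WC g" using assms by (simp add: divided_def)
 show "analytic0 WC (jm be g)" by (rule jm_analytic[OF g])
 show "analytic0 WC (%h. h tv ^ (mdeg be - k) * U0val j be (dl h))"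
  by (intro analytic0_mult tv_power_analytic0 analytic0_dl U0val_analytic0 assms(3))
 have pw: "h tv ^ k * h tv ^ (mdeg be - k) = h tv ^ mdeg be" for h :: "('n, 'm) wvar => 'k"
  using assms(2) by (simp flip: power_add)
 show "\<forall>\<^sub>F h in nb WC. h tv ^ k * jm be g h = h tv ^ k * (h tv ^ (mdeg be - k) * U0val j be (dl h))"
  using divided_jm[OF assms(1,3)] by eventually_elim (simp add: mult.assoc[symmetric] pw)
qed

definition x0 :: "(('n, 'm) wvar => 'k) => ('n, 'm) wvar => 'k" where
 "x0 h i = (case i of Inl c => h i | Inr l' => (case l' of None => h i | Some l => 0))"

lemma x0_simps [simp]: "x0 h (zv c) = h (zv c)" "x0 h tv = h tv" "x0 h (xv l) = 0"
 by (simp_all add: x0_def)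

lemma x0_ident: "(ALL l. h (xv l) = 0) ==> x0 h = h"
 by (rule ext) (auto simp: x0_def split: sum.splits option.splits)

lemma x0_analytic0: "i : WC ==> analytic0 WC (%h. x0 h i)"
 using analytic0_coord[OF finite_WC, of i]
 by (cases i; cases "projr i") (auto simp: x0_def)

lemma x0_zero: "x0 (%_. 0) i = 0"
 by (auto simp: x0_def split: sum.splits option.splits)

text \<open>Cancelling powers of \<open>tv\<close> works for germs but not for identities on
  \<open>x = 0\<close> alone; substituting \<open>x0\<close> turns the latter into the
  former.\<close>

lemma divided_jm_low:
 assumes "divided j k g" "mdeg be <= k" "k <= \<kappa> - 1"
 shows "\<forall>\<^sub>F h in nb WC. (ALL l. h (xv l) = 0) --> jm be g h = h tv ^ (\<kappa> - 1 - k) * h (zv (Uc j be))"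
proof -
 have g: "analytic0 WC g" using assms by (simp add: divided_def)
 have b: "mdeg be <= \<kappa>" "mdeg be <= \<kappa> - 1" using assms by auto
 have ev: "\<forall>\<^sub>F h in nb WC. P (x0 h)" if "eventually P (nb WC)" for P
  by (rule eventually_nb_compose[where g = "%i h. x0 h i", OF finite_WC finite_WC x0_analytic0 x0_zero that])
 have "\<forall>\<^sub>F h in nb WC. jm be g (x0 h) = h tv ^ (\<kappa> - 1 - k) * h (zv (Uc j be))"
 proof (rule eventually_cancel_tv)
  show "analytic0 WC (%h. jm be g (x0 h))"
   by (rule analytic0_compose[where g = "%i h. x0 h i", OF finite_WC finite_WC jm_analytic[OF g] x0_analytic0 x0_zero])
  have "zv (Uc j be) : WC" using b by auto
  then show "analytic0 WC (%h :: ('n, 'm) wvar => 'k. h tv ^ (\<kappa> - 1 - k) * h (zv (Uc j be)))"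
   by (intro analytic0_mult tv_power_analytic0 analytic0_coord finite_WC)
  show "\<forall>\<^sub>F h in nb WC. h tv ^ k * jm be g (x0 h) = h tv ^ k * (h tv ^ (\<kappa> - 1 - k) * h (zv (Uc j be)))"
   using ev[OF divided_jm[OF assms(1) b(1)]] ev[OF eventually_dl[OF U0_init]]
  proof eventually_elim
   case (elim h)
   have "U0val j be (dl (x0 h)) = h tv ^ (\<kappa> - 1 - mdeg be) * h (zv (Uc j be))"
    using elim(2) b by (simp add: U0val_def)
   then have "h tv ^ k * jm be g (x0 h) = h tv ^ (mdeg be + (\<kappa> - 1 - mdeg be)) * h (zv (Uc j be))"
    using elim(1) by (simp add: power_add mult.assoc)
   also have "mdeg be + (\<kappa> - 1 - mdeg be) = k + (\<kappa> - 1 - k)" using b assms(3) by simp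
   finally show ?case by (simp only: power_add mult.assoc)
  qed
 qed
 then show ?thesis by eventually_elim (auto simp: x0_ident)
qed

text \<open>One power at a time. At parameter 0 the quotient has zero derivatives of order
  \<open>k + 1\<close>, because a factor of the parameter is left over there, and zero derivatives
  of lower order at \<open>x = 0\<close>, because \<open>k < \<kappa> - 1\<close>. So its Taylor
  polynomial is 0 and another division is possible.\<close>

lemma ex_divided: "k <= \<kappa> - 1 ==> EX g. divided j k g"
proof (induction k)
 case 0
 have "divided j 0 (%h. U0 (Uc j 0) (dl h))"
  unfolding divided_def by (auto intro!: analytic0_dl U0_analytic0)
 then show ?case by blast
next
 case (Suc k)
 then obtain g where g: "divided j k g" by auto
 then have ga: "analytic0 WC g" by (simp add: divided_def)
 have k: "Suc k <= \<kappa> - 1" by fact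
 then have le: "Suc k <= \<kappa>" and pos: "0 < \<kappa> - 1 - k" by linarith+
 have "\<forall>\<^sub>F h in nb WC. h tv = 0 --> g h = 0"
 proof (rule jm_polynomial_zero[OF finite_jcoords ga, where K = "Suc k"])
  fix aa :: "'n mindex" assume "mdeg aa = Suc k"
  then show "\<forall>\<^sub>F h in nb WC. h tv = 0 --> jm aa g h = 0"
   using divided_jm_high[OF g, of aa] le by (auto elim!: eventually_mono)
 next
  fix be :: "'n mindex" assume "mdeg be < Suc k"
  then have "\<forall>\<^sub>F h in nb WC. (ALL l. h (xv l) = 0) --> jm be g h = h tv ^ (\<kappa> - 1 - k) * h (zv (Uc j be))"
   using divided_jm_low[OF g, of be] k by simp
  then show "\<forall>\<^sub>F h in nb WC. h tv = 0 --> (ALL l. h (xv l) = 0) --> jm be g h = 0"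
   by eventually_elim (use pos in \<open>auto simp: zero_power\<close>)
 qed
 then obtain g' where g': "analytic0 WC g'" "\<forall>\<^sub>F h in nb WC. g h = h tv * g' h"
  using analytic0_div[OF finite_WC _ ga, of tv] by auto
 have "\<forall>\<^sub>F h in nb WC. U0 (Uc j 0) (dl h) = h tv ^ Suc k * g' h"
  using g'(2) g[unfolded divided_def, THEN conjunct2] by eventually_elim (simp add: mult_ac)
 then show ?case using g'(1) unfolding divided_def by blast
qed

text \<open>The rescaled solution \<open>\<epsilon>^(1 - \<kappa>) u(\<epsilon> x)\<close>,
  continued analytically to \<open>\<epsilon> = 0\<close>, where it becomes the polynomial with the
  prescribed derivatives at the origin.\<close>

definition ut :: "'m => (('n, 'm) wvar => 'k) => 'k" where
 "ut j = (SOME g. divided j (\<kappa> - 1) g)"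

lemma divided_ut: "divided j (\<kappa> - 1) (ut j)"
 unfolding ut_def by (rule someI_ex[OF ex_divided]) simp

lemma ut_analytic0: "analytic0 WC (ut j)"
 and U0_dl: "\<forall>\<^sub>F h in nb WC. U0 (Uc j 0) (dl h) = h tv ^ (\<kappa> - 1) * ut j h"
 using divided_ut unfolding divided_def by auto

lemma ut_top:
 assumes "mdeg aa = \<kappa>"
 shows "\<forall>\<^sub>F h in nb WC. h tv = 0 --> jm aa (ut j) h = 0"
proof -
 have "\<kappa> - (\<kappa> - 1) = Suc 0" using order by simp
 with divided_jm_high[OF divided_ut, of aa j] assms show ?thesis
  by (auto elim!: eventually_mono)
qed

lemma ut_low:
 assumes "mdeg be < \<kappa>"
 shows "\<forall>\<^sub>F h in nb WC. (ALL l. h (xv l) = 0) --> jm be (ut j) h = h (zv (Uc j be))"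
proof -
 have "mdeg be <= \<kappa> - 1" using assms by simp
 with divided_jm_low[OF divided_ut, of be j] show ?thesis by simp
qed

lemma ut_zero: "ut j (%_. 0) = 0"
 using eventually_nb_zero[OF ut_low[of 0 j]] order by simp

lemma jpartial_U0_dl:
 "\<forall>\<^sub>F h in nb WC. jpartial (xv l) (U0 (Uc j 0)) (dl h) = h tv ^ (\<kappa> - 2) * jpartial (xv l) (ut j) h"
proof (rule eventually_cancel_tv[where k = 1])
 have xl: "xv l : WC" by auto
 have U: "analytic0 WC (U0 (Uc j 0))" by (rule U0_analytic0) simp
 show "analytic0 WC (%h. jpartial (xv l) (U0 (Uc j 0)) (dl h))"
  by (intro analytic0_dl analytic0_jpartial finite_WC xl U)
 show "analytic0 WC (%h. h tv ^ (\<kappa> - 2) * jpartial (xv l) (ut j) h)"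
  by (intro analytic0_mult tv_power_analytic0 analytic0_jpartial finite_WC xl ut_analytic0)
 have s: "set [xv l] \<subseteq> range (xv :: 'n => ('n, 'm) wvar)" by auto
 have p: "h tv ^ (\<kappa> - 1) = h tv * h tv ^ (\<kappa> - 2)" for h :: "('n, 'm) wvar => 'k"
 proof -
  have "\<kappa> - 1 = Suc (\<kappa> - 2)" using order by simp
  then show ?thesis by (simp only: power_Suc)
 qed
 show "\<forall>\<^sub>F h in nb WC. h tv ^ 1 * jpartial (xv l) (U0 (Uc j 0)) (dl h) =
   h tv ^ 1 * (h tv ^ (\<kappa> - 2) * jpartial (xv l) (ut j) h)"
  using jml_dl[OF U s] eventually_jml_cong[OF U0_dl[of j], of "[xv l]"] jml_pull_tv[OF finite_jcoords ut_analytic0 s, of "\<kappa> - 1" j]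
  by eventually_elim (simp add: p mult.assoc)
qed

subsection \<open>Leading terms\<close>

definition wgt :: "'n + 'm => nat" where
 "wgt c = (case c of Inl l => 1 | Inr j => \<kappa> - 1)"

text \<open>The offset levels the two kinds of components:
  \<open>wgt c + edef c = \<kappa> - 1\<close> for every \<open>c\<close>, so that
  \<open>Q^l u_l\<close> and \<open>R^j\<close> are compared in the same weight.\<close>

definition edef :: "'n + 'm => nat" where
 "edef c = (case c of Inl l => \<kappa> - 2 | Inr j => 0)"

definition wt :: "('n + 'm => nat) => nat" where
 "wt q = (SUM i:UNIV. wgt i * q i)"

lemma wgt_simps [simp]: "wgt (Inl l) = 1" "wgt (Inr j) = \<kappa> - 1"
 and edef_simps [simp]: "edef (Inl l) = \<kappa> - 2" "edef (Inr j) = 0"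
 by (simp_all add: wgt_def edef_def)

definition pth :: "(('n, 'm) wvar => 'k) => ('n + 'm) option => 'k" where
 "pth h i = (case i of None => h tv | Some c => (case c of Inl l => h (xv l) | Inr j => ut j h))"

lemma pth_simps [simp]: "pth h None = h tv" "pth h (Some (Inl l)) = h (xv l)" "pth h (Some (Inr j)) = ut j h"
 by (simp_all add: pth_def)

lemma pth_analytic0: "analytic0 WC (%h. pth h i)"
proof (cases i)
 case (Some c)
 then show ?thesis by (cases c) (auto simp: pth_def ut_analytic0 intro!: analytic0_coord)
qed (auto simp: pth_def intro!: analytic0_coord)

lemma pth_zero: "pth (%_. 0) i = 0"
 by (auto simp: pth_def ut_zero split: option.splits sum.splits)

lemma pt_dl: "\<forall>\<^sub>F h in nb WC. pt (dl h) = (%c. h tv ^ wgt c * pth h (Some c))"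
proof -
 have "\<forall>\<^sub>F h in nb WC. ALL j. U0 (Uc j 0) (dl h) = h tv ^ (\<kappa> - 1) * ut j h"
  by (intro eventually_all_finite U0_dl)
 then show ?thesis
 proof eventually_elim
  case (elim h)
  then show ?case by (auto simp: fun_eq_iff pt_def split: sum.splits)
 qed
qed

definition lead :: "nat => ('n + 'm => ('n + 'm => nat) => 'k) => 'n + 'm => ('n + 'm => 'k) => 'k" where
 "lead N C c p = (\<Sum>q | wt q + edef c = N. C c q * mmon UNIV p q)"

lemma finite_wt: "finite {q. wt q + e = N}"
proof (rule finite_subset)
 show "{q :: 'n + 'm => nat. wt q + e = N} \<subseteq> UNIV \<rightarrow>\<^sub>E {..N}"
 proof
  fix q :: "'n + 'm => nat" assume "q : {q. wt q + e = N}"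
  then have N: "wt q <= N" by simp
  have "q i <= N" for i
  proof -
   have "q i <= wgt i * q i" using order by (cases i) auto
   also have "... <= wt q" unfolding wt_def by (rule member_le_sum) auto
   finally show ?thesis using N by simp
  qed
  then show "q : UNIV \<rightarrow>\<^sub>E {..N}" by auto
 qed
 show "finite (UNIV \<rightarrow>\<^sub>E {..N} :: ('n + 'm => nat) set)" by (rule finite_PiE) auto
qed

end

text \<open>Of a symmetry only the linearized equation is retained. It is linear in
  \<open>X\<close>, so its solutions form a vector space, whereas the flow of a sum of fields is not
  directly accessible.\<close>

locale pde_lin = pde \<kappa> F
 for \<kappa> and F :: "('k::{real_normed_field,euclidean_space}, 'n::finite, 'm::finite) rhs" +
 fixes X :: "'k^('n + 'm) => 'k^('n + 'm)"
 assumes analytic_X: "vec_analytic_at X 0"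
  and linearized: "!!j aa. mdeg aa = \<kappa> ==> \<forall>\<^sub>F h in nb WC. h tv = 0 --> jm aa (charac X j) h =
   (SUM d:JC. jpartial d (F j aa) (%d. U0 d h) * (case d of Xc l => 0 | Uc i be => jm be (charac X i) h))"
begin

lemma charac_analytic0: "analytic0 WC (charac X j)"
proof -
 have "analytic0 WC (%h. vcomp X c (pt h))" for c
  using analytic0_compose[where g = "%i h. pt h i", OF finite_WC finite_class.finite_UNIV
    vcomp_analytic0[OF analytic_X] pt_analytic0 pt_zero] by simp
 then show ?thesis unfolding charac_def
  by (intro analytic0_diff analytic0_sum analytic0_mult analytic0_jpartial finite_WC U0_analytic0) auto
qed

text \<open>\<open>G\<close> is the scaled characteristic divided by \<open>tv^N\<close>.
  Multiplying the linearized equation by \<open>tv^\<kappa>\<close> leaves a positive power of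
  \<open>tv\<close> on each term of the right-hand side, since only orders below
  \<open>\<kappa>\<close> occur there; at \<open>tv = 0\<close> the flat equation remains.\<close>

lemma leading_term:
 assumes ro: "0 < ro" "!!c. pseries UNIV ro (C c) (vcomp X c)"
  and N: "!!c q. C c q ~= 0 ==> N <= wt q + edef c"
 obtains G :: "'m => (('n, 'm) wvar => 'k) => 'k"
 where "ALL j. analytic0 WC (G j)"
  "ALL j. ALL aa. mdeg aa = \<kappa> --> (\<forall>\<^sub>F h in nb WC. h tv = 0 --> jm aa (G j) h = 0)"
  "ALL j. \<forall>\<^sub>F h in nb WC. h tv = 0 --> G j h = lead N C (Inr j) (%c. pth h (Some c)) -
    (SUM l:UNIV. lead N C (Inl l) (%c. pth h (Some c)) * jpartial (xv l) (ut j) h)"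
proof -
 have "EX g. analytic0 UNIV g &
   (\<forall>\<^sub>F h in nb UNIV. h None ^ edef c * vcomp X c (%i. h None ^ wgt i * h (Some i)) = h None ^ N * g h) &
   (ALL h. (ALL i. norm (h (Some i)) <= ro) --> h None = 0 -->
    ((%q. (if wt q + edef c = N then C c q else 0) * mmon UNIV (%i. h (Some i)) q) has_sum g h) UNIV)" for c
 proof (rule weighted_division[OF ro(1) ro(2)[of c], where w = wgt and e = "edef c" and N = N])
  show "N <= (SUM i:UNIV. wgt i * q i) + edef c" if "C c q ~= 0" for q
   using N[OF that] by (simp add: wt_def)
  fix g assume g: "analytic0 UNIV g"
   "\<forall>\<^sub>F h in nb UNIV. h None ^ edef c * vcomp X c (%i. h None ^ wgt i * h (Some i)) = h None ^ N * g h"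
   "!!h. (ALL i. norm (h (Some i)) <= ro) ==> h None = 0 ==>
    ((%q. (if (SUM i:UNIV. wgt i * q i) + edef c = N then C c q else 0) * mmon UNIV (%i. h (Some i)) q) has_sum g h) UNIV"
  show ?thesis by (rule exI[of _ g]) (use g in \<open>simp add: wt_def\<close>)
 qed
 then obtain g where "ALL c. analytic0 UNIV (g c) &
   (\<forall>\<^sub>F h in nb UNIV. h None ^ edef c * vcomp X c (%i. h None ^ wgt i * h (Some i)) = h None ^ N * g c h) &
   (ALL h. (ALL i. norm (h (Some i)) <= ro) --> h None = 0 -->
    ((%q. (if wt q + edef c = N then C c q else 0) * mmon UNIV (%i. h (Some i)) q) has_sum g c h) UNIV)"
  by (rule exE[OF choice[OF allI]])
 then have ga: "!!c. analytic0 UNIV (g c)"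
  and ge: "!!c. \<forall>\<^sub>F h in nb UNIV. h None ^ edef c * vcomp X c (%i. h None ^ wgt i * h (Some i)) = h None ^ N * g c h"
  and gs: "!!c h. (ALL i. norm (h (Some i)) <= ro) ==> h None = 0 ==>
    ((%q. (if wt q + edef c = N then C c q else 0) * mmon UNIV (%i. h (Some i)) q) has_sum g c h) UNIV"
  by auto
 have gp: "analytic0 WC (%h. g c (pth h))" for c
  by (rule analytic0_compose[where g = "%i h. pth h i", OF finite_WC finite_class.finite_UNIV ga pth_analytic0 pth_zero])
 have evp: "\<forall>\<^sub>F h in nb WC. P (pth h)" if "eventually P (nb UNIV)" for P
  by (rule eventually_nb_compose[where g = "%i h. pth h i", OF finite_WC finite_class.finite_UNIV pth_analytic0 pth_zero that])
 define G where "G j h = g (Inr j) (pth h) - (SUM l:UNIV. g (Inl l) (pth h) * jpartial (xv l) (ut j) h)" for j h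
 have Ga: "analytic0 WC (G j)" for j
  unfolding G_def[abs_def]
  by (intro analytic0_diff analytic0_sum analytic0_mult gp analytic0_jpartial finite_WC ut_analytic0) auto
 have vc: "\<forall>\<^sub>F h in nb WC. ALL c. h tv ^ edef c * vcomp X c (pt (dl h)) = h tv ^ N * g c (pth h)"
 proof (intro eventually_all_finite)
  fix c
  show "\<forall>\<^sub>F h in nb WC. h tv ^ edef c * vcomp X c (pt (dl h)) = h tv ^ N * g c (pth h)"
   using evp[OF ge[of c]] pt_dl by eventually_elim simp
 qed
 have WG: "\<forall>\<^sub>F h in nb WC. charac X j (dl h) = h tv ^ N * G j h" for j
 proof -
  have "\<forall>\<^sub>F h in nb WC. ALL l. jpartial (xv l) (U0 (Uc j 0)) (dl h) = h tv ^ (\<kappa> - 2) * jpartial (xv l) (ut j) h"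
   by (intro eventually_all_finite jpartial_U0_dl)
  then show ?thesis using vc
  proof eventually_elim
   case (elim h)
   have 1: "vcomp X (Inr j) (pt (dl h)) = h tv ^ N * g (Inr j) (pth h)"
    using elim(2)[rule_format, of "Inr j"] by simp
   have 2: "vcomp X (Inl l) (pt (dl h)) * jpartial (xv l) (U0 (Uc j 0)) (dl h) =
     h tv ^ N * (g (Inl l) (pth h) * jpartial (xv l) (ut j) h)" for l
    using elim(2)[rule_format, of "Inl l"] elim(1) by (simp add: mult_ac)
   show ?case unfolding charac_def G_def 1 2 by (simp add: sum_distrib_left right_diff_distrib)
  qed
 qed
 have jmW: "\<forall>\<^sub>F h in nb WC. h tv ^ mdeg be * jm be (charac X j) (dl h) = h tv ^ N * jm be (G j) h" for be j
 proof -
  have "\<forall>\<^sub>F h in nb WC. jm be (%h. charac X j (dl h)) h = jm be (%h. h tv ^ N * G j h) h"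
   unfolding jm_def' by (rule eventually_jml_cong[OF WG])
  moreover have "\<forall>\<^sub>F h in nb WC. jm be (%h. h tv ^ N * G j h) h = h tv ^ N * jm be (G j) h"
   unfolding jm_def' by (rule jml_pull_tv[OF finite_jcoords Ga set_xlist])
  ultimately show ?thesis using jm_dl[OF charac_analytic0, of be j] by eventually_elim simp
 qed
 have top: "\<forall>\<^sub>F h in nb WC. h tv = 0 --> jm aa (G j) h = 0" if aa: "mdeg aa = \<kappa>" for aa j
 proof -
  define A where "A d h = jpartial d (F j aa) (%d. U0 d (dl h))" for d h
  \<comment> \<open>On \<open>JC\<close> the exponent \<open>\<kappa> - mdeg be\<close> is at least
    1, which makes the right-hand side vanish at \<open>tv = 0\<close>.\<close>
  define T where "T d h = (case d of Xc l => 0 | Uc i be => h tv ^ (\<kappa> - mdeg be) * jm be (G i) h)" for d h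
  have Aa: "analytic0 WC (A d)" if d: "d : JC" for d
   unfolding A_def[abs_def]
   by (rule analytic0_dl[OF analytic0_compose[where g = "%d h. U0 d h", OF finite_WC finite_jcoords
      analytic0_jpartial[OF finite_jcoords d F_analytic0[OF aa]] U0_analytic0 U0_zero]])
  have Ta: "analytic0 WC (T d)" for d
   by (cases d) (auto simp: T_def[abs_def] intro!: analytic0_mult tv_power_analytic0 jm_analytic Ga)
  have "\<forall>\<^sub>F h in nb WC. ALL d:JC. h tv ^ \<kappa> * (case d of Xc l => 0 | Uc i be => jm be (charac X i) (dl h)) = h tv ^ N * T d h"
  proof (intro eventually_ball_finite ballI finite_jcoords)
   fix d :: "('n, 'm) jcoord" assume d: "d : JC"
   show "\<forall>\<^sub>F h in nb WC. h tv ^ \<kappa> * (case d of Xc l => 0 | Uc i be => jm be (charac X i) (dl h)) = h tv ^ N * T d h"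
   proof (cases d)
    case (Uc i be)
    then have b: "mdeg be <= \<kappa>" using d by simp
    have p: "h tv ^ \<kappa> = h tv ^ (\<kappa> - mdeg be) * h tv ^ mdeg be" for h :: "('n, 'm) wvar => 'k"
     using b by (simp flip: power_add)
    show ?thesis using jmW[of be i] by eventually_elim (simp add: Uc T_def p mult_ac)
   qed (simp add: T_def)
  qed
  then have e: "\<forall>\<^sub>F h in nb WC. h tv ^ N * jm aa (G j) h = h tv ^ N * (SUM d:JC. A d h * T d h)"
   using jmW[of aa j] eventually_dl[OF linearized[OF aa, of j]]
  proof eventually_elim
   case (elim h)
   have "h tv ^ N * jm aa (G j) h = h tv ^ \<kappa> * jm aa (charac X j) (dl h)" using elim(2) aa by simp
   also have "... = h tv ^ \<kappa> * (SUM d:JC. A d h * (case d of Xc l => 0 | Uc i be => jm be (charac X i) (dl h)))"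
    unfolding A_def using elim(3) by simp
   also have "... = (SUM d:JC. A d h * (h tv ^ \<kappa> * (case d of Xc l => 0 | Uc i be => jm be (charac X i) (dl h))))"
    by (simp add: sum_distrib_left mult.left_commute)
   also have "... = (SUM d:JC. A d h * (h tv ^ N * T d h))"
    by (rule sum.cong) (use elim(1) in auto)
   finally show ?case by (simp add: sum_distrib_left mult.left_commute)
  qed
  have "\<forall>\<^sub>F h in nb WC. jm aa (G j) h = (SUM d:JC. A d h * T d h)"
   by (rule eventually_cancel_tv[OF jm_analytic[OF Ga] analytic0_sum[OF finite_jcoords analytic0_mult[OF Aa Ta]] e])
  then show ?thesis
  proof eventually_elim
   case (elim h)
   show ?case
   proof
    assume t: "h tv = 0"
    have "T d h = 0" if "d : JC" for d
     using that t order by (cases d) (auto simp: T_def power_0_left)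
    then show "jm aa (G j) h = 0" using elim by simp
   qed
  qed
 qed
 have val: "\<forall>\<^sub>F h in nb WC. h tv = 0 --> G j h = lead N C (Inr j) (%c. pth h (Some c)) -
    (SUM l:UNIV. lead N C (Inl l) (%c. pth h (Some c)) * jpartial (xv l) (ut j) h)" for j
 proof -
  have "\<forall>\<^sub>F h in nb UNIV. ALL i. norm (h (Some i)) <= ro"
   unfolding eventually_nb using ro(1) by (auto simp: pdisc_def)
  from evp[OF this] show ?thesis
  proof eventually_elim
   case (elim h)
   show ?case
   proof
    assume t: "h tv = 0"
    have "g c (pth h) = lead N C c (%c. pth h (Some c))" for c
    proof -
     have "((%q. (if wt q + edef c = N then C c q else 0) * mmon UNIV (%i. pth h (Some i)) q) has_sum g c (pth h)) UNIV"
      by (rule gs) (use elim t in auto)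
     then have "((%q. C c q * mmon UNIV (%i. pth h (Some i)) q) has_sum g c (pth h)) {q. wt q + edef c = N}"
      by (rule has_sum_cong_neutral[THEN iffD1, rotated -1]) auto
     then show ?thesis unfolding lead_def by (simp add: has_sum_finite_iff[OF finite_wt])
    qed
    then show "G j h = lead N C (Inr j) (%c. pth h (Some c)) -
    (SUM l:UNIV. lead N C (Inl l) (%c. pth h (Some c)) * jpartial (xv l) (ut j) h)"
     by (simp add: G_def)
   qed
  qed
 qed
 show ?thesis by (rule that[of G]) (use Ga top val in auto)
qed

end

section \<open>The flat equation\<close>

lemma ex_poly_antiderivative:
 fixes q :: "'k::field_char_0 poly"
 assumes "!!i. k <= i ==> coeff q i = 0"
 obtains P where "pderiv P = q" "!!i. Suc k <= i ==> coeff P i = 0"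
proof -
 define P where "P = (\<Sum>i\<le>degree q. monom (coeff q i / of_nat (Suc i)) (Suc i))"
 have P: "coeff P (Suc n) = coeff q n / of_nat (Suc n)" for n
 proof -
  have "coeff P (Suc n) = (\<Sum>i\<le>degree q. if i = n then coeff q i / of_nat (Suc i) else 0)"
   unfolding P_def coeff_sum by (rule sum.cong) auto
  also have "... = (if n <= degree q then coeff q n / of_nat (Suc n) else 0)"
   by (subst sum.delta) auto
  also have "... = coeff q n / of_nat (Suc n)"
   using coeff_eq_0[of q n] by auto
  finally show ?thesis .
 qed
 show ?thesis
 proof (rule that)
  have "coeff (pderiv P) n = coeff q n" for n
   unfolding coeff_pderiv P using of_nat_neq_0[of n, where 'a = 'k] by (simp del: of_nat_Suc)
  then show "pderiv P = q" by (rule poly_eqI)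
  fix i assume "Suc k <= i"
  then obtain n where "i = Suc n" "k <= n" by (cases i) auto
  then show "coeff P i = 0" using P[of n] assms[of n] by simp
 qed
qed

lemma coeff_monom_mult_linear_power:
 fixes a b :: "'k::idom"
 shows "coeff (monom 1 n * [:a, b:] ^ m) (n + m) = b ^ m"
proof -
 have "coeff ([:a, b:] ^ m) m = b ^ m & degree ([:a, b:] ^ m) <= m"
 proof (induction m)
  case (Suc m)
  have "coeff ([:a, b:] ^ Suc m) (Suc m) = b ^ Suc m"
   using Suc coeff_eq_0[of "[:a, b:] ^ m" "Suc m"] by simp
  moreover have "degree ([:a, b:] * [:a, b:] ^ m) <= 1 + m"
   by (rule order_trans[OF degree_mult_le add_mono]) (use Suc in auto)
  ultimately show ?case by simp
 qed simp
 then show ?thesis by (simp add: coeff_monom_mult)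
qed

lemma poly_eq_on_ball:
 fixes p q :: "'k::{real_normed_field} poly"
 assumes "!!t. norm t < 1 ==> poly p t = poly q t"
 shows "p = q"
proof (rule ccontr)
 assume "p ~= q"
 then have "finite {t. poly (p - q) t = 0}" by (intro poly_roots_finite) simp
 moreover have "poly (p - q) (of_real (1 / real (n + 2))) = 0" for n :: nat
 proof -
  have "norm (of_real (1 / real (n + 2)) :: 'k) < 1" unfolding norm_of_real by simp
  from assms[OF this] show ?thesis by (simp only: poly_diff diff_self)
 qed
 then have "(%n. of_real (1 / real (n + 2))) ` UNIV \<subseteq> {t. poly (p - q) t = 0}" by blast
 ultimately have "finite (range (%n. of_real (1 / real (n + 2)) :: 'k))" by (rule finite_subset[rotated])
 moreover have "inj (%n. of_real (1 / real (n + 2)) :: 'k)"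
  by (rule injI) (simp only: of_real_eq_iff, simp add: field_simps)
 ultimately show False using finite_imageD infinite_UNIV_nat by blast
qed

lemma pseries_mult_coord:
 fixes f :: "('i => 'k) => 'k::{real_normed_field,banach}"
 assumes "finite I" "i : I" "pseries I ro c f"
 shows "pseries I ro (%q. if q i = 0 then 0 else c (q(i := q i - 1))) (%h. h i * f h)"
proof -
 let ?d = "%q. if q i = 0 then 0 else c (q(i := q i - 1))"
 have s: "sum (p(i := p i + 1)) I = sum p I + 1" for p :: "'i => nat"
 proof -
  have "sum (p(i := p i + 1)) I = (p i + 1) + sum (p(i := p i + 1)) (I - {i})"
   using assms by (simp add: sum.remove)
  also have "sum (p(i := p i + 1)) (I - {i}) = sum p (I - {i})" by (rule sum.cong) auto
  finally show ?thesis using sum.remove[OF assms(1,2), of p] by simp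
 qed
 have dd: "?d (p(i := p i + 1)) = c p" for p by simp
 have "(%p. norm (c p) * ro ^ sum p I * ro) summable_on mindices I"
  using assms(3) by (intro summable_on_cmult_left) (simp add: pseries_def)
 then obtain x where "((%p. norm (c p) * ro ^ sum p I * ro) has_sum x) (mindices I)"
  by (auto simp: summable_on_def)
 then have "((%p. norm (?d (p(i := p i + 1))) * ro ^ sum (p(i := p i + 1)) I) has_sum x) (mindices I)"
  by (simp only: s dd power_add power_one_right mult.assoc)
 then have "((%q. norm (?d q) * ro ^ sum q I) has_sum x) {p : mindices I. p i > 0}"
  by (subst has_sum_shift_index[OF assms(2)])
 then have "((%q. norm (?d q) * ro ^ sum q I) has_sum x) (mindices I)"
  by (rule has_sum_cong_neutral[THEN iffD1, rotated -1]) auto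
 moreover have "((%q. ?d q * mmon I h q) has_sum h i * f h) (mindices I)" if h: "h : pdisc I ro" for h
 proof -
  have "((%p. c p * mmon I h p) has_sum f h) (mindices I)" using assms(3) h by (auto simp: pseries_def)
  from has_sum_cmult_right[OF this, of "h i"]
  have "((%p. ?d (p(i := p i + 1)) * mmon I h (p(i := p i + 1))) has_sum h i * f h) (mindices I)"
   by (simp add: mmon_shift[OF assms(1,2), simplified] mult_ac)
  then have "((%q. ?d q * mmon I h q) has_sum h i * f h) {p : mindices I. p i > 0}"
   by (subst has_sum_shift_index[OF assms(2)])
  then show ?thesis
   by (rule has_sum_cong_neutral[THEN iffD1, rotated -1]) auto
 qed
 ultimately show ?thesis unfolding pseries_def by (auto simp: summable_on_def)
qed

lemma pseries_finite:
 fixes c :: "('i::finite => nat) => 'k::{real_normed_field,banach}"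
 assumes "finite A"
 shows "pseries UNIV ro (%q. if q : A then c q else 0) (%h. SUM q:A. c q * mmon UNIV h q)"
proof -
 have M: "mindices UNIV = (UNIV :: ('i => nat) set)" by (simp add: mindices_def)
 have "((%q. (if q : A then c q else 0) * mmon UNIV h q) has_sum (SUM q:A. c q * mmon UNIV h q)) UNIV" for h
  by (rule has_sum_cong_neutral[THEN iffD1, rotated -1, OF has_sum_finite[OF assms]]) auto
 moreover have "((%q. norm (if q : A then c q else 0) * ro ^ sum q UNIV) has_sum (SUM q:A. norm (c q) * ro ^ sum q UNIV)) UNIV"
  by (rule has_sum_cong_neutral[THEN iffD1, rotated -1, OF has_sum_finite[OF assms]]) auto
 ultimately show ?thesis unfolding pseries_def M by (auto simp: summable_on_def)
qed

text \<open>Induction on \<open>k\<close>: along a ray the derivative of \<open>g\<close> is a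
  combination of first partial derivatives, to which the statement for the smaller order applies,
  and an antiderivative raises the degree by one. The size \<open>dt\<close> serves all parameters
  and directions.\<close>

lemma jm_polynomial_on_rays:
 fixes g :: "(('n::finite, 'm::finite) wvar => 'k) => 'k::{real_normed_field,euclidean_space}"
 assumes I: "finite I" and "analytic0 (I <+> UNIV) g"
  and "!!aa. mdeg aa = k ==> \<forall>\<^sub>F h in nb (I <+> UNIV). h tv = 0 --> jm aa g h = 0"
 shows "EX dt>0. ALL z \<eta>. (ALL c:I. norm (z c) <= dt) --> (ALL l. norm (\<eta> $ l) <= dt) -->
  (EX p. (ALL i>=k. coeff p i = 0) & (ALL t. norm t < 1 --> g (wemb 0 z (\<chi> l. t * \<eta> $ l)) = poly p t))"
 using assms(2,3)
proof (induction k arbitrary: g)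
 case 0
 have "\<forall>\<^sub>F h in nb (I <+> UNIV). h tv = 0 --> g h = 0" using "0.prems"(2)[of 0] by simp
 then obtain dt where dt: "0 < dt" and P: "!!h. h : pdisc (I <+> UNIV) dt ==> h tv = 0 --> g h = 0"
  unfolding eventually_nb by blast
 have "g (wemb 0 z (\<chi> l. t * \<eta> $ l)) = poly 0 t"
  if "ALL c:I. norm (z c) <= dt" "ALL l. norm (\<eta> $ l) <= dt" "norm t < 1" for z \<eta> t
 proof -
  have "norm (t * \<eta> $ l) <= 1 * dt" for l unfolding norm_mult using that by (intro mult_mono) auto
  then have "wemb 0 z (\<chi> l. t * \<eta> $ l) : pdisc (I <+> UNIV) dt"
   unfolding wemb_pdisc using that dt by simp
  then show ?thesis using P by simp
 qed
 then show ?case by (intro exI[of _ dt] conjI dt allI impI exI[of _ 0]) auto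
next
 case (Suc k)
 have fin: "finite (I <+> (UNIV :: 'n option set))" using I by simp
 have xl: "xv l : I <+> (UNIV :: 'n option set)" for l by auto
 let ?g = "%l. jpartial (xv l) g"
 have ga: "analytic0 (I <+> UNIV) (?g l)" for l by (rule analytic0_jpartial[OF fin xl Suc.prems(1)])
 have gt: "\<forall>\<^sub>F h in nb (I <+> UNIV). h tv = 0 --> jm aa (?g l) h = 0" if "mdeg aa = k" for aa l
 proof -
  have "\<forall>\<^sub>F h in nb (I <+> UNIV). jm aa (?g l) h = jpartial (xv l) (jm aa g) h"
   unfolding jm_def' by (rule eventually_jml_commute[OF fin _ xl Suc.prems(1)]) (use set_xlist in auto)
  moreover have "\<forall>\<^sub>F h in nb (I <+> UNIV). h tv = 0 --> jm (aa + axis l 1) g h = 0"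
   by (rule Suc.prems(2)) (use that in \<open>simp add: mdeg_add\<close>)
  ultimately show ?thesis using jm_step[OF I Suc.prems(1), of l aa]
   by eventually_elim simp
 qed
 have "ALL l. EX dt>0. ALL z \<eta>. (ALL c:I. norm (z c) <= dt) --> (ALL l. norm (\<eta> $ l) <= dt) -->
  (EX p. (ALL i>=k. coeff p i = 0) & (ALL t. norm t < 1 --> ?g l (wemb 0 z (\<chi> l. t * \<eta> $ l)) = poly p t))"
  by (rule allI, rule Suc.IH[OF ga gt])
 from choice[OF this] obtain dt1 where A: "ALL l. 0 < dt1 l & (ALL z \<eta>. (ALL c:I. norm (z c) <= dt1 l) --> (ALL l'. norm (\<eta> $ l') <= dt1 l) -->
  (EX p. (ALL i>=k. coeff p i = 0) & (ALL t. norm t < 1 --> ?g l (wemb 0 z (\<chi> l. t * \<eta> $ l)) = poly p t)))"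
  by (elim exE) (rule that)
 note dt1 = A[THEN spec, THEN conjunct1]
 note IH = A[THEN spec, THEN conjunct2, THEN spec, THEN spec, THEN mp, THEN mp]
 obtain ro M where ro: "0 < ro" "ps_le (I <+> UNIV) ro g M" using Suc.prems(1) by (auto simp: analytic0_def)
 define dt where "dt = min (ro / 2) (Min (range dt1))"
 have dt: "0 < dt" "dt < ro" "!!l. dt <= dt1 l"
 proof -
  show "0 < dt" using ro dt1 by (auto simp: dt_def)
  show "dt < ro" using ro by (auto simp: dt_def)
  show "dt <= dt1 l" for l unfolding dt_def by (rule min.coboundedI2) auto
 qed
 have "EX p. (ALL i>=Suc k. coeff p i = 0) & (ALL t. norm t < 1 --> g (wemb 0 z (\<chi> l. t * \<eta> $ l)) = poly p t)"
  if z: "ALL c:I. norm (z c) <= dt" and \<eta>: "ALL l. norm (\<eta> $ l) <= dt" for z \<eta>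
 proof -
  have "ALL l. EX p. (ALL i>=k. coeff p i = 0) & (ALL t. norm t < 1 --> ?g l (wemb 0 z (\<chi> l. t * \<eta> $ l)) = poly p t)"
   by (intro allI IH) (use z \<eta> dt(3) in \<open>auto intro: order_trans\<close>)
  from choice[OF this] obtain p where A': "ALL l. (ALL i>=k. coeff (p l) i = 0) &
    (ALL t. norm t < 1 --> ?g l (wemb 0 z (\<chi> l. t * \<eta> $ l)) = poly (p l) t)"
   by (elim exE) (rule that)
  have p: "!!l i. k <= i ==> coeff (p l) i = 0"
   "!!l t. norm t < 1 ==> ?g l (wemb 0 z (\<chi> l. t * \<eta> $ l)) = poly (p l) t"
   using A' by blast+
  define q where "q = (SUM l:UNIV. smult (\<eta> $ l) (p l))"
  have "coeff q i = 0" if "k <= i" for i using p(1) that by (simp add: q_def coeff_sum)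
  then obtain P where P: "pderiv P = q" "!!i. Suc k <= i ==> coeff P i = 0"
   using ex_poly_antiderivative by blast
  define f where "f t = g (wemb 0 z (\<chi> l. t * \<eta> $ l))" for t
  have "((%t. f t - poly P t) has_field_derivative 0) (at t within ball 0 1)" if t: "t : ball 0 1" for t
  proof -
   let ?c = "%i t. wemb 0 z (\<chi> l. t * \<eta> $ l) i"
   let ?d = "%i :: ('n, 'm) wvar. case i of Inl _ => 0 | Inr l' => (case l' of None => 0 | Some l => \<eta> $ l)"
   have tn: "norm t < 1" using t by simp
   have "norm (t * \<eta> $ l) <= 1 * dt" for l unfolding norm_mult using tn \<eta> by (intro mult_mono) auto
   then have w: "(%i. ?c i t) : pdisc (I <+> UNIV) dt"
    using wemb_pdisc[of 0 z "\<chi> l. t * \<eta> $ l" I dt] z dt(1) by simp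
   have "((%t. g (%i. ?c i t)) has_field_derivative
     (SUM i:I <+> UNIV. jpartial i g (%i. ?c i t) * ?d i)) (at t)"
   proof (rule ps_le_chain_rule[OF fin ro(2) _ dt(2)])
    show "(%i. ?c i t) : pdisc (I <+> UNIV) dt" by (rule w)
   next
    fix i assume "i : I <+> (UNIV :: 'n option set)"
    show "((%t. ?c i t) has_field_derivative ?d i) (at t)"
     by (auto simp: wemb_def split: sum.splits option.splits intro!: derivative_eq_intros)
   qed
   moreover have "(SUM i:I <+> UNIV. jpartial i g (%i. ?c i t) * ?d i) = poly q t"
   proof -
    have "(SUM i:I <+> UNIV. jpartial i g (%i. ?c i t) * ?d i) =
      (\<Sum>l'\<in>(UNIV :: 'n option set). jpartial (Inr l') g (%i. ?c i t) * ?d (Inr l'))"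
     using I by (subst sum.Plus) auto
    also have "... = (SUM l:UNIV. ?g l (%i. ?c i t) * \<eta> $ l)"
     by (simp add: UNIV_option_conv sum.reindex)
    also have "... = poly q t"
     using p(2)[OF tn] by (simp add: q_def poly_sum mult.commute)
    finally show ?thesis .
   qed
   ultimately have "(f has_field_derivative poly q t) (at t)" by (simp add: f_def[abs_def])
   from DERIV_diff[OF this poly_DERIV[of P t]] show ?thesis
    by (simp add: P(1) has_field_derivative_at_within)
  qed
  then obtain c where c: "!!t. t : ball 0 1 ==> f t - poly P t = c"
   using has_field_derivative_zero_constant[of "ball 0 1" "%t. f t - poly P t"] by auto
  show ?thesis
  proof (intro exI[of _ "P + [:c:]"] conjI allI impI)
   fix i assume "Suc k <= i"
   then show "coeff (P + [:c:]) i = 0" using P(2)[of i] by (cases i) auto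
  next
   fix t :: 'k assume "norm t < 1"
   then have "f t = poly P t + c" using c[of t] by (simp add: algebra_simps)
   then show "g (wemb 0 z (\<chi> l. t * \<eta> $ l)) = poly (P + [:c:]) t" by (simp add: f_def)
  qed
 qed
 then show ?case by (intro exI[of _ dt] conjI dt(1) allI impI)
qed

context pde
begin

subsection \<open>Powers of linear forms as test solutions\<close>

text \<open>The derivative \<open>\<partial>\<^sup>\<beta>\<close> of the component \<open>j\<close> of the polynomial solution \<open>v (a + x\<^sub>l)\<^bsup>\<kappa> - 1\<^esup>\<close>.\<close>

definition tval :: "'n => ('m => 'k) => 'k => 'm => 'n mindex => 'k^'n => 'k" where
 "tval l v a j be x = (if ALL i. i ~= l --> be $ i = 0
   then v j * (\<Prod>i<be $ l. of_nat (\<kappa> - 1 - i)) * (a + x $ l) ^ (\<kappa> - 1 - be $ l) else 0)"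

lemma tval_deriv:
 "((%t. tval l v a j be (x + axis k t)) has_field_derivative tval l v a j (be + axis k 1) x) (at 0)"
proof (cases "ALL i. i ~= l --> be $ i = 0")
 case b: True
 show ?thesis
 proof (cases "k = l")
  case True
  have e: "\<kappa> - 1 - (be + axis l 1) $ l = \<kappa> - 1 - be $ l - 1" "(be + axis l 1) $ l = Suc (be $ l)"
   by (simp_all add: axis_def)
  have c: "ALL i. i ~= l --> (be + axis l 1) $ i = 0" using b by (simp add: axis_def)
  have "((%t. (a + (x $ l + t)) ^ n) has_field_derivative of_nat n * (a + x $ l) ^ (n - 1)) (at 0)" for n
   by (auto intro!: derivative_eq_intros simp: One_nat_def)
  from DERIV_cmult[OF this[of "\<kappa> - 1 - be $ l"], of "v j * (\<Prod>i<be $ l. of_nat (\<kappa> - 1 - i))"]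
  have "((%t. v j * (\<Prod>i<be $ l. of_nat (\<kappa> - 1 - i)) * (a + (x $ l + t)) ^ (\<kappa> - 1 - be $ l)) has_field_derivative
    v j * (\<Prod>i<be $ l. of_nat (\<kappa> - 1 - i)) * (of_nat (\<kappa> - 1 - be $ l) * (a + x $ l) ^ (\<kappa> - 1 - be $ l - 1))) (at 0)" .
  moreover have "(%t. tval l v a j be (x + axis k t)) =
    (%t. v j * (\<Prod>i<be $ l. of_nat (\<kappa> - 1 - i)) * (a + (x $ l + t)) ^ (\<kappa> - 1 - be $ l))"
   using b True by (auto simp: tval_def axis_def fun_eq_iff)
  moreover have "tval l v a j (be + axis k 1) x =
    v j * (\<Prod>i<be $ l. of_nat (\<kappa> - 1 - i)) * (of_nat (\<kappa> - 1 - be $ l) * (a + x $ l) ^ (\<kappa> - 1 - be $ l - 1))"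
   unfolding tval_def True if_P[OF c] e by (simp add: prod.lessThan_Suc mult.assoc One_nat_def)
  ultimately show ?thesis by simp
 next
  case False
  then have "(be + axis k 1) $ k ~= 0" by (simp add: axis_def)
  then have "tval l v a j (be + axis k 1) x = 0" using False by (auto simp: tval_def)
  moreover have "(x + axis k t) $ l = x $ l" for t using False by (simp add: axis_def)
  then have "(%t. tval l v a j be (x + axis k t)) = (%t. tval l v a j be x)"
   by (simp only: tval_def)
  ultimately show ?thesis by simp
 qed
next
 case False
 then obtain i where i: "i ~= l" "be $ i ~= 0" by blast
 then have "(be + axis k 1) $ i ~= 0" by simp
 then have "tval l v a j (be + axis k 1) x = 0" "tval l v a j be y = 0" for y
  using i unfolding tval_def by metis+
 then show ?thesis by simp
qed

lemma tval_top: "mdeg aa = \<kappa> ==> tval l v a j aa x = 0"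
proof (cases "ALL i. i ~= l --> aa $ i = 0")
 case True
 assume "mdeg aa = \<kappa>"
 moreover have "mdeg aa = aa $ l + (SUM i:UNIV - {l}. aa $ i)" by (simp add: mdeg_def sum.remove)
 moreover have "(SUM i:UNIV - {l}. aa $ i) = 0" using True by (intro sum.neutral) auto
 ultimately have "\<kappa> - 1 : {..<aa $ l}" using order by simp
 then have "(\<Prod>i<aa $ l. of_nat (\<kappa> - 1 - i) :: 'k) = 0" by (intro prod_zero bexI[of _ "\<kappa> - 1"]) auto
 then show ?thesis by (simp add: tval_def)
qed (auto simp: tval_def)

text \<open>The jet of the test solution at the origin, that is, its parameter in the
  family.\<close>

definition testz :: "'n => ('m => 'k) => 'k => ('n, 'm) jcoord => 'k" where
 "testz l v a c = (case c of Xc k => 0 | Uc j be => tval l v a j be 0)"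

lemma testz_small:
 assumes "!!j. norm (v j) <= r" "norm a <= 1" "c : JC"
 shows "norm (testz l v a c) <= r * real \<kappa> ^ \<kappa>"
proof -
 have r: "0 <= r" using norm_ge_zero order_trans assms(1) by blast
 show ?thesis
 proof (cases "EX j be. c = Uc j be & (ALL i. i ~= l --> be $ i = 0)")
  case True
  then obtain j be where c: "c = Uc j be" "ALL i. i ~= l --> be $ i = 0" by blast
  have "be $ l <= mdeg be" unfolding mdeg_def by (rule member_le_sum) auto
  then have b: "be $ l <= \<kappa>" using assms(3) by (simp add: c)
  have "norm (\<Prod>i<be $ l. of_nat (\<kappa> - 1 - i) :: 'k) = (\<Prod>i<be $ l. real (\<kappa> - 1 - i))"
   by (simp add: prod_norm[symmetric])
  also have "... <= (\<Prod>i<be $ l. real \<kappa>)" by (rule prod_mono) auto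
  also have "... <= real \<kappa> ^ \<kappa>" using b order by (simp add: power_increasing)
  finally have "norm (\<Prod>i<be $ l. of_nat (\<kappa> - 1 - i) :: 'k) <= real \<kappa> ^ \<kappa>" .
  then have "norm (v j) * norm (\<Prod>i<be $ l. of_nat (\<kappa> - 1 - i) :: 'k) * norm a ^ (\<kappa> - 1 - be $ l) <= r * real \<kappa> ^ \<kappa> * 1"
   using assms r by (intro mult_mono power_le_one) auto
  then show ?thesis using c(2) by (simp add: c(1) testz_def tval_def norm_mult norm_power)
 next
  case False
  then have "testz l v a c = 0" by (cases c) (auto simp: testz_def tval_def)
  then show ?thesis using r by simp
 qed
qed

text \<open>At scaling parameter 0 a member of the family is its Taylor polynomial at the origin, so
  the jet of a test polynomial yields that polynomial. The bound is uniform in \<open>l\<close>,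
  \<open>v\<close> and \<open>a\<close>, which vary later.\<close>

lemma ut_test:
 "EX dt>0. ALL l v a x. (ALL j. norm (v j) <= dt) --> norm a <= 1 --> (ALL k. norm (x $ k) <= dt) -->
   (ALL j be. mdeg be <= \<kappa> --> jm be (ut j) (wemb 0 (testz l v a) x) = tval l v a j be x)"
proof -
 have "EX dt>0. ALL l v a x. (ALL j. norm (v j) <= dt) --> norm a <= 1 --> (ALL k. norm (x $ k) <= dt) -->
   (ALL be. mdeg be <= \<kappa> --> jm be (ut j) (wemb 0 (testz l v a) x) = tval l v a j be x)" for j
 proof -
  have "ALL aa. mdeg aa = \<kappa> --> (\<forall>\<^sub>F h in nb WC. h tv = 0 --> jm aa (ut j) h = 0)" using ut_top by blast
  from jm_taylor[OF finite_jcoords ut_analytic0[of j] this]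
  obtain dt where dt: "0 < dt" and T: "ALL z val. (ALL c:JC. norm (z c) <= dt) -->
   (ALL be x l. mdeg be < \<kappa> --> ((%t. val be (x + axis l t)) has_field_derivative val (be + axis l 1) x) (at 0)) -->
   (ALL aa x. mdeg aa = \<kappa> --> val aa x = 0) -->
   (ALL be. mdeg be < \<kappa> --> jm be (ut j) (wemb 0 z 0) = val be 0) -->
   (ALL x be. (ALL l. norm (x $ l) < dt) --> mdeg be <= \<kappa> --> jm be (ut j) (wemb 0 z x) = val be x)"
   by (elim exE conjE) (rule that)
  have "\<forall>\<^sub>F h in nb WC. ALL be:{be. mdeg be <= \<kappa>}. mdeg be < \<kappa> --> (ALL l. h (xv l) = 0) --> jm be (ut j) h = h (zv (Uc j be))"
  proof (intro eventually_ball_finite finite_mdeg_le ballI)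
   fix be :: "'n mindex"
   show "\<forall>\<^sub>F h in nb WC. mdeg be < \<kappa> --> (ALL l. h (xv l) = 0) --> jm be (ut j) h = h (zv (Uc j be))"
    by (cases "mdeg be < \<kappa>") (use ut_low in auto)
  qed
  then obtain dt' where dt': "0 < dt'" and L: "!!h. h : pdisc WC dt' ==> ALL be:{be. mdeg be <= \<kappa>}. mdeg be < \<kappa> -->
    (ALL l. h (xv l) = 0) --> jm be (ut j) h = h (zv (Uc j be))"
   unfolding eventually_nb by blast
  define B where "B = real \<kappa> ^ \<kappa>"
  have B: "1 <= B" unfolding B_def using order by (intro one_le_power) simp
  \<comment> \<open>The jet of a test solution may exceed \<open>v\<close> by the factor
    \<open>B\<close>, which bounds the products of exponents produced by differentiation.\<close>
  define r where "r = min (dt / 2) dt' / B"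
  have m0: "0 < min (dt / 2) dt'" using dt dt' by simp
  have r0: "0 < r" unfolding r_def using m0 B by simp
  have rB: "r * B = min (dt / 2) dt'" using B by (simp add: r_def)
  have "r * 1 <= r * B" using r0 B by (intro mult_left_mono) auto
  then have r: "r * B <= dt" "r * B <= dt'" "r < dt" using rB dt by auto
  have "jm be (ut j) (wemb 0 (testz l v a) x) = tval l v a j be x"
   if v: "ALL j. norm (v j) <= r" and a: "norm a <= 1" and x: "ALL k. norm (x $ k) <= r" and b: "mdeg be <= \<kappa>" for l v a x be
  proof -
   have z: "norm (testz l v a c) <= r * B" if "c : JC" for c
    unfolding B_def by (rule testz_small) (use v a that in auto)
   have w: "wemb 0 (testz l v a) 0 : pdisc WC dt'"
    unfolding wemb_pdisc using order_trans[OF z r(2)] dt' by auto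
   have low: "ALL be. mdeg be < \<kappa> --> jm be (ut j) (wemb 0 (testz l v a) 0) = tval l v a j be 0"
    using L[OF w] by (simp add: testz_def)
   have zz: "ALL c:JC. norm (testz l v a c) <= dt" using order_trans[OF z r(1)] by blast
   have xx: "ALL k. norm (x $ k) < dt" using x r(3) by (auto intro: le_less_trans)
   show ?thesis
    using T[rule_format, of "testz l v a" "tval l v a j" x be] zz xx low b tval_deriv tval_top by blast
  qed
  then show ?thesis by (intro exI[of _ r] conjI r0 allI impI)
 qed
 then have "ALL j. EX dt>0. ALL l v a x. (ALL j. norm (v j) <= dt) --> norm a <= 1 --> (ALL k. norm (x $ k) <= dt) -->
   (ALL be. mdeg be <= \<kappa> --> jm be (ut j) (wemb 0 (testz l v a) x) = tval l v a j be x)" by (rule allI)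
 from choice[OF this] obtain dt where A: "ALL j. 0 < dt j & (ALL l v a x. (ALL j'. norm (v j') <= dt j) -->
   norm a <= 1 --> (ALL k. norm (x $ k) <= dt j) -->
   (ALL be. mdeg be <= \<kappa> --> jm be (ut j) (wemb 0 (testz l v a) x) = tval l v a j be x))"
  by (elim exE) (rule that)
 note dt = A[THEN spec, THEN conjunct1]
 note P = A[THEN spec, THEN conjunct2, THEN spec, THEN spec, THEN spec, THEN spec, THEN mp, THEN mp, THEN mp, THEN spec, THEN mp]
 have le: "Min (range dt) <= dt j" for j by simp
 show ?thesis
 proof (intro exI[of _ "Min (range dt)"] conjI allI impI)
  show "0 < Min (range dt)" using dt by simp
  fix l :: 'n and v :: "'m => 'k" and a :: 'k and j and be :: "'n mindex" and x :: "'k^'n" assume "ALL j. norm (v j) <= Min (range dt)" "norm a <= 1" "ALL k. norm (x $ k) <= Min (range dt)" "mdeg be <= \<kappa>"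
  then show "jm be (ut j) (wemb 0 (testz l v a) x) = tval l v a j be x"
   using le[of j] by (intro P) (auto intro: order_trans)
 qed
qed

end

context pde_lin
begin

lemma lead_ps: "EX M. ps_le UNIV ro (lead N C c) M" if "0 < ro" for C :: "'n + 'm => ('n + 'm => nat) => 'k"
proof -
 have "ps_le UNIV ro (%p. \<Sum>q | wt q + edef c = N. C c q * mmon UNIV p q)
   (\<Sum>q | wt q + edef c = N. norm (C c q) * ro ^ sum q UNIV)"
  by (intro ps_le_sum ps_le_cmult ps_le_mmon ps_le_coord that finite_wt) auto
 then show ?thesis unfolding lead_def[abs_def] by blast
qed

text \<open>The coordinates \<open>(t \<eta>, v (a + t \<eta>\<^sub>l)\<^bsup>\<kappa> - 1\<^esup>)\<close> of the graph of a test solution along a ray.\<close>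

definition ray :: "'n => ('m => 'k) => 'k => 'k^'n => 'k => 'n + 'm => 'k" where
 "ray l v a \<eta> t c = (case c of Inl k => t * \<eta> $ k | Inr j => v j * (a + t * \<eta> $ l) ^ (\<kappa> - 1))"

lemma ray_simps [simp]: "ray l v a \<eta> t (Inl k) = t * \<eta> $ k" "ray l v a \<eta> t (Inr j) = v j * (a + t * \<eta> $ l) ^ (\<kappa> - 1)"
 by (simp_all add: ray_def)

lemma sum_UNIV_Plus: "(SUM i:UNIV. f i) = (SUM l:UNIV. f (Inl l)) + (SUM j:UNIV. f (Inr j))"
 for f :: "'n + 'm => 'b::comm_monoid_add"
 unfolding UNIV_Plus_UNIV[symmetric] by (subst sum.Plus) auto

lemma prod_UNIV_Plus: "(PROD i:UNIV. f i) = (PROD l:UNIV. f (Inl l)) * (PROD j:UNIV. f (Inr j))"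
 for f :: "'n + 'm => 'b::comm_monoid_mult"
 unfolding UNIV_Plus_UNIV[symmetric] by (subst prod.Plus) auto

text \<open>The restriction of a leading part to the graph of a test solution along a ray, as a
  formal polynomial in \<open>t\<close>. The factor of exponent \<open>edef c\<close> stands for the
  derivative \<open>u_l\<close> that accompanies \<open>Q^l\<close>.\<close>

definition raypoly :: "nat => ('n + 'm => ('n + 'm => nat) => 'k) => 'n => ('m => 'k) => 'k => 'k^'n => 'n + 'm => 'k poly" where
 "raypoly N C l v a \<eta> c = (\<Sum>q | wt q + edef c = N.
   smult (C c q * mmon UNIV (case_sum (vec_nth \<eta>) v) q)
    (monom 1 (SUM k:UNIV. q (Inl k)) * [:a, \<eta> $ l:] ^ ((\<kappa> - 1) * (SUM j:UNIV. q (Inr j)) + edef c)))"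

lemma mmon_ray:
 "mmon UNIV (ray l v a \<eta> t) q = mmon UNIV (case_sum (vec_nth \<eta>) v) q *
   (t ^ (SUM k:UNIV. q (Inl k)) * (a + t * \<eta> $ l) ^ ((\<kappa> - 1) * (SUM j:UNIV. q (Inr j))))"
 by (simp add: mmon_def prod_UNIV_Plus power_mult_distrib prod.distrib power_sum power_mult mult_ac)

lemma poly_raypoly: "poly (raypoly N C l v a \<eta> c) t = lead N C c (ray l v a \<eta> t) * (a + t * \<eta> $ l) ^ edef c"
proof -
 have "poly (raypoly N C l v a \<eta> c) t = (\<Sum>q | wt q + edef c = N. C c q * mmon UNIV (ray l v a \<eta> t) q * (a + t * \<eta> $ l) ^ edef c)"
  unfolding raypoly_def poly_sum
  by (rule sum.cong) (auto simp: poly_monom mmon_ray power_add mult_ac)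
 then show ?thesis by (simp add: lead_def sum_distrib_right)
qed

text \<open>Every term has formal degree \<open>N\<close>, since \<open>wt q + edef c = N\<close>;
  the coefficient of \<open>t^N\<close> does not see \<open>a\<close>, so it is the value for the
  homogeneous test solution.\<close>

lemma coeff_raypoly: "coeff (raypoly N C l v a \<eta> c) N = lead N C c (ray l v 0 \<eta> 1) * (\<eta> $ l) ^ edef c"
proof -
 have "coeff (raypoly N C l v a \<eta> c) N = (\<Sum>q | wt q + edef c = N. C c q * mmon UNIV (ray l v 0 \<eta> 1) q * (\<eta> $ l) ^ edef c)"
  unfolding raypoly_def coeff_sum
 proof (rule sum.cong)
  fix q assume "q : {q. wt q + edef c = N}"
  moreover have "wt q = (SUM k:UNIV. q (Inl k)) + (\<kappa> - 1) * (SUM j:UNIV. q (Inr j))"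
   by (simp add: wt_def sum_UNIV_Plus sum_distrib_left)
  ultimately have N: "N = (SUM k:UNIV. q (Inl k)) + ((\<kappa> - 1) * (SUM j:UNIV. q (Inr j)) + edef c)" by simp
  have "coeff (monom 1 (SUM k:UNIV. q (Inl k)) * [:a, \<eta> $ l:] ^ ((\<kappa> - 1) * (SUM j:UNIV. q (Inr j)) + edef c)) N =
    (\<eta> $ l) ^ ((\<kappa> - 1) * (SUM j:UNIV. q (Inr j)) + edef c)"
   using coeff_monom_mult_linear_power[of "SUM k:UNIV. q (Inl k)" a "\<eta> $ l" "(\<kappa> - 1) * (SUM j:UNIV. q (Inr j)) + edef c"]
   unfolding N[symmetric] .
  then show "coeff (smult (C c q * mmon UNIV (case_sum (vec_nth \<eta>) v) q)
    (monom 1 (SUM k:UNIV. q (Inl k)) * [:a, \<eta> $ l:] ^ ((\<kappa> - 1) * (SUM j:UNIV. q (Inr j)) + edef c))) N =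
    C c q * mmon UNIV (ray l v 0 \<eta> 1) q * (\<eta> $ l) ^ edef c"
   by (simp add: mmon_ray power_add mult_ac)
 qed simp
 then show ?thesis by (simp add: lead_def sum_distrib_right)
qed

section \<open>Relations between the leading coefficients\<close>

definition truncate :: "nat => ('n + 'm => ('n + 'm => nat) => 'k) => 'n + 'm => ('n + 'm => nat) => 'k" where
 "truncate N C c q = (if wt q + edef c = N then C c q else 0)"

context
 fixes ro :: real and C :: "'n + 'm => ('n + 'm => nat) => 'k" and N :: nat
 assumes ro: "0 < ro" "!!c. pseries UNIV ro (C c) (vcomp X c)"
  and N: "!!c q. C c q ~= 0 ==> N <= wt q + edef c"
begin

text \<open>On a ray the leading characteristic is a polynomial of degree less than
  \<open>\<kappa>\<close> by the flat equation; on a test solution it also has the explicit form on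
  the left. Two polynomials that agree on the unit ball are equal, so the bound on the degree
  becomes a statement about coefficients.\<close>

lemma flat_test:
 "EX dt>0. ALL l v a \<eta>. (ALL j. norm (v j) <= dt) --> norm a <= 1 --> (ALL k. norm (\<eta> $ k) <= dt) -->
   (ALL j. EX p. (ALL i>=\<kappa>. coeff p i = 0) &
    raypoly N C l v a \<eta> (Inr j) - smult (of_nat (\<kappa> - 1) * v j) (raypoly N C l v a \<eta> (Inl l)) = p)"
proof -
 obtain G where Ga: "ALL j. analytic0 WC (G j)"
  and Gt: "ALL j. ALL aa. mdeg aa = \<kappa> --> (\<forall>\<^sub>F h in nb WC. h tv = 0 --> jm aa (G j) h = 0)"
  and Gv: "ALL j. \<forall>\<^sub>F h in nb WC. h tv = 0 --> G j h = lead N C (Inr j) (%c. pth h (Some c)) -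
    (SUM l:UNIV. lead N C (Inl l) (%c. pth h (Some c)) * jpartial (xv l) (ut j) h)"
  by (rule leading_term[OF ro N])
 obtain dt1 where dt1: "0 < dt1" and U: "!!l v a x j be. (ALL j. norm (v j) <= dt1) ==> norm a <= 1 ==> (ALL k. norm (x $ k) <= dt1) ==>
   mdeg be <= \<kappa> ==> jm be (ut j) (wemb 0 (testz l v a) x) = tval l v a j be x"
  using ut_test by blast
 have "EX dt>0. ALL z \<eta>. (ALL c:JC. norm (z c) <= dt) --> (ALL l. norm (\<eta> $ l) <= dt) -->
  (EX p. (ALL i>=\<kappa>. coeff p i = 0) & (ALL t. norm t < 1 --> G j (wemb 0 z (\<chi> l. t * \<eta> $ l)) = poly p t))" for j
  by (rule jm_polynomial_on_rays[OF finite_jcoords]) (use Ga Gt in blast)+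
 then have "ALL j. EX dt>0. ALL z \<eta>. (ALL c:JC. norm (z c) <= dt) --> (ALL l. norm (\<eta> $ l) <= dt) -->
  (EX p. (ALL i>=\<kappa>. coeff p i = 0) & (ALL t. norm t < 1 --> G j (wemb 0 z (\<chi> l. t * \<eta> $ l)) = poly p t))" by (rule allI)
 from choice[OF this] obtain dt2 where A: "ALL j. 0 < dt2 j & (ALL z \<eta>. (ALL c:JC. norm (z c) <= dt2 j) --> (ALL l. norm (\<eta> $ l) <= dt2 j) -->
  (EX p. (ALL i>=\<kappa>. coeff p i = 0) & (ALL t. norm t < 1 --> G j (wemb 0 z (\<chi> l. t * \<eta> $ l)) = poly p t)))"
  by (elim exE) (rule that)
 note dt2 = A[THEN spec, THEN conjunct1]
 note ray2 = A[THEN spec, THEN conjunct2, THEN spec, THEN spec, THEN mp, THEN mp]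
 have "\<forall>\<^sub>F h in nb WC. ALL j. h tv = 0 --> G j h = lead N C (Inr j) (%c. pth h (Some c)) -
    (SUM l:UNIV. lead N C (Inl l) (%c. pth h (Some c)) * jpartial (xv l) (ut j) h)"
  by (intro eventually_all_finite) (use Gv in blast)
 moreover have "\<forall>\<^sub>F h in nb WC. ALL j l. jpartial (xv l) (ut j) h = jm (axis l 1) (ut j) h"
 proof (intro eventually_all_finite)
  fix j l
  show "\<forall>\<^sub>F h in nb WC. jpartial (xv l) (ut j) h = jm (axis l 1) (ut j) h"
   using jm_step[OF finite_jcoords ut_analytic0[of j], of l 0] by simp
 qed
 ultimately have "\<forall>\<^sub>F h in nb WC. ALL j. h tv = 0 --> G j h = lead N C (Inr j) (%c. pth h (Some c)) -
    (SUM l:UNIV. lead N C (Inl l) (%c. pth h (Some c)) * jm (axis l 1) (ut j) h)"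
  by eventually_elim simp
 then obtain dt3 where dt3: "0 < dt3" and V: "!!h. h : pdisc WC dt3 ==> ALL j. h tv = 0 -->
   G j h = lead N C (Inr j) (%c. pth h (Some c)) -
    (SUM l:UNIV. lead N C (Inl l) (%c. pth h (Some c)) * jm (axis l 1) (ut j) h)"
  unfolding eventually_nb by blast
 define B where "B = real \<kappa> ^ \<kappa>"
 have B: "1 <= B" unfolding B_def using order by (intro one_le_power) simp
 define m where "m = min dt1 (min (Min (range dt2)) dt3)"
 have m: "0 < m" "m <= dt1" "m <= dt3" using dt1 dt2 dt3 by (auto simp: m_def)
 have m2: "m <= dt2 j" for j
  unfolding m_def by (rule min.coboundedI2, rule min.coboundedI1) simp
 define r where "r = m / B"
 have rB: "r * B = m" using B by (simp add: r_def)
 have r: "0 < r" unfolding r_def using m B by simp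
 have "r * 1 <= r * B" using r B by (intro mult_left_mono) auto
 then have rm: "r <= m" using rB by simp
 have "EX p. (ALL i>=\<kappa>. coeff p i = 0) &
    raypoly N C l v a \<eta> (Inr j) - smult (of_nat (\<kappa> - 1) * v j) (raypoly N C l v a \<eta> (Inl l)) = p"
  if v: "ALL j. norm (v j) <= r" and a: "norm a <= 1" and \<eta>: "ALL k. norm (\<eta> $ k) <= r" for l v a \<eta> j
 proof -
  let ?z = "testz l v a"
  have z: "norm (?z c) <= m" if "c : JC" for c
   using testz_small[of v r a c l] v a that rB by (simp add: B_def)
  have "EX p. (ALL i>=\<kappa>. coeff p i = 0) & (ALL t. norm t < 1 --> G j (wemb 0 ?z (\<chi> l. t * \<eta> $ l)) = poly p t)"
  proof (rule ray2)
   show "ALL c:JC. norm (?z c) <= dt2 j" using order_trans[OF z m2] by blast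
   show "ALL l. norm (\<eta> $ l) <= dt2 j" using \<eta> rm m2[of j] by (meson order_trans)
  qed
  then obtain p where p: "ALL i>=\<kappa>. coeff p i = 0" "ALL t. norm t < 1 --> G j (wemb 0 ?z (\<chi> l. t * \<eta> $ l)) = poly p t" by blast
  have "raypoly N C l v a \<eta> (Inr j) - smult (of_nat (\<kappa> - 1) * v j) (raypoly N C l v a \<eta> (Inl l)) = p"
  proof (rule poly_eq_on_ball)
   fix t :: 'k assume t: "norm t < 1"
   let ?x = "\<chi> l. t * \<eta> $ l"
   have xb: "norm (?x $ k) <= m" for k
   proof -
    have "norm (?x $ k) <= 1 * r" unfolding vec_lambda_beta norm_mult using t \<eta> by (intro mult_mono) auto
    then show ?thesis using rm by simp
   qed
   have w: "wemb 0 ?z ?x : pdisc WC dt3"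
    unfolding wemb_pdisc using order_trans[OF z m(3)] order_trans[OF xb m(3)] dt3 by auto
   have ut: "jm be (ut i) (wemb 0 ?z ?x) = tval l v a i be ?x" if "mdeg be <= \<kappa>" for be i
   proof (rule U[OF _ a _ that])
    show "ALL j. norm (v j) <= dt1" using v rm m(2) by (meson order_trans)
    show "ALL k. norm (?x $ k) <= dt1" using order_trans[OF xb m(2)] by blast
   qed
   have u0: "ut i (wemb 0 ?z ?x) = v i * (a + t * \<eta> $ l) ^ (\<kappa> - 1)" for i
    using ut[of 0 i] by (simp add: tval_def)
   have u1: "jm (axis k 1) (ut j) (wemb 0 ?z ?x) =
     (if k = l then of_nat (\<kappa> - 1) * v j * (a + t * \<eta> $ l) ^ (\<kappa> - 2) else 0)" for k
   proof -
    have "mdeg (axis k 1 :: 'n mindex) <= \<kappa>" using order by simp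
    then have "jm (axis k 1) (ut j) (wemb 0 ?z ?x) = tval l v a j (axis k 1) ?x" by (rule ut)
    also have "... = (if k = l then of_nat (\<kappa> - 1) * v j * (a + t * \<eta> $ l) ^ (\<kappa> - 2) else 0)"
    proof (cases "k = l")
     case True
     have "ALL i. i ~= l --> (axis l 1 :: 'n mindex) $ i = 0" by (simp add: axis_def)
     moreover have "(axis l 1 :: 'n mindex) $ l = 1" by (simp add: axis_def)
     moreover have "\<kappa> - 1 - 1 = \<kappa> - 2" by simp
     ultimately show ?thesis using True by (simp add: tval_def lessThan_Suc One_nat_def mult_ac numeral_2_eq_2)
    next
     case False
     then have "(axis k 1 :: 'n mindex) $ k ~= 0" by (simp add: axis_def)
     then show ?thesis using False unfolding tval_def by auto
    qed
    finally show ?thesis .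
   qed
   have pr: "(%c. pth (wemb 0 ?z ?x) (Some c)) = ray l v a \<eta> t"
    by (rule ext) (auto simp: ray_def pth_def u0 split: sum.splits)
   have "poly p t = G j (wemb 0 ?z ?x)" using p(2) t by simp
   also have "... = lead N C (Inr j) (ray l v a \<eta> t) -
     (SUM k:UNIV. lead N C (Inl k) (ray l v a \<eta> t) * jm (axis k 1) (ut j) (wemb 0 ?z ?x))"
    using V[OF w] unfolding pr by simp
   also have "(SUM k:UNIV. lead N C (Inl k) (ray l v a \<eta> t) * jm (axis k 1) (ut j) (wemb 0 ?z ?x)) =
     (SUM k:UNIV. if k = l then lead N C (Inl l) (ray l v a \<eta> t) * (of_nat (\<kappa> - 1) * v j * (a + t * \<eta> $ l) ^ (\<kappa> - 2)) else 0)"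
    unfolding u1 by (rule sum.cong) auto
   also have "... = lead N C (Inl l) (ray l v a \<eta> t) * (of_nat (\<kappa> - 1) * v j * (a + t * \<eta> $ l) ^ (\<kappa> - 2))"
    by (subst sum.delta) auto
   finally show "poly (raypoly N C l v a \<eta> (Inr j) - smult (of_nat (\<kappa> - 1) * v j) (raypoly N C l v a \<eta> (Inl l))) t = poly p t"
    by (simp add: poly_raypoly mult_ac)
  qed
  then show ?thesis using p(1) by blast
 qed
 then show ?thesis by (intro exI[of _ r] conjI r allI impI)
qed

lemma pseries_lead: "pseries UNIV r (%q. b * truncate N C c q) (%p. b * lead N C c p)"
proof -
 have "pseries UNIV r (%q. if q : {q. wt q + edef c = N} then b * C c q else 0)
   (%p. \<Sum>q | wt q + edef c = N. (b * C c q) * mmon UNIV p q)"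
  by (rule pseries_finite[OF finite_wt])
 moreover have "(%q. if q : {q. wt q + edef c = N} then b * C c q else 0) = (%q. b * truncate N C c q)"
  by (auto simp: truncate_def)
 ultimately show ?thesis by (simp add: lead_def[abs_def] sum_distrib_left mult.assoc)
qed

text \<open>A relation that holds at all points \<open>(\<eta>, v \<eta>\<^sub>l\<^bsup>\<kappa> - 1\<^esup>)\<close> holds identically,
  because these points fill an open set.\<close>

lemma lead_identity:
 fixes f :: "('n + 'm => 'k) => 'k"
 assumes dt: "0 < dt" and f: "!!r. 0 < r ==> EX M. ps_le UNIV r f M"
  and z: "!!v \<eta>. (ALL j. norm (v j) <= dt) ==> (ALL k. norm (\<eta> $ k) <= dt) ==> \<eta> $ l ~= 0 ==> f (ray l v 0 \<eta> 1) = 0"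
 shows "f p = 0"
proof -
 have *: "f p = 0" if p: "p : pdisc UNIV (4 * dt)" for p
 proof -
 define b where "b c = (case c of Inl k => of_real (dt / 2) | Inr j => (0 :: 'k))" for c :: "'n + 'm"
 \<comment> \<open>Within \<open>dt / 4\<close> of the centre \<open>dt / 2\<close> the coordinate
   \<open>\<eta>_l\<close> has norm at least \<open>dt / 4\<close>; the second entry then makes
   \<open>v\<close>, the quotient by \<open>\<eta>_l^(\<kappa> - 1)\<close>, at most
   \<open>dt\<close>.\<close>
 define e where "e = min (dt / 4) (dt * (dt / 4) ^ (\<kappa> - 1))"
 have e: "0 < e" "e <= dt / 4" "e <= dt * (dt / 4) ^ (\<kappa> - 1)" using dt by (auto simp: e_def)
 have "0 < 4 * dt" using dt by simp
 then obtain M where M: "ps_le UNIV (4 * dt) f M" using f by blast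
 show ?thesis
 proof (rule ps_le_identity_off_center[OF finite_class.finite_UNIV _ M _ e(1) _ p])
  show "0 < 4 * dt" by fact
  show "b : pdisc UNIV (4 * dt / 4)" using dt by (auto simp: pdisc_def b_def norm_divide split: sum.splits)
  fix h :: "'n + 'm => 'k" assume h: "h : pdisc UNIV e"
  define \<eta> where "\<eta> = (\<chi> k. b (Inl k) + h (Inl k))"
  have hb: "norm (h c) <= e" for c using h by (simp add: pdisc_def)
  have nb: "norm (of_real (dt / 2) :: 'k) = dt / 2" using dt by simp
  have up: "norm (\<eta> $ k) <= dt" for k
  proof -
   have "norm (\<eta> $ k) <= dt / 2 + e"
    unfolding \<eta>_def b_def vec_lambda_beta sum.case
    using hb[of "Inl k"] norm_triangle_ineq[of "of_real (dt / 2)" "h (Inl k)"] nb by linarith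
   then show ?thesis using e(2) dt by linarith
  qed
  have lo: "dt / 4 <= norm (\<eta> $ k)" for k
  proof -
   have "dt / 2 - e <= norm (\<eta> $ k)"
    unfolding \<eta>_def b_def vec_lambda_beta sum.case
    using hb[of "Inl k"] norm_diff_ineq[of "of_real (dt / 2)" "h (Inl k)"] nb by linarith
   then show ?thesis using e(2) by linarith
  qed
  then have \<eta>0: "\<eta> $ l ~= 0" using dt by (metis divide_pos_pos norm_zero not_less zero_less_numeral)
  define v where "v j = h (Inr j) / (\<eta> $ l) ^ (\<kappa> - 1)" for j
  have "norm (v j) <= dt" for j
  proof -
   have p: "(dt / 4) ^ (\<kappa> - 1) <= norm (\<eta> $ l) ^ (\<kappa> - 1)" using lo dt by (intro power_mono) auto
   have "norm (h (Inr j)) <= dt * norm (\<eta> $ l) ^ (\<kappa> - 1)"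
    using hb[of "Inr j"] e(3) mult_left_mono[OF p, of dt] dt by linarith
   moreover have "0 < norm (\<eta> $ l) ^ (\<kappa> - 1)" using \<eta>0 by simp
   ultimately show ?thesis by (simp add: v_def norm_divide norm_power pos_divide_le_eq)
  qed
  then have "f (ray l v 0 \<eta> 1) = 0" using up \<eta>0 by (intro z) auto
  moreover have "ray l v 0 \<eta> 1 = (%i. b i + h i)"
   using \<eta>0 by (auto simp: fun_eq_iff ray_def v_def \<eta>_def b_def split: sum.splits)
  ultimately show "f (%i. b i + h i) = 0" by simp
 qed
 qed
 define r where "r = 4 * dt + (SUM c:UNIV. norm (p c))"
 have r: "0 < r" unfolding r_def using dt by (intro add_pos_nonneg sum_nonneg) auto
 then obtain M where M: "ps_le UNIV r f M" using f by blast
 have "norm (p c) <= r" for c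
 proof -
  have "norm (p c) <= (SUM c:UNIV. norm (p c))" by (rule member_le_sum) auto
  then show ?thesis using dt by (simp add: r_def)
 qed
 then have "p : pdisc UNIV r" by (simp add: pdisc_def)
 then show ?thesis by (rule ps_le_identity[OF finite_class.finite_UNIV r M _ *, rotated -1]) (use dt in auto)
qed

text \<open>For \<open>a = 0\<close> the vanishing coefficient of \<open>t^N\<close> says
  \<open>x_l R^j = (\<kappa> - 1) u^j Q^l\<close> on the leading parts. For \<open>a = 1\<close>
  this identity shows that \<open>1 + t \<eta>_l\<close> times the characteristic equals
  \<open>R^j\<close>; the product has degree at most \<open>\<kappa>\<close>, so \<open>R^j\<close>
  vanishes when \<open>N > \<kappa>\<close>.\<close>

lemma coefficient_relations:
 assumes "\<kappa> <= N"
 shows "(if q (Inl l) = 0 then 0 else truncate N C (Inr j) (q(Inl l := q (Inl l) - 1))) =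
   (if q (Inr j) = 0 then 0 else of_nat (\<kappa> - 1) * truncate N C (Inl l) (q(Inr j := q (Inr j) - 1)))"
  and "\<kappa> < N ==> truncate N C (Inr j) q = 0"
proof -
 obtain dt where dt: "0 < dt" and T: "!!l v a \<eta> j. (ALL j. norm (v j) <= dt) ==> norm a <= 1 ==> (ALL k. norm (\<eta> $ k) <= dt) ==>
   ALL i>=\<kappa>. coeff (raypoly N C l v a \<eta> (Inr j) - smult (of_nat (\<kappa> - 1) * v j) (raypoly N C l v a \<eta> (Inl l))) i = 0"
  using flat_test by metis
 have pw: "w * w ^ (\<kappa> - 2) = w ^ (\<kappa> - 1)" for w :: 'k
 proof -
  have "\<kappa> - 1 = Suc (\<kappa> - 2)" using order by simp
  then show ?thesis by (simp only: power_Suc)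
 qed
 have 1: "p (Inl l) * lead N C (Inr j) p - p (Inr j) * (of_nat (\<kappa> - 1) * lead N C (Inl l) p) = 0"
  for p
 proof (rule lead_identity[OF dt, where l = l and p = p
    and f = "%p. p (Inl l) * lead N C (Inr j) p - p (Inr j) * (of_nat (\<kappa> - 1) * lead N C (Inl l) p)"])
  fix r :: real assume r: "0 < r"
  obtain M1 M2 where M: "ps_le UNIV r (lead N C (Inr j)) M1" "ps_le UNIV r (lead N C (Inl l)) M2"
   using lead_ps[OF r] by blast
  have "ps_le UNIV r (%p. p (Inl l) * lead N C (Inr j) p - p (Inr j) * (of_nat (\<kappa> - 1) * lead N C (Inl l) p))
    (r * M1 + r * (norm (of_nat (\<kappa> - 1) :: 'k) * M2))"
   by (intro ps_le_diff ps_le_mult ps_le_cmult ps_le_coord r M) auto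
  then show "EX M. ps_le UNIV r (%p. p (Inl l) * lead N C (Inr j) p - p (Inr j) * (of_nat (\<kappa> - 1) * lead N C (Inl l) p)) M"
   by (rule exI)
 next
  fix v :: "'m => 'k" and \<eta> :: "'k^'n" assume v: "ALL j. norm (v j) <= dt" "ALL k. norm (\<eta> $ k) <= dt" "\<eta> $ l ~= 0"
  have "coeff (raypoly N C l v 0 \<eta> (Inr j) - smult (of_nat (\<kappa> - 1) * v j) (raypoly N C l v 0 \<eta> (Inl l))) N = 0"
   using T[of v 0 \<eta> l j] v assms by simp
  then have "lead N C (Inr j) (ray l v 0 \<eta> 1) = of_nat (\<kappa> - 1) * v j * (lead N C (Inl l) (ray l v 0 \<eta> 1) * (\<eta> $ l) ^ (\<kappa> - 2))"
   by (simp add: coeff_raypoly)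
  then show "ray l v 0 \<eta> 1 (Inl l) * lead N C (Inr j) (ray l v 0 \<eta> 1) -
    ray l v 0 \<eta> 1 (Inr j) * (of_nat (\<kappa> - 1) * lead N C (Inl l) (ray l v 0 \<eta> 1)) = 0"
   by (simp add: pw[symmetric] mult_ac)
 qed
 show "(if q (Inl l) = 0 then 0 else truncate N C (Inr j) (q(Inl l := q (Inl l) - 1))) =
   (if q (Inr j) = 0 then 0 else of_nat (\<kappa> - 1) * truncate N C (Inl l) (q(Inr j := q (Inr j) - 1)))"
 proof (rule pseries_unique[OF finite_class.finite_UNIV zero_less_one, where dt = 1 and ro' = 1 and p = q])
  have "pseries UNIV 1 (%q. truncate N C (Inr j) q) (lead N C (Inr j))" using pseries_lead[of 1 1 "Inr j"] by simp
  from pseries_mult_coord[OF finite_class.finite_UNIV UNIV_I this, of "Inl l"]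
  show "pseries UNIV 1 (%q. if q (Inl l) = 0 then 0 else truncate N C (Inr j) (q(Inl l := q (Inl l) - 1)))
    (%p. p (Inl l) * lead N C (Inr j) p)" .
  from pseries_mult_coord[OF finite_class.finite_UNIV UNIV_I pseries_lead[of 1 "of_nat (\<kappa> - 1)" "Inl l"], of "Inr j"]
  show "pseries UNIV 1 (%q. if q (Inr j) = 0 then 0 else of_nat (\<kappa> - 1) * truncate N C (Inl l) (q(Inr j := q (Inr j) - 1)))
    (%p. p (Inr j) * (of_nat (\<kappa> - 1) * lead N C (Inl l) p))" .
 qed (use 1 dt in \<open>auto simp: mindices_def\<close>)
 show "truncate N C (Inr j) q = 0" if NN: "\<kappa> < N"
 proof -
  have 2: "lead N C (Inr j) p = 0" for p
  proof (rule lead_identity[OF dt lead_ps, where l = l])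
   fix v :: "'m => 'k" and \<eta> :: "'k^'n" assume v: "ALL j. norm (v j) <= dt" "ALL k. norm (\<eta> $ k) <= dt" "\<eta> $ l ~= 0"
   define Q where "Q = raypoly N C l v 1 \<eta> (Inr j) - smult (of_nat (\<kappa> - 1) * v j) (raypoly N C l v 1 \<eta> (Inl l))"
   have Q: "coeff Q i = 0" if "\<kappa> <= i" for i
    using T[of v 1 \<eta> l j] v that by (simp add: Q_def)
   \<comment> \<open>By \<open>rel\<close> the \<open>Q^l\<close> term, once multiplied by
     \<open>1 + t \<eta>_l\<close>, equals \<open>t \<eta>_l R^j\<close>; subtracting it from
     \<open>(1 + t \<eta>_l) R^j\<close> leaves \<open>R^j\<close>.\<close>
   have "[:1, \<eta> $ l:] * Q = raypoly N C l v 1 \<eta> (Inr j)"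
   proof (rule poly_eq_on_ball)
    fix t :: 'k
    let ?w = "1 + t * \<eta> $ l" and ?R = "lead N C (Inr j) (ray l v 1 \<eta> t)"
     and ?Q = "lead N C (Inl l) (ray l v 1 \<eta> t)"
    have rel: "t * \<eta> $ l * ?R = v j * ?w ^ (\<kappa> - 1) * (of_nat (\<kappa> - 1) * ?Q)"
     using 1[of "ray l v 1 \<eta> t"] by simp
    have "poly ([:1, \<eta> $ l:] * Q) t = ?w * ?R - v j * (?w * ?w ^ (\<kappa> - 2)) * (of_nat (\<kappa> - 1) * ?Q)"
     by (simp add: Q_def poly_raypoly algebra_simps)
    also have "... = ?w * ?R - t * \<eta> $ l * ?R" unfolding pw rel ..
    also have "... = poly (raypoly N C l v 1 \<eta> (Inr j)) t" by (simp add: poly_raypoly algebra_simps)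
    finally show "poly ([:1, \<eta> $ l:] * Q) t = poly (raypoly N C l v 1 \<eta> (Inr j)) t" .
   qed
   then have "coeff (raypoly N C l v 1 \<eta> (Inr j)) N = coeff ([:1, \<eta> $ l:] * Q) N" by simp
   also have "... = 0" using Q[of N] Q[of "N - 1"] NN by (cases N) (auto simp: coeff_pCons)
   finally show "lead N C (Inr j) (ray l v 0 \<eta> 1) = 0" by (simp add: coeff_raypoly)
  qed
  have "pseries UNIV 1 (%q. truncate N C (Inr j) q) (lead N C (Inr j))" using pseries_lead[of 1 1 "Inr j"] by simp
  from pseries_zero_coeffs[OF finite_class.finite_UNIV zero_less_one zero_less_one this 2, of q]
  show ?thesis by (simp add: mindices_def)
 qed
qed

end

text \<open>The coefficients that remain free are those of a basis of the symmetry algebra of the homogeneous system.\<close>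

theorem coefficients_determine:
 assumes ro: "0 < ro" "!!c. pseries UNIV ro (C c) (vcomp X c)"
  and low: "!!c q. wt q + edef c <= \<kappa> - 1 ==> C c q = 0"
  and quad: "!!d. wgt d = 1 ==> C d (%i. if i = d then 2 else 0) = 0"
 shows "C c q = 0"
proof (rule ccontr)
 assume nz: "C c q ~= 0"
 \<comment> \<open>The lowest total weight that occurs; the hypothesis on low weights forces it to
   be at least \<open>\<kappa>\<close>.\<close>
 define N where "N = (LEAST n. EX c q. C c q ~= 0 & wt q + edef c = n)"
 have ex: "EX n c q. C c q ~= 0 & wt q + edef c = n" using nz by blast
 have N: "N <= wt q + edef c" if "C c q ~= 0" for c q
  unfolding N_def by (rule Least_le) (use that in blast)
 obtain c1 q1 where c1: "C c1 q1 ~= 0" "wt q1 + edef c1 = N"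
  using LeastI_ex[OF ex] unfolding N_def by blast
 then have "~ N <= \<kappa> - 1" using low by metis
 then have kN: "\<kappa> <= N" by simp
 note rel = coefficient_relations[OF ro N kN]
 let ?t = "truncate N C"
 have nz: "of_nat (\<kappa> - 1) ~= (0 :: 'k)" using order by simp
 \<comment> \<open>The coefficients of \<open>x_l R^j = (\<kappa> - 1) u^j Q^l\<close>, solved for
   those of \<open>Q^l\<close>: trade a factor \<open>x_l\<close> in \<open>Q^l\<close> for a factor
   \<open>u^j\<close> in \<open>R^j\<close>. \<open>relR\<close> is the reverse trade.\<close>
 have relQ: "of_nat (\<kappa> - 1) * ?t (Inl l) q = (if q (Inl l) = 0 then 0 else ?t (Inr j) (q(Inr j := q (Inr j) + 1, Inl l := q (Inl l) - 1)))" for l j q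
  using rel(1)[of "q(Inr j := q (Inr j) + 1)" l j] by (simp cong: if_cong split del: if_split)
 have relR: "?t (Inr j) q = (if q (Inr j) = 0 then 0 else of_nat (\<kappa> - 1) * ?t (Inl l) (q(Inl l := q (Inl l) + 1, Inr j := q (Inr j) - 1)))" for l j q
  using rel(1)[of "q(Inl l := q (Inl l) + 1)" l j] by (simp cong: if_cong split del: if_split)
 have Q0: "?t (Inl l) q = 0" for l q
 proof (cases "wt q + edef (Inl l) = N")
  case True
  \<comment> \<open>Any dependent variable will do; the relations pass through its component
    \<open>R^j\<close>.\<close>
  obtain j :: 'm where True by blast
  show ?thesis
  proof (cases "\<kappa> < N | q (Inl l) = 0")
   case True
   then have "of_nat (\<kappa> - 1) * ?t (Inl l) q = 0"
    unfolding relQ[of l q j] using rel(2) by auto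
   then show ?thesis using nz by simp
  next
   case False
   then have N: "N = \<kappa>" and q0: "0 < q (Inl l)" using kN by auto
   \<comment> \<open>In total weight \<open>\<kappa>\<close> the component \<open>Q^l\<close> is
     quadratic, because its offset is \<open>\<kappa> - 2\<close>. As \<open>x_l\<close> divides the
     monomial, the other factor is some variable of weight 1.\<close>
   have "wt q = 2" using True N order by simp
   moreover have "wt q = q (Inl l) + (SUM i:UNIV - {Inl l}. wgt i * q i)"
    unfolding wt_def by (subst sum.remove[of _ "Inl l"]) auto
   ultimately have two: "q (Inl l) + (SUM i:UNIV - {Inl l}. wgt i * q i) = 2" by simp
   have pos: "0 < wgt i" for i using order by (cases i) auto
   have quad0: "?t d (%i. if i = d then 2 else 0) = 0" if "wgt d = 1" for d
    using quad[OF that] by (simp add: truncate_def)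
   show ?thesis
   proof (cases "q (Inl l) = 1")
    case True
    then have "(SUM i:UNIV - {Inl l}. wgt i * q i) = 1" using two by simp
    from this[unfolded sum_eq_1_iff[OF finite_class.finite]]
    obtain d where d: "d : UNIV - {Inl l}" "wgt d * q d = 1" "ALL i:UNIV - {Inl l}. d ~= i --> wgt i * q i = 0"
     by blast
    have dl: "d ~= Inl l" "wgt d = 1" "q d = 1" using d by auto
    have q: "q i = (if i = Inl l | i = d then 1 else 0)" for i
    proof (cases "i = Inl l | i = d")
     case False
     then have "wgt i * q i = 0" using d(3)[rule_format, of i] by auto
     then show ?thesis using False pos[of i] by simp
    qed (use True dl in auto)
    show ?thesis
    proof (cases d)
     case (Inl k)
     \<comment> \<open>The coefficient of \<open>x_l x_k\<close> in \<open>Q^l\<close> equals, via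
       that of \<open>x_k u^j\<close> in \<open>R^j\<close>, the coefficient of \<open>x_k^2\<close>
       in \<open>Q^k\<close>, which is assumed to vanish.\<close>
     let ?s = "%i. if i = Inl k | i = Inr j then 1 else 0 :: nat"
     have 1: "q(Inr j := q (Inr j) + 1, Inl l := q (Inl l) - 1) = ?s"
      using dl by (auto simp: fun_eq_iff q Inl)
     have 2: "(%i. if i = Inl k then 2 else 0)(Inr j := (if Inr j = Inl k then 2 else 0) + 1,
       Inl k := (if Inl k = Inl k then 2 else 0) - 1) = ?s"
      by (auto simp: fun_eq_iff)
     have "?t (Inr j) ?s = 0"
      using relQ[of k "%i. if i = Inl k then 2 else 0" j] quad0[of "Inl k"] unfolding 2 by simp
     then have "of_nat (\<kappa> - 1) * ?t (Inl l) q = 0" unfolding relQ[of l q j] 1 by simp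
     then show ?thesis using nz by simp
    next
     case (Inr i)
     \<comment> \<open>Here \<open>u^i\<close> has weight 1; the coefficient of
       \<open>x_l u^i\<close> in \<open>Q^l\<close> is tied to that of the square of
       \<open>u^i\<close> in \<open>R^i\<close>.\<close>
     have 1: "q(Inr i := q (Inr i) + 1, Inl l := q (Inl l) - 1) = (%i'. if i' = Inr i then 2 else 0)"
      using dl by (auto simp: fun_eq_iff q Inr)
     have "of_nat (\<kappa> - 1) * ?t (Inl l) q = 0" unfolding relQ[of l q i] 1 using quad0[of "Inr i"] dl Inr by simp
     then show ?thesis using nz by simp
    qed
   next
    case False
    then have q2: "q (Inl l) = 2" and "(SUM i:UNIV - {Inl l}. wgt i * q i) = 0" using two q0 by linarith+
    then have "ALL i:UNIV - {Inl l}. wgt i * q i = 0" by (simp only: sum_eq_0_iff[OF finite_class.finite])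
    then have "q i = (if i = Inl l then 2 else 0)" for i
     using pos[of i] q2 by (cases "i = Inl l") (auto dest: bspec[of _ _ i])
    then have "q = (%i. if i = Inl l then 2 else 0)" by blast
    then show ?thesis using quad0[of "Inl l"] by simp
   qed
  qed
 qed (simp add: truncate_def)
 have R0: "?t (Inr j) q = 0" for j q
  using relR[of j q undefined] Q0 by simp
 have "?t c1 q1 = 0" using Q0 R0 by (cases c1) auto
 then show False using c1 by (simp add: truncate_def)
qed

end

section \<open>Germs of vector fields\<close>

lemma eventually_nb_vec_lambda:
 assumes "\<forall>\<^sub>F x in nhds (0 :: 'k::real_normed_field^'c::finite). P x"
 shows "\<forall>\<^sub>F p in nb UNIV. P (vec_lambda p)"
proof -
 obtain d where d: "0 < d" "!!x. dist x 0 < d ==> P x"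
  using assms unfolding eventually_nhds_metric by blast
 from eventually_nb_norm_vec[OF d(1)] show ?thesis
  by eventually_elim (simp add: d(2))
qed

lemma eventually_nhds_vec_nth:
 assumes "eventually P (nb UNIV)"
 shows "\<forall>\<^sub>F x in nhds (0 :: 'k::real_normed_field^'c::finite). P (vec_nth x)"
proof -
 obtain d where d: "0 < d" "!!p. p : pdisc UNIV d ==> P p" using assms unfolding eventually_nb by blast
 have "P (vec_nth x)" if "dist x 0 < d" for x :: "'k^'c"
 proof (rule d(2))
  have "norm (x $ i) <= d" for i
   using that Finite_Cartesian_Product.norm_nth_le[of x i] by simp
  then show "vec_nth x : pdisc UNIV d" by (simp add: pdisc_def)
 qed
 then show ?thesis unfolding eventually_nhds_metric using d(1) by blast
qed

section \<open>Power series coefficients of germs of vector fields\<close>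

lemma pseries_add:
 assumes "pseries I ro c f" "pseries I ro d g" "0 <= ro"
 shows "pseries I ro (%p. c p + d p) (%h. f h + g h)"
proof -
 have "(%p. norm (c p) * ro ^ sum p I + norm (d p) * ro ^ sum p I) summable_on mindices I"
  using assms by (intro summable_on_add) (auto simp: pseries_def)
 then have "(%p. norm (c p + d p) * ro ^ sum p I) summable_on mindices I"
 proof (rule summable_on_comparison_test)
  fix p
  have "norm (c p + d p) * ro ^ sum p I <= (norm (c p) + norm (d p)) * ro ^ sum p I"
   using assms(3) by (intro mult_right_mono norm_triangle_ineq) auto
  then show "norm (c p + d p) * ro ^ sum p I <= norm (c p) * ro ^ sum p I + norm (d p) * ro ^ sum p I"
   by (simp add: distrib_right)
  show "0 <= norm (c p + d p) * ro ^ sum p I" using assms(3) by simp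
 qed
 moreover have "((%p. (c p + d p) * mmon I h p) has_sum (f h + g h)) (mindices I)" if "h : pdisc I ro" for h
 proof -
  have "((%p. c p * mmon I h p) has_sum f h) (mindices I)" "((%p. d p * mmon I h p) has_sum g h) (mindices I)"
   using assms that by (auto simp: pseries_def)
  from has_sum_add[OF this] show ?thesis by (simp add: distrib_right)
 qed
 ultimately show ?thesis by (simp add: pseries_def)
qed

lemma pseries_cmult:
 assumes "pseries I ro c f"
 shows "pseries I ro (%p. a * c p) (%h. a * f h)"
proof -
 have "(%p. norm a * (norm (c p) * ro ^ sum p I)) summable_on mindices I"
  using assms by (intro summable_on_cmult_right) (auto simp: pseries_def)
 moreover have "((%p. (a * c p) * mmon I h p) has_sum (a * f h)) (mindices I)" if "h : pdisc I ro" for h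
 proof -
  have "((%p. c p * mmon I h p) has_sum f h) (mindices I)" using assms that by (auto simp: pseries_def)
  from has_sum_cmult_right[OF this, of a] show ?thesis by (simp add: mult.assoc)
 qed
 ultimately show ?thesis by (simp add: pseries_def norm_mult mult.assoc)
qed

definition field_series :: "('k::{real_normed_field,banach}^'c::finite => 'k^'c) => ('c => ('c => nat) => 'k) => bool" where
 "field_series X C \<longleftrightarrow> (EX ro>0. ALL c. pseries UNIV ro (C c) (vcomp X c))"

lemma ex_field_series:
 fixes X :: "'k::{real_normed_field,banach}^'c::finite => 'k^'c"
 assumes "vec_analytic_at X 0"
 shows "EX C. field_series X C"
proof -
 have "analytic0 UNIV (vcomp X c)" for c by (rule vcomp_analytic0[OF assms])
 then obtain ro M where ro: "0 < ro" and M: "ALL c:UNIV. ps_le UNIV ro (vcomp X c) M"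
  using analytic0_common_radius[where f = "vcomp X" and A = UNIV and dt = 1 and I = UNIV] zero_less_one by (metis finite)
 have "ALL c. EX C. pseries UNIV ro C (vcomp X c)" using M by (auto simp: ps_le_def)
 from choice[OF this] show ?thesis unfolding field_series_def using ro by blast
qed

lemma field_series_unique:
 fixes X Y :: "'k::{real_normed_field,banach}^'c::finite => 'k^'c"
 assumes "field_series X C" "field_series Y D" "abs_germ X = abs_germ Y"
 shows "C c q = D c q"
proof -
 have "\<forall>\<^sub>F x in nhds 0. X x = Y x" using assms(3) by (simp add: germ.abs_eq_iff)
 from eventually_nb_vec_lambda[OF this] obtain dt where dt: "0 < dt" "!!p. p : pdisc UNIV dt ==> X (vec_lambda p) = Y (vec_lambda p)"
  unfolding eventually_nb by blast
 obtain ro ro' where ro: "0 < ro" "pseries UNIV ro (C c) (vcomp X c)" "0 < ro'" "pseries UNIV ro' (D c) (vcomp Y c)"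
  using assms(1,2) unfolding field_series_def by blast
 have "vcomp X c h = vcomp Y c h" if "h : pdisc UNIV dt" for h
  using dt(2)[OF that] by (simp add: vcomp_def)
 then show ?thesis
  by (rule pseries_unique[OF finite_class.finite_UNIV ro(1) dt(1) ro(2,4,3)]) (simp_all add: mindices_def)
qed

lemma field_series_zero:
 fixes X :: "'k::{real_normed_field,banach}^'c::finite => 'k^'c"
 assumes "field_series X (%_ _. 0)"
 shows "abs_germ X = 0"
proof -
 obtain ro where ro: "0 < ro" "!!c. pseries UNIV ro (%_. 0) (vcomp X c)" using assms by (auto simp: field_series_def)
 have "vcomp X c h = 0" if "h : pdisc UNIV ro" for c h
 proof -
  have "((%p :: 'c => nat. 0) has_sum vcomp X c h) (mindices UNIV)" using ro(2)[of c] that unfolding pseries_def mult_zero_left by blast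
  then show ?thesis by (rule has_sum_unique) (rule has_sum_0, simp)
 qed
 then have "\<forall>\<^sub>F h in nb UNIV. ALL c. vcomp X c h = 0" unfolding eventually_nb using ro(1) by blast
 from eventually_nhds_vec_nth[OF this] have "\<forall>\<^sub>F x in nhds 0. X x = 0"
  by eventually_elim (simp add: vcomp_def vec_eq_iff)
 then show ?thesis by (simp add: zero_germ_def germ.abs_eq_iff)
qed

lemma field_series_add:
 fixes X Y :: "'k::{real_normed_field,banach}^'c::finite => 'k^'c"
 assumes "field_series X C" "field_series Y D"
 shows "field_series (%x. X x + Y x) (%c q. C c q + D c q)"
proof -
 obtain ro ro' where ro: "0 < ro" "!!c. pseries UNIV ro (C c) (vcomp X c)" "0 < ro'" "!!c. pseries UNIV ro' (D c) (vcomp Y c)"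
  using assms unfolding field_series_def by blast
 let ?r = "min ro ro'"
 have "pseries UNIV ?r (%q. C c q + D c q) (%h. vcomp X c h + vcomp Y c h)" for c
  by (rule pseries_add[OF pseries_shrink[OF ro(2)] pseries_shrink[OF ro(4)]]) (use ro in auto)
 moreover have "(%h. vcomp X c h + vcomp Y c h) = vcomp (%x. X x + Y x) c" for c
  by (simp add: vcomp_def fun_eq_iff)
 ultimately show ?thesis unfolding field_series_def using ro by (intro exI[of _ ?r]) auto
qed

lemma field_series_scale:
 fixes X :: "'k::{real_normed_field,banach}^'c::finite => 'k^'c"
 assumes "field_series X C"
 shows "field_series (%x. a *s X x) (%c q. a * C c q)"
proof -
 obtain ro where ro: "0 < ro" "!!c. pseries UNIV ro (C c) (vcomp X c)" using assms unfolding field_series_def by blast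
 have "(%h. a * vcomp X c h) = vcomp (%x. a *s X x) c" for c
  by (simp add: vcomp_def fun_eq_iff)
 then show ?thesis unfolding field_series_def using ro(1) pseries_cmult[OF ro(2), of a] by (intro exI[of _ ro]) auto
qed

text \<open>On germs of analytic fields the choice is unique by \<open>field_series_unique\<close>;
  on other germs the value is arbitrary, so linearity is available only on spaces of analytic
  germs.\<close>

definition gcoeff :: "('k^'c::finite, ('k::{real_normed_field,banach})^'c) germ => 'c \<times> ('c => nat) => 'k" where
 "gcoeff g i = (SOME k. EX X C. field_series X C & abs_germ X = g & k = C (fst i) (snd i))"

lemma gcoeff_eq:
 assumes "field_series X C"
 shows "gcoeff (abs_germ X) (c, q) = C c q"
 unfolding gcoeff_def
proof (rule some_equality)
 show "EX X' C'. field_series X' C' & abs_germ X' = abs_germ X & C c q = C' (fst (c, q)) (snd (c, q))"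
  using assms by auto
 fix k assume "EX X' C'. field_series X' C' & abs_germ X' = abs_germ X & k = C' (fst (c, q)) (snd (c, q))"
 then show "k = C c q" using field_series_unique[OF _ assms] by auto
qed

text \<open>Each functional cuts the dimension by at most one: a vector on which it is nonzero,
  together with a spanning set of its kernel, spans the space. Linearity is asked only on
  \<open>V\<close>, as this is all that \<open>gcoeff\<close> offers.\<close>

lemma (in vector_space) spanning_set_of_functionals:
 fixes f :: "'i => 'b => 'a"
 assumes "finite A" "subspace V"
  and "!!i x y. i : A ==> x : V ==> y : V ==> f i (x + y) = f i x + f i y"
  and "!!i a x. i : A ==> x : V ==> f i (scale a x) = a * f i x"
  and "!!x. x : V ==> (!!i. i : A ==> f i x = 0) ==> x = 0"
 shows "EX B. finite B & card B <= card A & V \<subseteq> span B"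
 using assms
proof (induction A arbitrary: V)
 case empty
 then have "V \<subseteq> span {}" by auto
 then show ?case by (intro exI[of _ "{}"]) auto
next
 case (insert i A)
 note V = subspace_0[OF insert.prems(1)] subspace_add[OF insert.prems(1)] subspace_scale[OF insert.prems(1)]
 define V' where "V' = {x : V. f i x = 0}"
 have f0: "f i 0 = 0" using insert.prems(3)[of i 0 0] V(1) by simp
 have V': "subspace V'"
 proof (rule subspaceI)
  show "0 : V'" using V(1) f0 by (simp add: V'_def)
  show "x + y : V'" if "x : V'" "y : V'" for x y
   using that V(2) insert.prems(2) by (simp add: V'_def)
  show "scale a x : V'" if "x : V'" for a x
   using that V(3) insert.prems(3) by (simp add: V'_def)
 qed
 have "EX B. finite B & card B <= card A & V' \<subseteq> span B"
 proof (rule insert.IH[OF V'])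
  show "x = 0" if "x : V'" "!!i. i : A ==> f i x = 0" for x
   using that by (intro insert.prems(4)) (auto simp: V'_def)
 qed (use insert.prems(2,3) in \<open>auto simp: V'_def\<close>)
 then obtain B where B: "finite B" "card B <= card A" "V' \<subseteq> span B" by blast
 show ?case
 proof (cases "V \<subseteq> V'")
  case True
  then show ?thesis using B insert.hyps by (intro exI[of _ B]) auto
 next
  case False
  then obtain w where w: "w : V" "f i w ~= 0" by (auto simp: V'_def)
  have "x : span (insert w B)" if x: "x : V" for x
  proof -
   let ?a = "f i x / f i w"
   have "x + scale (- ?a) w : V" by (intro V(2,3) x w)
   moreover have "f i (x + scale (- ?a) w) = 0"
    unfolding insert.prems(2)[OF insertI1 x V(3)[OF w(1)]] insert.prems(3)[OF insertI1 w(1)] using w(2) by simp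
   ultimately have "x + scale (- ?a) w : span B" using B(3) by (auto simp: V'_def)
   then have "x + scale (- ?a) w : span (insert w B)" using span_mono[of B "insert w B"] by auto
   moreover have "scale ?a w : span (insert w B)" by (intro span_scale span_base) simp
   ultimately have "(x + scale (- ?a) w) + scale ?a w : span (insert w B)" by (rule span_add)
   then show ?thesis by (simp add: scale_minus_left)
  qed
  moreover have "card (insert w B) <= card (insert i A)"
   using B insert.hyps card_insert_le_m1[of "card (insert i A)" B w] by (simp add: card_insert_if)
  ultimately show ?thesis using B(1) by (intro exI[of _ "insert w B"]) auto
 qed
qed

section \<open>The upper bound\<close>

context pde
begin

lemma jml_add:
 fixes f g :: "(('n, 'm) wvar => 'k) => 'k"
 assumes "analytic0 WC f" "analytic0 WC g" "set is \<subseteq> WC"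
 shows "\<forall>\<^sub>F h in nb WC. jml is (%h. f h + g h) h = jml is f h + jml is g h"
 using assms(3)
proof (induction "is")
 case (Cons i "is")
 then have IH: "\<forall>\<^sub>F h in nb WC. jml is (%h. f h + g h) h = jml is f h + jml is g h" and i: "i : WC" "set is \<subseteq> WC" by auto
 have "\<forall>\<^sub>F h in nb WC. jpartial i (%h. jml is f h + jml is g h) h = jpartial i (jml is f) h + jpartial i (jml is g) h"
  by (rule eventually_jpartial_add[OF finite_WC i(1) analytic0_jml[OF finite_WC i(2) assms(1)] analytic0_jml[OF finite_WC i(2) assms(2)]])
 then show ?case using eventually_jpartial_cong[OF IH, of i] by eventually_elim simp
qed simp

lemma jml_cmult:
 fixes f :: "(('n, 'm) wvar => 'k) => 'k"
 assumes "analytic0 WC f" "set is \<subseteq> WC"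
 shows "\<forall>\<^sub>F h in nb WC. jml is (%h. a * f h) h = a * jml is f h"
 using assms(2)
proof (induction "is")
 case (Cons i "is")
 then have IH: "\<forall>\<^sub>F h in nb WC. jml is (%h. a * f h) h = a * jml is f h" and i: "i : WC" "set is \<subseteq> WC" by auto
 have "\<forall>\<^sub>F h in nb WC. jpartial i (%h. a * jml is f h) h = jpartial i (%_. a) h * jml is f h + a * jpartial i (jml is f) h"
  by (rule eventually_jpartial_mult[OF finite_WC i(1) analytic0_const analytic0_jml[OF finite_WC i(2) assms(1)]])
 then show ?case using eventually_jpartial_cong[OF IH, of i] by eventually_elim simp
qed simp

lemma xlist_WC: "set (xlist aa :: ('n, 'm) wvar list) \<subseteq> WC"
 using set_xlist by auto

lemma charac_add: "charac (%x. X x + Y x) j = (%h. charac X j h + charac Y j h)"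
 by (rule ext) (simp add: charac_def vcomp_def distrib_right sum.distrib)

lemma charac_scale: "charac (%x. a *s X x) j = (%h. a * charac X j h)"
 by (rule ext) (simp add: charac_def vcomp_def right_diff_distrib sum_distrib_left mult.assoc)

lemma pde_lin_iff:
 "pde_lin \<kappa> F X \<longleftrightarrow> vec_analytic_at X 0 & (ALL j aa. mdeg aa = \<kappa> --> (\<forall>\<^sub>F h in nb WC. h tv = 0 --> jm aa (charac X j) h =
   (SUM d:JC. jpartial d (F j aa) (%d. U0 d h) * (case d of Xc l => 0 | Uc i be => jm be (charac X i) h))))"
 unfolding pde_lin_def pde_lin_axioms_def using pde_axioms by blast

lemma vec_analytic_at_zero_iff: "vec_analytic_at X 0 \<longleftrightarrow> (ALL c. analytic0 UNIV (vcomp X c))"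
 for X :: "'k^('n + 'm) => 'k^('n + 'm)"
 unfolding vec_analytic_at_def vcomp_def[abs_def] by (simp add: kanalytic_at_iff_analytic0)

lemma pde_lin_add:
 assumes X: "pde_lin \<kappa> F X" and Y: "pde_lin \<kappa> F Y"
 shows "pde_lin \<kappa> F (%x. X x + Y x)"
 unfolding pde_lin_iff
proof (intro conjI allI impI)
 have aX: "vec_analytic_at X 0" and aY: "vec_analytic_at Y 0" using X Y by (auto simp: pde_lin_iff)
 have "vcomp (%x. X x + Y x) c = (%h. vcomp X c h + vcomp Y c h)" for c
  by (simp add: vcomp_def fun_eq_iff)
 then show "vec_analytic_at (%x. X x + Y x) 0"
  using aX aY by (auto simp: vec_analytic_at_zero_iff intro: analytic0_add)
 have ja: "\<forall>\<^sub>F h in nb WC. jm be (charac (%x. X x + Y x) i) h = jm be (charac X i) h + jm be (charac Y i) h" for be i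
  unfolding charac_add jm_def'
  by (rule jml_add[OF pde_lin.charac_analytic0[OF X] pde_lin.charac_analytic0[OF Y] xlist_WC])
 fix j and aa :: "'n mindex" assume aa: "mdeg aa = \<kappa>"
 have "\<forall>\<^sub>F h in nb WC. ALL d:JC. (case d of Xc l => 0 | Uc i be => jm be (charac (%x. X x + Y x) i) h) =
   (case d of Xc l => 0 | Uc i be => jm be (charac X i) h) + (case d of Xc l => 0 | Uc i be => jm be (charac Y i) h)"
 proof (intro eventually_ball_finite ballI finite_jcoords)
  fix d :: "('n, 'm) jcoord"
  show "\<forall>\<^sub>F h in nb WC. (case d of Xc l => 0 | Uc i be => jm be (charac (%x. X x + Y x) i) h) =
   (case d of Xc l => 0 | Uc i be => jm be (charac X i) h) + (case d of Xc l => 0 | Uc i be => jm be (charac Y i) h)"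
   by (cases d) (simp_all add: ja)
 qed
 then show "\<forall>\<^sub>F h in nb WC. h tv = 0 --> jm aa (charac (%x. X x + Y x) j) h =
   (SUM d:JC. jpartial d (F j aa) (%d. U0 d h) * (case d of Xc l => 0 | Uc i be => jm be (charac (%x. X x + Y x) i) h))"
  using ja[of aa j] pde_lin.linearized[OF X aa, of j] pde_lin.linearized[OF Y aa, of j]
  by eventually_elim (simp add: distrib_left sum.distrib)
qed

lemma pde_lin_scale:
 assumes X: "pde_lin \<kappa> F X"
 shows "pde_lin \<kappa> F (%x. a *s X x)"
 unfolding pde_lin_iff
proof (intro conjI allI impI)
 have aX: "vec_analytic_at X 0" using X by (auto simp: pde_lin_iff)
 have "vcomp (%x. a *s X x) c = (%h. a * vcomp X c h)" for c
  by (simp add: vcomp_def fun_eq_iff)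
 then show "vec_analytic_at (%x. a *s X x) 0"
  using aX by (auto simp: vec_analytic_at_zero_iff intro!: analytic0_mult)
 have ja: "\<forall>\<^sub>F h in nb WC. jm be (charac (%x. a *s X x) i) h = a * jm be (charac X i) h" for be i
  unfolding charac_scale jm_def'
  by (rule jml_cmult[OF pde_lin.charac_analytic0[OF X] xlist_WC])
 fix j and aa :: "'n mindex" assume aa: "mdeg aa = \<kappa>"
 have "\<forall>\<^sub>F h in nb WC. ALL d:JC. (case d of Xc l => 0 | Uc i be => jm be (charac (%x. a *s X x) i) h) =
   a * (case d of Xc l => 0 | Uc i be => jm be (charac X i) h)"
 proof (intro eventually_ball_finite ballI finite_jcoords)
  fix d :: "('n, 'm) jcoord"
  show "\<forall>\<^sub>F h in nb WC. (case d of Xc l => 0 | Uc i be => jm be (charac (%x. a *s X x) i) h) =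
   a * (case d of Xc l => 0 | Uc i be => jm be (charac X i) h)"
   by (cases d) (simp_all add: ja)
 qed
 then show "\<forall>\<^sub>F h in nb WC. h tv = 0 --> jm aa (charac (%x. a *s X x) j) h =
   (SUM d:JC. jpartial d (F j aa) (%d. U0 d h) * (case d of Xc l => 0 | Uc i be => jm be (charac (%x. a *s X x) i) h))"
  using ja[of aa j] pde_lin.linearized[OF X aa, of j]
  by eventually_elim (simp add: sum_distrib_left mult.left_commute)
qed

lemma pde_lin_zero: "pde_lin \<kappa> F (%_. 0)"
proof -
 have c: "charac (%_. 0) j = (%_. 0)" for j by (rule ext) (simp add: charac_def vcomp_def)
 have j0: "jml is (%_. 0) = (%_. 0)" for "is" :: "('n, 'm) wvar list" by (induction "is") auto
 have cz: "(case d of Xc l => 0 | Uc i be => 0) = (0 :: 'k)" for d :: "('n, 'm) jcoord" by (cases d) auto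
 show ?thesis
  unfolding pde_lin_iff vec_analytic_at_zero_iff c jm_def' j0 cz by (simp add: vcomp_def[abs_def])
qed

lemma pde_lin_of_symmetry:
 assumes "infinitesimal_symmetry \<kappa> F X"
 shows "pde_lin \<kappa> F X"
proof -
 obtain \<Psi> where "vec_analytic_at X 0" "local_flow X \<Psi>" "\<forall>\<^sub>F s in nhds 0. lie_symmetry \<kappa> F (\<Psi> s)"
  using assms by (auto simp: infinitesimal_symmetry_def)
 then have s: "pde_sym \<kappa> F X \<Psi>"
  by (intro pde_sym.intro pde_axioms pde_sym_axioms.intro)
 show ?thesis unfolding pde_lin_iff using pde_sym.linearized_equation[OF s] \<open>vec_analytic_at X 0\<close> by blast
qed

text \<open>The second set has total weight exactly \<open>\<kappa>\<close>: for a variable of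
  weight 1 it contains the coefficient of its square in its own component, the coordinate that
  detects a projective symmetry.\<close>

definition free_coeffs :: "(('n + 'm) \<times> ('n + 'm => nat)) set" where
 "free_coeffs = {(c, q). wt q + edef c <= \<kappa> - 1} \<union> {(d, %i. if i = d then 2 else 0) | d. wgt d = 1}"

lemma finite_free_coeffs: "finite free_coeffs"
proof -
 have "{(c, q). wt q + edef c <= \<kappa> - 1} = (\<Union>c\<in>UNIV. \<Union>N\<in>{..\<kappa> - 1}. Pair c ` {q. wt q + edef c = N})" by auto
 moreover have "finite (\<Union>c\<in>UNIV. \<Union>N\<in>{..\<kappa> - 1}. Pair c ` {q. wt q + edef c = N})"
  by (intro finite_UN_I finite_imageI finite_wt) auto
 moreover have "{(d, %i. if i = d then 2 else 0 :: nat) | d :: 'n + 'm. wgt d = 1} \<subseteq> range (%d. (d, %i. if i = d then 2 else 0))" by auto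
 then have "finite {(d, %i. if i = d then 2 else 0 :: nat) | d :: 'n + 'm. wgt d = 1}"
  by (rule finite_subset) auto
 ultimately show ?thesis unfolding free_coeffs_def by simp
qed

theorem Sym_dim_bound: "germ_dim_le (Sym \<kappa> F) (card free_coeffs)"
proof -
 \<comment> \<open>A vector space of analytic germs that contains the symmetries; the dimension is
   bounded there.\<close>
 define V where "V = abs_germ ` {X. pde_lin \<kappa> F X}"
 have an: "vec_analytic_at X 0" if "pde_lin \<kappa> F X" for X using that by (simp add: pde_lin_iff)
 have sub: "germ.subspace V"
 proof (rule germ.subspaceI)
  show "0 : V" using pde_lin_zero by (auto simp: V_def zero_germ_def)
  show "x + y : V" if "x : V" "y : V" for x y
   using that pde_lin_add by (auto simp: V_def plus_germ.abs_eq)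
  show "germ_scale a x : V" if "x : V" for a x
   using that pde_lin_scale by (auto simp: V_def germ_scale.abs_eq)
 qed
 have "EX B. finite B & card B <= card free_coeffs & V \<subseteq> germ.span B"
 proof (rule germ.spanning_set_of_functionals[where f = "%i g. gcoeff g i", OF finite_free_coeffs sub])
  fix i x y assume "x : V" "y : V"
  then obtain X Y where X: "x = abs_germ X" "pde_lin \<kappa> F X" and Y: "y = abs_germ Y" "pde_lin \<kappa> F Y" by (auto simp: V_def)
  obtain C D where CD: "field_series X C" "field_series Y D" using ex_field_series[OF an] X Y by blast
  show "gcoeff (x + y) i = gcoeff x i + gcoeff y i"
   by (cases i) (simp add: X Y plus_germ.abs_eq gcoeff_eq[OF field_series_add[OF CD]] gcoeff_eq[OF CD(1)] gcoeff_eq[OF CD(2)])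
 next
  fix i a x assume "x : V"
  then obtain X where X: "x = abs_germ X" "pde_lin \<kappa> F X" by (auto simp: V_def)
  obtain C where C: "field_series X C" using ex_field_series[OF an] X by blast
  show "gcoeff (germ_scale a x) i = a * gcoeff x i"
   by (cases i) (simp add: X germ_scale.abs_eq gcoeff_eq[OF field_series_scale[OF C]] gcoeff_eq[OF C])
 next
  fix x assume "x : V" and z: "!!i. i : free_coeffs ==> gcoeff x i = 0"
  then obtain X where X: "x = abs_germ X" "pde_lin \<kappa> F X" by (auto simp: V_def)
  obtain C where C: "field_series X C" using ex_field_series[OF an] X by blast
  have Cz: "C c q = 0" if "(c, q) : free_coeffs" for c q
   using z[OF that] gcoeff_eq[OF C] by (simp add: X)
  obtain ro where ro: "0 < ro" "!!c. pseries UNIV ro (C c) (vcomp X c)" using C by (auto simp: field_series_def)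
  have "C c q = 0" for c q
   by (rule pde_lin.coefficients_determine[OF X(2) ro]) (auto intro!: Cz simp: free_coeffs_def)
  then have "C = (%_ _. 0)" by (simp add: fun_eq_iff)
  then show "x = 0" using field_series_zero C X by blast
 qed
 then obtain B where B: "finite B" "card B <= card free_coeffs" "V \<subseteq> germ.span B" by blast
 have "Sym \<kappa> F \<subseteq> V" using pde_lin_of_symmetry by (auto simp: Sym_def V_def)
 then have s: "Sym \<kappa> F \<subseteq> germ.span B" using B(3) by blast
 have "germ.dim (Sym \<kappa> F) <= card B" by (rule germ.dim_le_card[OF s B(1)])
 then show ?thesis unfolding germ_dim_le_def using s B by fastforce
qed

end

subsection \<open>Counting the free coefficients\<close>

text \<open>Splitting off the exponent of one variable reduces the count to a sum of binomial
  coefficients along a diagonal.\<close>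

lemma card_bounded_exponents:
 fixes S :: "'i set"
 assumes "finite S"
 shows "finite {a :: 'i => nat. (ALL i. i ~: S --> a i = 0) & sum a S <= r} &
  card {a :: 'i => nat. (ALL i. i ~: S --> a i = 0) & sum a S <= r} = (card S + r) choose r"
 using assms
proof (induction S arbitrary: r)
 case empty
 have "{a :: 'i => nat. ALL i. a i = 0} = {%_. 0}" by auto
 then show ?case by simp
next
 case (insert i S)
 define T where "T r = {a :: 'i => nat. (ALL i. i ~: S --> a i = 0) & sum a S <= r}" for r
 have T: "finite (T r)" "card (T r) = (card S + r) choose r" for r using insert.IH by (auto simp: T_def)
 have s: "sum (a(i := k)) S = sum a S" for a :: "'i => nat" and k
  by (rule sum.cong) (use insert.hyps in auto)
 have ins: "sum a (insert i S) = a i + sum a S" for a :: "'i => nat" using insert.hyps by simp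
 have eq: "{a :: 'i => nat. (ALL j. j ~: insert i S --> a j = 0) & sum a (insert i S) <= r} =
   (\<Union>k\<in>{..r}. (%a. a(i := k)) ` T (r - k))" (is "?L = ?R")
 proof
  show "?L \<subseteq> ?R"
  proof
   fix a assume a: "a : ?L"
   have "a(i := 0) : T (r - a i)" unfolding T_def mem_Collect_eq s using a insert.hyps by (auto simp: ins)
   then have "a : (%b. b(i := a i)) ` T (r - a i)" by (intro image_eqI[of _ _ "a(i := 0)"]) auto
   moreover have "a i <= r" using a by (auto simp: ins)
   ultimately show "a : ?R" by blast
  qed
  show "?R \<subseteq> ?L"
  proof
   fix b assume "b : ?R"
   then obtain k a where k: "k <= r" "a : T (r - k)" and b: "b = a(i := k)" by blast
   show "b : ?L" unfolding mem_Collect_eq b ins s using k by (auto simp: T_def)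
  qed
 qed
 have inj: "inj_on (%a. a(i := k)) (T r')" for k r'
 proof (rule inj_onI)
  fix a b :: "'i => nat" assume "a : T r'" "b : T r'" and e: "a(i := k) = b(i := k)"
  then have "a i = b i" using insert.hyps by (auto simp: T_def)
  moreover have "a j = b j" if "j ~= i" for j using fun_cong[OF e, of j] that by simp
  ultimately show "a = b" by (intro ext) metis
 qed
 have "card ?R = (\<Sum>k\<le>r. card ((%a. a(i := k)) ` T (r - k)))"
 proof (rule card_UN_disjoint)
  show "ALL k:{..r}. ALL k':{..r}. k ~= k' --> (%a. a(i := k)) ` T (r - k) \<inter> (%a. a(i := k')) ` T (r - k') = {}"
   by (auto dest: fun_cong[of _ _ i])
 qed (use T in auto)
 also have "... = (\<Sum>k\<le>r. (card S + (r - k)) choose (r - k))"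
  by (intro sum.cong refl) (simp add: card_image[OF inj] T)
 also have "... = (\<Sum>k\<le>r. (card S + k) choose k)"
  by (rule sum.reindex_bij_witness[of _ "%k. r - k" "%k. r - k"]) auto
 also have "... = Suc (card S + r) choose r" by (rule sum_choose_lower)
 finally have "card ?R = (card (insert i S) + r) choose r" using insert.hyps by simp
 moreover have "finite ?R" using T by auto
 ultimately show ?case unfolding eq by blast
qed

context pde
begin

text \<open>For \<open>\<kappa> = 2\<close> the dependent variables also have weight 1; this is the
  source of the two cases in the final formula.\<close>

lemma card_wgt_one: "card {d. wgt d = 1} = CARD('n) + (if \<kappa> = 2 then CARD('m) else 0)"
proof -
 have "{d :: 'n + 'm. wgt d = 1} = (if \<kappa> = 2 then UNIV else range Inl)"
 proof (rule set_eqI)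
  fix d :: "'n + 'm"
  show "d : {d. wgt d = 1} \<longleftrightarrow> d : (if \<kappa> = 2 then UNIV else range Inl)"
   using order by (cases d) auto
 qed
 moreover have "card (range Inl :: ('n + 'm) set) = CARD('n)" by (rule card_image) simp
 ultimately show ?thesis by simp
qed

lemma wt_unit: "wt (%i. if i = d then k else 0) = wgt d * k"
 unfolding wt_def by (subst sum.remove[of _ d]) auto

lemma wgt_pos: "0 < wgt d"
 using order by (cases d) auto

lemma wt_split: "wt q = (SUM l:UNIV. q (Inl l)) + (\<kappa> - 1) * (SUM j:UNIV. q (Inr j))"
 unfolding wt_def UNIV_Plus_UNIV[symmetric] by (subst sum.Plus) (auto simp: sum_distrib_left)

lemma wt_le_one_cases:
 assumes "wt q <= 1"
 shows "q = (%_. 0) | (EX d. wgt d = 1 & q = (%i. if i = d then 1 else 0))"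
proof -
 consider "wt q = 0" | "wt q = 1" using assms by fastforce
 then show ?thesis
 proof cases
  case 1
  then have "ALL i:UNIV. wgt i * q i = 0" unfolding wt_def sum_eq_0_iff[OF finite_class.finite] .
  from bspec[OF this UNIV_I] have "q i = 0" for i using wgt_pos[of i] by (metis mult_is_0 less_irrefl)
  then show ?thesis by blast
 next
  case 2
  from this[unfolded wt_def sum_eq_1_iff[OF finite_class.finite]]
  obtain d where d: "wgt d * q d = 1" "ALL i:UNIV. d ~= i --> wgt i * q i = 0" by blast
  have "q i = (if i = d then 1 else 0)" for i
   using d(1) d(2)[rule_format, of i] wgt_pos[of i] by (cases "i = d") auto
  then have "q = (%i. if i = d then 1 else 0)" by blast
  moreover have "wgt d = 1" using d(1) by simp
  ultimately show ?thesis by blast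
 qed
qed

lemma card_wt_le_one: "card {q. wt q <= 1} = 1 + card {d. wgt d = 1}"
proof -
 let ?e = "%(d :: 'n + 'm) i. if i = d then 1 else 0 :: nat"
 have "{q. wt q <= 1} = insert (%_. 0) (?e ` {d. wgt d = 1})"
 proof
  show "insert (%_. 0) (?e ` {d. wgt d = 1}) \<subseteq> {q. wt q <= 1}" by (auto simp: wt_unit) (simp add: wt_def)
  show "{q. wt q <= 1} \<subseteq> insert (%_. 0) (?e ` {d. wgt d = 1})" using wt_le_one_cases by blast
 qed
 moreover have "inj_on ?e {d. wgt d = 1}" by (rule inj_onI) (metis zero_neq_one)
 moreover have "(%_. 0) ~: ?e ` {d. wgt d = 1}"
 proof
  assume "(%_. 0) : ?e ` {d. wgt d = 1}"
  then obtain d where "(%_. 0) = ?e d" by blast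
  from fun_cong[OF this, of d] show False by simp
 qed
 ultimately show ?thesis by (simp add: card_image)
qed

text \<open>A single \<open>u^j\<close> uses up the whole weight \<open>\<kappa> - 1\<close>. So the
  monomials are those in \<open>x\<close> alone of degree at most \<open>\<kappa> - 1\<close>, and
  the \<open>u^j\<close> themselves.\<close>

lemma card_wt_le: "card {q. wt q <= \<kappa> - 1} = ((CARD('n) + \<kappa> - 1) choose (\<kappa> - 1)) + CARD('m)"
proof -
 let ?S = "range Inl :: ('n + 'm) set"
 let ?A = "{a :: 'n + 'm => nat. (ALL i. i ~: ?S --> a i = 0) & sum a ?S <= \<kappa> - 1}"
 let ?e = "%j (i :: 'n + 'm). if i = Inr j then 1 else 0 :: nat"
 have sS: "sum a ?S = (SUM l:UNIV. a (Inl l))" for a :: "'n + 'm => nat" by (subst sum.reindex) auto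
 have Inr0: "(ALL i. i ~: ?S --> a i = 0) \<longleftrightarrow> (ALL j. a (Inr j) = 0)" for a :: "'n + 'm => nat"
 proof -
  have "i ~: ?S \<longleftrightarrow> (EX j. i = Inr j)" for i by (cases i) auto
  then show ?thesis by auto
 qed
 have eq: "{q. wt q <= \<kappa> - 1} = ?A \<union> range ?e"
 proof
  show "?A \<union> range ?e \<subseteq> {q. wt q <= \<kappa> - 1}"
   unfolding Inr0 sS by (auto simp: wt_split wt_unit)
  show "{q. wt q <= \<kappa> - 1} \<subseteq> ?A \<union> range ?e"
  proof
   fix q assume "q : {q. wt q <= \<kappa> - 1}"
   then have q: "(SUM l:UNIV. q (Inl l)) + (\<kappa> - 1) * (SUM j:UNIV. q (Inr j)) <= \<kappa> - 1" by (simp add: wt_split)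
   show "q : ?A \<union> range ?e"
   proof (cases "(SUM j:UNIV. q (Inr j)) = 0")
    case True
    then show ?thesis using q unfolding Inr0 sS by auto
   next
    case False
    have "(SUM j:UNIV. q (Inr j)) = 1"
    proof (rule ccontr)
     assume "(SUM j:UNIV. q (Inr j)) ~= 1"
     then have "(\<kappa> - 1) * 2 <= (\<kappa> - 1) * (SUM j:UNIV. q (Inr j))" using False by (intro mult_left_mono) linarith+
     then show False using q order by linarith
    qed
    moreover from this have l: "q (Inl l) = 0" for l using q by simp
    ultimately have "(SUM j:UNIV. q (Inr j)) = 1" by simp
    from this[unfolded sum_eq_1_iff[OF finite_class.finite]]
    obtain j where j: "q (Inr j) = 1" "ALL i:UNIV. j ~= i --> q (Inr i) = 0" by blast
    have "q i = ?e j i" for i using j l by (cases i) auto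
    then have "q = ?e j" by blast
    then show ?thesis by blast
   qed
  qed
 qed
 have fS: "finite ?S" by simp
 have cS: "card ?S = CARD('n)" by (rule card_image) simp
 have A: "finite ?A" "card ?A = (CARD('n) + (\<kappa> - 1)) choose (\<kappa> - 1)"
  using card_bounded_exponents[OF fS, of "\<kappa> - 1"] unfolding cS by blast+
 have "inj ?e" by (rule injI) (metis sum.inject(2) zero_neq_one)
 then have "card (range ?e) = CARD('m)" by (rule card_image)
 moreover have "?A \<inter> range ?e = {}"
 proof (rule equals0I)
  fix a assume "a : ?A \<inter> range ?e"
  then obtain j where "a = ?e j" "ALL j. a (Inr j) = 0" unfolding Inr0 by blast
  from this(1) this(2)[rule_format, of j] show False by simp
 qed
 moreover have "finite (range ?e)" by simp
 ultimately have "card {q. wt q <= \<kappa> - 1} = card ?A + CARD('m)"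
  unfolding eq using A(1) by (simp add: card_Un_disjoint)
 moreover have "CARD('n) + (\<kappa> - 1) = CARD('n) + \<kappa> - 1" using order by simp
 ultimately show ?thesis using A(2) by simp
qed

lemma card_free_coeffs:
 "card free_coeffs = CARD('n) * (1 + card {d. wgt d = 1}) +
   CARD('m) * (((CARD('n) + \<kappa> - 1) choose (\<kappa> - 1)) + CARD('m)) + card {d. wgt d = 1}"
proof -
 let ?q = "%d :: 'n + 'm. (d, %i. if i = d then 2 else 0 :: nat)"
 let ?A = "range (Inl :: 'n => 'n + 'm) \<times> {q. wt q <= 1}" and ?B = "range (Inr :: 'm => 'n + 'm) \<times> {q. wt q <= \<kappa> - 1}"
  and ?D = "?q ` {d. wgt d = 1}"
 \<comment> \<open>The offset leaves weight at most 1 for the coefficients \<open>Q^l\<close> and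
   weight at most \<open>\<kappa> - 1\<close> for the \<open>R^j\<close>.\<close>
 have e: "wt q + edef c <= \<kappa> - 1 \<longleftrightarrow> (c, q) : ?A \<union> ?B" for c q
  using order by (cases c) auto
 have eq: "free_coeffs = ?A \<union> ?B \<union> ?D"
  unfolding free_coeffs_def using e by auto
 have f: "finite ?A" "finite ?B" "finite ?D"
  using finite_free_coeffs unfolding eq by auto
 have AB: "?A \<inter> ?B = {}" by auto
 have "(?A \<union> ?B) \<inter> ?D = {}"
 proof -
  have "wt (snd (?q d)) + edef (fst (?q d)) = \<kappa>" if "wgt d = 1" for d
   using that order by (cases d) (auto simp: wt_unit)
  then have "?q d ~: ?A \<union> ?B" if "wgt d = 1" for d
   unfolding e[symmetric] using that order by simp
  then show ?thesis by auto
 qed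
 then have "card free_coeffs = card ?A + card ?B + card ?D"
  unfolding eq using f AB by (simp add: card_Un_disjoint)
 moreover have "card ?A = CARD('n) * (1 + card {d. wgt d = 1})"
  unfolding card_cartesian_product card_wt_le_one by (subst card_image) auto
 moreover have "card ?B = CARD('m) * (((CARD('n) + \<kappa> - 1) choose (\<kappa> - 1)) + CARD('m))"
  unfolding card_cartesian_product card_wt_le by (subst card_image) auto
 moreover have "card ?D = card {d. wgt d = 1}" by (rule card_image) (auto intro: inj_onI)
 ultimately show ?thesis by simp
qed

lemma card_free_coeffs_2: "\<kappa> = 2 ==> card free_coeffs = (CARD('n) + CARD('m) + 2) * (CARD('n) + CARD('m))"
 unfolding card_free_coeffs card_wgt_one by (simp add: algebra_simps)

lemma card_free_coeffs_3:
 "\<kappa> >= 3 ==> card free_coeffs = (CARD('n))\<^sup>2 + 2 * CARD('n) + (CARD('m))\<^sup>2 + CARD('m) * ((CARD('n) + \<kappa> - 1) choose (\<kappa> - 1))"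
 unfolding card_free_coeffs card_wgt_one by (simp add: algebra_simps power2_eq_square)

end

section \<open>The homogeneous system\<close>

subsection \<open>Polynomial functions\<close>

definition aff :: "('k^'n::finite => 'k::comm_ring_1) => bool" where
 "aff L \<longleftrightarrow> (EX a b. L = (%x. a + (SUM l:UNIV. b l * x $ l)))"

text \<open>Polynomial functions of degree at most \<open>r\<close>, as sums of products of \<open>r\<close> affine functions. In this form
  they are visibly stable under projective changes of coordinates.\<close>

inductive PF :: "nat => ('k^'n::finite => 'k::comm_ring_1) => bool" where
 zero: "PF r (%_. 0)"
| add: "PF r f ==> PF r g ==> PF r (%x. f x + g x)"
| monomial: "length Ls = r ==> ALL L:set Ls. aff L ==> PF r (%x. c * (\<Prod>L\<leftarrow>Ls. L x))"

lemma aff_const [simp]: "aff (%_. a)"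
 unfolding aff_def by (intro exI[of _ a] exI[of _ "%_. 0"]) simp

lemma aff_coord: "aff (%x :: 'k::comm_ring_1^'n::finite. x $ l)"
proof -
 have "(SUM k:UNIV. (if k = l then 1 else 0) * x $ k) = x $ l" for x :: "'k^'n"
 proof -
  have "(SUM k:UNIV. (if k = l then 1 else 0) * x $ k) = (SUM k:UNIV. if k = l then x $ k else 0)"
   by (rule sum.cong) auto
  then show ?thesis by simp
 qed
 then show ?thesis unfolding aff_def by (intro exI[of _ 0] exI[of _ "%k. if k = l then 1 else 0"]) simp
qed

lemma aff_add: "aff f ==> aff g ==> aff (%x. f x + g x)"
proof -
 assume "aff f" "aff g"
 then obtain a b a' b' where "f = (%x. a + (SUM l:UNIV. b l * x $ l))" "g = (%x. a' + (SUM l:UNIV. b' l * x $ l))"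
  unfolding aff_def by blast
 then show ?thesis unfolding aff_def
  by (intro exI[of _ "a + a'"] exI[of _ "%l. b l + b' l"]) (simp add: algebra_simps sum.distrib)
qed

lemma aff_cmult: "aff f ==> aff (%x. c * f x)"
proof -
 assume "aff f"
 then obtain a b where "f = (%x. a + (SUM l:UNIV. b l * x $ l))" unfolding aff_def by blast
 then show ?thesis unfolding aff_def
  by (intro exI[of _ "c * a"] exI[of _ "%l. c * b l"]) (simp add: algebra_simps sum_distrib_left)
qed

lemma aff_sum: "finite A ==> (!!i. i : A ==> aff (f i)) ==> aff (%x. SUM i:A. f i x)"
 by (induction A rule: finite_induct) (auto intro: aff_add)

lemma aff_compose:
 assumes "aff L" "!!l. aff (%x. a x $ l)"
 shows "aff (%x. L (a x))"
proof -
 obtain c b where L: "L = (%x. c + (SUM l:UNIV. b l * x $ l))" using assms(1) unfolding aff_def by blast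
 show ?thesis unfolding L by (intro aff_add aff_const aff_sum aff_cmult assms(2)) auto
qed

lemma PF_cmult: "PF r f ==> PF r (%x. c * f x)"
proof (induction rule: PF.induct)
 case (monomial Ls r d)
 then show ?case using PF.monomial[of Ls r "c * d"] by (simp add: mult.assoc)
qed (auto simp: distrib_left intro: PF.zero PF.add)

lemma PF_sum: "finite A ==> (!!i. i : A ==> PF r (f i)) ==> PF r (%x. SUM i:A. f i x)"
 by (induction A rule: finite_induct) (auto intro: PF.zero PF.add)

lemma PF_const: "PF 0 (%_. c)"
 using PF.monomial[of "[]" 0 c] by simp

lemma PF_aff: "aff L ==> PF 1 L"
 using PF.monomial[of "[L]" 1 1] by simp

lemma PF_mult:
 assumes "PF r f" "PF s g"
 shows "PF (r + s) (%x. f x * g x)"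
 using assms(1)
proof (induction rule: PF.induct)
 case (monomial Ls r c)
 show ?case using assms(2)
 proof (induction rule: PF.induct)
  case (monomial Ms s d)
  have "PF (r + s) (%x. (c * d) * (\<Prod>L\<leftarrow>Ls @ Ms. L x))"
   by (rule PF.monomial) (use monomial \<open>length Ls = r\<close> \<open>ALL L:set Ls. aff L\<close> in auto)
  then show ?case by (simp add: mult_ac)
 qed (auto simp: distrib_left intro: PF.zero PF.add)
qed (auto simp: distrib_right intro: PF.zero PF.add)

lemma PF_mono:
 fixes f :: "'k::comm_ring_1^'n::finite => 'k"
 assumes "PF r f" "r <= s"
 shows "PF s f"
proof -
 have "PF k (%_ :: 'k^'n. 1 :: 'k)" for k
  using PF.monomial[of "replicate k (%_. 1)" k 1] by simp
 from PF_mult[OF assms(1) this[of "s - r"]] show ?thesis using assms(2) by simp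
qed

lemma PF_power: "PF r f ==> PF (r * n) (%x. f x ^ n)"
proof (induction n)
 case (Suc n)
 then show ?case using PF_mult[of r f "r * n" "%x. f x ^ n"] by simp
qed (simp add: PF_const)

lemma PF_prod: "finite A ==> (!!i. i : A ==> PF (r i) (f i)) ==> PF (SUM i:A. r i) (%x. PROD i:A. f i x)"
 by (induction A rule: finite_induct) (auto intro: PF_const PF_mult)

lemma PF_compose:
 assumes "PF r f" "!!l. aff (%x. a x $ l)"
 shows "PF r (%x. f (a x))"
 using assms(1)
proof (induction rule: PF.induct)
 case (monomial Ls r c)
 have "PF r (%x. c * (\<Prod>L\<leftarrow>map (%L x. L (a x)) Ls. L x))"
  by (rule PF.monomial) (use monomial aff_compose assms(2) in auto)
 then show ?case by (simp add: o_def)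
qed (auto intro: PF.zero PF.add)

text \<open>If \<open>L\<close> and \<open>E\<close> are affine, \<open>E y * L (y / E y)\<close>
  extends to an affine function of \<open>y\<close>; distributing the power of \<open>E\<close> over
  the \<open>r\<close> factors clears all denominators.\<close>

lemma PF_homogenize:
 fixes f :: "'k::field^'n::finite => 'k"
 assumes "PF r f" and E: "aff E"
 shows "EX v. PF r v & (ALL y. E y ~= 0 --> v y = E y ^ r * f ((1 / E y) *s y))"
 using assms(1)
proof (induction rule: PF.induct)
 case (zero r)
 show ?case by (intro exI[of _ "%_. 0"]) (auto intro: PF.zero)
next
 case (add r f g)
 then obtain v w where "PF r v" "ALL y. E y ~= 0 --> v y = E y ^ r * f ((1 / E y) *s y)"
  "PF r w" "ALL y. E y ~= 0 --> w y = E y ^ r * g ((1 / E y) *s y)" by blast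
 then show ?case by (intro exI[of _ "%y. v y + w y"]) (auto simp: distrib_left intro: PF.add)
next
 case (monomial Ls r c)
 have "EX M. aff M & (ALL y. E y ~= 0 --> M y = E y * L ((1 / E y) *s y))" if aL: "aff L" for L
 proof -
  obtain a b where L: "L = (%x. a + (SUM l:UNIV. b l * x $ l))" using aL unfolding aff_def by blast
  show ?thesis
  proof (intro exI conjI allI impI)
   show "aff (%y. a * E y + (SUM l:UNIV. b l * y $ l))"
    by (intro aff_add aff_cmult aff_sum aff_coord E) auto
   fix y assume "E y ~= 0"
   then show "a * E y + (SUM l:UNIV. b l * y $ l) = E y * L ((1 / E y) *s y)"
    by (simp add: L distrib_left sum_distrib_left mult_ac)
  qed
 qed
 then obtain M where M: "!!L. aff L ==> aff (M L)" "!!L y. aff L ==> E y ~= 0 ==> M L y = E y * L ((1 / E y) *s y)"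
  by metis
 show ?case
 proof (intro exI conjI allI impI)
  show "PF r (%y. c * (\<Prod>L\<leftarrow>map M Ls. L y))" by (rule PF.monomial) (use monomial M in auto)
  fix y assume y: "E y ~= 0"
  have "(\<Prod>L\<leftarrow>map M Ls. L y) = E y ^ length Ls * (\<Prod>L\<leftarrow>Ls. L ((1 / E y) *s y))" if "ALL L:set Ls. aff L" for Ls
   using that by (induction Ls) (auto simp: M(2)[OF _ y])
  with monomial show "c * (\<Prod>L\<leftarrow>map M Ls. L y) = E y ^ r * (c * (\<Prod>L\<leftarrow>Ls. L ((1 / E y) *s y)))"
   by (simp add: mult_ac)
 qed
qed

lemma PF_1_aff:
 assumes "PF 1 f"
 shows "aff f"
proof -
 have "PF r f ==> r = 1 ==> aff f" for r
 proof (induction rule: PF.induct)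
  case (monomial Ls r c)
  then obtain L where "Ls = [L]" by (metis One_nat_def length_0_conv length_Suc_conv)
  then show ?case using monomial by (simp add: aff_cmult)
 qed (auto intro: aff_add)
 then show ?thesis using assms by blast
qed

lemma aff_field_derivative:
 fixes b :: "'n::finite => 'k::real_normed_field"
 shows "((%t. a + (SUM k:UNIV. b k * (x + axis l t) $ k)) has_field_derivative b l) (at 0)"
proof -
 have "(SUM k:UNIV. b k * (x + axis l t) $ k) = (SUM k:UNIV. b k * x $ k) + b l * t" for t
 proof -
  have "(SUM k:UNIV. b k * (x + axis l t) $ k) = (SUM k:UNIV. b k * x $ k + (if k = l then b k * t else 0))"
   by (rule sum.cong) (auto simp: axis_def algebra_simps)
  then show ?thesis by (simp add: sum.distrib)
 qed
 then show ?thesis by (auto intro!: derivative_eq_intros)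
qed

text \<open>\<open>PFz d\<close> is degree less than \<open>d\<close>, so that differentiation lowers \<open>d\<close>.\<close>

definition PFz :: "nat => ('k^'n::finite => 'k::real_normed_field) => bool" where
 "PFz d f \<longleftrightarrow> (case d of 0 => f = (%_. 0) | Suc r => PF r f)"

lemma PFz_zero: "PFz d (%_. 0)"
 by (cases d) (auto simp: PFz_def intro: PF.zero)

text \<open>Product rule along the list of factors: differentiating an affine factor leaves a
  constant, so every term loses one factor.\<close>

lemma PF_derivative:
 fixes f :: "'k::real_normed_field^'n::finite => 'k"
 assumes "PF r f"
 shows "EX f'. PFz r f' & (ALL x. ((%t. f (x + axis l t)) has_field_derivative f' x) (at 0))"
 using assms
proof (induction rule: PF.induct)
 case (zero r)
 show ?case by (intro exI[of _ "%_. 0"]) (auto simp: PFz_zero)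
next
 case (add r f g)
 then obtain f' g' where f': "PFz r f'" "ALL x. ((%t. f (x + axis l t)) has_field_derivative f' x) (at 0)"
  and g': "PFz r g'" "ALL x. ((%t. g (x + axis l t)) has_field_derivative g' x) (at 0)" by blast
 show ?case
 proof (intro exI conjI allI)
  show "PFz r (%x. f' x + g' x)" using f'(1) g'(1) by (auto simp: PFz_def intro: PF.add split: nat.splits)
  show "((%t. f (x + axis l t) + g (x + axis l t)) has_field_derivative f' x + g' x) (at 0)" for x
   by (rule DERIV_add) (use f'(2) g'(2) in blast)+
 qed
next
 case (monomial Ls r c)
 have "EX f'. PFz (length Ls) f' & (ALL x. ((%t. \<Prod>L\<leftarrow>Ls. L (x + axis l t)) has_field_derivative f' x) (at 0))"
  if "ALL L:set Ls. aff L" for Ls :: "('k^'n => 'k) list"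
  using that
 proof (induction Ls)
  case Nil
  show ?case by (intro exI[of _ "%_. 0"]) (auto simp: PFz_zero)
 next
  case (Cons L Ls)
  then obtain f' where f': "PFz (length Ls) f'" "!!x. ((%t. \<Prod>L\<leftarrow>Ls. L (x + axis l t)) has_field_derivative f' x) (at 0)" by auto
  obtain a b where L: "L = (%x. a + (SUM l:UNIV. b l * x $ l))" using Cons.prems unfolding aff_def by auto
  have dL: "((%t. L (x + axis l t)) has_field_derivative b l) (at 0)" for x
   unfolding L by (rule aff_field_derivative)
  have a0: "axis l (0 :: 'k) = 0" by (simp add: axis_def vec_eq_iff)
  show ?case
  proof (intro exI conjI allI)
   have "PF (length Ls) (%x. L x * f' x)"
   proof (cases "length Ls")
    case 0
    then show ?thesis using f'(1) by (auto simp: PFz_def intro: PF.zero)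
   next
    case (Suc k)
    then have "PF k f'" using f'(1) by (simp add: PFz_def)
    from PF_mult[OF PF_aff this] show ?thesis using Cons.prems Suc by (simp add: One_nat_def)
   qed
   moreover have "PF (length Ls) (%x. b l * (\<Prod>L\<leftarrow>Ls. L x))" by (rule PF.monomial) (use Cons.prems in auto)
   ultimately show "PFz (length (L # Ls)) (%x. b l * (\<Prod>L\<leftarrow>Ls. L x) + L x * f' x)"
    by (simp add: PFz_def PF.add)
   show "((%t. \<Prod>L\<leftarrow>L # Ls. L (x + axis l t)) has_field_derivative b l * (\<Prod>L\<leftarrow>Ls. L x) + L x * f' x) (at 0)" for x
    using DERIV_mult[OF dL[of x] f'(2)[of x]] by (simp add: a0 algebra_simps)
  qed
 qed
 then obtain f' where f': "PFz (length Ls) f'" "ALL x. ((%t. \<Prod>L\<leftarrow>Ls. L (x + axis l t)) has_field_derivative f' x) (at 0)"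
  using monomial by blast
 show ?case
 proof (intro exI conjI allI)
  show "PFz r (%x. c * f' x)" using f'(1) monomial(1) by (auto simp: PFz_def intro: PF_cmult split: nat.splits)
  show "((%t. c * (\<Prod>L\<leftarrow>Ls. L (x + axis l t))) has_field_derivative c * f' x) (at 0)" for x
   by (rule DERIV_cmult) (use f'(2) in blast)
 qed
qed

lemma PFz_partial: "PFz d f ==> PFz (d - 1) (partial l f)"
proof (cases d)
 case 0
 assume "PFz d f"
 then have "partial l f = (%_. 0)" using 0 by (auto simp: PFz_def partial_def[abs_def])
 then show ?thesis by (simp add: PFz_zero)
next
 case (Suc r)
 assume "PFz d f"
 then have "PF r f" using Suc by (simp add: PFz_def)
 from PF_derivative[OF this, of l] obtain f' where "PFz r f'" "!!x. ((%t. f (x + axis l t)) has_field_derivative f' x) (at 0)" by blast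
 then have "partial l f = f'" "PFz r f'" by (auto simp: partial_def[abs_def] DERIV_imp_deriv)
 then show ?thesis using Suc by simp
qed

lemma mpartial_PF_zero:
 fixes f :: "'k::real_normed_field^'n::finite => 'k"
 assumes "PF r f" "r < mdeg aa"
 shows "mpartial aa f x = 0"
proof -
 have it: "PFz (d - n) ((partial l ^^ n) f)" if "PFz d f" for d n l and f :: "'k^'n => 'k"
 proof (induction n)
  case (Suc n)
  from PFz_partial[OF this, of l] show ?case by (simp add: diff_diff_left One_nat_def)
 qed (use that in simp)
 have fo: "PFz (Suc r - (\<Sum>l\<leftarrow>ls. aa $ l)) (foldr (%l. partial l ^^ (aa $ l)) ls f)" for ls
 proof (induction ls)
  case Nil
  then show ?case using assms(1) by (simp add: PFz_def)
 next
  case (Cons l ls)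
  from it[OF this, of "aa $ l" l] show ?case by (simp add: diff_diff_left add.commute)
 qed
 let ?ls = "SOME ls :: 'n list. distinct ls & set ls = UNIV"
 have "(\<Sum>l\<leftarrow>?ls. aa $ l) = mdeg aa"
  unfolding mdeg_def by (simp only: sum_list_distinct_conv_sum_set[OF some_enumeration(1)] some_enumeration(2))
 then have "PFz 0 (mpartial aa f)" using fo[of ?ls] assms(2) by (simp add: mpartial_def)
 then show ?thesis by (simp add: PFz_def)
qed

lemma aff_analytic0:
 fixes L :: "'k::{real_normed_field,banach}^'n::finite => 'k"
 assumes "aff L"
 shows "analytic0 UNIV (%h. L (\<chi> i. x $ i + h i))"
proof -
 obtain a b where L: "L = (%x. a + (SUM l:UNIV. b l * x $ l))" using assms unfolding aff_def by blast
 show ?thesis unfolding L vec_lambda_beta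
  by (intro analytic0_add analytic0_sum analytic0_mult analytic0_const analytic0_coord) auto
qed

lemma PF_analytic0:
 fixes f :: "'k::{real_normed_field,banach}^'n::finite => 'k"
 assumes "PF r f"
 shows "analytic0 UNIV (%h. f (\<chi> i. x $ i + h i))"
 using assms
proof (induction rule: PF.induct)
 case (monomial Ls r c)
 have "analytic0 UNIV (%h. \<Prod>L\<leftarrow>Ls. L (\<chi> i. x $ i + h i))" if "ALL L:set Ls. aff L" for Ls :: "('k^'n => 'k) list"
  using that
 proof (induction Ls)
  case (Cons L Ls)
  then have "analytic0 UNIV (%h. L (\<chi> i. x $ i + h i))" by (intro aff_analytic0) auto
  from analytic0_mult[OF this] Cons show ?case by simp
 qed simp
 then show ?case using monomial by (intro analytic0_mult analytic0_const) auto
qed (auto intro: analytic0_add)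

lemma aff_continuous: "aff L ==> continuous_on S (L :: 'k::real_normed_field^'n::finite => 'k)"
 unfolding aff_def by (auto intro!: continuous_intros)

subsection \<open>Solutions of the homogeneous system are polynomials\<close>

lemma foldr_dcoef:
 fixes c :: "('i => nat) => 'k::real_normed_field"
 shows "EX K. K ~= 0 & foldr dcoef ks c p = K * c (%i. p i + count_list ks i)"
proof (induction ks arbitrary: p)
 case Nil
 show ?case by (intro exI[of _ 1]) simp
next
 case (Cons k ks)
 obtain K where K: "K ~= 0" "foldr dcoef ks c (p(k := p k + 1)) = K * c (%i. (p(k := p k + 1)) i + count_list ks i)"
  using Cons by blast
 have "(%i. (p(k := p k + 1)) i + count_list ks i) = (%i. p i + count_list (k # ks) i)" by (auto simp: fun_eq_iff)
 with K have "foldr dcoef (k # ks) c p = of_nat (p k + 1) * (K * c (%i. p i + count_list (k # ks) i))"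
  by (simp add: dcoef_def)
 moreover have "of_nat (p k + 1) ~= (0 :: 'k)" by (simp only: of_nat_eq_0_iff)
 ultimately show ?case using K(1) by (intro exI[of _ "of_nat (p k + 1) * K"]) (simp add: mult.assoc)
qed

lemma ex_mindex_below:
 fixes q :: "'n::finite => nat"
 shows "k <= sum q UNIV ==> EX aa :: 'n mindex. mdeg aa = k & (ALL i. aa $ i <= q i)"
proof (induction k)
 case 0
 show ?case by (intro exI[of _ 0]) simp
next
 case (Suc k)
 then obtain aa :: "'n mindex" where aa: "mdeg aa = k" "ALL i. aa $ i <= q i" by auto
 have "EX i. aa $ i < q i"
 proof (rule ccontr)
  assume "~ (EX i. aa $ i < q i)"
  then have "sum q UNIV <= mdeg aa" unfolding mdeg_def by (intro sum_mono) (auto simp: not_less)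
  then show False using aa Suc.prems by simp
 qed
 then obtain i where i: "aa $ i < q i" by blast
 have "(aa + axis i 1) $ k <= q k" for k using aa i by (cases "k = i") (auto simp: axis_def)
 moreover have "mdeg (aa + axis i 1) = Suc k" using aa by (simp add: mdeg_add)
 ultimately show ?case by blast
qed

lemma jpartial_translate:
 "jpartial l (%h. f (\<chi> i. x $ i + h i)) h = partial l f (\<chi> i. x $ i + h i)"
proof -
 have "(\<chi> i. x $ i + (h(l := t)) i) = (\<chi> i. x $ i + h i) + axis l (t - h l)" for t
  by (auto simp: vec_eq_iff axis_def)
 then have e: "(%t. f (\<chi> i. x $ i + (h(l := t)) i)) = (%t. f ((\<chi> i. x $ i + h i) + axis l (t - h l)))"
  by simp
 have "((%t. f ((\<chi> i. x $ i + h i) + axis l (t - h l))) has_field_derivative D) (at (h l)) \<longleftrightarrow>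
   ((%t. f ((\<chi> i. x $ i + h i) + axis l t)) has_field_derivative D) (at 0)" for D
  using DERIV_shift[of "%t. f ((\<chi> i. x $ i + h i) + axis l (t - h l))" D 0 "h l"] by simp
 then show ?thesis unfolding jpartial_def partial_def e deriv_def by simp
qed

lemma mpartial_translate:
 fixes f :: "'k::real_normed_field^'n::finite => 'k" and aa :: "'n mindex"
 obtains ls where "!!i. count_list ls i = aa $ i"
  "!!x h. jml ls (%h. f (\<chi> i. x $ i + h i)) h = mpartial aa f (\<chi> i. x $ i + h i)"
proof
 let ?L = "SOME ls :: 'n list. distinct ls & set ls = UNIV"
 define ls where "ls = concat (map (%l. replicate (aa $ l) l) ?L)"
 have "count_list (concat (map (%l. replicate (aa $ l) l) ks)) i = (if i : set ks then aa $ i else 0)"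
  if "distinct ks" for ks :: "'n list" and i
  using that
 proof (induction ks)
  case (Cons k ks)
  have "count_list (replicate m k) i = (if i = k then m else 0)" for m by (induction m) auto
  then show ?case using Cons by auto
 qed simp
 from this[OF some_enumeration(1)] show "count_list ls i = aa $ i" for i
  by (simp add: ls_def some_enumeration(2))
 have j: "jml ks (%h. f (\<chi> i. x $ i + h i)) = (%h. foldr partial ks f (\<chi> i. x $ i + h i))" for ks x
 proof (induction ks)
  case (Cons k ks)
  show ?case by (rule ext) (simp add: Cons jpartial_translate)
 qed simp
 have "foldr partial (replicate m l) f = (partial l ^^ m) f" for m l and f :: "'k^'n => 'k"
  by (induction m) auto
 then have "foldr partial (concat (map (%l. replicate (aa $ l) l) ks)) f = foldr (%l. partial l ^^ (aa $ l)) ks f" for ks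
  by (induction ks) auto
 then show "jml ls (%h. f (\<chi> i. x $ i + h i)) h = mpartial aa f (\<chi> i. x $ i + h i)" for x h
  by (simp add: j ls_def mpartial_def)
qed

lemma pseries_jml:
 fixes f :: "('i => 'k) => 'k::{real_normed_field,banach}"
 assumes "finite I" "0 < ro" "pseries I ro c f" "set ks \<subseteq> I"
 shows "EX r>0. pseries I r (foldr dcoef ks c) (jml ks f)"
 using assms(4)
proof (induction ks)
 case Nil
 then show ?case using assms by auto
next
 case (Cons k ks)
 then obtain r where r: "0 < r" "pseries I r (foldr dcoef ks c) (jml ks f)" by auto
 then have "pseries I (r / 2) (dcoef k (foldr dcoef ks c)) (jpartial k (jml ks f))"
  using Cons.prems by (intro pseries_deriv(2)[OF assms(1)]) auto
 then show ?case using r by (intro exI[of _ "r / 2"]) auto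
qed

text \<open>An exponent \<open>q\<close> of degree above \<open>r\<close> dominates a multiindex of
  degree exactly \<open>r + 1\<close>. The corresponding derivative vanishes identically, and up to
  a nonzero integer the coefficient of \<open>q\<close> is one of its coefficients.\<close>

lemma flat_solution_polynomial:
 fixes f :: "'k::{real_normed_field,banach}^'n::finite => 'k"
 assumes an: "kanalytic_at UNIV (%z. f (vec_lambda z)) (vec_nth x)" and "open D" "x : D"
  and top: "!!y aa. y : D ==> mdeg aa = Suc r ==> mpartial aa f y = 0"
 shows "EX P. PF r P & (\<forall>\<^sub>F y in nhds x. f y = P y)"
proof -
 let ?g = "%h. f (\<chi> i. x $ i + h i)"
 have "analytic0 UNIV ?g" using an by (simp add: kanalytic_at_iff_analytic0)
 then obtain ro c where ro: "0 < ro" "pseries UNIV ro c ?g" by (auto simp: analytic0_def ps_le_def)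
 have M: "mindices UNIV = (UNIV :: ('n => nat) set)" by (simp add: mindices_def)
 obtain e where e: "0 < e" "!!y. dist y x < e ==> y : D" using assms(2,3) by (metis open_dist)
 obtain dt where dt: "0 < dt" "!!h. h : pdisc UNIV dt ==> norm (vec_lambda h :: 'k^'n) < e"
  using eventually_nb_norm_vec[OF e(1)] unfolding eventually_nb by blast
 have hD: "(\<chi> i. x $ i + h i) : D" if "h : pdisc UNIV dt" for h
 proof (rule e(2))
  have "(\<chi> i. x $ i + h i) - x = vec_lambda h" by (simp add: vec_eq_iff)
  then show "dist (\<chi> i. x $ i + h i) x < e" using dt(2)[OF that] by (simp add: dist_norm)
 qed
 have c0: "c q = 0" if q: "Suc r <= sum q UNIV" for q
 proof -
  obtain aa :: "'n mindex" where aa: "mdeg aa = Suc r" "ALL i. aa $ i <= q i" using ex_mindex_below[OF q] by blast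
  obtain ls where ls: "!!i. count_list ls i = aa $ i"
   "!!x h. jml ls (%h. f (\<chi> i. x $ i + h i)) h = mpartial aa f (\<chi> i. x $ i + h i)"
   using mpartial_translate[of aa f] by metis
  obtain r' where r': "0 < r'" "pseries UNIV r' (foldr dcoef ls c) (jml ls ?g)"
   using pseries_jml[OF finite_class.finite_UNIV ro] by blast
  have z: "jml ls ?g h = 0" if "h : pdisc UNIV dt" for h
   unfolding ls(2) by (rule top[OF hD[OF that] aa(1)])
  have "foldr dcoef ls c (%i. q i - aa $ i) = 0"
   by (rule pseries_zero_coeffs[OF finite_class.finite_UNIV r'(1) dt(1) r'(2) z]) (simp_all add: M)
  moreover obtain K where "K ~= 0" "foldr dcoef ls c (%i. q i - aa $ i) = K * c (%i. q i - aa $ i + count_list ls i)"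
   using foldr_dcoef by blast
  moreover have "(%i. q i - aa $ i + count_list ls i) = q" using aa(2) by (auto simp: ls(1))
  ultimately show ?thesis by simp
 qed
 let ?A = "{q :: 'n => nat. sum q UNIV <= r}"
 have fA: "finite ?A" using card_bounded_exponents[of "UNIV :: 'n set" r] by simp
 define P where "P y = (SUM q:?A. c q * (PROD i:UNIV. (y $ i - x $ i) ^ q i))" for y
 have ai: "aff (%y :: 'k^'n. y $ i - x $ i)" for i
  using aff_add[OF aff_coord[of i] aff_const[of "- x $ i"]] by simp
 have "PF r (%y. PROD i:UNIV. (y $ i - x $ i) ^ q i)" if "q : ?A" for q
 proof -
  have "PF (SUM i:UNIV. 1 * q i) (%y. PROD i:UNIV. (y $ i - x $ i) ^ q i)"
   by (intro PF_prod PF_power PF_aff ai) auto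
  then show ?thesis by (rule PF_mono) (use that in simp)
 qed
 then have "PF r P" unfolding P_def[abs_def] by (intro PF_sum PF_cmult fA)
 moreover have "f y = P y" if "dist y x < ro" for y
 proof -
  define h where "h i = y $ i - x $ i" for i
  have "norm (h i) <= ro" for i
   using that Finite_Cartesian_Product.norm_nth_le[of "y - x" i] by (simp add: h_def dist_norm)
  then have "((%q. c q * mmon UNIV h q) has_sum ?g h) UNIV" using ro(2) by (simp add: pseries_def M pdisc_def)
  then have "((%q. c q * mmon UNIV h q) has_sum ?g h) ?A"
   by (rule has_sum_cong_neutral[THEN iffD1, rotated -1]) (auto simp: c0 not_le)
  then have "?g h = (SUM q:?A. c q * mmon UNIV h q)" by (simp add: has_sum_finite_iff[OF fA])
  moreover have "(\<chi> i. x $ i + h i) = y" by (simp add: vec_eq_iff h_def)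
  ultimately show ?thesis by (simp add: P_def mmon_def h_def)
 qed
 then have "\<forall>\<^sub>F y in nhds x. f y = P y" unfolding eventually_nhds_metric using ro(1) by blast
 ultimately show ?thesis by blast
qed

lemma PF_local_solution:
 fixes v :: "'m::finite => 'k::{real_normed_field,euclidean_space}^'n::finite => 'k"
 assumes "!!j. PF (\<kappa> - 1) (v j)" "open E" "1 <= \<kappa>"
 shows "local_solution \<kappa> (%_ _ _. 0) E (%y. \<chi> j. v j y)"
proof -
 have "vec_analytic_at (%y. \<chi> j. v j y) y" for y
  unfolding vec_analytic_at_def using PF_analytic0[OF assms(1)] by (simp add: kanalytic_at_iff_analytic0)
 moreover have "mpartial aa (v j) y = 0" if "mdeg aa = \<kappa>" for aa j y
  by (rule mpartial_PF_zero[OF assms(1)]) (use that assms(3) in simp)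
 ultimately show ?thesis using assms(2) by (simp add: local_solution_def)
qed

lemma mpartial_zero: "mpartial 0 f = (f :: 'k::real_normed_field^'n::finite => 'k)"
proof -
 have "foldr (%l. partial l ^^ ((0 :: 'n mindex) $ l)) ls f = f" for ls by (induction ls) auto
 then show ?thesis by (simp add: mpartial_def)
qed

lemma mpartial_axis: "mpartial (axis l 1) f = partial l (f :: 'k::real_normed_field^'n::finite => 'k)"
proof -
 have "foldr (%k. partial k ^^ ((axis l 1 :: 'n mindex) $ k)) ls f = (if l : set ls then partial l f else f)"
  if "distinct ls" for ls
  using that by (induction ls) (auto simp: axis_def One_nat_def)
 from this[OF some_enumeration(1)] show ?thesis by (simp add: mpartial_def some_enumeration(2))
qed

text \<open>The map \<open>a\<close> is the
  change of the independent variables on the graph of \<open>P\<close>, and \<open>b\<close> is its inverse.\<close>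

lemma flat_lie_symmetryI:
 fixes \<Phi> :: "'k::{real_normed_field,euclidean_space}^('n::finite + 'm::finite) => 'k^('n + 'm)"
 assumes \<kappa>: "2 <= \<kappa>" and diffeo: "local_analytic_diffeo \<Phi>" and \<epsilon>: "0 < \<epsilon>"
  and main: "!!P x0. (ALL j. PF (\<kappa> - 1) (P j)) ==> (ALL l. norm (x0 $ l) < \<epsilon>) ==> (ALL j. norm (P j x0) < \<epsilon>) ==>
   (ALL j l. norm (partial l (P j) x0) < \<epsilon>) ==>
   EX a b N E v. (ALL j. PF (\<kappa> - 1) (v j)) & open N & open E & x0 : N & continuous_on E b &
    (ALL x:N. a x : E & b (a x) = x & \<Phi> (join_vec x (\<chi> j. P j x)) = join_vec (a x) (\<chi> j. v j (a x))) &
    (ALL y:E. b y : N --> a (b y) = y)"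
 shows "lie_symmetry \<kappa> (%_ _ _. 0) \<Phi>"
 unfolding lie_symmetry_def
proof (intro conjI diffeo exI[of _ \<epsilon>] \<epsilon> allI impI ballI)
 fix D and u :: "'k^'n => 'k^'m" and x0
 assume sol: "local_solution \<kappa> (%_ _ _. 0) D u" and x0: "x0 : D"
  and jet: "ALL c:jcoords (\<kappa> - 1). norm (jet (\<kappa> - 1) u x0 c) < \<epsilon>"
 have D: "open D" and an: "!!x. x : D ==> vec_analytic_at u x"
  and top: "!!x j aa. x : D ==> mdeg aa = \<kappa> ==> mpartial aa (%y. u y $ j) x = 0"
  using sol by (auto simp: local_solution_def)
 have "EX P. PF (\<kappa> - 1) P & (\<forall>\<^sub>F y in nhds x0. u y $ j = P y)" for j
 proof (rule flat_solution_polynomial[OF _ D x0])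
  show "kanalytic_at UNIV (%z. u (vec_lambda z) $ j) (vec_nth x0)" using an[OF x0] by (simp add: vec_analytic_at_def)
  show "mpartial aa (%y. u y $ j) y = 0" if "y : D" "mdeg aa = Suc (\<kappa> - 1)" for y aa
   using top that \<kappa> by simp
 qed
 then have "ALL j. EX P. PF (\<kappa> - 1) P & (\<forall>\<^sub>F y in nhds x0. u y $ j = P y)" by blast
 from choice[OF this] obtain P where P: "ALL j. PF (\<kappa> - 1) (P j) & (\<forall>\<^sub>F y in nhds x0. u y $ j = P j y)" by blast
 have "\<forall>\<^sub>F y in nhds x0. ALL j. u y $ j = P j y" by (intro eventually_all_finite) (use P in blast)
 then obtain N1 where N1: "open N1" "x0 : N1" "!!y j. y : N1 ==> u y $ j = P j y"
  unfolding eventually_nhds by blast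
 have ux: "u x = (\<chi> j. P j x)" if "x : N1" for x using N1(3)[OF that] by (simp add: vec_eq_iff)
 have "EX a b N E v. (ALL j. PF (\<kappa> - 1) (v j)) & open N & open E & x0 : N & continuous_on E b &
    (ALL x:N. a x : E & b (a x) = x & \<Phi> (join_vec x (\<chi> j. P j x)) = join_vec (a x) (\<chi> j. v j (a x))) &
    (ALL y:E. b y : N --> a (b y) = y)"
 proof (rule main)
  show "ALL j. PF (\<kappa> - 1) (P j)" using P by blast
  show "ALL l. norm (x0 $ l) < \<epsilon>"
  proof
   fix l
   show "norm (x0 $ l) < \<epsilon>" using bspec[OF jet, of "Xc l"] by (simp add: jet_def)
  qed
  show "ALL j. norm (P j x0) < \<epsilon>"
  proof
   fix j
   show "norm (P j x0) < \<epsilon>" using bspec[OF jet, of "Uc j 0"] N1(3)[OF N1(2), of j] by (simp add: jet_def mpartial_zero)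
  qed
  show "ALL j l. norm (partial l (P j) x0) < \<epsilon>"
  proof (intro allI)
   fix j l
   have le: "mdeg (axis l 1 :: 'n mindex) <= \<kappa> - 1" using \<kappa> by simp
   have "partial l (P j) x0 = partial l (%y. u y $ j) x0"
    by (rule partial_cong[OF N1(1,2)]) (simp add: N1(3))
   then show "norm (partial l (P j) x0) < \<epsilon>"
    using bspec[OF jet, of "Uc j (axis l 1)"] le by (simp add: jet_def mpartial_axis)
  qed
 qed
 then obtain a b N E v where v: "ALL j. PF (\<kappa> - 1) (v j)" and N: "open N" "x0 : N" and E: "open E" "continuous_on E b"
  and ab: "!!x. x : N ==> a x : E & b (a x) = x & \<Phi> (join_vec x (\<chi> j. P j x)) = join_vec (a x) (\<chi> j. v j (a x))"
  and ba: "!!y. y : E ==> b y : N ==> a (b y) = y" by blast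
 define D' where "D' = D \<inter> N1 \<inter> N"
 \<comment> \<open>Only the points that come from \<open>D'\<close>, so that the two graphs coincide
   and are not merely included in each other; continuity of \<open>b\<close> keeps the set
   open.\<close>
 define E' where "E' = E \<inter> b -` D'"
 have oD': "open D'" using D N1(1) N(1) by (auto simp: D'_def)
 have oE': "open E'" unfolding E'_def by (rule continuous_open_preimage[OF E(2,1) oD'])
 have "\<Phi> ` graph_on D' u = graph_on E' (%y. \<chi> j. v j y)"
 proof
  show "\<Phi> ` graph_on D' u \<subseteq> graph_on E' (%y. \<chi> j. v j y)"
  proof
   fix p assume "p : \<Phi> ` graph_on D' u"
   then obtain x where x: "x : D'" "p = \<Phi> (join_vec x (u x))" by (auto simp: graph_on_def)
   then have "p = join_vec (a x) (\<chi> j. v j (a x))" "a x : E'"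
    using ab[of x] ux[of x] by (auto simp: D'_def E'_def)
   then show "p : graph_on E' (%y. \<chi> j. v j y)" by (auto simp: graph_on_def)
  qed
  show "graph_on E' (%y. \<chi> j. v j y) \<subseteq> \<Phi> ` graph_on D' u"
  proof
   fix p assume "p : graph_on E' (%y. \<chi> j. v j y)"
   then obtain y where y: "y : E'" "p = join_vec y (\<chi> j. v j y)" by (auto simp: graph_on_def)
   then have b: "b y : D'" "a (b y) = y" using ba[of y] by (auto simp: E'_def D'_def)
   then have "p = \<Phi> (join_vec (b y) (u (b y)))"
    using ab[of "b y"] ux[of "b y"] y(2) by (auto simp: D'_def)
   then show "p : \<Phi> ` graph_on D' u" using b(1) by (auto simp: graph_on_def)
  qed
 qed
 moreover have "local_solution \<kappa> (%_ _ _. 0) E' (%y. \<chi> j. v j y)"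
  by (rule PF_local_solution[OF _ oE']) (use v \<kappa> in auto)
 moreover have "x0 : D'" "D' \<subseteq> D" using x0 N1 N by (auto simp: D'_def)
 ultimately show "EX D' E v. open D' & x0 : D' & D' \<subseteq> D & local_solution \<kappa> (%_ _ _. 0) E v & \<Phi> ` graph_on D' u = graph_on E v"
  using oD' by blast
qed

subsection \<open>Explicit one-parameter groups\<close>

lemma analytic0_exp:
 fixes i :: 'i
 assumes "finite I" "i : I"
 shows "analytic0 I (%h. exp (h i :: 'k::{real_normed_field,banach}))"
proof -
 have "ps_le I 1 (%h. exp (h i :: 'k)) (exp 1)"
 proof (rule ps_le_has_sum[where f = "%n h. of_real (inverse (fact n)) * h i ^ n" and A = UNIV
    and M = "%n. inverse (fact n)" and B = "exp 1"])
  fix n :: nat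
  have "ps_le I 1 (%h. of_real (inverse (fact n)) * h i ^ n :: 'k) (norm (of_real (inverse (fact n)) :: 'k) * 1 ^ n)"
   by (intro ps_le_cmult ps_le_power ps_le_coord assms) auto
  moreover have "norm (of_real (inverse (fact n)) :: 'k) = inverse (fact n)" unfolding norm_of_real by simp
  ultimately show "ps_le I 1 (%h. of_real (inverse (fact n)) * h i ^ n :: 'k) (inverse (fact n))" by simp
 next
  show "((%n. inverse (fact n)) has_sum exp (1 :: real)) UNIV"
   using norm_summable_imp_has_sum[OF summable_norm_exp[of "1 :: real"] exp_converges] by simp
  fix h :: "'i => 'k"
  have "(%n. h i ^ n /\<^sub>R fact n) = (%n. of_real (inverse (fact n)) * h i ^ n)"
   by (simp add: scaleR_conv_of_real)
  then show "((%n. of_real (inverse (fact n)) * h i ^ n) has_sum exp (h i)) UNIV"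
   using norm_summable_imp_has_sum[OF summable_norm_exp[of "h i"] exp_converges] by simp
 qed auto
 then show ?thesis unfolding analytic0_def using zero_less_one by blast
qed

lemma analytic0_geometric:
 fixes g :: "('i => 'k) => 'k::{real_normed_field,banach}"
 assumes "finite I" "analytic0 I g" "g (%_. 0) = 0"
 shows "analytic0 I (%h. 1 / (1 - g h))"
proof -
 obtain ro where ro: "0 < ro" "ALL j:{()}. ps_le I ro g (1 / 2)"
  by (rule analytic0_small[where g = "%_. g" and J = "{()}" and I = I and sg = "1 / 2"]) (use assms in auto)
 then have g: "ps_le I ro g (1 / 2)" by simp
 have "ps_le I ro (%h. 1 / (1 - g h)) 2"
 proof (rule ps_le_has_sum[where f = "%n h. g h ^ n" and A = UNIV and M = "%n. (1 / 2) ^ n" and B = 2, OF ro(1)])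
  show "ps_le I ro (%h. g h ^ n) ((1 / 2) ^ n)" for n by (rule ps_le_power[OF ro(1) g])
  have "(%n. (1 / 2 :: real) ^ n) sums (1 / (1 - 1 / 2))" by (rule geometric_sums) simp
  then have "(%n. (1 / 2 :: real) ^ n) sums 2" by simp
  moreover have "summable (%n. norm ((1 / 2 :: real) ^ n))" by (simp add: norm_power)
  ultimately show "((%n. (1 / 2 :: real) ^ n) has_sum 2) UNIV" by (rule norm_summable_imp_has_sum[rotated])
  fix h :: "'i => 'k" assume "h : pdisc I ro"
  then have "norm (g h) <= 1 / 2" by (rule ps_le_bound[OF g])
  then have n: "norm (g h) < 1" by simp
  have "summable (%n. norm (g h ^ n))" using n by (simp add: norm_power summable_geometric)
  then show "((%n. g h ^ n) has_sum 1 / (1 - g h)) UNIV"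
   by (rule norm_summable_imp_has_sum[OF _ geometric_sums[OF n]])
 qed simp
 then show ?thesis unfolding analytic0_def using ro(1) by blast
qed

lemma vec_analytic_at_iff:
 fixes f :: "'k::{real_normed_field,banach}^'c::finite => 'k^'d::finite"
 shows "vec_analytic_at f p \<longleftrightarrow> (ALL d. analytic0 UNIV (%h. f (\<chi> i. p $ i + h i) $ d))"
 unfolding vec_analytic_at_def by (simp add: kanalytic_at_iff_analytic0)

lemma pde_flat:
 assumes "2 <= \<kappa>"
 shows "pde \<kappa> ((%_ _ _. 0) :: ('k::{real_normed_field,euclidean_space}, 'n::finite, 'm::finite) rhs)"
proof
 let ?Z = "(%_ _ _. 0) :: ('k, 'n, 'm) rhs"
 show "2 <= \<kappa>" by fact
 show "kanalytic_at (jcoords (\<kappa> - 1)) (?Z j aa) (%_. 0)" for j aa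
  by (simp add: kanalytic_at_iff_analytic0)
 \<comment> \<open>One half of the bracket, computed explicitly. The two index shifts commute, so it
   is symmetric in \<open>k\<close> and \<open>l\<close> and the bracket vanishes.\<close>
 have *: "(SUM d:jcoords (\<kappa> - 1). pfaff_field \<kappa> ?Z k d z * jpartial d (pfaff_field \<kappa> ?Z l c) z) =
   (case c of Xc _ => 0 | Uc i be => (if mdeg be + 3 <= \<kappa> then z (Uc i (be + axis l 1 + axis k 1)) else 0))" for k l c z
 proof (cases "EX i be. c = Uc i be & mdeg be + 2 <= \<kappa>")
  case True
  then obtain i be where c: "c = Uc i be" "mdeg be + 2 <= \<kappa>" by blast
  let ?d = "Uc i (be + axis l 1) :: ('n, 'm) jcoord"
  have f: "pfaff_field \<kappa> ?Z l c = (%z. z ?d)" using c by (simp add: pfaff_field_def fun_eq_iff)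
  have d: "?d : jcoords (\<kappa> - 1)" using c by (simp add: mdeg_add)
  have "(SUM d:jcoords (\<kappa> - 1). pfaff_field \<kappa> ?Z k d z * jpartial d (%z. z ?d) z) =
    (SUM d:jcoords (\<kappa> - 1). if d = ?d then pfaff_field \<kappa> ?Z k d z else 0)"
   by (rule sum.cong) (auto simp: jpartial_coord)
  also have "... = pfaff_field \<kappa> ?Z k ?d z" using d by simp
  finally show ?thesis using c unfolding f by (simp add: pfaff_field_def mdeg_add)
 next
  case False
  then have "EX b. pfaff_field \<kappa> ?Z l c = (%_. b)"
   by (cases c) (auto simp: pfaff_field_def fun_eq_iff)
  then have "jpartial d (pfaff_field \<kappa> ?Z l c) z = 0" for d by auto
  then show ?thesis using False by (cases c) auto
 qed
 have "jbracket (jcoords (\<kappa> - 1)) (pfaff_field \<kappa> ?Z k) (pfaff_field \<kappa> ?Z l) c z = 0" for k l c z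
  unfolding jbracket_def sum_subtractf * by (cases c) (simp_all add: add.commute add.left_commute)
 then show "completely_integrable \<kappa> ?Z" unfolding completely_integrable_def using zero_less_one by blast
qed

locale flat_system = pde \<kappa> F
 for \<kappa> and F :: "('k::{real_normed_field,euclidean_space}, 'n::finite, 'm::finite) rhs" +
 assumes F0: "F = (%_ _ _. 0)"
begin

section \<open>Shears\<close>

abbreviation low :: "'n + 'm => ('n + 'm => nat) => bool" where
 "low c q \<equiv> wt q + edef c <= \<kappa> - 1"

definition mono :: "('n + 'm => nat) => 'k^('n + 'm) => 'k" where
 "mono q z = mmon UNIV (vec_nth z) q"

definition shear :: "'k => 'n + 'm => ('n + 'm => nat) => 'k^('n + 'm) => 'k^('n + 'm)" where
 "shear sg c q z = z + axis c (sg * mono q z)"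

text \<open>The field multiplies the direction \<open>c\<close> by a monomial. If the monomial does
  not involve \<open>z c\<close>, it is constant along the flow, which is linear in
  \<open>s\<close>; if it is \<open>z c\<close> itself, the flow is \<open>exp s * z c\<close>, a
  shear of size \<open>exp s - 1\<close>.\<close>

definition time :: "'n + 'm => ('n + 'm => nat) => 'k => 'k" where
 "time c q s = (if q c = 0 then s else exp s - 1)"

lemma low_cases:
 assumes "low c q"
 shows "q c = 0 | q = (%i. if i = c then 1 else 0)"
proof (cases "q c = 0")
 case False
 have we: "wgt c + edef c = \<kappa> - 1" using order by (cases c) auto
 have "wt q = wgt c * q c + (SUM i:UNIV - {c}. wgt i * q i)"
  unfolding wt_def by (subst sum.remove[of _ c]) auto
 then have le: "wgt c * q c + (SUM i:UNIV - {c}. wgt i * q i) <= wgt c" using assms we by linarith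
 have "wgt c * 1 <= wgt c * q c" using False by (intro mult_left_mono) auto
 then have s0: "(SUM i:UNIV - {c}. wgt i * q i) = 0" and "wgt c * q c = wgt c" using le by linarith+
 then have "q c = 1" using wgt_pos[of c] by (simp add: One_nat_def)
 moreover have "q i = 0" if "i ~= c" for i
 proof -
  have "wgt i * q i = 0" using s0 that unfolding sum_eq_0_iff[OF finite_class.finite] by blast
  then show ?thesis using wgt_pos[of i] by simp
 qed
 ultimately show ?thesis by (auto simp: fun_eq_iff)
qed simp

lemma mono_unit: "mono (%i. if i = c then 1 else 0) z = z $ c"
proof -
 have "(PROD i:UNIV. z $ i ^ (if i = c then 1 else 0)) = (PROD i:UNIV. if i = c then z $ c else 1)"
  by (rule prod.cong) auto
 then show ?thesis by (simp add: mono_def mmon_def)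
qed

lemma mono_shear:
 assumes "low c q"
 shows "mono q (shear sg c q z) = (if q c = 0 then 1 else 1 + sg) * mono q z"
proof (cases "q c = 0")
 case True
 have "(shear sg c q z $ i) ^ q i = (z $ i) ^ q i" for i
  using True by (cases "i = c") (auto simp: shear_def axis_def)
 then show ?thesis using True by (simp add: mono_def mmon_def)
next
 case False
 have q: "q = (%i. if i = c then 1 else 0)"
 proof (rule disjE[OF low_cases[OF assms]])
  assume "q c = 0"
  with False show ?thesis by contradiction
 qed
 have m: "mono q y = y $ c" for y unfolding q by (rule mono_unit)
 show ?thesis using False by (simp add: m shear_def axis_def algebra_simps)
qed

lemma shear_inverse:
 assumes "low c q" "(if q c = 0 then 1 else 1 + sg) * ta = - sg"
 shows "shear ta c q (shear sg c q z) = z"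
proof -
 have "ta * mono q (shear sg c q z) = ((if q c = 0 then 1 else 1 + sg) * ta) * mono q z"
  unfolding mono_shear[OF assms(1)] by (simp add: mult_ac)
 then have "ta * mono q (shear sg c q z) = - sg * mono q z" unfolding assms(2) .
 then have "shear ta c q (shear sg c q z) = shear sg c q z + axis c (- sg * mono q z)"
  unfolding shear_def[of ta] by simp
 then show ?thesis by (auto simp: shear_def axis_def vec_eq_iff)
qed

lemma shear_analytic: "vec_analytic_at (shear sg c q) p"
proof -
 have "(%h. shear sg c q (\<chi> i. p $ i + h i) $ d) =
   (%h. (p $ d + h d) + (if d = c then sg else 0) * (PROD i:UNIV. (p $ i + h i) ^ q i))" for d
  by (auto simp: shear_def axis_def mono_def mmon_def)
 then show ?thesis unfolding vec_analytic_at_iff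
  by (simp only:) (intro allI analytic0_add analytic0_mult analytic0_prod analytic0_power analytic0_coord analytic0_const; simp)
qed

lemma shear_diffeo:
 assumes "low c q"
 shows "local_analytic_diffeo (shear (time c q s) c q)"
proof -
 let ?sg = "time c q s" and ?ta = "time c q (- s)"
 have 1: "(if q c = 0 then 1 else 1 + ?sg) * ?ta = - ?sg" "(if q c = 0 then 1 else 1 + ?ta) * ?sg = - ?ta"
  by (auto simp: time_def algebra_simps simp flip: exp_add)
 show ?thesis unfolding local_analytic_diffeo_def
  by (intro conjI exI[of _ "shear ?ta c q"] shear_analytic always_eventually allI shear_inverse assms 1)
qed

lemma shear_flow:
 assumes "low c q"
 shows "local_flow (%z. axis c (mono q z)) (%s. shear (time c q s) c q)"
 unfolding local_flow_def
proof (intro conjI allI)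
 fix d
 have "analytic0 UNIV (%z :: ('n + 'm) option => 'k. time c q (z None))"
  unfolding time_def[abs_def]
  by (cases "q c = 0") (auto intro!: analytic0_coord analytic0_diff analytic0_exp)
 then have "analytic0 UNIV (%z :: ('n + 'm) option => 'k. z (Some d) + (if d = c then time c q (z None) else 0) * (PROD i:UNIV. z (Some i) ^ q i))"
  by (cases "d = c") (auto intro!: analytic0_add analytic0_mult analytic0_prod analytic0_power analytic0_coord)
 moreover have "(%z :: ('n + 'm) option => 'k. shear (time c q (z None)) c q (\<chi> i. z (Some i)) $ d) =
   (%z. z (Some d) + (if d = c then time c q (z None) else 0) * (PROD i:UNIV. z (Some i) ^ q i))"
  by (auto simp: shear_def axis_def mono_def mmon_def)
 ultimately show "kanalytic_at UNIV (%z. shear (time c q (z None)) c q (\<chi> i. z (Some i)) $ d) (%_. 0)"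
  by (simp add: kanalytic_at_iff_analytic0 cong: if_cong)
next
 show "EX dt>0. ALL p. norm p < dt --> shear (time c q 0) c q p = p & (ALL s. norm s < dt -->
   (ALL d. ((%t. shear (time c q t) c q p $ d) has_field_derivative axis c (mono q (shear (time c q s) c q p)) $ d) (at s)))"
 proof (intro exI[of _ 1] conjI allI impI zero_less_one)
  fix p :: "'k^('n + 'm)" and s d
  show "shear (time c q 0) c q p = p" by (auto simp: shear_def time_def axis_def vec_eq_iff)
  have "(time c q has_field_derivative (if q c = 0 then 1 else 1 + time c q s)) (at s)"
   unfolding time_def[abs_def] by (cases "q c = 0") (auto intro!: derivative_eq_intros)
  then have "((%t. p $ c + time c q t * mono q p) has_field_derivative (if q c = 0 then 1 else 1 + time c q s) * mono q p) (at s)"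
   by (auto intro!: derivative_eq_intros)
  then show "((%t. shear (time c q t) c q p $ d) has_field_derivative axis c (mono q (shear (time c q s) c q p)) $ d) (at s)"
   unfolding mono_shear[OF assms] by (cases "d = c") (simp_all add: shear_def axis_def)
 qed
qed

lemma PF_mono_graph:
 assumes "ALL j. PF (\<kappa> - 1) (P j)"
 shows "PF (wt q) (%x. mono q (join_vec x (\<chi> j. P j x)))"
 unfolding mono_def mmon_def wt_def
proof (rule PF_prod)
 fix i
 have "PF (wgt i) (%x. join_vec x (\<chi> j. P j x) $ i)"
  using assms by (cases i) (auto simp: join_vec_def intro: PF_aff aff_coord)
 then show "PF (wgt i * q i) (%x. (join_vec x (\<chi> j. P j x) $ i) ^ q i)" by (rule PF_power)
qed simp

lemma join_axis_Inl:
 fixes t :: "'a::ab_group_add"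
 shows "join_vec x u + axis (Inl l) t = join_vec (x + axis l t) u"
 by (auto simp: vec_eq_iff join_vec_def axis_def split: sum.splits)

lemma join_axis_Inr:
 fixes t :: "'a::ab_group_add"
 shows "join_vec x u + axis (Inr j) t = join_vec x (u + axis j t)"
 by (auto simp: vec_eq_iff join_vec_def axis_def split: sum.splits)

text \<open>Shearing \<open>u^j\<close> adds to a solution a polynomial of degree at most
  \<open>\<kappa> - 1\<close>. Shearing \<open>x_l\<close> uses a function of weight at most 1,
  which is affine on the graph; the result is an affine change of the independent variables, and it
  preserves degrees.\<close>

lemma shear_symmetry:
 assumes lo: "low c q" and s: "norm s < 1"
 shows "lie_symmetry \<kappa> F (shear (time c q s) c q)"
 unfolding F0
proof (rule flat_lie_symmetryI[OF order shear_diffeo[OF lo] zero_less_one])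
 fix P :: "'m => 'k^'n => 'k" and x0 :: "'k^'n"
 assume P: "ALL j. PF (\<kappa> - 1) (P j)" and "ALL l. norm (x0 $ l) < 1" "ALL j. norm (P j x0) < 1"
  and dP: "ALL j l. norm (partial l (P j) x0) < 1"
 let ?sg = "time c q s"
 define L where "L x = mono q (join_vec x (\<chi> j. P j x))" for x
 have PL: "PF (wt q) L" unfolding L_def[abs_def] by (rule PF_mono_graph[OF P])
 have sh: "shear ?sg c q (join_vec x (\<chi> j. P j x)) = join_vec x (\<chi> j. P j x) + axis c (?sg * L x)" for x
  by (simp add: shear_def L_def)
 show "EX a b N E v. (ALL j. PF (\<kappa> - 1) (v j)) & open N & open E & x0 : N & continuous_on E b &
    (ALL x:N. a x : E & b (a x) = x & shear ?sg c q (join_vec x (\<chi> j. P j x)) = join_vec (a x) (\<chi> j. v j (a x))) &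
    (ALL y:E. b y : N --> a (b y) = y)"
 proof (cases c)
  case (Inr j)
  define v where "v i x = P i x + (if i = j then ?sg else 0) * L x" for i x
  have "wt q <= \<kappa> - 1" using lo by simp
  then have "PF (\<kappa> - 1) (v i)" for i
   unfolding v_def[abs_def] using P PF_mono[OF PL] by (intro PF.add PF_cmult) auto
  moreover have "shear ?sg c q (join_vec x (\<chi> j. P j x)) = join_vec x (\<chi> i. v i x)" for x
  proof -
   have "(\<chi> i. P i x) + axis j (?sg * L x) = (\<chi> i. v i x)" by (auto simp: vec_eq_iff v_def axis_def)
   then show ?thesis unfolding sh unfolding Inr join_axis_Inr by (rule arg_cong)
  qed
  ultimately show ?thesis
   by (intro exI[of _ "%x. x"] exI[of _ UNIV] exI[of _ v]) (auto intro: continuous_intros)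
 next
  case (Inl l)
  have w1: "wt q <= 1" using lo order Inl by simp
  have "aff L" by (rule PF_1_aff[OF PF_mono[OF PL w1]])
  then obtain a0 b where L: "L = (%x. a0 + (SUM k:UNIV. b k * x $ k))" unfolding aff_def by blast
  have dL: "((%t. L (x0 + axis l t)) has_field_derivative b l) (at 0)"
   unfolding L by (rule aff_field_derivative)
  have Lax: "L (x + axis l t) = L x + b l * t" for x t
  proof -
   have "(SUM k:UNIV. b k * (x + axis l t) $ k) = (SUM k:UNIV. b k * x $ k + (if k = l then b l * t else 0))"
    by (rule sum.cong) (auto simp: axis_def algebra_simps)
   then show ?thesis by (simp add: L sum.distrib)
  qed
  \<comment> \<open>The factor by which \<open>a\<close> stretches \<open>L\<close>. Smallness is
    used when \<open>L\<close> is a component of \<open>P\<close>: its slope and \<open>s\<close>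
    are both below 1 in norm. For \<open>q c\<close> nonzero the factor is
    \<open>exp s\<close>.\<close>
  have nz: "1 + ?sg * b l ~= 0"
  proof (cases "q c = 0")
   case False
   have q: "q = (%i. if i = c then 1 else 0)"
   proof (rule disjE[OF low_cases[OF lo]])
    assume "q c = 0"
    with False show ?thesis by contradiction
   qed
   have "L = (%x. x $ l)" unfolding L_def[abs_def] q mono_unit Inl by (simp add: join_vec_def)
   then have "b l = 1" using Lax[of 0 1] by (simp add: axis_def)
   then show ?thesis using False by (simp add: time_def)
  next
   case True
   have "norm (b l) < 1"
    using wt_le_one_cases[OF w1]
   proof
    assume "q = (%_. 0)"
    then have "L = (%_. 1)" by (simp add: L_def[abs_def] mono_def mmon_def)
    then have "b l = 0" using Lax[of 0 1] by simp
    then show ?thesis by simp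
   next
    assume "EX d. wgt d = 1 & q = (%i. if i = d then 1 else 0)"
    then obtain d where q: "q = (%i. if i = d then 1 else 0)" by blast
    have Ld: "L = (%x. join_vec x (\<chi> j. P j x) $ d)" unfolding L_def[abs_def] q mono_unit ..
    show ?thesis
    proof (cases d)
     case (Inl k)
     then have "k ~= l" using True q \<open>c = Inl l\<close> by auto
     then have "b l = 0" using Lax[of 0 1] unfolding Ld Inl by (simp add: join_vec_def axis_def)
     then show ?thesis by simp
    next
     case (Inr j)
     then have "L = P j" unfolding Ld by (simp add: join_vec_def)
     then have "partial l (P j) x0 = b l" unfolding partial_def using dL by (simp add: DERIV_imp_deriv)
     then show ?thesis using dP by metis
    qed
   qed
   then have "norm (s * b l) < 1" unfolding norm_mult using s
    by (metis mult_strict_mono' mult_1 norm_ge_zero)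
   then have "1 + s * b l ~= 0" by (metis add_eq_0_iff norm_minus_cancel norm_one order_less_irrefl)
   then show ?thesis using True by (simp add: time_def)
  qed
  define a where "a x = x + axis l (?sg * L x)" for x
  \<comment> \<open>As \<open>L\<close> is affine, \<open>a\<close> multiplies \<open>L\<close> by
    \<open>1 + ?sg * b l\<close>; hence \<open>L x\<close> can be recovered from \<open>a x\<close>,
    and \<open>a\<close> is inverted explicitly.\<close>
  define b' where "b' y = y + axis l (- (?sg / (1 + ?sg * b l)) * L y)" for y
  have ax: "axis l t + axis l t' = axis l (t + t')" for t t' :: 'k by (auto simp: vec_eq_iff axis_def)
  have ax0: "axis l (0 :: 'k) = 0" by (auto simp: vec_eq_iff axis_def)
  have La: "L (a x) = (1 + ?sg * b l) * L x" for x unfolding a_def Lax by (simp add: algebra_simps)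
  have ba: "b' (a x) = x" for x
   unfolding b'_def La using nz by (simp add: a_def add.assoc ax ax0)
  have Lb: "L (b' y) = L y / (1 + ?sg * b l)" for y
   unfolding b'_def Lax using nz by (simp add: field_simps)
  have ab: "a (b' y) = y" for y
   unfolding a_def Lb by (simp add: b'_def add.assoc ax ax0)
  have aL: "aff L" unfolding L aff_def by blast
  have ab': "aff (%y. b' y $ k)" for k
  proof (cases "k = l")
   case True
   have "(%y. b' y $ k) = (%y. y $ l + (- (?sg / (1 + ?sg * b l))) * L y)"
    by (auto simp: b'_def axis_def True)
   then show ?thesis by (simp only:) (intro aff_add aff_coord aff_cmult aL)
  next
   case False
   then have "(%y. b' y $ k) = (%y. y $ k)" by (auto simp: b'_def axis_def)
   then show ?thesis by (simp add: aff_coord)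
  qed
  have cb: "continuous_on UNIV b'"
  proof -
   have "continuous_on UNIV (%y. \<chi> k. b' y $ k)" by (intro continuous_on_vec_lambda aff_continuous ab')
   then show ?thesis by simp
  qed
  have "PF (\<kappa> - 1) (%y. P j (b' y))" for j
   by (rule PF_compose[OF P[THEN spec, of j], of b', OF ab'])
  moreover have "shear ?sg c q (join_vec x (\<chi> j. P j x)) = join_vec (a x) (\<chi> j. P j x)" for x
   unfolding sh unfolding Inl join_axis_Inl a_def ..
  ultimately show ?thesis
   by (intro exI[of _ a] exI[of _ b'] exI[of _ UNIV] exI[of _ "%j y. P j (b' y)"]) (simp add: ba ab cb)
 qed
qed

lemma low_field_symmetry:
 assumes "low c q"
 shows "infinitesimal_symmetry \<kappa> F (%z. axis c (mono q z))"
 unfolding infinitesimal_symmetry_def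
proof (intro conjI exI)
 have "(%h. axis c (mono q (\<chi> i. (0 :: 'k^('n + 'm)) $ i + h i)) $ d) = (%h. (if d = c then 1 else 0) * (PROD i:UNIV. h i ^ q i))" for d
  by (auto simp: axis_def mono_def mmon_def)
 then show "vec_analytic_at (%z :: 'k^('n + 'm). axis c (mono q z)) 0"
  unfolding vec_analytic_at_iff
  by (simp only:) (intro allI analytic0_mult analytic0_prod analytic0_power analytic0_coord analytic0_const; simp)
 show "local_flow (%z. axis c (mono q z)) (%s. shear (time c q s) c q)" by (rule shear_flow[OF assms])
 show "\<forall>\<^sub>F s in nhds 0. lie_symmetry \<kappa> F (shear (time c q s) c q)"
  unfolding eventually_nhds_metric using shear_symmetry[OF assms] by (intro exI[of _ 1]) auto
qed

section \<open>Projective transformations\<close>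

definition proj :: "'n + 'm => 'k => 'k^('n + 'm) => 'k^('n + 'm)" where
 "proj d s z = (\<chi> i. z $ i * (1 / (1 - s * z $ d)) ^ wgt i)"

lemma proj_nth: "proj d s z $ i = z $ i * (1 / (1 - s * z $ d)) ^ wgt i"
 by (simp add: proj_def)

text \<open>Because \<open>z d\<close> has weight 1, the denominator \<open>1 - s z_d\<close> turns
  into its reciprocal when the sign of \<open>s\<close> is changed at the image point, and the
  powers cancel.\<close>

lemma proj_inverse:
 assumes "wgt d = 1" "1 - s * z $ d ~= 0"
 shows "proj d (- s) (proj d s z) = z"
proof -
 have "1 - (- s) * proj d s z $ d = 1 / (1 - s * z $ d)"
  using assms by (simp add: proj_nth field_simps)
 then have "proj d (- s) (proj d s z) $ i = z $ i" for i
  unfolding proj_nth[of d "- s"] using assms(2) by (simp add: proj_nth power_mult_distrib[symmetric] mult.assoc)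
 then show ?thesis by (simp add: vec_eq_iff)
qed

lemma proj_zero [simp]: "proj d s 0 = 0"
 by (simp add: proj_def vec_eq_iff)

lemma proj_analytic: "vec_analytic_at (proj d s) 0"
 unfolding vec_analytic_at_iff proj_nth
 by (simp, intro allI analytic0_mult analytic0_power analytic0_geometric analytic0_coord analytic0_const) auto

lemma mult_small:
 fixes s t :: 'k
 assumes "norm s < 1" "norm t < 1"
 shows "1 - s * t ~= 0"
proof
 assume "1 - s * t = 0"
 then have "s * t = 1" by simp
 then have "norm s * norm t = 1" by (metis norm_mult norm_one)
 moreover have "norm s * norm t < 1 * 1" using assms by (intro mult_strict_mono') auto
 ultimately show False by simp
qed

lemma proj_diffeo:
 assumes "wgt d = 1" "norm s < 1"
 shows "local_analytic_diffeo (proj d s)"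
proof -
 have "proj d (- s') (proj d s' z) = z" if "norm s' < 1" "dist z 0 < 1" for s' z
 proof (rule proj_inverse[OF assms(1) mult_small[OF that(1)]])
  show "norm (z $ d) < 1" using that(2) Finite_Cartesian_Product.norm_nth_le[of z d] by simp
 qed
 then have "\<forall>\<^sub>F z in nhds 0. proj d (- s') (proj d s' z) = z" if "norm s' < 1" for s'
  unfolding eventually_nhds_metric using that zero_less_one by blast
 from this[of s] this[of "- s"] show ?thesis
  unfolding local_analytic_diffeo_def using assms(2)
  by (intro conjI exI[of _ "proj d (- s)"] proj_analytic) (simp_all add: proj_analytic)
qed

text \<open>For \<open>d = Inl l\<close> this is the classical field whose components are
  \<open>x_l x_k\<close> and \<open>(\<kappa> - 1) x_l u^j\<close>.\<close>

definition proj_field :: "'n + 'm => 'k^('n + 'm) => 'k^('n + 'm)" where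
 "proj_field d z = (\<chi> i. of_nat (wgt i) * (z $ d * z $ i))"

lemma proj_flow:
 assumes d: "wgt d = 1"
 shows "local_flow (proj_field d) (proj d)"
 unfolding local_flow_def
proof (intro conjI allI)
 fix i
 have "analytic0 UNIV (%z :: ('n + 'm) option => 'k. z (Some i) * (1 / (1 - z None * z (Some d))) ^ wgt i)"
  by (intro analytic0_mult analytic0_power analytic0_geometric analytic0_coord) auto
 then show "kanalytic_at UNIV (%z. proj d (z None) (\<chi> i. z (Some i)) $ i) (%_. 0)"
  by (simp add: kanalytic_at_iff_analytic0 proj_nth)
next
 show "EX dt>0. ALL p. norm p < dt --> proj d 0 p = p & (ALL s. norm s < dt -->
   (ALL i. ((%t. proj d t p $ i) has_field_derivative proj_field d (proj d s p) $ i) (at s)))"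
 proof (intro exI[of _ 1] conjI allI impI zero_less_one)
  fix p :: "'k^('n + 'm)" and s :: 'k and i
  assume p: "norm p < 1"
  show "proj d 0 p = p" by (simp add: proj_def vec_eq_iff)
  assume s: "norm s < 1"
  have "norm (p $ d) < 1" using p Finite_Cartesian_Product.norm_nth_le[of p d] by simp
  then have nz: "1 - s * p $ d ~= 0" by (rule mult_small[OF s])
  define g where "g t = 1 / (1 - t * p $ d)" for t
  have "(g has_field_derivative p $ d * (g s * g s)) (at s)"
   unfolding g_def[abs_def] using nz by (auto intro!: derivative_eq_intros simp: field_simps)
  from DERIV_cmult[OF DERIV_power[OF this, of "wgt i"], of "p $ i"]
  have D: "((%t. p $ i * g t ^ wgt i) has_field_derivative
    p $ i * (of_nat (wgt i) * (p $ d * (g s * g s) * g s ^ (wgt i - Suc 0)))) (at s)" .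
  have w: "g s * (g s * g s ^ (wgt i - Suc 0)) = g s * g s ^ wgt i"
   using wgt_pos[of i] by (cases "wgt i") auto
  have "p $ i * (of_nat (wgt i) * (p $ d * (g s * g s) * g s ^ (wgt i - Suc 0))) =
    of_nat (wgt i) * (p $ d * p $ i) * (g s * (g s * g s ^ (wgt i - Suc 0)))" by (simp add: mult_ac)
  also have "... = proj_field d (proj d s p) $ i"
   unfolding w using d by (simp add: proj_field_def proj_nth g_def[symmetric] mult_ac)
  finally have "p $ i * (of_nat (wgt i) * (p $ d * (g s * g s) * g s ^ (wgt i - Suc 0))) = proj_field d (proj d s p) $ i" .
  moreover have "(%t. proj d t p $ i) = (%t. p $ i * g t ^ wgt i)" by (simp add: proj_nth g_def)
  ultimately show "((%t. proj d t p $ i) has_field_derivative proj_field d (proj d s p) $ i) (at s)"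
   using D by simp
 qed
qed

text \<open>On the graph of \<open>P\<close>, the new independent variables are \<open>x / (1 - s L(x))\<close>, where \<open>L\<close> is affine.
  The inverse is \<open>y / E(y)\<close> with \<open>E\<close> affine, and \<open>P\<close> is transformed into a homogenization of \<open>P\<close>.\<close>

lemma proj_symmetry:
 assumes d: "wgt d = 1" and s: "norm s < 1"
 shows "lie_symmetry \<kappa> F (proj d s)"
 unfolding F0
proof (rule flat_lie_symmetryI[OF order proj_diffeo[OF assms]])
 define N where "N = real CARD('n)"
 \<comment> \<open>The constant term \<open>L0\<close> differs from \<open>L x0\<close> by at most
   \<open>N * \<epsilon>\<close>, so it is below \<open>\<epsilon> * (N + 1) = 1 / 2\<close>, and
   both denominators \<open>1 - s * L0\<close> and \<open>1 - s * L x0\<close> are nonzero.\<close>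
 define \<epsilon> where "\<epsilon> = 1 / (2 * (N + 1))"
 have N: "0 <= N" by (simp add: N_def)
 show \<epsilon>0: "0 < \<epsilon>" using N by (simp add: \<epsilon>_def)
 have \<epsilon>N: "\<epsilon> * (N + 1) = 1 / 2" using N by (simp add: \<epsilon>_def field_simps)
 have "\<epsilon> * 1 <= \<epsilon> * (N + 1)" using N \<epsilon>0 by (intro mult_left_mono) auto
 then have \<epsilon>1: "\<epsilon> <= 1 / 2" using \<epsilon>N by simp
 fix P :: "'m => 'k^'n => 'k" and x0 :: "'k^'n"
 assume P: "ALL j. PF (\<kappa> - 1) (P j)" and x0: "ALL l. norm (x0 $ l) < \<epsilon>" and Px0: "ALL j. norm (P j x0) < \<epsilon>"
  and dP: "ALL j l. norm (partial l (P j) x0) < \<epsilon>"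
 define L where "L x = join_vec x (\<chi> j. P j x) $ d" for x
 have Ld: "L = (case d of Inl k => (%x. x $ k) | Inr j => P j)"
  by (auto simp: L_def fun_eq_iff join_vec_def split: sum.splits)
 have aL: "aff L"
 proof (cases d)
  case (Inl k)
  then show ?thesis unfolding Ld by (simp add: aff_coord)
 next
  case (Inr j)
  then have "\<kappa> - 1 = 1" using d by simp
  then have "PF 1 (P j)" using P by metis
  then show ?thesis unfolding Ld Inr using PF_1_aff by simp
 qed
 then obtain L0 b where L: "L = (%x. L0 + (SUM k:UNIV. b k * x $ k))" unfolding aff_def by blast
 define ell where "ell y = (SUM k:UNIV. b k * y $ k)" for y
 have L': "L x = L0 + ell x" for x by (simp add: L ell_def)
 have lin: "ell (r *s y) = r * ell y" for r y
  by (simp add: ell_def sum_distrib_left mult.left_commute)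
 have al: "aff ell" unfolding aff_def by (intro exI[of _ 0] exI[of _ b]) (simp add: ell_def fun_eq_iff)
 have Lx0: "norm (L x0) < \<epsilon>" using x0 Px0 unfolding Ld by (auto split: sum.splits)
 have b1: "norm (b l) <= 1" for l
 proof (cases d)
  case (Inl k)
  have e: "(SUM k:UNIV. b k * (axis l 1 :: 'k^'n) $ k) = b l"
  proof -
   have "(SUM k:UNIV. b k * (axis l 1 :: 'k^'n) $ k) = (SUM k:UNIV. if k = l then b l else 0)"
    by (rule sum.cong) (auto simp: axis_def)
   then show ?thesis by simp
  qed
  have "L (axis l 1) - L 0 = b l" by (simp add: L e)
  moreover have "L (axis l 1) - L 0 = (if k = l then 1 else 0)" unfolding Ld Inl by (simp add: axis_def)
  ultimately show ?thesis by (metis norm_one norm_zero order_refl zero_le_one)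
 next
  case (Inr j)
  have "((%t. L (x0 + axis l t)) has_field_derivative b l) (at 0)" unfolding L by (rule aff_field_derivative)
  moreover have "L = P j" unfolding Ld Inr by simp
  ultimately have "partial l (P j) x0 = b l" unfolding partial_def by (simp add: DERIV_imp_deriv)
  moreover have "norm (partial l (P j) x0) < \<epsilon>" using dP by blast
  ultimately show ?thesis using \<epsilon>1 by simp
 qed
 have "norm (ell x0) <= (SUM k:(UNIV :: 'n set). \<epsilon>)" unfolding ell_def
 proof (rule sum_norm_le)
  fix k :: 'n
  have "norm (b k) * norm (x0 $ k) <= 1 * \<epsilon>" using b1 x0 by (intro mult_mono) (auto intro: less_imp_le)
  then show "norm (b k * x0 $ k) <= \<epsilon>" by (simp add: norm_mult)
 qed
 then have "norm (ell x0) <= N * \<epsilon>" by (simp add: N_def)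
 moreover have "norm L0 <= norm (L x0) + norm (ell x0)"
  using norm_triangle_ineq4[of "L x0" "ell x0"] by (simp add: L')
 ultimately have "norm L0 < \<epsilon> * (N + 1)" using Lx0 by (simp add: algebra_simps)
 then have nL0: "1 - s * L0 ~= 0" using \<epsilon>N by (intro mult_small[OF s]) simp
 have nLx0: "1 - s * L x0 ~= 0" using Lx0 \<epsilon>1 by (intro mult_small[OF s]) simp
 \<comment> \<open>The reciprocal of the denominator expressed in the new variables:
   \<open>E (a x) = 1 / (1 - s * L x)\<close>. It is affine because \<open>L\<close> is, so the
   inverse change is projective too.\<close>
 define E where "E y = 1 / (1 - s * L0) + s / (1 - s * L0) * ell y" for y
 have E': "E y = (1 + s * ell y) / (1 - s * L0)" for y by (simp add: E_def add_divide_distrib)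
 have aE: "aff E" unfolding E_def[abs_def] by (intro aff_add aff_const aff_cmult al)
 define a where "a x = (1 / (1 - s * L x)) *s x" for x
 define b' where "b' y = (1 / E y) *s y" for y
 have Ea: "E (a x) = 1 / (1 - s * L x)" if "1 - s * L x ~= 0" for x
 proof -
  have "1 + s * ell (a x) = (1 - s * L0) / (1 - s * L x)"
   using that unfolding a_def lin by (simp add: L' field_simps)
  then show ?thesis using nL0 by (simp add: E')
 qed
 have ba: "b' (a x) = x" if "1 - s * L x ~= 0" for x
  unfolding b'_def Ea[OF that] using that by (simp add: a_def)
 have Lb: "1 - s * L (b' y) = 1 / E y" if "E y ~= 0" for y
 proof -
  have 1: "1 + s * ell y ~= 0" using that by (auto simp: E')
  have "1 - s * L (b' y) = (1 - s * L0) - s * (ell y / E y)" unfolding L' b'_def lin by (simp add: algebra_simps)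
  also have "... = (1 - s * L0) * (1 - s * ell y / (1 + s * ell y))" unfolding E' using nL0 1 by (simp add: field_simps)
  also have "... = (1 - s * L0) / (1 + s * ell y)" using 1 by (simp add: field_simps)
  finally show ?thesis by (simp add: E')
 qed
 have ab: "a (b' y) = y" if "E y ~= 0" for y
  unfolding a_def Lb[OF that] using that by (simp add: b'_def)
 \<comment> \<open>The transformed solution is \<open>E^(\<kappa> - 1)\<close> times
   \<open>P\<close> at \<open>y / E\<close>: the weight of \<open>u\<close> is the degree bound, so
   the factor just clears the denominators.\<close>
 have "ALL j. EX v. PF (\<kappa> - 1) v & (ALL y. E y ~= 0 --> v y = E y ^ (\<kappa> - 1) * P j ((1 / E y) *s y))"
  using PF_homogenize[OF _ aE] P by blast
 from choice[OF this] obtain v where v: "ALL j. PF (\<kappa> - 1) (v j) &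
   (ALL y. E y ~= 0 --> v j y = E y ^ (\<kappa> - 1) * P j ((1 / E y) *s y))" by (elim exE) (rule that)
 have op: "open {x. f x ~= 0}" if "aff f" for f :: "'k^'n => 'k"
 proof -
  have "open (f -` (- {0}))" by (rule open_vimage[OF open_Compl[OF closed_singleton] aff_continuous[OF that]])
  then show ?thesis by (simp add: vimage_def)
 qed
 have "aff (%x. 1 - s * L x)" using aff_add[OF aff_const[of 1] aff_cmult[OF aL, of "- s"]] by simp
 then have oN: "open {x. 1 - s * L x ~= 0}" by (rule op)
 have cb: "continuous_on {y. E y ~= 0} b'"
 proof -
  have "continuous_on {y. E y ~= 0} (%y. \<chi> k. (1 / E y) * y $ k)"
   by (intro continuous_on_vec_lambda continuous_on_mult continuous_on_divide aff_continuous[OF aE] continuous_intros) auto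
  moreover have "(%y. \<chi> k. (1 / E y) * y $ k) = b'" by (simp add: b'_def fun_eq_iff vec_eq_iff)
  ultimately show ?thesis by (simp only:)
 qed
 have gr: "proj d s (join_vec x (\<chi> j. P j x)) = join_vec (a x) (\<chi> j. v j (a x))" if x: "1 - s * L x ~= 0" for x
 proof -
  have Ex: "E (a x) ~= 0" unfolding Ea[OF x] using x by simp
  have vj: "v j (a x) = P j x * (1 / (1 - s * L x)) ^ (\<kappa> - 1)" for j
  proof -
   have "v j (a x) = E (a x) ^ (\<kappa> - 1) * P j (b' (a x))" using v Ex unfolding b'_def by blast
   then show ?thesis unfolding ba[OF x] Ea[OF x] by (simp add: mult.commute)
  qed
  have "proj d s (join_vec x (\<chi> j. P j x)) $ i = join_vec (a x) (\<chi> j. v j (a x)) $ i" for i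
   unfolding proj_nth L_def[symmetric]
  proof (cases i)
   case (Inl k)
   then show "join_vec x (\<chi> j. P j x) $ i * (1 / (1 - s * L x)) ^ wgt i = join_vec (a x) (\<chi> j. v j (a x)) $ i"
    by (simp add: join_vec_def a_def)
  next
   case (Inr j)
   then show "join_vec x (\<chi> j. P j x) $ i * (1 / (1 - s * L x)) ^ wgt i = join_vec (a x) (\<chi> j. v j (a x)) $ i"
    by (simp add: join_vec_def vj)
  qed
  then show ?thesis by (simp add: vec_eq_iff)
 qed
 show "EX a b N E v. (ALL j. PF (\<kappa> - 1) (v j)) & open N & open E & x0 : N & continuous_on E b &
    (ALL x:N. a x : E & b (a x) = x & proj d s (join_vec x (\<chi> j. P j x)) = join_vec (a x) (\<chi> j. v j (a x))) &
    (ALL y:E. b y : N --> a (b y) = y)"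
 proof (intro exI conjI)
  show "ALL j. PF (\<kappa> - 1) (v j)" using v by blast
  show "open {x. 1 - s * L x ~= 0}" by (rule oN)
  show "open {y. E y ~= 0}" by (rule op[OF aE])
  show "x0 : {x. 1 - s * L x ~= 0}" using nLx0 by simp
  show "continuous_on {y. E y ~= 0} b'" by (rule cb)
  show "ALL x:{x. 1 - s * L x ~= 0}. a x : {y. E y ~= 0} & b' (a x) = x &
    proj d s (join_vec x (\<chi> j. P j x)) = join_vec (a x) (\<chi> j. v j (a x))"
   using ba gr Ea by simp
  show "ALL y:{y. E y ~= 0}. b' y : {x. 1 - s * L x ~= 0} --> a (b' y) = y" using ab by simp
 qed
qed

lemma proj_field_symmetry:
 assumes "wgt d = 1"
 shows "infinitesimal_symmetry \<kappa> F (proj_field d)"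
 unfolding infinitesimal_symmetry_def
proof (intro conjI exI)
 show "vec_analytic_at (proj_field d) 0"
  unfolding vec_analytic_at_iff proj_field_def
  by (simp, intro allI analytic0_mult analytic0_coord analytic0_const) auto
 show "local_flow (proj_field d) (proj d)" by (rule proj_flow[OF assms])
 show "\<forall>\<^sub>F s in nhds 0. lie_symmetry \<kappa> F (proj d s)"
  unfolding eventually_nhds_metric using proj_symmetry[OF assms] by (intro exI[of _ 1]) auto
qed

subsection \<open>Dimension of the symmetry algebra of the homogeneous system\<close>

definition bas :: "('n + 'm) \<times> ('n + 'm => nat) => 'k^('n + 'm) => 'k^('n + 'm)" where
 "bas i = (if low (fst i) (snd i) then (%z. axis (fst i) (mono (snd i) z)) else proj_field (fst i))"

text \<open>The power series coefficients of \<open>bas i\<close>. In the projective case component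
  \<open>c\<close> consists of the single monomial \<open>z_d z_c\<close>, written as a sum of two
  unit exponents so that \<open>c = d\<close> gives a square.\<close>

definition bcoeff :: "('n + 'm) \<times> ('n + 'm => nat) => 'n + 'm => ('n + 'm => nat) => 'k" where
 "bcoeff i c q = (if low (fst i) (snd i) then (if (c, q) = i then 1 else 0)
   else if q = (%k. (if k = fst i then 1 else 0) + (if k = c then 1 else 0)) then of_nat (wgt c) else 0)"

lemma free_cases:
 assumes "i : free_coeffs"
 shows "low (fst i) (snd i) | (EX d. wgt d = 1 & ~ low (fst i) (snd i) & i = (d, %k. if k = d then 2 else 0))"
 using assms unfolding free_coeffs_def by auto

lemma bas_symmetry: "i : free_coeffs ==> infinitesimal_symmetry \<kappa> F (bas i)"
 using free_cases[of i] by (auto simp: bas_def intro: low_field_symmetry proj_field_symmetry)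

lemma bas_series: "field_series (bas i) (bcoeff i)"
 unfolding field_series_def
proof (intro exI[of _ 1] conjI allI zero_less_one)
 fix c
 show "pseries UNIV 1 (bcoeff i c) (vcomp (bas i) c)"
 proof (cases "low (fst i) (snd i)")
  case True
  have "pseries UNIV 1 (%q. if q : (if c = fst i then {snd i} else {}) then (1 :: 'k) else 0)
    (%h. SUM q:(if c = fst i then {snd i} else {}). 1 * mmon UNIV h q)"
   by (rule pseries_finite) simp
  moreover have "(%q. if q : (if c = fst i then {snd i} else {}) then (1 :: 'k) else 0) = bcoeff i c"
   using True by (cases i) (auto simp: bcoeff_def fun_eq_iff)
  moreover have "(%h. SUM q:(if c = fst i then {snd i} else {}). 1 * mmon UNIV h q) = vcomp (bas i) c"
   using True by (auto simp: bas_def vcomp_def fun_eq_iff axis_def mono_def mmon_def)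
  ultimately show ?thesis by simp
 next
  case False
  let ?q = "%k. (if k = fst i then 1 else 0) + (if k = c then 1 else 0) :: nat"
  have "pseries UNIV 1 (%q. if q : {?q} then (of_nat (wgt c) :: 'k) else 0)
    (%h. SUM q:{?q}. of_nat (wgt c) * mmon UNIV h q)"
   by (rule pseries_finite) simp
  moreover have "(%q. if q : {?q} then (of_nat (wgt c) :: 'k) else 0) = bcoeff i c"
   using False by (auto simp: bcoeff_def fun_eq_iff)
  moreover have "(%h. SUM q:{?q}. of_nat (wgt c) * mmon UNIV h q) = vcomp (bas i) c"
  proof
   fix h :: "'n + 'm => 'k"
   have u: "mmon UNIV h (%k. if k = e then 1 else 0) = h e" for e
    using mono_unit[of e "vec_lambda h"] by (simp add: mono_def mmon_def)
   show "(SUM q:{?q}. of_nat (wgt c) * mmon UNIV h q) = vcomp (bas i) c h"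
    using False by (simp add: mmon_add u bas_def vcomp_def proj_field_def)
  qed
  ultimately show ?thesis by simp
 qed
qed

text \<open>All monomials of a projective field have total weight \<open>\<kappa>\<close>, so they
  meet no free coefficient of low weight. Among the quadratic free coefficients only the square of
  \<open>z_d\<close> in component \<open>d\<close> occurs, with factor
  \<open>wgt d = 1\<close>.\<close>

lemma bcoeff_dual:
 assumes "i : free_coeffs" "(c, q) : free_coeffs"
 shows "bcoeff i c q = (if (c, q) = i then 1 else 0)"
proof -
 have we: "wgt c + edef c = \<kappa> - 1" for c using order by (cases c) auto
 consider "low (fst i) (snd i)" | d where "wgt d = 1" "~ low (fst i) (snd i)" "i = (d, %k. if k = d then 2 else 0)"
  using free_cases[OF assms(1)] by blast
 then show ?thesis
 proof cases
  case 1
  then show ?thesis by (simp add: bcoeff_def)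
 next
  case (2 d)
  let ?q = "%k. (if k = d then 1 else 0) + (if k = c then 1 else 0) :: nat"
  have b: "bcoeff i c q = (if q = ?q then of_nat (wgt c) else 0)" using 2 by (simp add: bcoeff_def)
  consider "low c q" | "wgt c = 1" "q = (%k. if k = c then 2 else 0)" using free_cases[OF assms(2)] by auto
  then show ?thesis
  proof cases
   case 1
   have "wt ?q = wgt d * 1 + wgt c * 1"
    using wt_unit[of d 1] wt_unit[of c 1] by (simp add: wt_def distrib_left sum.distrib)
   then have "wt ?q + edef c = \<kappa>" using we[of c] 2(1) order by simp
   then have "q ~= ?q" using 1 order by auto
   moreover have "(c, q) ~= i" using 1 2(2) by auto
   ultimately show ?thesis unfolding b by simp
  next
   case c: 2
   show ?thesis
   proof (cases "c = d")
    case True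
    then have "q = ?q" using c(2) by (auto simp: fun_eq_iff)
    then show ?thesis unfolding b using c True 2(3) by simp
   next
    case False
    then have "q d = 0" unfolding c(2) by auto
    then have "q ~= ?q" by (auto dest: fun_cong[of _ _ d])
    moreover have "(c, q) ~= i" using False 2(3) by simp
    ultimately show ?thesis unfolding b by simp
   qed
  qed
 qed
qed

lemma gcoeff_sum:
 assumes "finite A"
 shows "EX X C. field_series X C & abs_germ X = (SUM i:A. germ_scale (u i) (abs_germ (bas i))) &
  (ALL c q. C c q = (SUM i:A. u i * bcoeff i c q))"
 using assms
proof (induction A rule: finite_induct)
 case empty
 have "pseries UNIV 1 (%_. 0) (vcomp (%_ :: 'k^('n + 'm). 0 :: 'k^('n + 'm)) c)" for c
  using pseries_finite[of "{}" 1 "%_. 0 :: 'k"] by (simp add: vcomp_def[abs_def])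
 then have "field_series (%_ :: 'k^('n + 'm). 0 :: 'k^('n + 'm)) (%_ _. 0)"
  unfolding field_series_def using zero_less_one by blast
 then show ?case by (intro exI[of _ "%_. 0"] exI[of _ "%_ _. 0"]) (auto simp: zero_germ_def)
next
 case (insert i A)
 then obtain X C where X: "field_series X C" "abs_germ X = (SUM i:A. germ_scale (u i) (abs_germ (bas i)))"
  "ALL c q. C c q = (SUM i:A. u i * bcoeff i c q)" by blast
 let ?X = "%x. u i *s bas i x + X x"
 have "field_series ?X (%c q. u i * bcoeff i c q + C c q)"
  by (rule field_series_add[OF field_series_scale[OF bas_series] X(1)])
 moreover have "abs_germ ?X = (SUM i:insert i A. germ_scale (u i) (abs_germ (bas i)))"
  unfolding sum.insert[OF insert.hyps] X(2)[symmetric] unfolding germ_scale.abs_eq plus_germ.abs_eq by (rule refl)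
 ultimately show ?case using insert.hyps X(3)
  by (intro exI[of _ ?X] exI[of _ "%c q. u i * bcoeff i c q + C c q"]) auto
qed

text \<open>The germs \<open>bas i\<close> are symmetries, and by duality with the free coefficients
  they are independent; this gives the lower bound. The upper bound for general systems closes the
  gap.\<close>

theorem flat_dim: "germ.dim (Sym \<kappa> F) = card free_coeffs"
proof -
 let ?be = "%i. abs_germ (bas i)"
 have dual: "gcoeff (?be i) j = (if j = i then 1 else 0)" if "i : free_coeffs" "j : free_coeffs" for i j
  using gcoeff_eq[OF bas_series, of i "fst j" "snd j"] bcoeff_dual[OF that(1), of "fst j" "snd j"] that(2) by simp
 have inj: "inj_on ?be free_coeffs"
  by (rule inj_onI) (metis dual zero_neq_one)
 have ind: "germ.independent (?be ` free_coeffs)"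
 proof
  assume "germ.dependent (?be ` free_coeffs)"
  then obtain u where u: "EX v:?be ` free_coeffs. u v ~= 0" "(SUM v:?be ` free_coeffs. germ_scale (u v) v) = 0"
   using germ.dependent_finite[of "?be ` free_coeffs"] finite_free_coeffs by auto
  then obtain j where j: "j : free_coeffs" "u (?be j) ~= 0" by blast
  have "(SUM i:free_coeffs. germ_scale (u (?be i)) (?be i)) = 0"
   using u(2) by (simp add: sum.reindex[OF inj])
  moreover obtain X C where X: "field_series X C" "abs_germ X = (SUM i:free_coeffs. germ_scale (u (?be i)) (?be i))"
   "ALL c q. C c q = (SUM i:free_coeffs. u (?be i) * bcoeff i c q)"
   using gcoeff_sum[OF finite_free_coeffs, of "%i. u (?be i)"] by blast
  moreover obtain Y :: "'k^('n + 'm) => 'k^('n + 'm)" and D where Y: "field_series Y D" "abs_germ Y = 0" "ALL c q. D c q = 0"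
   using gcoeff_sum[of "{}" "%_. 0"] by auto
  ultimately have "C (fst j) (snd j) = 0" using field_series_unique[OF X(1) Y(1)] by simp
  moreover have "C (fst j) (snd j) = (SUM i:free_coeffs. if i = j then u (?be i) else 0)"
   unfolding X(3)[rule_format]
  proof (rule sum.cong)
   fix i assume "i : free_coeffs"
   then show "u (?be i) * bcoeff i (fst j) (snd j) = (if i = j then u (?be i) else 0)"
    using bcoeff_dual[of i "fst j" "snd j"] j(1) by auto
  qed simp
  ultimately show False using j finite_free_coeffs by simp
 qed
 have sub: "?be ` free_coeffs \<subseteq> Sym \<kappa> F" using bas_symmetry by (auto simp: Sym_def)
 obtain B where B: "finite B" "Sym \<kappa> F \<subseteq> germ.span B" and le: "germ.dim (Sym \<kappa> F) <= card free_coeffs"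
  using Sym_dim_bound by (auto simp: germ_dim_le_def)
 obtain T where T: "T \<subseteq> Sym \<kappa> F" "germ.independent T" "Sym \<kappa> F \<subseteq> germ.span T" "card T = germ.dim (Sym \<kappa> F)"
  by (rule germ.basis_exists)
 have "finite T" using germ.independent_span_bound[OF B(1) T(2)] T(1) B(2) by blast
 then have "card (?be ` free_coeffs) <= card T"
  using germ.independent_span_bound[OF _ ind] sub T(3) by blast
 then have "card free_coeffs <= germ.dim (Sym \<kappa> F)" using T(4) by (simp add: card_image[OF inj])
 then show ?thesis using le by simp
qed

end

theorem theorem1:
  fixes F :: "('k::{real_normed_field,euclidean_space}, 'n::finite, 'm::finite) rhs"
    and \<kappa> n m :: nat
  assumes "n = CARD('n)" and "m = CARD('m)" and "\<kappa> \<ge> 2"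
    and "\<And>j \<alpha>. mdeg \<alpha> = \<kappa> \<Longrightarrow> kanalytic_at (jcoords (\<kappa> - 1)) (F j \<alpha>) (\<lambda>_. 0)"
    and "completely_integrable \<kappa> F"
  shows "(\<kappa> = 2 \<longrightarrow> germ_dim_le (Sym \<kappa> F) ((n + m + 2) * (n + m))) \<and>
    (\<kappa> \<ge> 3 \<longrightarrow>
       germ_dim_le (Sym \<kappa> F) (n^2 + 2 * n + m^2 + m * ((n + \<kappa> - 1) choose (\<kappa> - 1)))) \<and>
    (\<kappa> = 2 \<longrightarrow>
       germ.dim (Sym \<kappa> ((\<lambda>_ _ _. 0) :: ('k, 'n, 'm) rhs)) = (n + m + 2) * (n + m)) \<and>
    (\<kappa> \<ge> 3 \<longrightarrow>
       germ.dim (Sym \<kappa> ((\<lambda>_ _ _. 0) :: ('k, 'n, 'm) rhs)) =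
         n^2 + 2 * n + m^2 + m * ((n + \<kappa> - 1) choose (\<kappa> - 1)))"
proof -
 interpret S: pde \<kappa> F by (unfold_locales) (use assms(3-5) in auto)
 interpret Z: flat_system \<kappa> "(%_ _ _. 0) :: ('k, 'n, 'm) rhs"
  by (intro flat_system.intro pde_flat assms(3) flat_system_axioms.intro refl)
 show ?thesis
  using S.Sym_dim_bound Z.flat_dim S.card_free_coeffs_2 S.card_free_coeffs_3 Z.card_free_coeffs_2 Z.card_free_coeffs_3
  unfolding assms(1,2) by auto
qed

end
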